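(* Let $\lambda>0$, $0<q\le 1$ and $\alpha\le p_s^*-1$, and let $u$ be a positive weak solution of $(P_\lambda)$. Then there exists $\gamma\in(0,s]$ such that $u\in C^{\gamma}_{loc}(\Omega')$ for all $\Omega'\subset\subset\Omega$.
   Context: Let $1<p<\infty$, $s\in(0,1)$, $n>sp$, $p_s^*=\frac{np}{n-sp}$, and let $\Omega\subset\mathbb{R}^n$ be a bounded domain with smooth boundary. Put $Q=\mathbb{R}^{2n}\setminus((\mathbb{R}^n\setminus\Omega)\times(\mathbb{R}^n\setminus\Omega))$. $X_0$ is the space of measurable $u:\mathbb{R}^n\to\mathbb{R}$ with $u|_\Omega\in L^p(\Omega)$, $u=0$ a.e. in $\mathbb{R}^n\setminus\Omega$ and $\|u\|:=\left(\int_Q\frac{|u(x)-u(y)|^p}{|x-y|^{n+sp}}\,dx\,dy\right)^{1/p}<\infty$; $\|\cdot\|$ is the norm on $X_0$. $(P_\lambda)$ is the problem $(-\Delta_p)^su=\lambda u^{-q}+u^\alpha$, $u>0$ in $\Omega$, $u=0$ in $\mathbb{R}^n\setminus\Omega$. A positive weak solution of $(P_\lambda)$ is $u\in X_0$ with $u>0$ in $\Omega$ and, for all $\psi\in C_c^\infty(\Omega)$, $$\int_Q\frac{|u(x)-u(y)|^{p-2}(u(x)-u(y))(\psi(x)-\psi(y))}{|x-y|^{n+sp}}\,dx\,dy-\int_\Omega(\lambda u^{-q}+u^\alpha)\psi\,dx=0.$$ $\Omega'\subset\subset\Omega$ means $\Omega'$ is open with $\overline{\Omega'}$ a compact subset of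 $\Omega$; $C^\gamma_{loc}$ denotes local Hölder continuity with exponent $\gamma$. *)

theory Defs
  imports "HOL-Analysis.Analysis"
begin

text \<open>The ambient space is \<^typ>\<open>real ^ 'n\<close>, so that $n$ is \<^term>\<open>CARD('n)\<close>.\<close>

subsection \<open>Smooth functions and smooth bounded domains\<close>

primrec Ck :: "nat \<Rightarrow> (real ^ 'n \<Rightarrow> real) \<Rightarrow> bool" where
  "Ck 0 f \<longleftrightarrow> continuous_on UNIV f"
| "Ck (Suc k) f \<longleftrightarrow>
     (\<exists>g :: real ^ 'n \<Rightarrow> real ^ 'n.
        (\<forall>x. (f has_derivative (\<lambda>h. g x \<bullet> h)) (at x)) \<and> (\<forall>i. Ck k (\<lambda>x. g x $ i)))"

definition smooth :: "(real ^ 'n \<Rightarrow> real) \<Rightarrow> bool" where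
  "smooth f \<longleftrightarrow> (\<forall>k. Ck k f)"

text \<open>An element of $C_c^\infty(\Omega)$ is represented by its extension by zero to the whole space.\<close>

definition test_function :: "(real ^ 'n) set \<Rightarrow> (real ^ 'n \<Rightarrow> real) \<Rightarrow> bool" where
  "test_function \<Omega> \<psi> \<longleftrightarrow>
     smooth \<psi> \<and> compact (closure {x. \<psi> x \<noteq> 0}) \<and> closure {x. \<psi> x \<noteq> 0} \<subseteq> \<Omega>"

text \<open>Near each boundary point the set lies strictly above a smooth graph over a hyperplane,
  after a rotation of the axes: the unit vector \<open>e\<close> is the new last axis, and only the values
  of \<open>\<phi>\<close> on the hyperplane orthogonal to \<open>e\<close> are used.\<close>

definition smooth_boundary :: "(real ^ 'n) set \<Rightarrow> bool" where
  "smooth_boundary \<Omega> \<longleftrightarrow>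
     (\<forall>x0 \<in> frontier \<Omega>. \<exists>r > 0. \<exists>e \<phi>. norm e = 1 \<and> smooth \<phi> \<and>
        \<Omega> \<inter> ball x0 r = {x \<in> ball x0 r. \<phi> (x - (x \<bullet> e) *\<^sub>R e) < x \<bullet> e})"

definition smooth_bounded_domain :: "(real ^ 'n) set \<Rightarrow> bool" where
  "smooth_bounded_domain \<Omega> \<longleftrightarrow>
     open \<Omega> \<and> connected \<Omega> \<and> \<Omega> \<noteq> {} \<and> bounded \<Omega> \<and> smooth_boundary \<Omega>"

subsection \<open>The space $X_0$\<close>

definition Qset :: "(real ^ 'n) set \<Rightarrow> ((real ^ 'n) \<times> (real ^ 'n)) set" where
  "Qset \<Omega> = UNIV - (UNIV - \<Omega>) \<times> (UNIV - \<Omega>)"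

text \<open>Double integrals are taken with respect to Lebesgue measure on the product type. On the
  diagonal, a null set, all quotients below take the value 0.\<close>

definition X0 :: "real \<Rightarrow> real \<Rightarrow> (real ^ 'n) set \<Rightarrow> (real ^ 'n \<Rightarrow> real) set" where
  "X0 p s \<Omega> = {u. u \<in> borel_measurable lebesgue \<and>
     (\<integral>\<^sup>+ x \<in> \<Omega>. ennreal (\<bar>u x\<bar> powr p) \<partial>lebesgue) < \<infinity> \<and>
     (AE x in lebesgue. x \<notin> \<Omega> \<longrightarrow> u x = 0) \<and>
     (\<integral>\<^sup>+ z \<in> Qset \<Omega>. ennreal (\<bar>u (fst z) - u (snd z)\<bar> powr p /
        norm (fst z - snd z) powr (real CARD('n) + s * p)) \<partial>lebesgue) < \<infinity>}"

definition critical_exponent :: "nat \<Rightarrow> real \<Rightarrow> real \<Rightarrow> real" where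
  "critical_exponent n p s = real n * p / (real n - s * p)"

subsection \<open>Weak solutions\<close>

text \<open>If \<open>a = 0\<close> then \<open>\<bar>a\<bar> powr (p - 2) * a = 0\<close> for every \<open>p\<close>, also for \<open>p < 2\<close>,
  as it should be for \<open>p > 1\<close>.\<close>

definition weak_integrand ::
  "real \<Rightarrow> real \<Rightarrow> (real ^ 'n \<Rightarrow> real) \<Rightarrow> (real ^ 'n \<Rightarrow> real) \<Rightarrow> (real ^ 'n) \<times> (real ^ 'n) \<Rightarrow> real" where
  "weak_integrand p s u \<psi> z =
     \<bar>u (fst z) - u (snd z)\<bar> powr (p - 2) * (u (fst z) - u (snd z)) * (\<psi> (fst z) - \<psi> (snd z)) /
       norm (fst z - snd z) powr (real CARD('n) + s * p)"

text \<open>Elements of $X_0$ are considered up to null sets, so \<open>u > 0\<close> in \<open>\<Omega>\<close> means almost everywhere.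
  The Bochner integral of a non-integrable function is 0 by convention; the integrability
  conditions say that the integrals in the weak formulation exist.\<close>

definition positive_weak_solution ::
  "real \<Rightarrow> real \<Rightarrow> (real ^ 'n) set \<Rightarrow> real \<Rightarrow> real \<Rightarrow> real \<Rightarrow> (real ^ 'n \<Rightarrow> real) \<Rightarrow> bool" where
  "positive_weak_solution p s \<Omega> lam q \<alpha> u \<longleftrightarrow>
     u \<in> X0 p s \<Omega> \<and>
     (AE x in lebesgue. x \<in> \<Omega> \<longrightarrow> u x > 0) \<and>
     (\<forall>\<psi>. test_function \<Omega> \<psi> \<longrightarrow>
        set_integrable lebesgue (Qset \<Omega>) (weak_integrand p s u \<psi>) \<and>
        set_integrable lebesgue \<Omega> (\<lambda>x. (lam * u x powr (- q) + u x powr \<alpha>) * \<psi> x) \<and>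
        (LINT z : Qset \<Omega> | lebesgue. weak_integrand p s u \<psi> z)
          - (LINT x : \<Omega> | lebesgue. (lam * u x powr (- q) + u x powr \<alpha>) * \<psi> x) = 0)"

subsection \<open>Local Hoelder continuity\<close>

definition compactly_contained :: "(real ^ 'n) set \<Rightarrow> (real ^ 'n) set \<Rightarrow> bool" where
  "compactly_contained \<Omega>' \<Omega> \<longleftrightarrow> open \<Omega>' \<and> compact (closure \<Omega>') \<and> closure \<Omega>' \<subseteq> \<Omega>"

definition locally_hoelder_on :: "real \<Rightarrow> (real ^ 'n) set \<Rightarrow> (real ^ 'n \<Rightarrow> real) \<Rightarrow> bool" where
  "locally_hoelder_on \<gamma> S f \<longleftrightarrow>
     (\<forall>K. compact K \<and> K \<subseteq> S \<longrightarrow>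
        (\<exists>C. \<forall>x \<in> K. \<forall>y \<in> K. \<bar>f x - f y\<bar> \<le> C * norm (x - y) powr \<gamma>))"

end

theory Submission
  imports Defs
begin

text \<open>The proof is De Giorgi's method for fractional energies. In the Caccioppoli inequality for a
  subsolution the nonlocal cross term, usually discarded, is kept: it measures how much of the ball lies
  below the level and plays the role of the logarithmic lemma. Since the right-hand side is nonnegative,
  \<open>- u\<close> is a subsolution of the homogeneous inequality, and as \<open>u > 0\<close> almost everywhere the sets
  \<open>u < t\<close> shrink to null sets while the smallness demanded by the De Giorgi iteration is independent of
  \<open>t\<close>; hence \<open>u\<close> is locally bounded below and the singular term is locally bounded. The critical
  power is absorbed by the Sobolev inequality on high levels, which gives a local upper bound. With both
  bounds the right-hand side is locally bounded, the oscillation on balls of radius \<open>r / 8 ^ i\<close> decays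
  geometrically, and the limit values of \<open>u\<close> along a set of full measure form a Hoelder continuous
  representative.\<close>

subsection \<open>Kernel integrals\<close>

text \<open>The weak formulation admits only smooth compactly supported test functions, whereas
  every energy estimate tests with (v - k)^+ times a power of a cutoff. The bridge is mollification:
  its error is an average of translation errors, small on the left by Young's inequality and on the
  right because the equation itself makes the right-hand side locally integrable. Quantities that
  may be infinite live in \<open>ennreal\<close>; finiteness is proved where something has to be
  subtracted or absorbed. \<kappa> and the conditions on the Hoelder exponent involve p, s and the
  dimension only, so the exponent is fixed before \<Omega>' is chosen. Nonlocality costs a tail at
  every scale: in the oscillation argument a power barrier of small exponent controls u outside the
  current ball, and its tail above the current oscillation tends to 0 with the exponent. The factor
  8 between radii comes from the growth estimate, which reads a measure condition on a quarter ball
  and concludes on an eighth.\<close>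

lemma emeasure_ball_vec:
  fixes x :: "real ^ 'n"
  assumes "0 \<le> r"
  shows "emeasure lborel (ball x r) = ennreal (unit_ball_vol (real CARD('n)) * r ^ CARD('n))"
  using emeasure_ball[of r x] assms by simp

lemma unit_ball_vol_vec_pos: "0 < unit_ball_vol (real CARD('n::finite))"
  by simp

lemma powr_minus_mono:
  fixes a b c :: real
  assumes "0 < a" "a \<le> b" "0 \<le> c"
  shows "b powr (- c) \<le> a powr (- c)"
  using assms by (intro powr_mono2') auto

text \<open>Takes the place of polar coordinates: by \<open>eq\<close>, the coefficients times the
  volumes of the balls form a geometric series. It serves both for shells going to infinity and for
  shells shrinking to \<open>x\<close>.\<close>

lemma nn_integral_dyadic_le:
  fixes x :: "real ^ 'n" and f :: "real ^ 'n \<Rightarrow> ennreal"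
  assumes f: "\<And>y. f y \<le> (\<Sum>i. ennreal (c i) * indicator (ball x (\<rho> i)) y)"
    and c: "\<And>i. 0 \<le> c i" and r: "\<And>i. 0 \<le> \<rho> i"
    and eq: "\<And>i. c i * \<rho> i ^ CARD('n) = B * \<theta> ^ i"
    and B: "0 \<le> B" and th: "0 < \<theta>" "\<theta> < 1"
  shows "(\<integral>\<^sup>+ y. f y \<partial>lborel) \<le> ennreal (unit_ball_vol (real CARD('n)) * B / (1 - \<theta>))"
proof -
  let ?V = "unit_ball_vol (real CARD('n))"
  have "(\<integral>\<^sup>+ y. f y \<partial>lborel) \<le> (\<integral>\<^sup>+ y. (\<Sum>i. ennreal (c i) * indicator (ball x (\<rho> i)) y) \<partial>lborel)"
    by (intro nn_integral_mono f)
  also have "\<dots> = (\<Sum>i. \<integral>\<^sup>+ y. ennreal (c i) * indicator (ball x (\<rho> i)) y \<partial>lborel)"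
  proof (rule nn_integral_suminf)
    fix i
    have [measurable]: "ball x (\<rho> i) \<in> sets borel" by simp
    show "(\<lambda>y. ennreal (c i) * indicator (ball x (\<rho> i)) y) \<in> borel_measurable lborel" by measurable
  qed
  also have "\<dots> = (\<Sum>i. ennreal (?V * B * \<theta> ^ i))"
  proof (intro arg_cong[where f=suminf] ext)
    fix i
    have "(\<integral>\<^sup>+ y. ennreal (c i) * indicator (ball x (\<rho> i)) y \<partial>lborel)
        = ennreal (c i) * ennreal (?V * \<rho> i ^ CARD('n))"
      using r by (subst nn_integral_cmult_indicator) (auto simp: emeasure_ball_vec)
    also have "\<dots> = ennreal (c i * (?V * \<rho> i ^ CARD('n)))"
      using c r by (simp add: ennreal_mult')
    also have "c i * (?V * \<rho> i ^ CARD('n)) = ?V * (c i * \<rho> i ^ CARD('n))" by simp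
    finally show "(\<integral>\<^sup>+ y. ennreal (c i) * indicator (ball x (\<rho> i)) y \<partial>lborel) = ennreal (?V * B * \<theta> ^ i)"
      by (simp add: eq mult.assoc)
  qed
  also have "\<dots> = ennreal (\<Sum>i. ?V * B * \<theta> ^ i)"
    using th B by (intro suminf_ennreal2 summable_mult summable_geometric) auto
  also have "(\<Sum>i. ?V * B * \<theta> ^ i) = ?V * B / (1 - \<theta>)"
    using th by (subst suminf_mult) (auto simp: suminf_geometric summable_geometric)
  finally show ?thesis .
qed

lemma suminf_ge_term_ennreal: "(f :: nat \<Rightarrow> ennreal) i \<le> (\<Sum>i. f i)"
  using sum_le_suminf[of f "{i}"] by (simp add: summableI)

text \<open>The sum of the geometric series over dyadic shells. The factor 2^n appears because a
  shell is estimated by the value at its inner radius on the ball of its outer, doubled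
  radius.\<close>

definition tail_const :: "'n::finite itself \<Rightarrow> real \<Rightarrow> real" where
  "tail_const _ a = unit_ball_vol (real CARD('n)) * 2 ^ CARD('n) / (1 - 2 powr (- a))"

definition near_const :: "'n::finite itself \<Rightarrow> real \<Rightarrow> real" where
  "near_const _ b = unit_ball_vol (real CARD('n)) * 2 ^ CARD('n) / (1 - 2 powr (- b))"

lemma tail_const_pos: "0 < a \<Longrightarrow> 0 < tail_const TYPE('n::finite) a"
  unfolding tail_const_def by (auto intro!: divide_pos_pos mult_pos_pos simp: powr_less_one)

lemma near_const_pos: "0 < b \<Longrightarrow> 0 < near_const TYPE('n::finite) b"
  unfolding near_const_def by (auto intro!: divide_pos_pos mult_pos_pos simp: powr_less_one)

lemma dyadic_up:
  fixes d R :: real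
  assumes "0 < R" "R \<le> d"
  obtains i :: nat where "2 ^ i * R \<le> d" "d < 2 ^ (i + 1) * R"
proof -
  define i where "i = nat \<lfloor>log 2 (d / R)\<rfloor>"
  have "0 \<le> log 2 (d / R)" using assms by simp
  then have i: "real i \<le> log 2 (d / R)" "log 2 (d / R) < real i + 1"
    unfolding i_def by linarith+
  have "d / R = 2 powr log 2 (d / R)" using assms by simp
  then have "2 powr real i \<le> d / R" "d / R < 2 powr (real i + 1)"
    using i powr_mono[OF i(1), of 2] powr_less_mono[OF i(2), of 2] by auto
  then have "2 ^ i \<le> d / R" "d / R < 2 ^ (i + 1)"
    by (auto simp: powr_realpow powr_add)
  then show ?thesis using assms that by (simp add: field_simps)
qed

text \<open>On the shell between 2^i R and 2^(i+1) R the kernel times the volume is of order (2^i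
  R)^(-a), which is summable. Applied with a = s p to the kernel itself, and with a = s p / 2 to a
  kernel that has lost half of its decay to a growing barrier.\<close>

lemma kernel_tail_le:
  fixes x :: "real ^ 'n"
  assumes a: "0 < a" and R: "0 < R"
  shows "(\<integral>\<^sup>+ y. ennreal (indicator {y. R \<le> norm (x - y)} y * norm (x - y) powr (- (real CARD('n) + a))) \<partial>lborel)
         \<le> ennreal (tail_const TYPE('n) a * R powr (- a))"
proof -
  let ?N = "real CARD('n)"
  have "(\<integral>\<^sup>+ y. ennreal (indicator {y. R \<le> norm (x - y)} y * norm (x - y) powr (- (?N + a))) \<partial>lborel)
     \<le> ennreal (unit_ball_vol ?N * (2 ^ CARD('n) * R powr (- a)) / (1 - 2 powr (- a)))"
  proof (rule nn_integral_dyadic_le[where x=x and c="\<lambda>i. (2 ^ i * R) powr (- (?N + a))" and \<rho>="\<lambda>i. 2 ^ (i+1) * R"])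
    fix y
    show "ennreal (indicator {y. R \<le> norm (x - y)} y * norm (x - y) powr (- (?N + a)))
       \<le> (\<Sum>i. ennreal ((2 ^ i * R) powr (- (?N + a))) * indicator (ball x (2 ^ (i+1) * R)) y)"
    proof (cases "R \<le> norm (x - y)")
      case True
      then obtain i :: nat where i: "2 ^ i * R \<le> norm (x - y)" "norm (x - y) < 2 ^ (i + 1) * R"
        using dyadic_up R by metis
      have "norm (x - y) powr (- (?N + a)) \<le> (2 ^ i * R) powr (- (?N + a))"
        using i R a by (intro powr_minus_mono) auto
      then have "ennreal (indicator {y. R \<le> norm (x - y)} y * norm (x - y) powr (- (?N + a)))
         \<le> ennreal ((2 ^ i * R) powr (- (?N + a))) * indicator (ball x (2 ^ (i+1) * R)) y"
        using i True by (auto simp: dist_norm indicator_def intro!: ennreal_leI)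
      also have "\<dots> \<le> (\<Sum>i. ennreal ((2 ^ i * R) powr (- (?N + a))) * indicator (ball x (2 ^ (i+1) * R)) y)"
        by (rule suminf_ge_term_ennreal)
      finally show ?thesis .
    qed simp
  next
    fix i
    have "(2 ^ i * R) powr (- (?N + a)) * (2 ^ (i + 1) * R) ^ CARD('n)
       = (2 ^ i * R) powr (- (?N + a)) * ((2 ^ i * R) powr ?N * 2 ^ CARD('n))"
      using R by (simp add: powr_realpow power_mult_distrib)
    also have "\<dots> = (2 ^ i * R) powr (- a) * 2 ^ CARD('n)"
      by (simp add: powr_add[symmetric] mult.assoc[symmetric])
    also have "(2 ^ i * R) powr (- a) = (2 powr (- a)) ^ i * R powr (- a)"
      using R by (simp add: powr_mult powr_powr powr_realpow[symmetric] mult.commute)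
    finally show "(2 ^ i * R) powr (- (?N + a)) * (2 ^ (i + 1) * R) ^ CARD('n) = 2 ^ CARD('n) * R powr (- a) * (2 powr (- a)) ^ i"
      by simp
  qed (use R a in \<open>auto simp: powr_less_one\<close>)
  then show ?thesis by (simp add: tail_const_def mult.assoc)
qed

text \<open>With b = p - s p this says that p-th powers of Lipschitz differences are integrable
  against the singular kernel near the diagonal; the positivity of this b is where s < 1
  enters.\<close>

lemma kernel_near_le:
  fixes x :: "real ^ 'n"
  assumes b: "0 < b" and R: "0 < R"
  shows "(\<integral>\<^sup>+ y. ennreal (indicator (ball x R) y * norm (x - y) powr (b - real CARD('n))) \<partial>lborel)
         \<le> ennreal (near_const TYPE('n) b * R powr b)"
proof -
  let ?N = "real CARD('n)"
  have "(\<integral>\<^sup>+ y. ennreal (indicator (ball x R) y * norm (x - y) powr (b - ?N)) \<partial>lborel)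
     \<le> ennreal (unit_ball_vol ?N * (2 ^ CARD('n) * R powr b) / (1 - 2 powr (- b)))"
  proof (rule nn_integral_dyadic_le[where x=x and c="\<lambda>i. (R / 2 ^ i) powr b * (R / 2 ^ (i+1)) powr (- ?N)" and \<rho>="\<lambda>i. R / 2 ^ i"])
    fix y
    show "ennreal (indicator (ball x R) y * norm (x - y) powr (b - ?N))
       \<le> (\<Sum>i. ennreal ((R / 2 ^ i) powr b * (R / 2 ^ (i+1)) powr (- ?N)) * indicator (ball x (R / 2 ^ i)) y)"
    proof (cases "y \<in> ball x R \<and> y \<noteq> x")
      case True
      define d where "d = norm (x - y)"
      have d: "0 < d" "d < R" using True by (auto simp: d_def dist_norm)
      have "1 \<le> R / d" using d by simp
      then obtain i :: nat where i: "2 ^ i * 1 \<le> R / d" "R / d < 2 ^ (i + 1) * 1"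
        using dyadic_up[of 1 "R/d"] by auto
      \<comment> \<open>The shell found is closed at its outer radius, but the balls are open: if d
        equals R / 2^i the next larger ball has to be taken. It exists because d < R excludes i =
        0.\<close>
      define j where "j = (if d = R / 2 ^ i then i - 1 else i)"
      have i': "d \<le> R / 2 ^ i" "R / 2 ^ (i + 1) < d" using i d by (auto simp: field_simps)
      have j: "d < R / 2 ^ j" "R / 2 ^ (j + 1) \<le> d"
      proof -
        have "i \<noteq> 0" if "d = R / 2 ^ i" using that d by (cases i) auto
        then show "d < R / 2 ^ j" "R / 2 ^ (j + 1) \<le> d"
          using i' d by (auto simp: j_def field_simps gr0_conv_Suc split: if_splits)
      qed
      have "d powr (b - ?N) = d powr b * d powr (- ?N)"
        by (simp add: powr_add[symmetric])
      also have "\<dots> \<le> (R / 2 ^ j) powr b * (R / 2 ^ (j+1)) powr (- ?N)"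
        using j d R b by (intro mult_mono powr_mono2 powr_minus_mono) auto
      finally have "ennreal (indicator (ball x R) y * norm (x - y) powr (b - ?N))
         \<le> ennreal ((R / 2 ^ j) powr b * (R / 2 ^ (j+1)) powr (- ?N)) * indicator (ball x (R / 2 ^ j)) y"
        using j True by (auto simp: dist_norm indicator_def d_def intro!: ennreal_leI)
      also have "\<dots> \<le> (\<Sum>i. ennreal ((R / 2 ^ i) powr b * (R / 2 ^ (i+1)) powr (- ?N)) * indicator (ball x (R / 2 ^ i)) y)"
        by (rule suminf_ge_term_ennreal)
      finally show ?thesis .
    qed auto
  next
    fix i
    define q where "q = R / 2 ^ (i+1)"
    have q: "0 < q" "R / 2 ^ i = 2 * q" using R by (simp_all add: q_def)
    have "q powr (- ?N) * (2 * q) ^ CARD('n) = 2 ^ CARD('n)"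
      using q(1) by (simp add: powr_realpow powr_minus power_mult_distrib)
    then have "(R / 2 ^ (i+1)) powr (- ?N) * (R / 2 ^ i) ^ CARD('n) = 2 ^ CARD('n)"
      by (simp only: q(2)) (simp only: q_def)
    then have "(R / 2 ^ i) powr b * (R / 2 ^ (i+1)) powr (- ?N) * (R / 2 ^ i) ^ CARD('n)
       = (R / 2 ^ i) powr b * 2 ^ CARD('n)"
      by (metis mult.assoc)
    moreover have "(R / 2 ^ i) powr b = R powr b * (2 powr (- b)) ^ i"
      using R by (simp add: powr_divide powr_powr powr_realpow[symmetric] mult.commute powr_minus_divide)
    ultimately show "(R / 2 ^ i) powr b * (R / 2 ^ (i+1)) powr (- ?N) * (R / 2 ^ i) ^ CARD('n) = 2 ^ CARD('n) * R powr b * (2 powr (- b)) ^ i"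
      by (metis mult.assoc mult.commute)
  qed (use R b in \<open>auto simp: powr_less_one\<close>)
  then show ?thesis by (simp add: near_const_def mult.assoc)
qed

subsection \<open>Fractional energy, Faber--Krahn and Sobolev inequalities\<close>

text \<open>The real \<open>N\<close> abbreviates the dimension; \<open>dim_type\<close> only ties it to the index type.\<close>

locale fractional =
  fixes p s N :: real and dim_type :: "'n::finite itself"
  assumes N_def: "N = real CARD('n)" and p1: "1 < p" and s0: "0 < s" and s1: "s < 1" and spN: "s * p < N"
begin

text \<open>Since 0 powr c = 0, the kernel is 0 on the diagonal. Lower bounds for it therefore need
  distinct points.\<close>

definition ker :: "real ^ 'n \<Rightarrow> real ^ 'n \<Rightarrow> real" where
  "ker x y = norm (x - y) powr (- (N + s * p))"

text \<open>The p-th power of the Gagliardo seminorm over the whole space. For functions vanishing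
  outside \<Omega> it coincides with the double integral over \<open>Qset \<Omega>\<close>.\<close>

definition energy :: "(real ^ 'n \<Rightarrow> real) \<Rightarrow> ennreal" where
  "energy g = (\<integral>\<^sup>+ x. \<integral>\<^sup>+ y. ennreal (\<bar>g x - g y\<bar> powr p * ker x y) \<partial>lborel \<partial>lborel)"

lemma p0: "0 < p" and sp0: "0 < s * p" and N1: "1 \<le> N" and N0: "0 < N"
  using p1 s0 by (auto simp: Suc_le_eq N_def)

lemma V_pos [simp]: "0 < unit_ball_vol N"
  using N0 by simp

lemma ker_nonneg [simp]: "0 \<le> ker x y"
  by (simp add: ker_def)

lemma ker_sym: "ker x y = ker y x"
  by (simp add: ker_def norm_minus_commute)

lemma ker_measurable [measurable (raw)]:
  "f \<in> borel_measurable M \<Longrightarrow> g \<in> borel_measurable M \<Longrightarrow> (\<lambda>z. ker (f z) (g z)) \<in> borel_measurable M"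
  unfolding ker_def by measurable

text \<open>Chosen so that \<open>level_const * m powr (s * p / N)\<close> equals r^(N + s p) / m,
  where r is the radius of a ball of measure 2 m.\<close>

definition level_const :: real where
  "level_const = (2 / unit_ball_vol N) powr (1 + s * p / N)"

lemma level_const_pos: "0 < level_const"
  using V_pos by (simp add: level_const_def del: V_pos)

text \<open>A ball of measure \<open>2 m\<close> around \<open>x\<close> cannot be covered by \<open>A\<close> up to measure \<open>m\<close>; this one remark
  yields both the Faber--Krahn and the Sobolev inequality.\<close>

lemma jump_le_energy_density:
  fixes f :: "real ^ 'n \<Rightarrow> real"
  assumes A[measurable]: "A \<in> sets borel" and m: "emeasure lborel A \<le> ennreal m" "0 < m" and t: "0 < t"
    and f[measurable]: "f \<in> borel_measurable borel"
    and jump: "\<And>y. y \<notin> A \<Longrightarrow> t \<le> \<bar>f x - f y\<bar>"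
  shows "ennreal (t powr p) \<le> ennreal (level_const * m powr (s * p / N)) *
           (\<integral>\<^sup>+ y. ennreal (\<bar>f x - f y\<bar> powr p * ker x y) \<partial>lborel)"
proof -
  define V where "V = unit_ball_vol N"
  have V: "0 < V" unfolding V_def by (rule V_pos)
  define r where "r = (2 * m / V) powr (1 / N)"
  have r: "0 < r" using m V by (simp add: r_def)
  have rN: "r powr N = 2 * m / V" using m V N0 by (simp add: r_def powr_powr)
  have rN': "V * r ^ CARD('n) = 2 * m"
    using rN r V by (simp add: powr_realpow[symmetric] N_def)
  have "ennreal (2 * m) = emeasure lborel (ball x r)"
    using r rN' by (subst emeasure_ball_vec) (auto simp: V_def N_def)
  also have "\<dots> \<le> emeasure lborel ((ball x r - A) \<union> A)"
    by (intro emeasure_mono) auto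
  also have "\<dots> \<le> emeasure lborel (ball x r - A) + emeasure lborel A"
    by (intro emeasure_subadditive) auto
  also have "\<dots> \<le> emeasure lborel (ball x r - A) + ennreal m"
    using m by (intro add_left_mono)
  finally have "ennreal m + ennreal m \<le> emeasure lborel (ball x r - A) + ennreal m"
    using m by (simp add: ennreal_plus[symmetric] del: ennreal_plus)
  then have big: "ennreal m \<le> emeasure lborel (ball x r - A)"
    by (simp add: ennreal_add_left_cancel_le add.commute)
  have "ennreal (t powr p * r powr (- (N + s * p))) * ennreal m
      \<le> ennreal (t powr p * r powr (- (N + s * p))) * emeasure lborel (ball x r - A)"
    using big by (intro mult_left_mono) auto
  also have "\<dots> = (\<integral>\<^sup>+ y. ennreal (t powr p * r powr (- (N + s * p))) * indicator (ball x r - A) y \<partial>lborel)"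
    by (subst nn_integral_cmult_indicator) auto
  also have "\<dots> \<le> (\<integral>\<^sup>+ y. ennreal (\<bar>f x - f y\<bar> powr p * ker x y) \<partial>lborel)"
  proof (intro nn_integral_mono)
    fix y
    show "ennreal (t powr p * r powr (- (N + s * p))) * indicator (ball x r - A) y
        \<le> ennreal (\<bar>f x - f y\<bar> powr p * ker x y)"
    proof (cases "y \<in> ball x r - A")
      case True
      then have j: "t \<le> \<bar>f x - f y\<bar>" and d: "norm (x - y) < r" using jump by (auto simp: dist_norm)
      \<comment> \<open>The lower bound for \<open>ker x y\<close> fails on the diagonal; the
        positive jump excludes it.\<close>
      have "x \<noteq> y" using j t by auto
      then have "r powr (- (N + s * p)) \<le> ker x y"
        unfolding ker_def using d sp0 N0 by (intro powr_minus_mono) auto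
      moreover have "t powr p \<le> \<bar>f x - f y\<bar> powr p" using j t p0 by (intro powr_mono2) auto
      ultimately show ?thesis using True by (auto intro!: ennreal_leI mult_mono)
    qed auto
  qed
  finally have main: "ennreal (t powr p * r powr (- (N + s * p)) * m)
      \<le> (\<integral>\<^sup>+ y. ennreal (\<bar>f x - f y\<bar> powr p * ker x y) \<partial>lborel)"
    using m by (simp add: ennreal_mult' )
  have e1: "r powr (- (N + s * p)) = V / (2 * m) * (2 * m / V) powr (- (s * p / N))"
  proof -
    have "r powr (- (N + s * p)) = r powr (- N) * r powr (- (s * p))"
      by (simp add: powr_add[symmetric])
    also have "r powr (- N) = V / (2 * m)" using rN by (simp add: powr_minus)
    also have "r powr (- (s * p)) = (2 * m / V) powr (- (s * p / N))"
      using N0 by (simp add: r_def powr_powr)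
    finally show ?thesis .
  qed
  have e2: "level_const * m powr (s * p / N) = (2 / V) * (2 * m / V) powr (s * p / N)"
  proof -
    have "2 * m / V = (2 / V) * m" by simp
    then have "(2 * m / V) powr (s * p / N) = (2 / V) powr (s * p / N) * m powr (s * p / N)"
      using m V by (metis powr_mult)
    then show ?thesis using V by (simp add: level_const_def V_def[symmetric] powr_add)
  qed
  have "level_const * m powr (s * p / N) * (t powr p * r powr (- (N + s * p)) * m) = t powr p"
    unfolding e1 e2 using m V by (simp add: powr_minus field_simps)
  then have "ennreal (t powr p) = ennreal (level_const * m powr (s * p / N)) * ennreal (t powr p * r powr (- (N + s * p)) * m)"
    using level_const_pos by (metis ennreal_mult' less_eq_real_def mult_nonneg_nonneg powr_ge_zero)
  also have "\<dots> \<le> ennreal (level_const * m powr (s * p / N)) * (\<integral>\<^sup>+ y. ennreal (\<bar>f x - f y\<bar> powr p * ker x y) \<partial>lborel)"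
    by (intro mult_left_mono main) simp
  finally show ?thesis .
qed

text \<open>At a point with f x nonzero take the set where f does not vanish as the exceptional set:
  outside it the jump from x is exactly |f x|. Integrating the density bound over x gives the
  claim.\<close>

lemma faber_krahn:
  fixes f :: "real ^ 'n \<Rightarrow> real"
  assumes f[measurable]: "f \<in> borel_measurable borel"
    and m: "emeasure lborel {x. f x \<noteq> 0} \<le> ennreal m" "0 < m"
  shows "(\<integral>\<^sup>+ x. ennreal (\<bar>f x\<bar> powr p) \<partial>lborel) \<le> ennreal (level_const * m powr (s * p / N)) * energy f"
proof -
  have "(\<integral>\<^sup>+ x. ennreal (\<bar>f x\<bar> powr p) \<partial>lborel)
     \<le> (\<integral>\<^sup>+ x. ennreal (level_const * m powr (s * p / N)) *
           (\<integral>\<^sup>+ y. ennreal (\<bar>f x - f y\<bar> powr p * ker x y) \<partial>lborel) \<partial>lborel)"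
  proof (intro nn_integral_mono)
    fix x
    show "ennreal (\<bar>f x\<bar> powr p) \<le> ennreal (level_const * m powr (s * p / N)) *
           (\<integral>\<^sup>+ y. ennreal (\<bar>f x - f y\<bar> powr p * ker x y) \<partial>lborel)"
    proof (cases "f x = 0")
      case False
      show ?thesis
        by (rule jump_le_energy_density[OF _ m]) (use False in auto)
    qed simp
  qed
  also have "\<dots> = ennreal (level_const * m powr (s * p / N)) * energy f"
    unfolding energy_def by (intro nn_integral_cmult) measurable
  finally show ?thesis .
qed

abbreviation pst :: real where "pst \<equiv> N * p / (N - s * p)"

lemma pst_props: "p < pst" "0 < pst" "p + pst * (s * p / N) = pst" "p / pst = 1 - s * p / N"
    "pst / p = N / (N - s * p)"
proof -
  have d: "0 < N - s * p" using spN by simp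
  show "p < pst" using d p0 sp0 by (simp add: field_simps)
  then show "0 < pst" using p0 by linarith
  show "p + pst * (s * p / N) = pst" using d N0 by (simp add: field_simps)
  show "p / pst = 1 - s * p / N" "pst / p = N / (N - s * p)" using d N0 p0 by (simp_all add: field_simps)
qed

definition sob_const :: real where "sob_const = 2 powr pst * level_const"

lemma sob_const_pos: "0 < sob_const"
  by (simp add: sob_const_def level_const_pos)

text \<open>A self-improving estimate. With i the integral itself, Chebyshev bounds the measure of
  {f \<ge> f x / 2} by i over a power of f x, and the jump bound integrates to i \<le> C e i^(s p /
  N). Dividing by the power of i needs i finite, hence the bound \<open>B\<close> and the bounded
  set \<open>S\<close>.\<close>

lemma sobolev_bounded:
  fixes f :: "real ^ 'n \<Rightarrow> real"
  assumes f[measurable]: "f \<in> borel_measurable borel" and nn: "\<And>x. 0 \<le> f x" and B: "\<And>x. f x \<le> B"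
    and S: "bounded S" "\<And>x. x \<notin> S \<Longrightarrow> f x = 0"
    and e: "energy f \<le> ennreal e" "0 \<le> e"
  shows "(\<integral>\<^sup>+ x. ennreal (f x powr pst) \<partial>lborel) \<le> ennreal ((sob_const * e) powr (N / (N - s * p)))"
proof -
  let ?I = "\<integral>\<^sup>+ x. ennreal (f x powr pst) \<partial>lborel"
  have d: "0 < N - s * p" using spN by simp
  obtain R where R: "S \<subseteq> ball 0 R" "0 < R" using S(1) bounded_subset_ballD by blast
  have "?I \<le> (\<integral>\<^sup>+ x. ennreal (B powr pst) * indicator (ball (0 :: real ^ 'n) R) x \<partial>lborel)"
  proof (intro nn_integral_mono)
    fix x show "ennreal (f x powr pst) \<le> ennreal (B powr pst) * indicator (ball 0 R) x"
      using subsetD[OF R(1), of x] S(2)[of x] nn[of x] B[of x] pst_props(2)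
      by (cases "x \<in> S") (auto simp: indicator_def intro!: ennreal_leI powr_mono2)
  qed
  also have "\<dots> = ennreal (B powr pst) * emeasure lborel (ball (0::real^'n) R)"
    by (subst nn_integral_cmult_indicator) auto
  also have "\<dots> < \<infinity>" using R by (subst emeasure_ball_vec) (auto simp: ennreal_mult_less_top)
  finally have "?I < top" by simp
  then obtain i where i: "?I = ennreal i" "0 \<le> i" by (metis ennreal_cases less_irrefl)
  show ?thesis
  proof (cases "i = 0")
    case False
    then have i0: "0 < i" using i by simp
    have "?I \<le> (\<integral>\<^sup>+ x. ennreal (sob_const * i powr (s * p / N)) *
           (\<integral>\<^sup>+ y. ennreal (\<bar>f x - f y\<bar> powr p * ker x y) \<partial>lborel) \<partial>lborel)"
    proof (intro nn_integral_mono)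
      fix x
      let ?G = "\<integral>\<^sup>+ y. ennreal (\<bar>f x - f y\<bar> powr p * ker x y) \<partial>lborel"
      show "ennreal (f x powr pst) \<le> ennreal (sob_const * i powr (s * p / N)) * ?G"
      proof (cases "f x = 0")
        case False
        \<comment> \<open>Half of the value: where f y < t, the jump from x is at least t. The
          relation f x = 2 t is the origin of the factor 2^pst in \<open>sob_const\<close>.\<close>
        define t where "t = f x / 2"
        have t: "0 < t" using False nn[of x] by (simp add: t_def)
        define m where "m = i / t powr pst"
        have m: "0 < m" using i0 t by (simp add: m_def)
        have "emeasure lborel {y. t \<le> f y} = (\<integral>\<^sup>+ y. indicator {y. t \<le> f y} y \<partial>lborel)"
          by (simp add: nn_integral_indicator)
        also have "\<dots> \<le> (\<integral>\<^sup>+ y. ennreal (1 / t powr pst) * ennreal (f y powr pst) \<partial>lborel)"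
        proof (intro nn_integral_mono)
          fix y show "indicator {y. t \<le> f y} y \<le> ennreal (1 / t powr pst) * ennreal (f y powr pst)"
          proof (cases "t \<le> f y")
            case True
            then have "t powr pst \<le> f y powr pst" using t pst_props(2) by (intro powr_mono2) auto
            then have "1 \<le> 1 / t powr pst * f y powr pst" using t by (simp add: field_simps)
            then show ?thesis using True t
              by (simp add: ennreal_mult'[symmetric] del: ennreal_mult')
          qed auto
        qed
        also have "\<dots> = ennreal (1 / t powr pst) * ?I" by (intro nn_integral_cmult) measurable
        also have "\<dots> = ennreal m" using i by (simp add: m_def ennreal_mult'[symmetric])
        finally have mm: "emeasure lborel {y. t \<le> f y} \<le> ennreal m" .
        have "ennreal (t powr p) \<le> ennreal (level_const * m powr (s * p / N)) * ?G"
        proof (rule jump_le_energy_density[OF _ mm m t])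
          fix y assume "y \<notin> {y. t \<le> f y}"
          then show "t \<le> \<bar>f x - f y\<bar>" using nn[of y] by (auto simp: t_def)
        qed auto
        then have "ennreal (2 powr pst * t powr (pst * (s * p / N))) * ennreal (t powr p)
           \<le> ennreal (2 powr pst * t powr (pst * (s * p / N))) * (ennreal (level_const * m powr (s * p / N)) * ?G)"
          by (intro mult_left_mono) auto
        also have "\<dots> = ennreal (2 powr pst * t powr (pst * (s * p / N)) * (level_const * m powr (s * p / N))) * ?G"
          using level_const_pos by (simp add: ennreal_mult' mult.assoc)
        also have "2 powr pst * t powr (pst * (s * p / N)) * (level_const * m powr (s * p / N)) = sob_const * i powr (s * p / N)"
          using t i0 by (simp add: m_def sob_const_def powr_divide powr_powr)
        also have "ennreal (2 powr pst * t powr (pst * (s * p / N))) * ennreal (t powr p) = ennreal (f x powr pst)"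
        proof -
          have "t powr (pst * (s * p / N)) * t powr p = t powr pst"
            using pst_props(3) by (simp add: powr_add[symmetric] add.commute)
          moreover have "f x powr pst = 2 powr pst * t powr pst" using t by (simp add: t_def powr_divide)
          ultimately show ?thesis by (simp add: ennreal_mult'[symmetric] mult.assoc)
        qed
        finally show ?thesis .
      qed simp
    qed
    also have "\<dots> = ennreal (sob_const * i powr (s * p / N)) * energy f"
      unfolding energy_def by (intro nn_integral_cmult) measurable
    also have "\<dots> \<le> ennreal (sob_const * i powr (s * p / N)) * ennreal e"
      by (intro mult_left_mono e) simp
    finally have "ennreal i \<le> ennreal (sob_const * i powr (s * p / N) * e)"
      using i sob_const_pos e by (simp add: ennreal_mult'[symmetric])
    then have "i \<le> sob_const * i powr (s * p / N) * e"
      using sob_const_pos e by (subst (asm) ennreal_le_iff) auto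
    then have "i powr (1 - s * p / N) \<le> sob_const * e"
      using i0 by (simp add: powr_diff field_simps)
    then have "(i powr (1 - s * p / N)) powr (N / (N - s * p)) \<le> (sob_const * e) powr (N / (N - s * p))"
      using d N0 by (intro powr_mono2) auto
    moreover have "(1 - s * p / N) * (N / (N - s * p)) = 1" using d N0 by (simp add: field_simps)
    ultimately have "i powr 1 \<le> (sob_const * e) powr (N / (N - s * p))" by (simp only: powr_powr)
    then have "i \<le> (sob_const * e) powr (N / (N - s * p))" using i0 by (simp only: powr_one)
    then show ?thesis unfolding i(1) by (rule ennreal_leI)
  qed (use i in simp)
qed

lemma energy_mono:
  assumes "\<And>x y. \<bar>f x - f y\<bar> \<le> \<bar>g x - g y\<bar>"
  shows "energy f \<le> energy g"
  unfolding energy_def using assms p0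
  by (intro nn_integral_mono ennreal_leI mult_right_mono powr_mono2) auto

text \<open>The bound for min(f, i) does not depend on i, truncation does not increase the energy,
  and monotone convergence removes the truncation.\<close>

lemma sobolev:
  fixes f :: "real ^ 'n \<Rightarrow> real"
  assumes f[measurable]: "f \<in> borel_measurable borel" and nn: "\<And>x. 0 \<le> f x"
    and S: "bounded S" "\<And>x. x \<notin> S \<Longrightarrow> f x = 0"
    and e: "energy f \<le> ennreal e" "0 \<le> e"
  shows "(\<integral>\<^sup>+ x. ennreal (f x powr pst) \<partial>lborel) \<le> ennreal ((sob_const * e) powr (N / (N - s * p)))"
proof -
  have "(\<integral>\<^sup>+ x. ennreal (f x powr pst) \<partial>lborel) \<le> (\<integral>\<^sup>+ x. (SUP i. ennreal (min (f x) (real i) powr pst)) \<partial>lborel)"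
  proof (intro nn_integral_mono)
    fix x
    obtain i :: nat where "f x \<le> real i" using real_arch_simple by blast
    then show "ennreal (f x powr pst) \<le> (SUP i. ennreal (min (f x) (real i) powr pst))"
      by (intro SUP_upper2[of i]) (auto simp: min_def)
  qed
  also have "\<dots> = (SUP i. \<integral>\<^sup>+ x. ennreal (min (f x) (real i) powr pst) \<partial>lborel)"
    using nn pst_props(2)
    by (intro nn_integral_monotone_convergence_SUP) (auto simp: incseq_def le_fun_def intro!: ennreal_leI powr_mono2)
  also have "\<dots> \<le> ennreal ((sob_const * e) powr (N / (N - s * p)))"
  proof (rule SUP_least)
    fix i
    have "energy (\<lambda>x. min (f x) (real i)) \<le> ennreal e"
      by (rule order_trans[OF energy_mono e(1)]) (auto simp: min_def)
    then show "(\<integral>\<^sup>+ x. ennreal (min (f x) (real i) powr pst) \<partial>lborel) \<le> ennreal ((sob_const * e) powr (N / (N - s * p)))"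
      using nn S e(2) by (intro sobolev_bounded[where S=S and B="real i"]) auto
  qed
  finally show ?thesis .
qed

end

subsection \<open>Smooth mollifiers\<close>

lemma Ck_imp_continuous: "Ck k f \<Longrightarrow> continuous_on UNIV f"
  by (cases k) (auto intro!: continuous_at_imp_continuous_on dest: has_derivative_continuous)

lemma Ck_Suc_imp: "Ck (Suc k) f \<Longrightarrow> Ck k f"
proof (induction k arbitrary: f)
  case 0
  then show ?case using Ck_imp_continuous by (metis Ck.simps(1))
next
  case (Suc k)
  then show ?case by (metis Ck.simps(2))
qed

lemma Ck_const: "Ck k (\<lambda>x. c)"
proof (induction k arbitrary: c)
  case (Suc k)
  then show ?case by (auto intro!: exI[of _ "\<lambda>x. 0"])
qed simp

lemma Ck_coord: "Ck k (\<lambda>x::real^'n. x $ i)"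
proof (cases k)
  case 0
  then show ?thesis by (auto intro!: continuous_intros)
next
  case (Suc m)
  have "((\<lambda>x::real^'n. x $ i) has_derivative (\<lambda>h. axis i 1 \<bullet> h)) (at x)" for x
    by (simp add: inner_axis' bounded_linear_imp_has_derivative bounded_linear_vec_nth)
  moreover have "Ck m (\<lambda>x::real^'n. (axis i 1 :: real ^ 'n) $ j)" for j by (rule Ck_const)
  ultimately show ?thesis using Suc by (auto intro!: exI[of _ "\<lambda>x. axis i 1"])
qed

lemma Ck_add: "Ck k f \<Longrightarrow> Ck k g \<Longrightarrow> Ck k (\<lambda>x. f x + g x)"
proof (induction k arbitrary: f g)
  case 0
  then show ?case by (auto intro!: continuous_intros)
next
  case (Suc k)
  obtain f' where f': "\<And>x. (f has_derivative (\<lambda>h. f' x \<bullet> h)) (at x)" "\<And>i. Ck k (\<lambda>x. f' x $ i)"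
    using Suc.prems(1) by auto
  obtain g' where g': "\<And>x. (g has_derivative (\<lambda>h. g' x \<bullet> h)) (at x)" "\<And>i. Ck k (\<lambda>x. g' x $ i)"
    using Suc.prems(2) by auto
  have "((\<lambda>x. f x + g x) has_derivative (\<lambda>h. (f' x + g' x) \<bullet> h)) (at x)" for x
    using has_derivative_add[OF f'(1) g'(1)] by (simp add: inner_add_left)
  moreover have "Ck k (\<lambda>x. (f' x + g' x) $ i)" for i using Suc.IH[OF f'(2) g'(2)] by simp
  ultimately show ?case by (auto intro!: exI[of _ "\<lambda>x. f' x + g' x"])
qed

lemma Ck_mult: "Ck k f \<Longrightarrow> Ck k g \<Longrightarrow> Ck k (\<lambda>x. f x * g x)"
proof (induction k arbitrary: f g)
  case 0
  then show ?case by (auto intro!: continuous_intros)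
next
  case (Suc k)
  have fk: "Ck k f" "Ck k g" using Suc.prems Ck_Suc_imp by blast+
  obtain f' where f': "\<And>x. (f has_derivative (\<lambda>h. f' x \<bullet> h)) (at x)" "\<And>i. Ck k (\<lambda>x. f' x $ i)"
    using Suc.prems(1) by auto
  obtain g' where g': "\<And>x. (g has_derivative (\<lambda>h. g' x \<bullet> h)) (at x)" "\<And>i. Ck k (\<lambda>x. g' x $ i)"
    using Suc.prems(2) by auto
  have "((\<lambda>x. f x * g x) has_derivative (\<lambda>h. (f x *\<^sub>R g' x + g x *\<^sub>R f' x) \<bullet> h)) (at x)" for x
    using has_derivative_mult[OF f'(1) g'(1)] by (simp add: inner_add_left mult.commute add.commute)
  moreover have "Ck k (\<lambda>x. (f x *\<^sub>R g' x + g x *\<^sub>R f' x) $ i)" for i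
    using Ck_add[OF Suc.IH[OF fk(1) g'(2)] Suc.IH[OF fk(2) f'(2)]] by simp
  ultimately show ?case by (auto intro!: exI[of _ "\<lambda>x. f x *\<^sub>R g' x + g x *\<^sub>R f' x"])
qed

definition flat :: "nat \<Rightarrow> real \<Rightarrow> real" where
  "flat j t = (if 0 < t then exp (- 1 / t) / t ^ j else 0)"

lemma flat_right_limit: "(flat j \<longlongrightarrow> 0) (at_right 0)"
proof -
  have "((\<lambda>x::real. x ^ j / exp x) \<longlongrightarrow> 0) at_top" by (rule tendsto_power_div_exp_0)
  moreover have "eventually (\<lambda>x::real. x ^ j / exp x = flat j (inverse x)) at_top"
    using eventually_gt_at_top[of 0]
    by eventually_elim (simp add: flat_def exp_minus divide_simps power_inverse)
  ultimately show ?thesis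
    unfolding filterlim_at_right_to_top by (rule Lim_transform_eventually)
qed

text \<open>The derivatives of the flat function stay inside the family, which makes smoothness an induction.\<close>

lemma DERIV_flat: "(flat j has_real_derivative (flat (j + 2) t - real j * flat (j + 1) t)) (at t)"
proof -
  consider "t > 0" | "t < 0" | "t = 0" by linarith
  then show ?thesis
  proof cases
    case 1
    have "((\<lambda>t. exp (- 1 / t) / t ^ j) has_real_derivative (flat (j + 2) t - real j * flat (j + 1) t)) (at t)"
      using 1 by (auto intro!: derivative_eq_intros simp: flat_def power2_eq_square divide_simps power_add)
         (cases j; simp add: algebra_simps)
    moreover have "eventually (\<lambda>x. exp (- 1 / x) / x ^ j = flat j x) (nhds t)"
      using eventually_nhds_in_open[of "{0<..}" t] 1 by (auto simp: flat_def elim: eventually_mono)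
    ultimately show ?thesis by (subst (asm) DERIV_cong_ev[OF refl _ refl]) auto
  next
    case 2
    have "eventually (\<lambda>x. 0 = flat j x) (nhds t)"
      using eventually_nhds_in_open[of "{..<0}" t] 2 by (auto simp: flat_def elim: eventually_mono)
    moreover have "((\<lambda>t. 0) has_real_derivative 0) (at t)" by simp
    ultimately show ?thesis using 2 by (subst (asm) DERIV_cong_ev[OF refl _ refl]) (auto simp: flat_def)
  next
    case 3
    have "((\<lambda>y. (flat j y - flat j 0) / (y - 0)) \<longlongrightarrow> 0) (at 0)"
    proof (rule filterlim_split_at)
      have "eventually (\<lambda>y::real. 0 = (flat j y - flat j 0) / (y - 0)) (at_left 0)"
        by (auto simp: flat_def eventually_at_filter)
      then show "((\<lambda>y. (flat j y - flat j 0) / (y - 0)) \<longlongrightarrow> 0) (at_left 0)"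
        by (rule Lim_transform_eventually[OF tendsto_const])
      \<comment> \<open>The right difference quotient at 0 is itself a member of the family, so
        \<open>flat_right_limit\<close> applies to it.\<close>
      have "eventually (\<lambda>y::real. flat (j + 1) y = (flat j y - flat j 0) / (y - 0)) (at_right 0)"
        by (auto simp: flat_def eventually_at_filter)
      then show "((\<lambda>y. (flat j y - flat j 0) / (y - 0)) \<longlongrightarrow> 0) (at_right 0)"
        by (rule Lim_transform_eventually[OF flat_right_limit])
    qed
    then show ?thesis using 3 by (simp add: has_field_derivative_iff flat_def)
  qed
qed

text \<open>The inner function is a polynomial, hence smooth at the origin as well, where the norm
  is not. The induction runs over all j at once, because differentiating raises j.\<close>

lemma Ck_flat_ball: "Ck k (\<lambda>x::real^'n. flat j (r - x \<bullet> x))"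
proof (induction k arbitrary: j)
  case 0
  have "continuous_on UNIV (flat j)"
    using DERIV_flat by (auto intro!: continuous_at_imp_continuous_on DERIV_isCont)
  then show ?case
    by (auto intro!: continuous_on_compose2[of UNIV "flat j"] continuous_intros)
next
  case (Suc k)
  define D where "D = (\<lambda>x::real^'n. flat (j + 2) (r - x \<bullet> x) - real j * flat (j + 1) (r - x \<bullet> x))"
  have "((\<lambda>x::real^'n. flat j (r - x \<bullet> x)) has_derivative (\<lambda>h. ((- 2 * D x) *\<^sub>R x) \<bullet> h)) (at x)" for x
  proof -
    have "((\<lambda>x::real^'n. r - x \<bullet> x) has_derivative (\<lambda>h. - 2 * (x \<bullet> h))) (at x)"
      by (auto intro!: derivative_eq_intros simp: inner_commute)
    from has_derivative_compose[OF this DERIV_flat[of j, unfolded has_field_derivative_def]]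
    show ?thesis by (simp add: D_def algebra_simps)
  qed
  moreover have "Ck k (\<lambda>x. ((- 2 * D x) *\<^sub>R x) $ i)" for i
  proof -
    have "Ck k D"
      using Ck_add[OF Suc.IH[of "j+2"] Ck_mult[OF Ck_const[of k "- real j"] Suc.IH[of "j+1"]]]
      by (simp add: D_def)
    from Ck_mult[OF Ck_mult[OF Ck_const[of k "-2"] this] Ck_coord[of k i]] show ?thesis by simp
  qed
  ultimately show ?case by (auto intro!: exI[of _ "\<lambda>x. (- 2 * D x) *\<^sub>R x"])
qed

lemma smooth_measurable [measurable_dest]: "smooth f \<Longrightarrow> f \<in> borel_measurable borel"
  unfolding smooth_def using Ck_imp_continuous borel_measurable_continuous_onI by blast

lemma ex_mollifier:
  assumes e: "0 < e"
  obtains \<rho> :: "real ^ 'n \<Rightarrow> real" where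
    "smooth \<rho>" "\<And>x. 0 \<le> \<rho> x" "\<And>x. e < norm x \<Longrightarrow> \<rho> x = 0" "(\<integral>\<^sup>+ x. ennreal (\<rho> x) \<partial>lborel) = 1"
proof -
  define F where "F = (\<lambda>x::real^'n. flat 0 (e\<^sup>2 - x \<bullet> x))"
  have F_nn: "0 \<le> F x" for x by (simp add: F_def flat_def)
  have F_sm: "smooth F" by (simp add: smooth_def F_def Ck_flat_ball)
  then have [measurable]: "F \<in> borel_measurable borel" by measurable
  have F0: "F x = 0" if "e < norm x" for x
    using that e power_strict_mono[of e "norm x" 2] by (simp add: F_def flat_def power2_norm_eq_inner)
  let ?Z = "\<integral>\<^sup>+ x. ennreal (F x) \<partial>lborel"
  have "?Z \<le> (\<integral>\<^sup>+ x. 1 * indicator (cball (0::real^'n) e) x \<partial>lborel)"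
  proof (intro nn_integral_mono)
    fix x show "ennreal (F x) \<le> 1 * indicator (cball 0 e) x"
      using F0[of x] by (auto simp: indicator_def F_def flat_def ennreal_le_1 split: if_splits)
  qed
  also have "\<dots> = emeasure lborel (cball (0::real^'n) e)" by simp
  also have "\<dots> < top" using emeasure_lborel_cball_finite[of "0::real^'n" e] by simp
  finally obtain z where z: "?Z = ennreal z" "0 \<le> z" by (metis ennreal_cases less_irrefl)
  have "0 < z"
  proof (rule ccontr)
    assume "\<not> 0 < z"
    then have "?Z = 0" using z by simp
    then have "AE x in lborel. F x = 0" using F_nn
      by (auto simp: nn_integral_0_iff_AE ennreal_eq_0_iff intro: antisym elim!: eventually_mono)
    moreover have "F x \<noteq> 0" if "x \<in> ball 0 e" for x
      using that power_strict_mono[of "norm x" e 2] by (simp add: F_def flat_def power2_norm_eq_inner)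
    ultimately have "AE x in lborel. x \<notin> ball (0::real^'n) e" by (auto elim: eventually_mono)
    then have "emeasure lborel (ball (0::real^'n) e) = 0" by (simp add: AE_iff_null_sets null_setsD1)
    moreover have "0 < unit_ball_vol (real CARD('n)) * e ^ CARD('n)"
      using e unit_ball_vol_vec_pos[where 'n='n] by (intro mult_pos_pos zero_less_power)
    moreover have "emeasure lborel (ball (0::real^'n) e) = ennreal (unit_ball_vol (real CARD('n)) * e ^ CARD('n))"
      using e by (intro emeasure_ball_vec) simp
    ultimately show False by (simp only: ennreal_eq_0_iff)
  qed
  show ?thesis
  proof (rule that[of "\<lambda>x. 1 / z * F x"])
    show "smooth (\<lambda>x. 1 / z * F x)"
      using F_sm unfolding smooth_def by (intro allI Ck_mult Ck_const) auto
    have "(\<integral>\<^sup>+ x. ennreal (1 / z * F x) \<partial>lborel) = (\<integral>\<^sup>+ x. ennreal (1 / z) * ennreal (F x) \<partial>lborel)"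
      using \<open>0 < z\<close> F_nn by (intro nn_integral_cong ennreal_mult) auto
    also have "\<dots> = ennreal (1 / z) * ?Z" by (intro nn_integral_cmult) measurable
    also have "\<dots> = 1" using z \<open>0 < z\<close> by (simp add: ennreal_mult[symmetric])
    finally show "(\<integral>\<^sup>+ x. ennreal (1 / z * F x) \<partial>lborel) = 1" .
  qed (use F_nn F0 \<open>0 < z\<close> in auto)
qed

lemma bounded_continuous_compact_support:
  fixes \<rho> :: "real ^ 'n \<Rightarrow> real"
  assumes "continuous_on UNIV \<rho>" "\<And>x. e < norm x \<Longrightarrow> \<rho> x = 0"
  obtains B where "0 \<le> B" "\<And>x. \<bar>\<rho> x\<bar> \<le> B"
proof -
  have "compact (\<rho> ` cball 0 e)"
    using assms(1) by (intro compact_continuous_image) (auto intro: continuous_on_subset)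
  then have "bounded (\<rho> ` cball 0 e)" by (rule compact_imp_bounded)
  then obtain B where B: "0 < B" "\<And>x. x \<in> cball 0 e \<Longrightarrow> \<bar>\<rho> x\<bar> \<le> B" unfolding bounded_pos by auto
  have "\<bar>\<rho> x\<bar> \<le> B" for x using B assms(2)[of x] by (cases "x \<in> cball 0 e") auto
  then show ?thesis using B that[of B] by simp
qed

text \<open>All derivatives fall on \<rho>, so integrability of \<psi> suffices; the gradient of
  \<rho> inherits the compact support, which keeps the induction going. The remainder of the
  difference quotient is dominated by 2 L |\<psi>|, where L bounds the gradient.\<close>

lemma Ck_convolution:
  fixes \<rho> \<psi> :: "real ^ 'n \<Rightarrow> real"
  assumes "Ck k \<rho>" "\<And>x. e < norm x \<Longrightarrow> \<rho> x = 0" and psi: "integrable lborel \<psi>"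
  shows "Ck k (\<lambda>x. LINT y|lborel. \<rho> (x - y) * \<psi> y)"
  using assms(1,2)
proof (induction k arbitrary: \<rho>)
  case 0
  then have cont: "continuous_on UNIV \<rho>" by simp
  then have [measurable]: "\<rho> \<in> borel_measurable borel" by (rule borel_measurable_continuous_onI)
  obtain B where B: "0 \<le> B" "\<And>x. \<bar>\<rho> x\<bar> \<le> B" using bounded_continuous_compact_support[OF cont 0(2)] by blast
  have [measurable]: "\<psi> \<in> borel_measurable borel" using psi by auto
  show ?case
  proof (simp, rule continuous_at_imp_continuous_on, intro ballI, unfold continuous_at_sequentially comp_def, intro allI impI)
    fix x and X :: "nat \<Rightarrow> real ^ 'n" assume X: "X \<longlonglongrightarrow> x"
    show "(\<lambda>n. LINT y|lborel. \<rho> (X n - y) * \<psi> y) \<longlonglongrightarrow> (LINT y|lborel. \<rho> (x - y) * \<psi> y)"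
    proof (rule integral_dominated_convergence[where w="\<lambda>y. B * \<bar>\<psi> y\<bar>"])
      show "integrable lborel (\<lambda>y. B * \<bar>\<psi> y\<bar>)" using psi by auto
      show "AE y in lborel. (\<lambda>n. \<rho> (X n - y) * \<psi> y) \<longlonglongrightarrow> \<rho> (x - y) * \<psi> y"
      proof (intro AE_I2 tendsto_intros)
        fix y
        have "isCont \<rho> (x - y)" using cont by (simp add: continuous_on_eq_continuous_at)
        then show "(\<lambda>n. \<rho> (X n - y)) \<longlonglongrightarrow> \<rho> (x - y)"
          by (rule isCont_tendsto_compose) (intro tendsto_intros X)
      qed
      show "AE y in lborel. norm (\<rho> (X n - y) * \<psi> y) \<le> B * \<bar>\<psi> y\<bar>" for n
        using B by (auto simp: abs_mult intro!: mult_right_mono)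
    qed measurable
  qed
next
  case (Suc k)
  obtain g where g: "\<And>x. (\<rho> has_derivative (\<lambda>h. g x \<bullet> h)) (at x)" "\<And>i. Ck k (\<lambda>x. g x $ i)"
    using Suc.prems(1) by auto
  have g0: "g x = 0" if "e < norm x" for x
  proof -
    have "open {x::real^'n. e < norm x}" by (intro open_Collect_less continuous_intros)
    then have "((\<lambda>x. 0) has_derivative (\<lambda>h. g x \<bullet> h)) (at x)"
      by (rule has_derivative_transform_within_open[OF g(1)]) (use that Suc.prems(2) in auto)
    moreover have "((\<lambda>x. 0) has_derivative (\<lambda>h. 0)) (at x)" by simp
    ultimately have "(\<lambda>h. g x \<bullet> h) = (\<lambda>h. 0)" by (rule has_derivative_unique)
    then have "g x \<bullet> g x = 0" by metis
    then show ?thesis by simp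
  qed
  have gc: "continuous_on UNIV g"
    using g(2) Ck_imp_continuous continuous_on_vec_lambda[of UNIV "\<lambda>i x. g x $ i"] by (auto simp: vec_lambda_eta)
  have rc: "continuous_on UNIV \<rho>" using Suc.prems(1) by (rule Ck_imp_continuous)
  have [measurable]: "\<rho> \<in> borel_measurable borel" "g \<in> borel_measurable borel"
    using gc rc by (auto intro: borel_measurable_continuous_onI)
  have psi_m[measurable]: "\<psi> \<in> borel_measurable borel" using psi by auto
  have "continuous_on UNIV (\<lambda>x. norm (g x))" using gc by (intro continuous_intros)
  then obtain L where L: "0 \<le> L" "\<And>x. norm (g x) \<le> L"
    using bounded_continuous_compact_support[of "\<lambda>x. norm (g x)" e] g0 by (metis abs_norm_cancel norm_zero)
  obtain B where B: "0 \<le> B" "\<And>x. \<bar>\<rho> x\<bar> \<le> B"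
    using bounded_continuous_compact_support[OF rc Suc.prems(2)] by blast
  have lip: "\<bar>\<rho> x - \<rho> y\<bar> \<le> L * norm (x - y)" for x y
  proof -
    have "norm (\<rho> x - \<rho> y) \<le> L * norm (x - y)"
    proof (rule differentiable_bound[of UNIV _ "\<lambda>x h. g x \<bullet> h"])
      fix x show "onorm (\<lambda>h. g x \<bullet> h) \<le> L"
        by (rule onorm_le) (metis L(2) Cauchy_Schwarz_ineq2 mult_right_mono norm_ge_zero order_trans real_norm_def)
    qed (use g in auto)
    then show ?thesis by simp
  qed
  have int_rho: "integrable lborel (\<lambda>y. \<rho> (x - y) * \<psi> y)" for x
    by (rule Bochner_Integration.integrable_bound[of _ "\<lambda>y. B * \<bar>\<psi> y\<bar>"])
       (use psi B in \<open>auto simp: abs_mult intro!: mult_right_mono\<close>)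
  have int_g: "integrable lborel (\<lambda>y. g (x - y) $ i * \<psi> y)" for x i
  proof (rule Bochner_Integration.integrable_bound[of _ "\<lambda>y. L * \<bar>\<psi> y\<bar>"])
    have [measurable]: "(\<lambda>x. g x $ i) \<in> borel_measurable borel"
      using g(2)[of i] Ck_imp_continuous borel_measurable_continuous_onI by blast
    show "(\<lambda>y. g (x - y) $ i * \<psi> y) \<in> borel_measurable lborel" by measurable
    have "\<bar>g z $ i\<bar> \<le> L" for z using L(2)[of z] component_le_norm_cart[of "g z" i] by linarith
    then show "AE y in lborel. norm (g (x - y) $ i * \<psi> y) \<le> norm (L * \<bar>\<psi> y\<bar>)"
      using L(1) by (auto simp: abs_mult intro!: mult_right_mono)
  qed (use psi in auto)
  have expand: "(g (x - y) \<bullet> h) * \<psi> y = (\<Sum>i\<in>UNIV. (g (x - y) $ i * \<psi> y) * h $ i)" for x y h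
    unfolding inner_vec_def sum_distrib_right by (intro sum.cong) simp_all
  define G where "G = (\<lambda>x. \<chi> i. LINT y|lborel. g (x - y) $ i * \<psi> y)"
  have G_inner: "G x \<bullet> h = (LINT y|lborel. (g (x - y) \<bullet> h) * \<psi> y)" for x h
  proof -
    have "G x \<bullet> h = (\<Sum>i\<in>UNIV. (LINT y|lborel. g (x - y) $ i * \<psi> y) * h $ i)"
      by (simp add: G_def inner_vec_def)
    also have "\<dots> = (\<Sum>i\<in>UNIV. LINT y|lborel. (g (x - y) $ i * \<psi> y) * h $ i)" by simp
    also have "\<dots> = (LINT y|lborel. (\<Sum>i\<in>UNIV. (g (x - y) $ i * \<psi> y) * h $ i))"
      using int_g by (intro Bochner_Integration.integral_sum[symmetric]) auto
    also have "\<dots> = (LINT y|lborel. (g (x - y) \<bullet> h) * \<psi> y)"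
      unfolding expand ..
    finally show ?thesis .
  qed
  have int_gh: "integrable lborel (\<lambda>y. (g (x - y) \<bullet> h) * \<psi> y)" for x h
  proof -
    have "integrable lborel (\<lambda>y. \<Sum>i\<in>UNIV. (g (x - y) $ i * \<psi> y) * h $ i)"
      using int_g by (intro Bochner_Integration.integrable_sum integrable_mult_left)
    then show ?thesis unfolding expand .
  qed
  let ?c = "\<lambda>x. LINT y|lborel. \<rho> (x - y) * \<psi> y"
  have "(?c has_derivative (\<lambda>h. G x \<bullet> h)) (at x)" for x
    unfolding has_derivative_at
  proof (intro conjI bounded_linear_inner_right)
    show "((\<lambda>h. norm (?c (x + h) - ?c x - G x \<bullet> h) / norm h) \<longlongrightarrow> 0) (at 0)"
      unfolding tendsto_at_iff_sequentially comp_def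
    proof (intro allI impI)
      fix X :: "nat \<Rightarrow> real ^ 'n" assume Xn: "\<forall>i. X i \<in> UNIV - {0}" and X: "X \<longlonglongrightarrow> 0"
      define q where "q = (\<lambda>n y. (\<rho> (x + X n - y) - \<rho> (x - y) - g (x - y) \<bullet> X n) * \<psi> y / norm (X n))"
      have eq: "norm (?c (x + X n) - ?c x - G x \<bullet> X n) / norm (X n) = \<bar>LINT y|lborel. q n y\<bar>" for n
      proof -
        have "?c (x + X n) - ?c x - G x \<bullet> X n
          = (LINT y|lborel. \<rho> (x + X n - y) * \<psi> y - \<rho> (x - y) * \<psi> y - (g (x - y) \<bullet> X n) * \<psi> y)"
          using int_rho int_gh by (simp add: G_inner)
        then have "(?c (x + X n) - ?c x - G x \<bullet> X n) / norm (X n) = (LINT y|lborel. q n y)"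
          by (simp add: q_def left_diff_distrib[symmetric] flip: integral_divide_zero)
        from arg_cong[OF this, of abs] show ?thesis by (simp only: abs_divide abs_norm_cancel real_norm_def)
      qed
      have "(\<lambda>n. LINT y|lborel. q n y) \<longlonglongrightarrow> (LINT y|(lborel::(real^'n) measure). 0)"
      proof (rule integral_dominated_convergence[where w="\<lambda>y. (2 * L) * \<bar>\<psi> y\<bar>"])
        show "integrable lborel (\<lambda>y. (2 * L) * \<bar>\<psi> y\<bar>)" using psi by auto
        show "AE y in lborel. (\<lambda>n. q n y) \<longlonglongrightarrow> 0"
        proof (rule AE_I2)
          fix y
          have "((\<lambda>h. norm (\<rho> ((x - y) + h) - \<rho> (x - y) - g (x - y) \<bullet> h) / norm h) \<longlongrightarrow> 0) (at 0)"
            using g(1)[of "x - y"] by (simp add: has_derivative_at)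
          then have "(\<lambda>n. norm (\<rho> ((x - y) + X n) - \<rho> (x - y) - g (x - y) \<bullet> X n) / norm (X n)) \<longlonglongrightarrow> 0"
            unfolding tendsto_at_iff_sequentially comp_def using Xn X by blast
          then have "(\<lambda>n. norm (\<rho> ((x - y) + X n) - \<rho> (x - y) - g (x - y) \<bullet> X n) / norm (X n) * \<bar>\<psi> y\<bar>) \<longlonglongrightarrow> 0"
            by (rule tendsto_mult_left_zero)
          then have "(\<lambda>n. \<bar>q n y\<bar>) \<longlonglongrightarrow> 0"
            by (simp add: q_def abs_mult diff_add_eq)
          then show "(\<lambda>n. q n y) \<longlonglongrightarrow> 0" by (rule tendsto_rabs_zero_cancel)
        qed
        show "AE y in lborel. norm (q n y) \<le> 2 * L * \<bar>\<psi> y\<bar>" for n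
        proof (rule AE_I2)
          fix y
          have "\<bar>g (x - y) \<bullet> X n\<bar> \<le> L * norm (X n)"
            by (metis L(2) Cauchy_Schwarz_ineq2 mult_right_mono norm_ge_zero order_trans)
          moreover have "\<bar>\<rho> (x + X n - y) - \<rho> (x - y)\<bar> \<le> L * norm (X n)"
            using lip[of "x + X n - y" "x - y"] by (simp add: algebra_simps)
          ultimately have "\<bar>\<rho> (x + X n - y) - \<rho> (x - y) - g (x - y) \<bullet> X n\<bar> \<le> 2 * L * norm (X n)" by linarith
          then have "\<bar>\<rho> (x + X n - y) - \<rho> (x - y) - g (x - y) \<bullet> X n\<bar> / norm (X n) \<le> 2 * L"
            using Xn by (simp add: divide_simps)
          then have "\<bar>\<rho> (x + X n - y) - \<rho> (x - y) - g (x - y) \<bullet> X n\<bar> / norm (X n) * \<bar>\<psi> y\<bar> \<le> 2 * L * \<bar>\<psi> y\<bar>"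
            by (rule mult_right_mono) simp
          then show "norm (q n y) \<le> 2 * L * \<bar>\<psi> y\<bar>" by (simp add: q_def abs_mult)
        qed
      qed (auto simp: q_def)
      then have "(\<lambda>n. \<bar>LINT y|lborel. q n y\<bar>) \<longlonglongrightarrow> 0" by (simp add: tendsto_rabs_zero)
      then show "(\<lambda>n. norm (?c (x + X n) - ?c (x) - G x \<bullet> X n) / norm (X n)) \<longlonglongrightarrow> 0" by (simp only: eq)
    qed
  qed
  moreover have "Ck k (\<lambda>x. G x $ i)" for i
    using Suc.IH[OF g(2)[of i]] g0 by (simp add: G_def)
  ultimately show ?case by (auto intro!: exI[of _ G])
qed

subsection \<open>Translations\<close>

lemma lborel_reflect: "distr lborel borel (\<lambda>y. x - y) = (lborel :: (real ^ 'n) measure)"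
  by (subst (2) lborel_affine[of "-1" x]) (auto simp: density_1)

lemma integral_reflect:
  fixes f :: "real ^ 'n \<Rightarrow> real"
  assumes [measurable]: "f \<in> borel_measurable borel"
  shows "(LINT y|lborel. f (x - y)) = (LINT y|lborel. f y)"
  by (subst (2) lborel_reflect[of x, symmetric], subst integral_distr) auto

lemma nn_integral_translate:
  fixes f :: "real ^ 'n \<Rightarrow> ennreal"
  assumes [measurable]: "f \<in> borel_measurable borel"
  shows "(\<integral>\<^sup>+ y. f (y - t) \<partial>lborel) = (\<integral>\<^sup>+ y. f y \<partial>lborel)"
  by (subst (2) lborel_distr_plus[of "- t", symmetric], subst nn_integral_distr) auto

text \<open>A measurable function is an almost everywhere limit of continuous ones. After truncating
  these to [-B, B] and cutting them off, dominated convergence yields an approximation in L^1, and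
  uniform continuity controls the translates of the approximant.\<close>

lemma translation_L1_continuous:
  fixes \<psi> :: "real ^ 'n \<Rightarrow> real"
  assumes psi[measurable]: "\<psi> \<in> borel_measurable borel" and B: "\<And>x. \<bar>\<psi> x\<bar> \<le> B"
    and R: "\<And>x. R < norm x \<Longrightarrow> \<psi> x = 0" and e: "0 < e"
  obtains \<delta> where "0 < \<delta>"
    "\<And>t. norm t \<le> \<delta> \<Longrightarrow> (\<integral>\<^sup>+ x. ennreal \<bar>\<psi> (x - t) - \<psi> x\<bar> \<partial>lborel) \<le> ennreal e"
proof -
  define R' where "R' = max R 0"
  have R': "0 \<le> R'" "\<And>x. R' < norm x \<Longrightarrow> \<psi> x = 0" using R by (auto simp: R'_def)
  have B0: "0 \<le> B" using B[of 0] by linarith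
  have "\<psi> measurable_on UNIV"
    by (rule lebesgue_measurable_imp_measurable_on) (auto intro: measurable_completion)
  then obtain Z g where Z: "negligible Z" and g: "\<And>n. continuous_on UNIV (g n)"
    and lim: "\<And>x. x \<notin> Z \<Longrightarrow> (\<lambda>n. g n x) \<longlonglongrightarrow> \<psi> x"
    unfolding measurable_on_def by auto
  \<comment> \<open>A continuous cutoff equal to 1 on the ball of radius R': it gives the
    approximants compact support and does not change \<psi>.\<close>
  define c where "c = (\<lambda>x::real^'n. max 0 (min 1 (R' + 1 - norm x)))"
  have c: "0 \<le> c x" "c x \<le> 1" "R' + 1 < norm x \<Longrightarrow> c x = 0" for x by (auto simp: c_def)
  have c\<psi>: "\<psi> x * c x = \<psi> x" for x using R'(2)[of x] by (cases "R' < norm x") (auto simp: c_def)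
  define \<phi> where "\<phi> = (\<lambda>n x. max (- B) (min B (g n x)) * c x)"
  have phi_cont: "continuous_on UNIV (\<phi> n)" for n
    unfolding \<phi>_def c_def by (intro continuous_intros g)
  have [measurable]: "\<phi> n \<in> borel_measurable borel" for n using phi_cont by (rule borel_measurable_continuous_onI)
  have phi_B: "\<bar>\<phi> n x\<bar> \<le> B * c x" for n x
  proof -
    have "\<bar>max (- B) (min B (g n x))\<bar> \<le> B" using B0 by auto
    then show ?thesis using c(1)[of x] by (auto simp: \<phi>_def abs_mult intro!: mult_right_mono)
  qed
  have phi_lim: "(\<lambda>n. \<phi> n x) \<longlonglongrightarrow> \<psi> x" if "x \<notin> Z" for x
  proof -
    have "(\<lambda>n. \<phi> n x) \<longlonglongrightarrow> max (- B) (min B (\<psi> x)) * c x"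
      unfolding \<phi>_def by (intro tendsto_intros lim that)
    moreover have "max (- B) (min B (\<psi> x)) = \<psi> x" using B[of x] by auto
    ultimately show ?thesis using c\<psi> by simp
  qed
  have AEZ: "AE x in lborel. x \<notin> Z"
    using Z by (auto simp: negligible_iff_null_sets dest: AE_not_in simp: AE_completion_iff)
  have [measurable]: "cball (0::real^'n) (R' + 1) \<in> sets borel" by simp
  have "(\<lambda>n. \<integral>\<^sup>+ x. ennreal \<bar>\<phi> n x - \<psi> x\<bar> \<partial>lborel) \<longlonglongrightarrow> (\<integral>\<^sup>+ x. 0 \<partial>(lborel::(real^'n) measure))"
  proof (rule nn_integral_dominated_convergence[where w="\<lambda>x. ennreal (2 * B) * indicator (cball 0 (R'+1)) x"])
    show "AE x in lborel. ennreal \<bar>\<phi> n x - \<psi> x\<bar> \<le> ennreal (2 * B) * indicator (cball 0 (R'+1)) x" for n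
    proof (rule AE_I2)
      fix x
      show "ennreal \<bar>\<phi> n x - \<psi> x\<bar> \<le> ennreal (2 * B) * indicator (cball 0 (R'+1)) x"
      proof (cases "x \<in> cball 0 (R' + 1)")
        case True
        have "\<bar>\<phi> n x\<bar> \<le> B" using phi_B[of n x] c[of x] B0 mult_left_le[of "c x" B] by linarith
        then show ?thesis using True B[of x] by (auto intro!: ennreal_leI)
      next
        case False
        then have "\<phi> n x = 0" "\<psi> x = 0" using c(3)[of x] R'(2)[of x] by (auto simp: \<phi>_def)
        then show ?thesis by simp
      qed
    qed
    show "(\<integral>\<^sup>+ x. ennreal (2 * B) * indicator (cball 0 (R'+1)) x \<partial>(lborel::(real^'n) measure)) < \<infinity>"
      using emeasure_lborel_cball_finite[of "0::real^'n" "R'+1"]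
      by (subst nn_integral_cmult_indicator) (auto simp: ennreal_mult_less_top)
    show "AE x in lborel. (\<lambda>n. ennreal \<bar>\<phi> n x - \<psi> x\<bar>) \<longlonglongrightarrow> 0"
      using AEZ
    proof eventually_elim
      case (elim x)
      have "(\<lambda>n. \<bar>\<phi> n x - \<psi> x\<bar>) \<longlonglongrightarrow> 0"
        using phi_lim[OF elim] by (simp add: LIM_zero_iff tendsto_rabs_zero_iff)
      then show ?case using tendsto_ennrealI by fastforce
    qed
  qed auto
  then have "(\<lambda>n. \<integral>\<^sup>+ x. ennreal \<bar>\<phi> n x - \<psi> x\<bar> \<partial>lborel) \<longlonglongrightarrow> 0" by simp
  then have "\<forall>\<^sub>F n in sequentially. (\<integral>\<^sup>+ x. ennreal \<bar>\<phi> n x - \<psi> x\<bar> \<partial>lborel) < ennreal (e / 3)"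
    by (rule order_tendstoD(2)) (use e in auto)
  then obtain n where n: "(\<integral>\<^sup>+ x. ennreal \<bar>\<phi> n x - \<psi> x\<bar> \<partial>lborel) < ennreal (e / 3)"
    by (auto simp: eventually_sequentially)
  \<comment> \<open>For |t| \<le> 1 the difference between the approximant and its translate lives
    in this ball, so a uniform error is multiplied by this volume.\<close>
  define V where "V = measure lborel (cball (0::real^'n) (R' + 2))"
  have V: "emeasure lborel (cball (0::real^'n) (R' + 2)) = ennreal V"
    unfolding V_def by (metis emeasure_eq_ennreal_measure emeasure_lborel_cball_finite less_irrefl infinity_ennreal_def)
  have V0: "0 \<le> V" by (simp add: V_def)
  have "uniformly_continuous_on (cball 0 (R' + 3)) (\<phi> n)"
    using phi_cont by (intro compact_uniformly_continuous) (auto intro: continuous_on_subset)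
  moreover have "0 < e / (3 * (V + 1))" using e V0 by simp
  ultimately obtain d where d: "0 < d"
    "\<And>x y. x \<in> cball 0 (R'+3) \<Longrightarrow> y \<in> cball 0 (R'+3) \<Longrightarrow> dist y x < d \<Longrightarrow> dist (\<phi> n y) (\<phi> n x) < e / (3 * (V + 1))"
    unfolding uniformly_continuous_on_def by metis
  show ?thesis
  proof (rule that[of "min 1 (d / 2)"])
    fix t :: "real ^ 'n" assume "norm t \<le> min 1 (d / 2)"
    then have t: "norm t \<le> 1" "norm t < d" using d(1) by auto
    have mid: "(\<integral>\<^sup>+ x. ennreal \<bar>\<phi> n (x - t) - \<phi> n x\<bar> \<partial>lborel) \<le> ennreal (e / 3)"
    proof -
      have "(\<integral>\<^sup>+ x. ennreal \<bar>\<phi> n (x - t) - \<phi> n x\<bar> \<partial>lborel)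
         \<le> (\<integral>\<^sup>+ x. ennreal (e / (3 * (V + 1))) * indicator (cball (0::real^'n) (R'+2)) x \<partial>lborel)"
      proof (intro nn_integral_mono)
        fix x :: "real ^ 'n"
        have nx: "norm (x - t) \<le> norm x + 1" "norm x \<le> norm (x - t) + 1"
          using t norm_triangle_ineq4[of x t] norm_triangle_ineq2[of x t] by linarith+
        show "ennreal \<bar>\<phi> n (x - t) - \<phi> n x\<bar> \<le> ennreal (e / (3 * (V + 1))) * indicator (cball 0 (R'+2)) x"
        proof (cases "x \<in> cball 0 (R' + 2)")
          case True
          then have "dist (\<phi> n (x - t)) (\<phi> n x) < e / (3 * (V + 1))"
            using nx t by (intro d(2)) (auto simp: dist_norm norm_minus_commute[of t x])
          then show ?thesis using True by (auto simp: dist_real_def intro!: ennreal_leI)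
        next
          case False
          then have "\<phi> n x = 0" "\<phi> n (x - t) = 0" using nx c(3)[of x] c(3)[of "x - t"] by (auto simp: \<phi>_def)
          then show ?thesis by simp
        qed
      qed
      also have "\<dots> = ennreal (e / (3 * (V + 1))) * ennreal V"
        by (subst nn_integral_cmult_indicator) (auto simp: V)
      also have "\<dots> = ennreal (e / (3 * (V + 1)) * V)" using V0 e by (intro ennreal_mult[symmetric]) auto
      also have "\<dots> \<le> ennreal (e / 3)" using V0 e by (intro ennreal_leI) (simp add: field_simps)
      finally show ?thesis .
    qed
    have "(\<integral>\<^sup>+ x. ennreal \<bar>\<psi> (x - t) - \<psi> x\<bar> \<partial>lborel)
       \<le> (\<integral>\<^sup>+ x. ennreal \<bar>\<phi> n (x - t) - \<psi> (x - t)\<bar> + ennreal \<bar>\<phi> n (x - t) - \<phi> n x\<bar> + ennreal \<bar>\<phi> n x - \<psi> x\<bar> \<partial>lborel)"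
      by (intro nn_integral_mono) (auto simp: ennreal_plus[symmetric] simp del: ennreal_plus intro!: ennreal_leI)
    also have "\<dots> = (\<integral>\<^sup>+ x. ennreal \<bar>\<phi> n (x - t) - \<psi> (x - t)\<bar> \<partial>lborel)
        + (\<integral>\<^sup>+ x. ennreal \<bar>\<phi> n (x - t) - \<phi> n x\<bar> \<partial>lborel) + (\<integral>\<^sup>+ x. ennreal \<bar>\<phi> n x - \<psi> x\<bar> \<partial>lborel)"
      by (subst nn_integral_add; measurable)+
    also have "(\<integral>\<^sup>+ x. ennreal \<bar>\<phi> n (x - t) - \<psi> (x - t)\<bar> \<partial>lborel) = (\<integral>\<^sup>+ x. ennreal \<bar>\<phi> n x - \<psi> x\<bar> \<partial>lborel)"
      by (rule nn_integral_translate[of "\<lambda>x. ennreal \<bar>\<phi> n x - \<psi> x\<bar>"]) measurable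
    also have "(\<integral>\<^sup>+ x. ennreal \<bar>\<phi> n x - \<psi> x\<bar> \<partial>lborel) + (\<integral>\<^sup>+ x. ennreal \<bar>\<phi> n (x - t) - \<phi> n x\<bar> \<partial>lborel)
        + (\<integral>\<^sup>+ x. ennreal \<bar>\<phi> n x - \<psi> x\<bar> \<partial>lborel) \<le> ennreal (e / 3) + ennreal (e / 3) + ennreal (e / 3)"
      using n mid by (intro add_mono) auto
    also have "\<dots> = ennreal e" using e by (simp add: ennreal_plus[symmetric] del: ennreal_plus)
    finally show "(\<integral>\<^sup>+ x. ennreal \<bar>\<psi> (x - t) - \<psi> x\<bar> \<partial>lborel) \<le> ennreal e" .
  qed (use d in auto)
qed

subsection \<open>Extending the class of test functions\<close>

text \<open>Both summands are at most the maximum, so no convexity is involved and exponents below 1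
  are allowed; the lemma is applied with p - 1, which may be small.\<close>

lemma add_powr_le:
  fixes a b c :: real
  assumes "0 \<le> a" "0 \<le> b" "0 \<le> c"
  shows "(a + b) powr c \<le> 2 powr c * (a powr c + b powr c)"
proof -
  have "(a + b) powr c \<le> (2 * max a b) powr c" using assms by (intro powr_mono2) auto
  also have "\<dots> = 2 powr c * max a b powr c" using assms by (simp add: powr_mult)
  also have "max a b powr c \<le> a powr c + b powr c" by (auto simp: max_def)
  finally show ?thesis by simp
qed

text \<open>The support lies in the sum of K and a closed ball of radius e, which is compact as a
  sum of compact sets.\<close>

lemma test_function_convolution:
  fixes \<rho> \<psi> :: "real ^ 'n \<Rightarrow> real"
  assumes rho: "smooth \<rho>" "\<And>x. e < norm x \<Longrightarrow> \<rho> x = 0"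
    and psi: "\<psi> \<in> borel_measurable borel" "\<And>x. \<bar>\<psi> x\<bar> \<le> B" "\<And>x. x \<notin> K \<Longrightarrow> \<psi> x = 0"
    and K: "compact K" "(\<Union>x\<in>K. cball x e) \<subseteq> \<Omega>"
  shows "test_function \<Omega> (\<lambda>x. LINT y|lborel. \<rho> (x - y) * \<psi> y)"
proof -
  have Km: "K \<in> sets borel" using K(1) by (simp add: compact_imp_closed borel_closed)
  have Kf: "emeasure lborel K < \<infinity>" by (rule emeasure_compact_finite[OF K(1)])
  have "integrable lborel (\<lambda>x. indicator K x * B)"
    using Km Kf by (intro integrable_mult_left integrable_real_indicator) auto
  then have int: "integrable lborel \<psi>"
    by (rule Bochner_Integration.integrable_bound)
       (use psi in \<open>auto simp: indicator_def intro!: AE_I2 intro: order_trans[OF _ abs_ge_self]\<close>)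
  let ?c = "\<lambda>x. LINT y|lborel. \<rho> (x - y) * \<psi> y"
  let ?T = "\<Union>x\<in>K. cball x e"
  have "?T = (\<Union>x\<in>K. \<Union>y\<in>cball 0 e. {x + y})"
    by (auto simp: dist_norm) (metis add.commute diff_add_cancel mem_cball_0 norm_minus_commute)
  then have T: "compact ?T" using compact_sums'[OF K(1) compact_cball[of 0 e]] by simp
  have sub: "{x. ?c x \<noteq> 0} \<subseteq> ?T"
  proof
    fix x assume "x \<in> {x. ?c x \<noteq> 0}"
    moreover have "?c x = 0" if "\<And>y. \<rho> (x - y) * \<psi> y = 0"
      by (simp only: that Bochner_Integration.integral_zero)
    ultimately have "\<not> (\<forall>y. \<rho> (x - y) * \<psi> y = 0)" by blast
    then obtain y where "\<rho> (x - y) \<noteq> 0" "\<psi> y \<noteq> 0" by auto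
    then have "y \<in> K" "norm (x - y) \<le> e" using rho(2) psi(3) by (metis not_le_imp_less)+
    then show "x \<in> ?T" by (auto simp: dist_norm norm_minus_commute)
  qed
  then have sub': "closure {x. ?c x \<noteq> 0} \<subseteq> ?T" by (rule closure_minimal) (rule compact_imp_closed[OF T])
  have "smooth ?c" using rho int Ck_convolution unfolding smooth_def by blast
  moreover have "compact (closure {x. ?c x \<noteq> 0})"
    using sub T by (meson bounded_closure bounded_subset compact_closure compact_imp_bounded)
  ultimately show ?thesis using sub' K(2) by (auto simp: test_function_def)
qed

lemma compact_neighbourhood:
  fixes K :: "(real ^ 'n) set"
  assumes "compact K" "open \<Omega>" "K \<subseteq> \<Omega>"
  obtains d where "0 < d" "(\<Union>x\<in>K. cball x d) \<subseteq> \<Omega>" "compact (\<Union>x\<in>K. cball x d)"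
proof -
  obtain e where e: "0 < e" "(\<Union>x\<in>K. cball x e) \<subseteq> \<Omega>"
    using compact_subset_open_imp_cball_epsilon_subset[OF assms] by metis
  have "(\<Union>x\<in>K. cball x e) = (\<Union>x\<in>K. \<Union>y\<in>cball 0 e. {x + y})"
    by (auto simp: dist_norm) (metis add.commute diff_add_cancel mem_cball_0 norm_minus_commute)
  then have "compact (\<Union>x\<in>K. cball x e)" using compact_sums'[OF assms(1) compact_cball[of 0 e]] by simp
  then show ?thesis using that e by blast
qed

lemma convolution_reflect:
  fixes \<rho> \<psi> :: "real ^ 'n \<Rightarrow> real"
  assumes [measurable]: "\<rho> \<in> borel_measurable borel" "\<psi> \<in> borel_measurable borel"
  shows "(LINT y|lborel. \<rho> (x - y) * \<psi> y) = (LINT t|lborel. \<rho> t * \<psi> (x - t))"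
  using integral_reflect[of "\<lambda>t. \<rho> t * \<psi> (x - t)" x] by simp

lemma borel_measurable_fst_snd [measurable (raw)]:
  fixes f :: "'a \<Rightarrow> (real ^ 'n) \<times> (real ^ 'n)"
  assumes "f \<in> borel_measurable M"
  shows "(\<lambda>x. fst (f x)) \<in> borel_measurable M" "(\<lambda>x. snd (f x)) \<in> borel_measurable M"
proof -
  have f: "f \<in> measurable M (borel \<Otimes>\<^sub>M borel)" using assms by (simp add: borel_prod)
  show "(\<lambda>x. fst (f x)) \<in> borel_measurable M" by (rule measurable_compose[OF f measurable_fst])
  show "(\<lambda>x. snd (f x)) \<in> borel_measurable M" by (rule measurable_compose[OF f measurable_snd])
qed

section \<open>Flux, Young's inequality and translations\<close>

context fractional
begin

definition flux :: "(real ^ 'n \<Rightarrow> real) \<Rightarrow> (real ^ 'n \<Rightarrow> real) \<Rightarrow> (real ^ 'n) \<times> (real ^ 'n) \<Rightarrow> real" where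
  "flux v \<psi> z = \<bar>v (fst z) - v (snd z)\<bar> powr (p - 2) * (v (fst z) - v (snd z)) *
     (\<psi> (fst z) - \<psi> (snd z)) * ker (fst z) (snd z)"

lemma flux_measurable [measurable]:
  assumes [measurable]: "v \<in> borel_measurable borel" "\<psi> \<in> borel_measurable borel"
  shows "flux v \<psi> \<in> borel_measurable borel"
  unfolding flux_def by measurable

text \<open>A dichotomy replaces conjugate exponents: if a^(p-1) \<le> \<tau> b^(p-1) the first term
  suffices; otherwise b is at most \<tau>^(-1/(p-1)) a and the second one does.\<close>

lemma young:
  assumes a: "0 \<le> a" and b: "0 \<le> b" and t: "0 < \<tau>"
  shows "a powr (p - 1) * b \<le> \<tau> * b powr p + \<tau> powr (- 1 / (p - 1)) * a powr p"
proof -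
  have pp: "c powr (p - 1) * c = c powr p" if "0 \<le> c" for c :: real
    using that p1 powr_mult_base[of c "p - 1"] by (simp add: mult.commute)
  show ?thesis
  proof (cases "a powr (p - 1) \<le> \<tau> * b powr (p - 1)")
    case True
    then have "a powr (p - 1) * b \<le> \<tau> * b powr (p - 1) * b" using b by (rule mult_right_mono)
    also have "\<dots> = \<tau> * b powr p" using pp[OF b] by (simp add: mult.assoc)
    finally show ?thesis by (simp add: add_increasing2)
  next
    case False
    then have "b powr (p - 1) \<le> a powr (p - 1) / \<tau>" using t by (simp add: field_simps)
    then have "(b powr (p - 1)) powr (1 / (p - 1)) \<le> (a powr (p - 1) / \<tau>) powr (1 / (p - 1))"
      using p1 by (intro powr_mono2) auto
    then have "b \<le> a / \<tau> powr (1 / (p - 1))"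
      using a b p1 by (simp add: powr_powr powr_divide)
    then have "b \<le> \<tau> powr (- 1 / (p - 1)) * a" by (simp add: powr_minus_divide)
    then have "a powr (p - 1) * b \<le> a powr (p - 1) * (\<tau> powr (- 1 / (p - 1)) * a)" by (intro mult_left_mono) auto
    also have "\<dots> = \<tau> powr (- 1 / (p - 1)) * a powr p" using pp[OF a] by (simp add: mult.left_commute)
    finally show ?thesis using t by (simp add: add_increasing)
  qed
qed

lemma abs_powr_mult: "\<bar>d\<bar> powr (p - 2) * \<bar>d\<bar> = \<bar>d\<bar> powr (p - 1)"
  using powr_mult_base[of "\<bar>d\<bar>" "p - 2"] by (cases "d = 0") (auto simp: mult.commute)

lemma abs_flux:
  "\<bar>flux v \<psi> z\<bar> = \<bar>v (fst z) - v (snd z)\<bar> powr (p - 1) * \<bar>\<psi> (fst z) - \<psi> (snd z)\<bar> * ker (fst z) (snd z)"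
  by (simp add: flux_def abs_mult abs_powr_mult)

lemma energy_pair:
  assumes [measurable]: "g \<in> borel_measurable borel"
  shows "energy g = (\<integral>\<^sup>+ z. ennreal (\<bar>g (fst z) - g (snd z)\<bar> powr p * ker (fst z) (snd z)) \<partial>lborel)"
  unfolding energy_def
  using lborel.nn_integral_fst[of "\<lambda>z. ennreal (\<bar>g (fst z) - g (snd z)\<bar> powr p * ker (fst z) (snd z))" lborel]
  by (simp add: lborel_prod)

lemma energy_translate:
  assumes [measurable]: "g \<in> borel_measurable borel"
  shows "energy (\<lambda>x. g (x - t)) = energy g"
proof -
  have "energy (\<lambda>x. g (x - t)) = (\<integral>\<^sup>+ x. (\<integral>\<^sup>+ y. ennreal (\<bar>g (x - t) - g (y - t)\<bar> powr p * ker (x - t) (y - t)) \<partial>lborel) \<partial>lborel)"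
    by (simp add: energy_def ker_def)
  also have "\<dots> = (\<integral>\<^sup>+ x. (\<integral>\<^sup>+ y. ennreal (\<bar>g (x - t) - g y\<bar> powr p * ker (x - t) y) \<partial>lborel) \<partial>lborel)"
    by (intro nn_integral_cong nn_integral_translate) measurable
  also have "\<dots> = energy g"
    unfolding energy_def
    by (rule nn_integral_translate) measurable
  finally show ?thesis .
qed

lemma flux_integrable:
  assumes [measurable]: "v \<in> borel_measurable borel" "\<psi> \<in> borel_measurable borel"
    and "energy v < \<infinity>" "energy \<psi> < \<infinity>"
  shows "integrable lborel (flux v \<psi>)"
proof (rule integrableI_bounded)
  have "(\<integral>\<^sup>+ z. ennreal (norm (flux v \<psi> z)) \<partial>lborel)
      \<le> (\<integral>\<^sup>+ z. ennreal (\<bar>\<psi> (fst z) - \<psi> (snd z)\<bar> powr p * ker (fst z) (snd z))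
             + ennreal (\<bar>v (fst z) - v (snd z)\<bar> powr p * ker (fst z) (snd z)) \<partial>lborel)"
  proof (intro nn_integral_mono)
    fix z :: "(real ^ 'n) \<times> (real ^ 'n)"
    have "\<bar>flux v \<psi> z\<bar> \<le> (1 * \<bar>\<psi> (fst z) - \<psi> (snd z)\<bar> powr p + 1 powr (- 1 / (p - 1)) * \<bar>v (fst z) - v (snd z)\<bar> powr p) * ker (fst z) (snd z)"
      unfolding abs_flux by (intro mult_right_mono young) auto
    then show "ennreal (norm (flux v \<psi> z)) \<le> ennreal (\<bar>\<psi> (fst z) - \<psi> (snd z)\<bar> powr p * ker (fst z) (snd z))
             + ennreal (\<bar>v (fst z) - v (snd z)\<bar> powr p * ker (fst z) (snd z))"
      by (simp add: ennreal_plus[symmetric] distrib_right del: ennreal_plus)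
  qed
  also have "\<dots> = energy \<psi> + energy v"
    by (subst nn_integral_add) (auto simp: energy_pair)
  also have "\<dots> < \<infinity>" using assms by simp
  finally show "(\<integral>\<^sup>+ z. ennreal (norm (flux v \<psi> z)) \<partial>lborel) < \<infinity>" .
qed measurable

lemma nn_integral_pair:
  assumes [measurable]: "f \<in> borel_measurable (borel :: ((real ^ 'n) \<times> (real ^ 'n)) measure)"
  shows "(\<integral>\<^sup>+ z. f z \<partial>lborel) = (\<integral>\<^sup>+ x. \<integral>\<^sup>+ y. f (x, y) \<partial>lborel \<partial>lborel)"
    "(\<integral>\<^sup>+ z. f z \<partial>lborel) = (\<integral>\<^sup>+ y. \<integral>\<^sup>+ x. f (x, y) \<partial>lborel \<partial>lborel)"
  using lborel.nn_integral_fst[of f lborel] lborel_pair.nn_integral_snd[of f]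
  by (simp_all add: lborel_prod)

lemma ker_tail_le:
  assumes "0 < R"
  shows "(\<integral>\<^sup>+ y. ennreal (indicator {y. R \<le> norm (x - y)} y * ker x y) \<partial>lborel) \<le> ennreal (tail_const TYPE('n) (s * p) * R powr (- (s * p)))"
  using kernel_tail_le[OF sp0 assms, of x] by (simp add: ker_def N_def[symmetric])

text \<open>Continuity under translations of the pairing between the flux of \<open>v\<close> and the increments of
  \<open>\<psi>\<close>. Young's inequality discards the region where the increment of \<open>v\<close> is large or the points are
  close; on the rest only the translation in $L^1$ matters.\<close>

lemma pairing_translation_small:
  assumes v[measurable]: "v \<in> borel_measurable borel" and Ev: "energy v < \<infinity>"
    and psi[measurable]: "\<psi> \<in> borel_measurable borel" and B: "\<And>x. \<bar>\<psi> x\<bar> \<le> B"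
    and R: "\<And>x. R < norm x \<Longrightarrow> \<psi> x = 0" and Epsi: "energy \<psi> < \<infinity>" and e: "0 < e"
  obtains \<delta> where "0 < \<delta>"
    "\<And>t. norm t \<le> \<delta> \<Longrightarrow> (\<integral>\<^sup>+ z. ennreal (\<bar>v (fst z) - v (snd z)\<bar> powr (p - 1) *
        \<bar>(\<psi> (fst z - t) - \<psi> (fst z)) - (\<psi> (snd z - t) - \<psi> (snd z))\<bar> * ker (fst z) (snd z)) \<partial>lborel) \<le> ennreal e"
proof -
  obtain ep where ep: "energy \<psi> = ennreal ep" "0 \<le> ep" using Epsi by (metis ennreal_cases less_irrefl infinity_ennreal_def)
  \<comment> \<open>By translation invariance the increment of \<psi> has energy at most 2^p times
    twice that of \<psi>, so this choice keeps the first Young term below e/3. The added 1 guards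
    against zero energy.\<close>
  define \<tau> where "\<tau> = e / 3 / (2 powr p * (ep + ep) + 1)"
  have tau: "0 < \<tau>" "\<tau> * (2 powr p * (ep + ep)) \<le> e / 3"
    using e ep by (auto simp: \<tau>_def field_simps add_pos_nonneg intro!: divide_pos_pos)
  define c where "c = \<tau> powr (- 1 / (p - 1))"
  have c: "0 < c" using tau by (simp add: c_def)
  define a where "a = (\<lambda>z. \<bar>v (fst z) - v (snd z)\<bar>)"
  have [measurable]: "a \<in> borel_measurable borel" unfolding a_def by measurable
  define k where "k = (\<lambda>z. ker (fst z) (snd z))"
  have [measurable]: "k \<in> borel_measurable borel" unfolding k_def by measurable
  have k0: "0 \<le> k z" for z by (simp add: k_def)
  \<comment> \<open>As n grows these sets shrink to the diagonal, where the weight is 0, so the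
    energy of v carried by them tends to 0 by dominated convergence.\<close>
  define Bad where "Bad = (\<lambda>n::nat. {z::(real^'n)\<times>(real^'n). real n < a z \<or> norm (fst z - snd z) < 1 / real n})"
  have [measurable]: "Bad n \<in> sets borel" for n unfolding Bad_def by measurable
  have "(\<lambda>n. \<integral>\<^sup>+ z. ennreal (a z powr p * k z) * indicator (Bad n) z \<partial>lborel) \<longlonglongrightarrow> (\<integral>\<^sup>+ z. 0 \<partial>(lborel :: ((real^'n)\<times>(real^'n)) measure))"
  proof (rule nn_integral_dominated_convergence[where w="\<lambda>z. ennreal (a z powr p * k z)"])
    show "(\<integral>\<^sup>+ z. ennreal (a z powr p * k z) \<partial>lborel) < \<infinity>"
      using Ev by (simp add: energy_pair a_def k_def)
    show "AE z in lborel. (\<lambda>n. ennreal (a z powr p * k z) * indicator (Bad n) z) \<longlonglongrightarrow> 0"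
    proof (rule AE_I2)
      fix z :: "(real ^ 'n) \<times> (real ^ 'n)"
      show "(\<lambda>n. ennreal (a z powr p * k z) * indicator (Bad n) z) \<longlonglongrightarrow> 0"
      proof (cases "fst z = snd z")
        case True
        then have "k z = 0" by (simp add: k_def ker_def)
        then show ?thesis by simp
      next
        case False
        define d where "d = norm (fst z - snd z)"
        have d: "0 < d" using False by (simp add: d_def)
        obtain m :: nat where m: "max (a z) (1 / d) \<le> real m" using real_arch_simple by blast
        have "z \<notin> Bad n" if "m \<le> n" for n
        proof -
          have "max (a z) (1 / d) \<le> real n" using m that by linarith
          then have n: "a z \<le> real n" "1 / d \<le> real n" by auto
          have "0 < 1 / d" using d by simp
          then have "0 < real n" using n by linarith
          then have "1 / real n \<le> d" using n d by (simp add: field_simps)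
          then show ?thesis using n by (auto simp: Bad_def d_def)
        qed
        then have "eventually (\<lambda>n. 0 = ennreal (a z powr p * k z) * indicator (Bad n) z) sequentially"
          unfolding eventually_sequentially by (intro exI[of _ m]) auto
        then show ?thesis by (rule Lim_transform_eventually[OF tendsto_const])
      qed
    qed
  qed (auto simp: indicator_def)
  then have "\<forall>\<^sub>F n in sequentially. (\<integral>\<^sup>+ z. ennreal (a z powr p * k z) * indicator (Bad n) z \<partial>lborel) < ennreal (e / 3 / c)"
    by (intro order_tendstoD(2)[where y=0]) (use e c in auto)
  then have "\<forall>\<^sub>F n in sequentially. (\<integral>\<^sup>+ z. ennreal (a z powr p * k z) * indicator (Bad n) z \<partial>lborel) < ennreal (e / 3 / c) \<and> 0 < n"
    using eventually_gt_at_top[of "0::nat"] by (rule eventually_conj)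
  then obtain n where n: "(\<integral>\<^sup>+ z. ennreal (a z powr p * k z) * indicator (Bad n) z \<partial>lborel) < ennreal (e / 3 / c)" "0 < n"
    by (metis (no_types, lifting) eventually_sequentially order_refl)
  define C where "C = tail_const TYPE('n) (s * p) * (1 / real n) powr (- (s * p))"
  have C: "0 < C" using tail_const_pos[OF sp0, where 'n='n] n by (simp add: C_def)
  \<comment> \<open>Off \<open>Bad n\<close> the factor coming from v is at most n^(p-1), and the
    kernel seen from either endpoint has mass at most \<open>C\<close>; the two endpoints give the
    2.\<close>
  define D where "D = real n powr (p - 1) * (2 * C)"
  have D: "0 < D" using C n by (simp add: D_def)
  obtain \<delta> where delta: "0 < \<delta>"
    "\<And>t. norm t \<le> \<delta> \<Longrightarrow> (\<integral>\<^sup>+ x. ennreal \<bar>\<psi> (x - t) - \<psi> x\<bar> \<partial>lborel) \<le> ennreal (e / 3 / D)"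
    using translation_L1_continuous[OF psi B R, where e="e / 3 / D"] e D by auto
  show ?thesis
  proof (rule that[OF delta(1)])
    fix t :: "real ^ 'n" assume t: "norm t \<le> \<delta>"
    define g where "g = (\<lambda>x. \<psi> (x - t) - \<psi> x)"
    have [measurable]: "g \<in> borel_measurable borel" unfolding g_def by measurable
    define b where "b = (\<lambda>z. \<bar>g (fst z) - g (snd z)\<bar>)"
    have [measurable]: "b \<in> borel_measurable borel" unfolding b_def by measurable
    define far where "far = {z::(real^'n)\<times>(real^'n). 1 / real n \<le> norm (fst z - snd z)}"
    have [measurable]: "far \<in> sets borel" unfolding far_def by measurable
    have pw: "ennreal (a z powr (p - 1) * b z * k z) \<le> ennreal (\<tau> * b z powr p * k z)
        + (ennreal c * (ennreal (a z powr p * k z) * indicator (Bad n) z)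
        + ennreal (real n powr (p - 1)) * (ennreal (b z * k z) * indicator far z))" for z
    proof (cases "z \<in> Bad n")
      case True
      have "a z powr (p - 1) * b z * k z \<le> (\<tau> * b z powr p + c * a z powr p) * k z"
        unfolding c_def using k0 tau by (intro mult_right_mono young) (auto simp: a_def b_def)
      then have "ennreal (a z powr (p - 1) * b z * k z) \<le> ennreal (\<tau> * b z powr p * k z + c * (a z powr p * k z))"
        by (intro ennreal_leI) (simp add: algebra_simps)
      also have "\<dots> = ennreal (\<tau> * b z powr p * k z) + ennreal c * ennreal (a z powr p * k z)"
        using tau c k0 by (subst ennreal_plus) (auto simp: ennreal_mult)
      also have "\<dots> \<le> ennreal (\<tau> * b z powr p * k z) + (ennreal c * ennreal (a z powr p * k z)
         + ennreal (real n powr (p - 1)) * (ennreal (b z * k z) * indicator far z))"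
        by (intro add_left_mono) simp
      finally show ?thesis using True by simp
    next
      case False
      then have z: "a z \<le> real n" "z \<in> far" by (auto simp: Bad_def far_def)
      have "a z powr (p - 1) \<le> real n powr (p - 1)" using z p1 by (intro powr_mono2) (auto simp: a_def)
      then have "a z powr (p - 1) * (b z * k z) \<le> real n powr (p - 1) * (b z * k z)"
        using k0 by (intro mult_right_mono) (auto simp: b_def)
      then have "ennreal (a z powr (p - 1) * b z * k z) \<le> ennreal (real n powr (p - 1)) * (ennreal (b z * k z) * indicator far z)"
        using z k0 by (simp add: ennreal_mult'[symmetric] mult.assoc b_def ennreal_leI)
      also have "\<dots> \<le> ennreal (\<tau> * b z powr p * k z)
        + (ennreal c * (ennreal (a z powr p * k z) * indicator (Bad n) z)
        + ennreal (real n powr (p - 1)) * (ennreal (b z * k z) * indicator far z))"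
        by (simp add: add_increasing)
      finally show ?thesis .
    qed
    have first: "(\<integral>\<^sup>+ z. ennreal (\<tau> * b z powr p * k z) \<partial>lborel) \<le> ennreal (e / 3)"
    proof -
      have "(\<integral>\<^sup>+ z. ennreal (\<tau> * b z powr p * k z) \<partial>lborel)
         \<le> (\<integral>\<^sup>+ z. ennreal (\<tau> * 2 powr p) * (ennreal (\<bar>\<psi> (fst z - t) - \<psi> (snd z - t)\<bar> powr p * k z) + ennreal (\<bar>\<psi> (fst z) - \<psi> (snd z)\<bar> powr p * k z)) \<partial>lborel)"
      proof (intro nn_integral_mono)
        fix z
        have "b z powr p \<le> (\<bar>\<psi> (fst z - t) - \<psi> (snd z - t)\<bar> + \<bar>\<psi> (fst z) - \<psi> (snd z)\<bar>) powr p"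
          using p0 by (intro powr_mono2) (auto simp: b_def g_def)
        also have "\<dots> \<le> 2 powr p * (\<bar>\<psi> (fst z - t) - \<psi> (snd z - t)\<bar> powr p + \<bar>\<psi> (fst z) - \<psi> (snd z)\<bar> powr p)"
          using p0 by (intro add_powr_le) auto
        finally have "\<tau> * (b z powr p * k z) \<le> \<tau> * (2 powr p * (\<bar>\<psi> (fst z - t) - \<psi> (snd z - t)\<bar> powr p + \<bar>\<psi> (fst z) - \<psi> (snd z)\<bar> powr p) * k z)"
          using tau k0 by (intro mult_left_mono mult_right_mono) auto
        then have "\<tau> * b z powr p * k z \<le> (\<tau> * 2 powr p) * (\<bar>\<psi> (fst z - t) - \<psi> (snd z - t)\<bar> powr p * k z + \<bar>\<psi> (fst z) - \<psi> (snd z)\<bar> powr p * k z)"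
          by (simp add: algebra_simps)
        then show "ennreal (\<tau> * b z powr p * k z) \<le> ennreal (\<tau> * 2 powr p) * (ennreal (\<bar>\<psi> (fst z - t) - \<psi> (snd z - t)\<bar> powr p * k z) + ennreal (\<bar>\<psi> (fst z) - \<psi> (snd z)\<bar> powr p * k z))"
          using tau k0 by (simp add: ennreal_mult'[symmetric] ennreal_plus[symmetric] ennreal_leI del: ennreal_plus)
      qed
      also have "\<dots> = ennreal (\<tau> * 2 powr p) * (energy (\<lambda>x. \<psi> (x - t)) + energy \<psi>)"
        by (subst nn_integral_cmult, measurable, subst nn_integral_add, measurable) (simp add: energy_pair k_def)
      also have "\<dots> = ennreal (\<tau> * 2 powr p) * (ennreal ep + ennreal ep)"
        by (simp add: energy_translate ep)
      also have "\<dots> = ennreal (\<tau> * (2 powr p * (ep + ep)))"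
        using ep tau by (simp add: ennreal_mult'[symmetric] ennreal_plus[symmetric] mult.assoc del: ennreal_plus)
      also have "\<dots> \<le> ennreal (e / 3)" using tau by (intro ennreal_leI) auto
      finally show ?thesis .
    qed
    have second: "(\<integral>\<^sup>+ z. ennreal c * (ennreal (a z powr p * k z) * indicator (Bad n) z) \<partial>lborel) \<le> ennreal (e / 3)"
    proof -
      have "(\<integral>\<^sup>+ z. ennreal c * (ennreal (a z powr p * k z) * indicator (Bad n) z) \<partial>lborel)
          = ennreal c * (\<integral>\<^sup>+ z. ennreal (a z powr p * k z) * indicator (Bad n) z \<partial>lborel)"
        by (intro nn_integral_cmult) measurable
      also have "\<dots> \<le> ennreal c * ennreal (e / 3 / c)" using n by (intro mult_left_mono) auto
      also have "\<dots> = ennreal (e / 3)" using c e by (simp add: ennreal_mult[symmetric])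
      finally show ?thesis .
    qed
    have third: "(\<integral>\<^sup>+ z. ennreal (real n powr (p - 1)) * (ennreal (b z * k z) * indicator far z) \<partial>lborel) \<le> ennreal (e / 3)"
    proof -
      have G: "(\<integral>\<^sup>+ x. ennreal \<bar>g x\<bar> \<partial>lborel) \<le> ennreal (e / 3 / D)" unfolding g_def using delta(2)[OF t] .
      have half: "(\<integral>\<^sup>+ x. \<integral>\<^sup>+ y. ennreal \<bar>g x\<bar> * (ennreal (ker x y) * indicator {y. 1 / real n \<le> norm (x - y)} y) \<partial>lborel \<partial>lborel)
          \<le> ennreal (e / 3 / D) * ennreal C"
      proof -
        have "(\<integral>\<^sup>+ x. \<integral>\<^sup>+ y. ennreal \<bar>g x\<bar> * (ennreal (ker x y) * indicator {y. 1 / real n \<le> norm (x - y)} y) \<partial>lborel \<partial>lborel)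
            \<le> (\<integral>\<^sup>+ x. ennreal \<bar>g x\<bar> * ennreal C \<partial>lborel)"
        proof (intro nn_integral_mono)
          fix x :: "real ^ 'n"
          have [measurable]: "{y. 1 / real n \<le> norm (x - y)} \<in> sets borel"
            by (intro borel_closed closed_Collect_le continuous_intros)
          have "(\<integral>\<^sup>+ y. ennreal \<bar>g x\<bar> * (ennreal (ker x y) * indicator {y. 1 / real n \<le> norm (x - y)} y) \<partial>lborel)
             = ennreal \<bar>g x\<bar> * (\<integral>\<^sup>+ y. ennreal (ker x y) * indicator {y. 1 / real n \<le> norm (x - y)} y \<partial>lborel)"
            by (intro nn_integral_cmult) measurable
          also have "(\<integral>\<^sup>+ y. ennreal (ker x y) * indicator {y. 1 / real n \<le> norm (x - y)} y \<partial>lborel)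
             = (\<integral>\<^sup>+ y. ennreal (indicator {y. 1 / real n \<le> norm (x - y)} y * ker x y) \<partial>lborel)"
            by (intro nn_integral_cong) (auto simp: indicator_def)
          also have "ennreal \<bar>g x\<bar> * \<dots> \<le> ennreal \<bar>g x\<bar> * ennreal C"
            unfolding C_def using n by (intro mult_left_mono ker_tail_le) auto
          finally show "(\<integral>\<^sup>+ y. ennreal \<bar>g x\<bar> * (ennreal (ker x y) * indicator {y. 1 / real n \<le> norm (x - y)} y) \<partial>lborel) \<le> ennreal \<bar>g x\<bar> * ennreal C" .
        qed
        also have "\<dots> = (\<integral>\<^sup>+ x. ennreal \<bar>g x\<bar> \<partial>lborel) * ennreal C" by (intro nn_integral_multc) measurable
        also have "\<dots> \<le> ennreal (e / 3 / D) * ennreal C" by (intro mult_right_mono G) auto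
        finally show ?thesis .
      qed
      have "(\<integral>\<^sup>+ z. ennreal (b z * k z) * indicator far z \<partial>lborel)
         \<le> (\<integral>\<^sup>+ z. ennreal (\<bar>g (fst z)\<bar> * k z) * indicator far z + ennreal (\<bar>g (snd z)\<bar> * k z) * indicator far z \<partial>lborel)"
      proof (intro nn_integral_mono)
        fix z
        have "b z * k z \<le> \<bar>g (fst z)\<bar> * k z + \<bar>g (snd z)\<bar> * k z"
          unfolding distrib_right[symmetric] using k0 by (intro mult_right_mono) (auto simp: b_def)
        then show "ennreal (b z * k z) * indicator far z \<le> ennreal (\<bar>g (fst z)\<bar> * k z) * indicator far z + ennreal (\<bar>g (snd z)\<bar> * k z) * indicator far z"
          using k0 by (auto simp: indicator_def ennreal_plus[symmetric] ennreal_leI simp del: ennreal_plus)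
      qed
      also have "\<dots> = (\<integral>\<^sup>+ z. ennreal (\<bar>g (fst z)\<bar> * k z) * indicator far z \<partial>lborel) + (\<integral>\<^sup>+ z. ennreal (\<bar>g (snd z)\<bar> * k z) * indicator far z \<partial>lborel)"
        by (intro nn_integral_add) measurable
      also have "(\<integral>\<^sup>+ z. ennreal (\<bar>g (fst z)\<bar> * k z) * indicator far z \<partial>lborel)
         = (\<integral>\<^sup>+ x. \<integral>\<^sup>+ y. ennreal \<bar>g x\<bar> * (ennreal (ker x y) * indicator {y. 1 / real n \<le> norm (x - y)} y) \<partial>lborel \<partial>lborel)"
        by (subst nn_integral_pair(1), measurable, intro nn_integral_cong) (auto simp: k_def far_def indicator_def ennreal_mult)
      also have "(\<integral>\<^sup>+ z. ennreal (\<bar>g (snd z)\<bar> * k z) * indicator far z \<partial>lborel)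
         = (\<integral>\<^sup>+ x. \<integral>\<^sup>+ y. ennreal \<bar>g x\<bar> * (ennreal (ker x y) * indicator {y. 1 / real n \<le> norm (x - y)} y) \<partial>lborel \<partial>lborel)"
        by (subst nn_integral_pair(2), measurable, intro nn_integral_cong)
           (auto simp: k_def far_def indicator_def ennreal_mult ker_sym norm_minus_commute)
      finally have "(\<integral>\<^sup>+ z. ennreal (b z * k z) * indicator far z \<partial>lborel) \<le> ennreal (e / 3 / D) * ennreal C + ennreal (e / 3 / D) * ennreal C"
        using half by (meson add_mono order_trans)
      then have "ennreal (real n powr (p - 1)) * (\<integral>\<^sup>+ z. ennreal (b z * k z) * indicator far z \<partial>lborel)
         \<le> ennreal (real n powr (p - 1)) * (ennreal (e / 3 / D) * ennreal C + ennreal (e / 3 / D) * ennreal C)"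
        by (rule mult_left_mono) simp
      also have "\<dots> = ennreal (real n powr (p - 1) * (e / 3 / D * C + e / 3 / D * C))"
        using C D e by (simp add: ennreal_mult[symmetric] ennreal_plus[symmetric] del: ennreal_plus)
      also have "real n powr (p - 1) * (e / 3 / D * C + e / 3 / D * C) = e / 3"
        using C n by (simp add: D_def field_simps)
      finally show ?thesis by (subst nn_integral_cmult) auto
    qed
    have "(\<integral>\<^sup>+ z. ennreal (a z powr (p - 1) * b z * k z) \<partial>lborel)
       \<le> (\<integral>\<^sup>+ z. ennreal (\<tau> * b z powr p * k z)
        + (ennreal c * (ennreal (a z powr p * k z) * indicator (Bad n) z)
        + ennreal (real n powr (p - 1)) * (ennreal (b z * k z) * indicator far z)) \<partial>lborel)"
      by (intro nn_integral_mono pw)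
    also have "\<dots> = (\<integral>\<^sup>+ z. ennreal (\<tau> * b z powr p * k z) \<partial>lborel)
        + ((\<integral>\<^sup>+ z. ennreal c * (ennreal (a z powr p * k z) * indicator (Bad n) z) \<partial>lborel)
        + (\<integral>\<^sup>+ z. ennreal (real n powr (p - 1)) * (ennreal (b z * k z) * indicator far z) \<partial>lborel))"
      by (subst nn_integral_add; measurable)+
    also have "\<dots> \<le> ennreal (e / 3) + (ennreal (e / 3) + ennreal (e / 3))"
      by (intro add_mono first second third)
    also have "\<dots> = ennreal e" using e by (simp add: ennreal_plus[symmetric] del: ennreal_plus)
    finally show "(\<integral>\<^sup>+ z. ennreal (\<bar>v (fst z) - v (snd z)\<bar> powr (p - 1) *
        \<bar>(\<psi> (fst z - t) - \<psi> (fst z)) - (\<psi> (snd z - t) - \<psi> (snd z))\<bar> * ker (fst z) (snd z)) \<partial>lborel) \<le> ennreal e"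
      by (simp add: a_def b_def g_def k_def)
  qed
qed

end

section \<open>Mollification errors as averages of translation errors\<close>

definition mollifier :: "real \<Rightarrow> (real ^ 'n \<Rightarrow> real) \<Rightarrow> bool" where
  "mollifier e \<rho> \<longleftrightarrow> smooth \<rho> \<and> (\<forall>x. 0 \<le> \<rho> x) \<and> (\<forall>x. e < norm x \<longrightarrow> \<rho> x = 0) \<and>
     (\<integral>\<^sup>+ x. ennreal (\<rho> x) \<partial>lborel) = 1"

lemma mollifier_integral:
  assumes "mollifier e \<rho>"
  shows "integrable lborel \<rho>" "(LINT x|lborel. \<rho> x) = 1"
proof -
  have m: "\<rho> \<in> borel_measurable lborel" and nn: "\<And>x. 0 \<le> \<rho> x" and i: "(\<integral>\<^sup>+ x. ennreal (\<rho> x) \<partial>lborel) = 1"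
    using assms smooth_measurable by (auto simp: mollifier_def)
  show "integrable lborel \<rho>" using m nn i by (intro integrableI_nonneg) auto
  show "(LINT x|lborel. \<rho> x) = 1" using m nn i by (subst integral_eq_nn_integral) auto
qed

lemma mollifier_average_le:
  assumes "mollifier e \<rho>" and "\<And>t. norm t \<le> e \<Longrightarrow> \<Phi> t \<le> c"
  shows "(\<integral>\<^sup>+ t. ennreal (\<rho> t) * \<Phi> t \<partial>lborel) \<le> c"
proof -
  have [measurable]: "\<rho> \<in> borel_measurable borel" using assms(1) smooth_measurable by (auto simp: mollifier_def)
  have "(\<integral>\<^sup>+ t. ennreal (\<rho> t) * \<Phi> t \<partial>lborel) \<le> (\<integral>\<^sup>+ t. ennreal (\<rho> t) * c \<partial>lborel)"
  proof (intro nn_integral_mono)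
    fix t show "ennreal (\<rho> t) * \<Phi> t \<le> ennreal (\<rho> t) * c"
      using assms by (cases "norm t \<le> e") (auto simp: mollifier_def intro!: mult_left_mono)
  qed
  also have "\<dots> = (\<integral>\<^sup>+ t. ennreal (\<rho> t) \<partial>lborel) * c" by (intro nn_integral_multc) measurable
  also have "\<dots> = c" using assms(1) by (simp add: mollifier_def)
  finally show ?thesis .
qed

text \<open>A mollified function is an average of translates, so its error is bounded by the average
  of the translation errors. The first bound is for the right-hand side of the equation, the second,
  about increments of the error, for the flux.\<close>

lemma mollified_increment_le:
  fixes \<psi> :: "real ^ 'n \<Rightarrow> real"
  assumes rho: "mollifier e \<rho>" and psi[measurable]: "\<psi> \<in> borel_measurable borel" and B: "\<And>x. \<bar>\<psi> x\<bar> \<le> B"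
  defines "c \<equiv> \<lambda>x. LINT y|lborel. \<rho> (x - y) * \<psi> y"
  shows "ennreal \<bar>c x - \<psi> x\<bar> \<le> (\<integral>\<^sup>+ t. ennreal (\<rho> t) * ennreal \<bar>\<psi> (x - t) - \<psi> x\<bar> \<partial>lborel)" (is ?A)
    and "ennreal \<bar>(c x - \<psi> x) - (c y - \<psi> y)\<bar>
      \<le> (\<integral>\<^sup>+ t. ennreal (\<rho> t) * ennreal \<bar>(\<psi> (x - t) - \<psi> x) - (\<psi> (y - t) - \<psi> y)\<bar> \<partial>lborel)" (is ?B)
proof -
  have [measurable]: "\<rho> \<in> borel_measurable borel" using rho smooth_measurable by (auto simp: mollifier_def)
  have nn: "0 \<le> \<rho> x" for x using rho by (simp add: mollifier_def)
  have int: "integrable lborel (\<lambda>t. \<rho> t * \<psi> (x - t))" for x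
    by (rule Bochner_Integration.integrable_bound[of _ "\<lambda>t. \<rho> t * B"])
       (use mollifier_integral[OF rho] B nn order_trans[OF abs_ge_zero B] in \<open>auto simp: abs_mult intro!: mult_left_mono\<close>)
  have int': "integrable lborel (\<lambda>t. \<rho> t * \<psi> x)" for x
    using mollifier_integral[OF rho] by (intro integrable_mult_left) auto
  have d: "c x - \<psi> x = (LINT t|lborel. \<rho> t * \<psi> (x - t) - \<rho> t * \<psi> x)" for x
    using int int' mollifier_integral[OF rho] by (simp add: c_def convolution_reflect)
  have intd: "integrable lborel (\<lambda>t. \<rho> t * \<psi> (x - t) - \<rho> t * \<psi> x)" for x
    using int int' by (intro Bochner_Integration.integrable_diff)
  have "ennreal \<bar>c x - \<psi> x\<bar> \<le> (\<integral>\<^sup>+ t. ennreal (norm (\<rho> t * \<psi> (x - t) - \<rho> t * \<psi> x)) \<partial>lborel)"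
    unfolding d using integral_norm_bound_ennreal[OF intd[of x]] by simp
  also have "\<dots> = (\<integral>\<^sup>+ t. ennreal (\<rho> t) * ennreal \<bar>\<psi> (x - t) - \<psi> x\<bar> \<partial>lborel)"
    using nn by (intro nn_integral_cong) (simp add: right_diff_distrib[symmetric] abs_mult ennreal_mult)
  finally show ?A .
  have dd: "(c x - \<psi> x) - (c y - \<psi> y) = (LINT t|lborel. (\<rho> t * \<psi> (x - t) - \<rho> t * \<psi> x) - (\<rho> t * \<psi> (y - t) - \<rho> t * \<psi> y))"
    unfolding d using intd by (subst Bochner_Integration.integral_diff[OF intd intd]) simp
  have "ennreal \<bar>(c x - \<psi> x) - (c y - \<psi> y)\<bar>
     \<le> (\<integral>\<^sup>+ t. ennreal (norm ((\<rho> t * \<psi> (x - t) - \<rho> t * \<psi> x) - (\<rho> t * \<psi> (y - t) - \<rho> t * \<psi> y))) \<partial>lborel)"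
    unfolding dd using integral_norm_bound_ennreal[OF Bochner_Integration.integrable_diff[OF intd[of x] intd[of y]]] by simp
  also have "\<dots> = (\<integral>\<^sup>+ t. ennreal (\<rho> t) * ennreal \<bar>(\<psi> (x - t) - \<psi> x) - (\<psi> (y - t) - \<psi> y)\<bar> \<partial>lborel)"
    using nn by (intro nn_integral_cong) (simp add: right_diff_distrib[symmetric] abs_mult ennreal_mult)
  finally show ?B .
qed

context fractional
begin

text \<open>Weak subsolutions of $(-\Delta_p)^s v \le F$ in \<open>\<Omega>\<close>, tested with all nonnegative functions of
  finite energy and compact support. Both \<open>u\<close> (with the right-hand side of the equation) and \<open>- u\<close>
  (with right-hand side 0) are of this kind.\<close>

definition weak_sub :: "(real ^ 'n) set \<Rightarrow> (real ^ 'n \<Rightarrow> real) \<Rightarrow> (real ^ 'n \<Rightarrow> real) \<Rightarrow> bool" where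
  "weak_sub \<Omega> v F \<longleftrightarrow> v \<in> borel_measurable borel \<and> F \<in> borel_measurable borel \<and> (\<forall>x. 0 \<le> F x) \<and> energy v < \<infinity> \<and>
    (\<forall>\<psi> K. \<psi> \<in> borel_measurable borel \<longrightarrow> (\<forall>x. 0 \<le> \<psi> x) \<longrightarrow> compact K \<longrightarrow> K \<subseteq> \<Omega> \<longrightarrow> (\<forall>x. x \<notin> K \<longrightarrow> \<psi> x = 0) \<longrightarrow>
       energy \<psi> < \<infinity> \<longrightarrow> ennreal (LINT z|lborel. flux v \<psi> z) \<le> (\<integral>\<^sup>+ x. ennreal (F x * \<psi> x) \<partial>lborel))"

text \<open>The truncations min(\<psi>, n) have smaller increments than \<psi>, so their energies
  are finite and their fluxes are dominated by the flux of \<psi>. On the right-hand side, which may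
  be infinite, monotonicity is enough.\<close>

lemma weak_subI_bounded:
  assumes v[measurable]: "v \<in> borel_measurable borel" and F[measurable]: "F \<in> borel_measurable borel"
    and F0: "\<And>x. 0 \<le> F x" and Ev: "energy v < \<infinity>"
    and bdd: "\<And>\<psi> K B. \<lbrakk>\<psi> \<in> borel_measurable borel; \<And>x. 0 \<le> \<psi> x; \<And>x. \<psi> x \<le> B; compact K; K \<subseteq> \<Omega>;
       \<And>x. x \<notin> K \<Longrightarrow> \<psi> x = 0; energy \<psi> < \<infinity>\<rbrakk> \<Longrightarrow> ennreal (LINT z|lborel. flux v \<psi> z) \<le> (\<integral>\<^sup>+ x. ennreal (F x * \<psi> x) \<partial>lborel)"
  shows "weak_sub \<Omega> v F"
  unfolding weak_sub_def
proof (intro conjI v F Ev allI F0 impI)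
  fix \<psi> K assume psi[measurable]: "\<psi> \<in> borel_measurable borel" and nn: "\<forall>x. 0 \<le> \<psi> x"
    and K: "compact K" "K \<subseteq> \<Omega>" "\<forall>x. x \<notin> K \<longrightarrow> \<psi> x = 0" and E: "energy \<psi> < \<infinity>"
  let ?m = "\<lambda>n::nat. \<lambda>x. min (\<psi> x) (real n)"
  have lim: "(\<lambda>n. LINT z|lborel. flux v (?m n) z) \<longlonglongrightarrow> (LINT z|lborel. flux v \<psi> z)"
  proof (rule integral_dominated_convergence[where w="\<lambda>z. \<bar>flux v \<psi> z\<bar>"])
    show "integrable lborel (\<lambda>z. \<bar>flux v \<psi> z\<bar>)" using flux_integrable[OF v psi Ev E] by auto
    show "AE z in lborel. (\<lambda>n. flux v (?m n) z) \<longlonglongrightarrow> flux v \<psi> z"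
    proof (rule AE_I2)
      fix z
      obtain n :: nat where n: "max (\<psi> (fst z)) (\<psi> (snd z)) \<le> real n" using real_arch_simple by blast
      have "eventually (\<lambda>m. flux v \<psi> z = flux v (?m m) z) sequentially"
        using eventually_ge_at_top[of n]
      proof eventually_elim
        case (elim m)
        then have "max (\<psi> (fst z)) (\<psi> (snd z)) \<le> real m" using n by linarith
        then show ?case by (simp add: flux_def min_def)
      qed
      then show "(\<lambda>n. flux v (?m n) z) \<longlonglongrightarrow> flux v \<psi> z" by (rule Lim_transform_eventually[OF tendsto_const])
    qed
    show "AE z in lborel. norm (flux v (?m n) z) \<le> \<bar>flux v \<psi> z\<bar>" for n
      unfolding real_norm_def abs_flux by (intro AE_I2 mult_right_mono mult_left_mono) auto
  qed measurable
  have "ennreal (LINT z|lborel. flux v (?m n) z) \<le> (\<integral>\<^sup>+ x. ennreal (F x * \<psi> x) \<partial>lborel)" for n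
  proof -
    have "energy (?m n) \<le> energy \<psi>" by (rule energy_mono) (auto simp: min_def)
    then have "energy (?m n) < \<infinity>" using E by auto
    then have "ennreal (LINT z|lborel. flux v (?m n) z) \<le> (\<integral>\<^sup>+ x. ennreal (F x * ?m n x) \<partial>lborel)"
      using nn K by (intro bdd[where K=K and B="real n"]) auto
    also have "\<dots> \<le> (\<integral>\<^sup>+ x. ennreal (F x * \<psi> x) \<partial>lborel)"
      using F0 by (intro nn_integral_mono ennreal_leI mult_left_mono) auto
    finally show ?thesis .
  qed
  then show "ennreal (LINT z|lborel. flux v \<psi> z) \<le> (\<integral>\<^sup>+ x. ennreal (F x * \<psi> x) \<partial>lborel)"
    by (intro LIMSEQ_le_const2[OF tendsto_ennrealI[OF lim]]) auto
qed

end

text \<open>The sign \<sigma> is 1 for the solution and -1 for its negative, whose flux has the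
  opposite sign. The extension of the test class is thus carried out once for both.\<close>

locale weak_equation = fractional p s N dim_type
  for p s N :: real and dim_type :: "'n::finite itself" +
  fixes \<Omega> :: "(real ^ 'n) set" and v f :: "real ^ 'n \<Rightarrow> real" and \<sigma> :: real
  assumes open_dom: "open \<Omega>" and v_meas [measurable]: "v \<in> borel_measurable borel" and energy_v: "energy v < \<infinity>"
    and f_meas [measurable]: "f \<in> borel_measurable borel" and f_nonneg: "\<And>x. 0 \<le> f x"
    and weak: "\<And>\<psi>. test_function \<Omega> \<psi> \<Longrightarrow> integrable lborel (flux v \<psi>) \<and> integrable lborel (\<lambda>x. f x * \<psi> x) \<and>
      (LINT z|lborel. flux v \<psi> z) = \<sigma> * (LINT x|lborel. f x * \<psi> x)"
begin

text \<open>The integrability clause is read off for one particular test function, the mollified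
  indicator of a neighbourhood of K, which equals 1 on K.\<close>

lemma density_locally_integrable:
  assumes "compact K" "K \<subseteq> \<Omega>"
  shows "(\<integral>\<^sup>+ x. ennreal (f x) * indicator K x \<partial>lborel) < \<infinity>"
proof -
  obtain d where d: "0 < d" "(\<Union>x\<in>K. cball x d) \<subseteq> \<Omega>" "compact (\<Union>x\<in>K. cball x d)"
    using compact_neighbourhood[OF assms(1) open_dom assms(2)] by metis
  define K' where "K' = (\<Union>x\<in>K. cball x d)"
  obtain d' where d': "0 < d'" "(\<Union>x\<in>K'. cball x d') \<subseteq> \<Omega>"
    using compact_neighbourhood[of K' \<Omega>] d open_dom unfolding K'_def by metis
  \<comment> \<open>The bound d makes the mollified indicator equal to 1 on K; the bound d' keeps
    its support inside \<Omega>.\<close>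
  define e where "e = min d d'"
  obtain \<rho> :: "real ^ 'n \<Rightarrow> real" where rho: "smooth \<rho>" "\<And>x. 0 \<le> \<rho> x" "\<And>x. e < norm x \<Longrightarrow> \<rho> x = 0"
      "(\<integral>\<^sup>+ x. ennreal (\<rho> x) \<partial>lborel) = 1"
    using ex_mollifier[of e] d d' by (auto simp: e_def)
  have mol: "mollifier e \<rho>" using rho by (simp add: mollifier_def)
  have [measurable]: "\<rho> \<in> borel_measurable borel" using rho by (simp add: smooth_measurable)
  have [measurable]: "K' \<in> sets borel" using d by (simp add: K'_def compact_imp_closed borel_closed)
  let ?\<psi> = "indicator K' :: real ^ 'n \<Rightarrow> real"
  let ?c = "\<lambda>x. LINT y|lborel. \<rho> (x - y) * ?\<psi> y"
  have "test_function \<Omega> ?c"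
  proof (rule test_function_convolution[where B=1 and K=K' and e=e])
    show "(\<Union>x\<in>K'. cball x e) \<subseteq> \<Omega>" using d' by (fastforce simp: e_def)
    show "?\<psi> \<in> borel_measurable borel" by measurable
  qed (use rho d in \<open>auto simp: K'_def indicator_def\<close>)
  then have int: "integrable lborel (\<lambda>x. f x * ?c x)" using weak by blast
  have c0: "0 \<le> ?c x" for x using rho by (intro integral_nonneg_AE) auto
  have c1: "?c x = 1" if "x \<in> K" for x
  proof -
    have "\<rho> (x - y) * ?\<psi> y = \<rho> (x - y)" for y
    proof (cases "y \<in> K'")
      case False
      then have "e < norm (x - y)" using that by (auto simp: K'_def e_def dist_norm)
      then show ?thesis using rho(3) by simp
    qed simp
    then have "?c x = (LINT y|lborel. \<rho> (x - y))" by (simp only:)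
    also have "\<dots> = 1" using mollifier_integral[OF mol] by (simp add: integral_reflect)
    finally show ?thesis .
  qed
  have "(\<integral>\<^sup>+ x. ennreal (f x) * indicator K x \<partial>lborel) \<le> (\<integral>\<^sup>+ x. ennreal (norm (f x * ?c x)) \<partial>lborel)"
    using c1 by (intro nn_integral_mono) (auto simp: indicator_def f_nonneg)
  also have "\<dots> < \<infinity>" using int by (simp add: integrable_iff_bounded)
  finally show ?thesis .
qed

text \<open>As f is only locally integrable, it is split at a height n: above n the integral of f
  over a compact neighbourhood is small, below n the continuity of translations in L^1 applies.
  Boundedness of \<psi> is spent on the first part.\<close>

lemma density_translation_small:
  fixes \<psi> :: "real ^ 'n \<Rightarrow> real"
  assumes psi[measurable]: "\<psi> \<in> borel_measurable borel" and B: "\<And>x. \<bar>\<psi> x\<bar> \<le> B"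
    and K: "compact K" "K \<subseteq> \<Omega>" "\<And>x. x \<notin> K \<Longrightarrow> \<psi> x = 0" and e: "0 < e"
  obtains \<delta> where "0 < \<delta>"
    "\<And>t. norm t \<le> \<delta> \<Longrightarrow> (\<integral>\<^sup>+ x. ennreal (f x * \<bar>\<psi> (x - t) - \<psi> x\<bar>) \<partial>lborel) \<le> ennreal e"
proof -
  have B0: "0 \<le> B" using B[of 0] by linarith
  obtain d where d: "0 < d" "(\<Union>x\<in>K. cball x d) \<subseteq> \<Omega>" "compact (\<Union>x\<in>K. cball x d)"
    using compact_neighbourhood[OF K(1) open_dom K(2)] by metis
  define K' where "K' = (\<Union>x\<in>K. cball x d)"
  have [measurable]: "K' \<in> sets borel" using d by (simp add: K'_def compact_imp_closed borel_closed)
  have fin: "(\<integral>\<^sup>+ x. ennreal (f x) * indicator K' x \<partial>lborel) < \<infinity>"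
    using density_locally_integrable[of K'] d by (simp add: K'_def)
  have "(\<lambda>n. \<integral>\<^sup>+ x. ennreal (f x) * indicator (K' \<inter> {x. real n < f x}) x \<partial>lborel) \<longlonglongrightarrow> (\<integral>\<^sup>+ x. 0 \<partial>(lborel :: (real^'n) measure))"
  proof (rule nn_integral_dominated_convergence[where w="\<lambda>x. ennreal (f x) * indicator K' x"])
    show "AE x in lborel. (\<lambda>n. ennreal (f x) * indicator (K' \<inter> {x. real n < f x}) x) \<longlonglongrightarrow> 0"
    proof (rule AE_I2)
      fix x
      obtain n :: nat where n: "f x \<le> real n" using real_arch_simple by blast
      have "eventually (\<lambda>m. 0 = ennreal (f x) * indicator (K' \<inter> {x. real m < f x}) x) sequentially"
        using eventually_ge_at_top[of n] by eventually_elim (use n in \<open>auto simp: indicator_def\<close>)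
      then show "(\<lambda>n. ennreal (f x) * indicator (K' \<inter> {x. real n < f x}) x) \<longlonglongrightarrow> 0"
        by (rule Lim_transform_eventually[OF tendsto_const])
    qed
  qed (use fin in \<open>auto simp: indicator_def\<close>)
  then have "\<forall>\<^sub>F n in sequentially. (\<integral>\<^sup>+ x. ennreal (f x) * indicator (K' \<inter> {x. real n < f x}) x \<partial>lborel) < ennreal (e / 2 / (2 * B + 1))"
    by (intro order_tendstoD(2)[where y=0]) (use e B0 in auto)
  then obtain n where n: "(\<integral>\<^sup>+ x. ennreal (f x) * indicator (K' \<inter> {x. real n < f x}) x \<partial>lborel) < ennreal (e / 2 / (2 * B + 1))"
    by (auto simp: eventually_sequentially)
  obtain R where R: "\<And>x. x \<in> K \<Longrightarrow> norm x \<le> R" using compact_imp_bounded[OF K(1)] by (auto simp: bounded_iff)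
  have R': "\<psi> x = 0" if "R < norm x" for x using that R[of x] K(3)[of x] by (cases "x \<in> K") auto
  obtain \<delta> where delta: "0 < \<delta>" "\<And>t. norm t \<le> \<delta> \<Longrightarrow> (\<integral>\<^sup>+ x. ennreal \<bar>\<psi> (x - t) - \<psi> x\<bar> \<partial>lborel) \<le> ennreal (e / 2 / (real n + 1))"
    using translation_L1_continuous[OF psi B R', where e="e / 2 / (real n + 1)"] e by auto
  show ?thesis
  proof (rule that[of "min \<delta> d"])
    fix t :: "real ^ 'n" assume t: "norm t \<le> min \<delta> d"
    let ?g = "\<lambda>x. \<bar>\<psi> (x - t) - \<psi> x\<bar>"
    have g: "?g x = 0" if "x \<notin> K'" for x
    proof -
      have "x \<notin> K" using that d(1) by (auto simp: K'_def)
      moreover have "x - t \<notin> K" using that t by (auto simp: K'_def dist_norm)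
      ultimately show ?thesis using K(3) by simp
    qed
    have g2: "?g x \<le> 2 * B" for x using B[of x] B[of "x - t"] by linarith
    have "(\<integral>\<^sup>+ x. ennreal (f x * ?g x) \<partial>lborel)
       \<le> (\<integral>\<^sup>+ x. ennreal (real n) * ennreal (?g x) + ennreal (2 * B) * (ennreal (f x) * indicator (K' \<inter> {x. real n < f x}) x) \<partial>lborel)"
    proof (intro nn_integral_mono)
      fix x
      show "ennreal (f x * ?g x) \<le> ennreal (real n) * ennreal (?g x) + ennreal (2 * B) * (ennreal (f x) * indicator (K' \<inter> {x. real n < f x}) x)"
      proof (cases "x \<in> K' \<and> real n < f x")
        case True
        have "f x * ?g x \<le> 2 * B * f x" using mult_left_mono[OF g2 f_nonneg] by (simp add: mult.commute)
        then have "ennreal (f x * ?g x) \<le> ennreal (2 * B) * ennreal (f x)"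
          using B0 f_nonneg by (simp add: ennreal_mult[symmetric] ennreal_leI)
        then show ?thesis using True by (simp add: add_increasing)
      next
        case False
        then have "f x * ?g x \<le> real n * ?g x"
          using g[of x] by (cases "x \<in> K'") (auto intro!: mult_right_mono)
        then have "ennreal (f x * ?g x) \<le> ennreal (real n) * ennreal (?g x)"
          by (simp add: ennreal_mult[symmetric] ennreal_leI)
        then show ?thesis by (simp add: add_increasing2)
      qed
    qed
    also have "\<dots> = ennreal (real n) * (\<integral>\<^sup>+ x. ennreal (?g x) \<partial>lborel) + ennreal (2 * B) * (\<integral>\<^sup>+ x. ennreal (f x) * indicator (K' \<inter> {x. real n < f x}) x \<partial>lborel)"
      by (subst nn_integral_add, measurable, subst nn_integral_cmult, measurable, subst nn_integral_cmult, measurable)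
    also have "\<dots> \<le> ennreal (real n) * ennreal (e / 2 / (real n + 1)) + ennreal (2 * B) * ennreal (e / 2 / (2 * B + 1))"
      using t n delta by (intro add_mono mult_left_mono) auto
    also have "\<dots> = ennreal (real n * (e / 2 / (real n + 1)) + 2 * B * (e / 2 / (2 * B + 1)))"
      using e B0 by (simp add: ennreal_mult[symmetric] ennreal_plus[symmetric] del: ennreal_plus)
    also have "\<dots> \<le> ennreal e"
    proof (rule ennreal_leI)
      have "real n * (e / 2 / (real n + 1)) \<le> e / 2" using e by (simp add: field_simps)
      moreover have "2 * B * (e / 2 / (2 * B + 1)) \<le> e / 2" using e B0 by (simp add: field_simps)
      ultimately show "real n * (e / 2 / (real n + 1)) + 2 * B * (e / 2 / (2 * B + 1)) \<le> e" by linarith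
    qed
    finally show "(\<integral>\<^sup>+ x. ennreal (f x * ?g x) \<partial>lborel) \<le> ennreal e" .
  qed (use d delta in auto)
qed

text \<open>The equation holds for the mollified \<psi>. Fubini turns the error on each side into an
  average over |t| \<le> e of translation errors, so the two sides for \<psi> differ by an
  arbitrarily small amount.\<close>

lemma weak_bounded:
  fixes \<psi> :: "real ^ 'n \<Rightarrow> real"
  assumes psi[measurable]: "\<psi> \<in> borel_measurable borel" and B: "\<And>x. \<bar>\<psi> x\<bar> \<le> B"
    and K: "compact K" "K \<subseteq> \<Omega>" "\<And>x. x \<notin> K \<Longrightarrow> \<psi> x = 0" and E: "energy \<psi> < \<infinity>"
  shows "integrable lborel (\<lambda>x. f x * \<psi> x)" "(LINT z|lborel. flux v \<psi> z) = \<sigma> * (LINT x|lborel. f x * \<psi> x)"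
proof -
  have B0: "0 \<le> B" using B[of 0] by linarith
  have [measurable]: "K \<in> sets borel" using K by (simp add: compact_imp_closed borel_closed)
  show int: "integrable lborel (\<lambda>x. f x * \<psi> x)"
  proof (rule integrableI_bounded)
    have "(\<integral>\<^sup>+ x. ennreal (norm (f x * \<psi> x)) \<partial>lborel) \<le> (\<integral>\<^sup>+ x. ennreal B * (ennreal (f x) * indicator K x) \<partial>lborel)"
    proof (intro nn_integral_mono)
      fix x
      have "\<bar>f x * \<psi> x\<bar> \<le> B * f x" using mult_left_mono[OF B[of x] f_nonneg[of x]] f_nonneg[of x] by (simp add: abs_mult mult.commute)
      then show "ennreal (norm (f x * \<psi> x)) \<le> ennreal B * (ennreal (f x) * indicator K x)"
        using K(3)[of x] B0 f_nonneg by (cases "x \<in> K") (auto simp: ennreal_mult[symmetric] ennreal_leI)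
    qed
    also have "\<dots> = ennreal B * (\<integral>\<^sup>+ x. ennreal (f x) * indicator K x \<partial>lborel)" by (intro nn_integral_cmult) measurable
    also have "\<dots> < \<infinity>" using density_locally_integrable[OF K(1,2)] by (simp add: ennreal_mult_less_top)
    finally show "(\<integral>\<^sup>+ x. ennreal (norm (f x * \<psi> x)) \<partial>lborel) < \<infinity>" .
  qed measurable
  obtain R where R: "\<And>x. x \<in> K \<Longrightarrow> norm x \<le> R" using compact_imp_bounded[OF K(1)] by (auto simp: bounded_iff)
  have R': "\<psi> x = 0" if "R < norm x" for x using that R[of x] K(3)[of x] by (cases "x \<in> K") auto
  obtain d where d: "0 < d" "(\<Union>x\<in>K. cball x d) \<subseteq> \<Omega>" using compact_neighbourhood[OF K(1) open_dom K(2)] by metis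
  have close: "\<bar>(LINT z|lborel. flux v \<psi> z) - \<sigma> * (LINT x|lborel. f x * \<psi> x)\<bar> \<le> e1 + \<bar>\<sigma>\<bar> * e1" if e1: "0 < e1" for e1
  proof -
    obtain d1 where d1: "0 < d1" "\<And>t. norm t \<le> d1 \<Longrightarrow> (\<integral>\<^sup>+ z. ennreal (\<bar>v (fst z) - v (snd z)\<bar> powr (p - 1) *
        \<bar>(\<psi> (fst z - t) - \<psi> (fst z)) - (\<psi> (snd z - t) - \<psi> (snd z))\<bar> * ker (fst z) (snd z)) \<partial>lborel) \<le> ennreal e1"
      using pairing_translation_small[OF v_meas energy_v psi B R' E e1] by blast
    obtain d2 where d2: "0 < d2" "\<And>t. norm t \<le> d2 \<Longrightarrow> (\<integral>\<^sup>+ x. ennreal (f x * \<bar>\<psi> (x - t) - \<psi> x\<bar>) \<partial>lborel) \<le> ennreal e1"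
      using density_translation_small[OF psi B K e1] by blast
    \<comment> \<open>d keeps the support in \<Omega>; d1 and d2 are the translation moduli of the
      two sides.\<close>
    define e where "e = min d (min d1 d2)"
    obtain \<rho> :: "real ^ 'n \<Rightarrow> real" where rho: "smooth \<rho>" "\<And>x. 0 \<le> \<rho> x" "\<And>x. e < norm x \<Longrightarrow> \<rho> x = 0"
        "(\<integral>\<^sup>+ x. ennreal (\<rho> x) \<partial>lborel) = 1"
      using ex_mollifier[of e] d d1 d2 by (auto simp: e_def)
    have mol: "mollifier e \<rho>" using rho by (simp add: mollifier_def)
    have [measurable]: "\<rho> \<in> borel_measurable borel" using rho by (simp add: smooth_measurable)
    let ?c = "\<lambda>x. LINT y|lborel. \<rho> (x - y) * \<psi> y"
    have test: "test_function \<Omega> ?c"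
    proof (rule test_function_convolution[OF rho(1) rho(3) psi B K(3) K(1)])
      show "(\<Union>x\<in>K. cball x e) \<subseteq> \<Omega>" using d by (fastforce simp: e_def)
    qed auto
    then have [measurable]: "?c \<in> borel_measurable borel" by (intro smooth_measurable) (simp add: test_function_def)
    have w: "integrable lborel (flux v ?c)" "integrable lborel (\<lambda>x. f x * ?c x)"
        "(LINT z|lborel. flux v ?c z) = \<sigma> * (LINT x|lborel. f x * ?c x)"
      using weak[OF test] by auto
    have intpsi: "integrable lborel (flux v \<psi>)" using flux_integrable[OF v_meas psi energy_v E] .
    have "ennreal \<bar>(LINT z|lborel. flux v ?c z) - (LINT z|lborel. flux v \<psi> z)\<bar>
        = ennreal \<bar>LINT z|lborel. flux v ?c z - flux v \<psi> z\<bar>"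
      using w(1) intpsi by simp
    also have "\<dots> \<le> (\<integral>\<^sup>+ z. ennreal (norm (flux v ?c z - flux v \<psi> z)) \<partial>lborel)"
      using integral_norm_bound_ennreal[OF Bochner_Integration.integrable_diff[OF w(1) intpsi]] by simp
    also have "\<dots> \<le> (\<integral>\<^sup>+ z. \<integral>\<^sup>+ t. ennreal (\<rho> t) * ennreal (\<bar>v (fst z) - v (snd z)\<bar> powr (p - 1) *
        \<bar>(\<psi> (fst z - t) - \<psi> (fst z)) - (\<psi> (snd z - t) - \<psi> (snd z))\<bar> * ker (fst z) (snd z)) \<partial>lborel \<partial>lborel)"
    proof (intro nn_integral_mono)
      fix z :: "(real ^ 'n) \<times> (real ^ 'n)"
      let ?a = "\<bar>v (fst z) - v (snd z)\<bar> powr (p - 1) * ker (fst z) (snd z)"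
      have "flux v ?c z - flux v \<psi> z = flux v (\<lambda>x. ?c x - \<psi> x) z" by (simp add: flux_def algebra_simps)
      then have "norm (flux v ?c z - flux v \<psi> z) = ?a * \<bar>(?c (fst z) - \<psi> (fst z)) - (?c (snd z) - \<psi> (snd z))\<bar>"
        by (simp add: abs_flux)
      then have "ennreal (norm (flux v ?c z - flux v \<psi> z)) = ennreal ?a * ennreal \<bar>(?c (fst z) - \<psi> (fst z)) - (?c (snd z) - \<psi> (snd z))\<bar>"
        by (simp add: ennreal_mult[symmetric])
      also have "\<dots> \<le> ennreal ?a * (\<integral>\<^sup>+ t. ennreal (\<rho> t) * ennreal \<bar>(\<psi> (fst z - t) - \<psi> (fst z)) - (\<psi> (snd z - t) - \<psi> (snd z))\<bar> \<partial>lborel)"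
        by (intro mult_left_mono mollified_increment_le(2)[OF mol psi B]) auto
      also have "\<dots> = (\<integral>\<^sup>+ t. ennreal ?a * (ennreal (\<rho> t) * ennreal \<bar>(\<psi> (fst z - t) - \<psi> (fst z)) - (\<psi> (snd z - t) - \<psi> (snd z))\<bar>) \<partial>lborel)"
        by (intro nn_integral_cmult[symmetric]) measurable
      also have "\<dots> = (\<integral>\<^sup>+ t. ennreal (\<rho> t) * ennreal (\<bar>v (fst z) - v (snd z)\<bar> powr (p - 1) *
        \<bar>(\<psi> (fst z - t) - \<psi> (fst z)) - (\<psi> (snd z - t) - \<psi> (snd z))\<bar> * ker (fst z) (snd z)) \<partial>lborel)"
        using rho(2) by (intro nn_integral_cong) (simp add: ennreal_mult[symmetric] mult_ac)
      finally show "ennreal (norm (flux v ?c z - flux v \<psi> z)) \<le> (\<integral>\<^sup>+ t. ennreal (\<rho> t) * ennreal (\<bar>v (fst z) - v (snd z)\<bar> powr (p - 1) *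
        \<bar>(\<psi> (fst z - t) - \<psi> (fst z)) - (\<psi> (snd z - t) - \<psi> (snd z))\<bar> * ker (fst z) (snd z)) \<partial>lborel)" .
    qed
    also have "\<dots> = (\<integral>\<^sup>+ t. \<integral>\<^sup>+ z. ennreal (\<rho> t) * ennreal (\<bar>v (fst z) - v (snd z)\<bar> powr (p - 1) *
        \<bar>(\<psi> (fst z - t) - \<psi> (fst z)) - (\<psi> (snd z - t) - \<psi> (snd z))\<bar> * ker (fst z) (snd z)) \<partial>lborel \<partial>lborel)"
      by (intro lborel_pair.Fubini'[symmetric]) measurable
    also have "\<dots> = (\<integral>\<^sup>+ t. ennreal (\<rho> t) * (\<integral>\<^sup>+ z. ennreal (\<bar>v (fst z) - v (snd z)\<bar> powr (p - 1) *
        \<bar>(\<psi> (fst z - t) - \<psi> (fst z)) - (\<psi> (snd z - t) - \<psi> (snd z))\<bar> * ker (fst z) (snd z)) \<partial>lborel) \<partial>lborel)"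
      by (intro nn_integral_cong nn_integral_cmult) measurable
    also have "\<dots> \<le> ennreal e1"
      by (rule mollifier_average_le[OF mol d1(2)]) (simp add: e_def)
    finally have f1: "\<bar>(LINT z|lborel. flux v ?c z) - (LINT z|lborel. flux v \<psi> z)\<bar> \<le> e1" using e1 by simp
    have "ennreal \<bar>(LINT x|lborel. f x * ?c x) - (LINT x|lborel. f x * \<psi> x)\<bar> = ennreal \<bar>LINT x|lborel. f x * ?c x - f x * \<psi> x\<bar>"
      using w(2) int by simp
    also have "\<dots> \<le> (\<integral>\<^sup>+ x. ennreal (norm (f x * ?c x - f x * \<psi> x)) \<partial>lborel)"
      using integral_norm_bound_ennreal[OF Bochner_Integration.integrable_diff[OF w(2) int]] by simp
    also have "\<dots> \<le> (\<integral>\<^sup>+ x. \<integral>\<^sup>+ t. ennreal (\<rho> t) * ennreal (f x * \<bar>\<psi> (x - t) - \<psi> x\<bar>) \<partial>lborel \<partial>lborel)"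
    proof (intro nn_integral_mono)
      fix x
      have "ennreal (norm (f x * ?c x - f x * \<psi> x)) = ennreal (f x) * ennreal \<bar>?c x - \<psi> x\<bar>"
        using f_nonneg by (simp add: right_diff_distrib[symmetric] abs_mult ennreal_mult)
      also have "\<dots> \<le> ennreal (f x) * (\<integral>\<^sup>+ t. ennreal (\<rho> t) * ennreal \<bar>\<psi> (x - t) - \<psi> x\<bar> \<partial>lborel)"
        by (intro mult_left_mono mollified_increment_le(1)[OF mol psi B]) auto
      also have "\<dots> = (\<integral>\<^sup>+ t. ennreal (f x) * (ennreal (\<rho> t) * ennreal \<bar>\<psi> (x - t) - \<psi> x\<bar>) \<partial>lborel)"
        by (intro nn_integral_cmult[symmetric]) measurable
      also have "\<dots> = (\<integral>\<^sup>+ t. ennreal (\<rho> t) * ennreal (f x * \<bar>\<psi> (x - t) - \<psi> x\<bar>) \<partial>lborel)"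
        using rho(2) f_nonneg by (intro nn_integral_cong) (simp add: ennreal_mult[symmetric] mult_ac)
      finally show "ennreal (norm (f x * ?c x - f x * \<psi> x)) \<le> (\<integral>\<^sup>+ t. ennreal (\<rho> t) * ennreal (f x * \<bar>\<psi> (x - t) - \<psi> x\<bar>) \<partial>lborel)" .
    qed
    also have "\<dots> = (\<integral>\<^sup>+ t. \<integral>\<^sup>+ x. ennreal (\<rho> t) * ennreal (f x * \<bar>\<psi> (x - t) - \<psi> x\<bar>) \<partial>lborel \<partial>lborel)"
      by (intro lborel_pair.Fubini'[symmetric]) measurable
    also have "\<dots> = (\<integral>\<^sup>+ t. ennreal (\<rho> t) * (\<integral>\<^sup>+ x. ennreal (f x * \<bar>\<psi> (x - t) - \<psi> x\<bar>) \<partial>lborel) \<partial>lborel)"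
      by (intro nn_integral_cong nn_integral_cmult) measurable
    also have "\<dots> \<le> ennreal e1"
      by (rule mollifier_average_le[OF mol d2(2)]) (simp add: e_def)
    finally have f2: "\<bar>(LINT x|lborel. f x * ?c x) - (LINT x|lborel. f x * \<psi> x)\<bar> \<le> e1" using e1 by simp
    have "\<bar>\<sigma> * (LINT x|lborel. f x * ?c x) - \<sigma> * (LINT x|lborel. f x * \<psi> x)\<bar> \<le> \<bar>\<sigma>\<bar> * e1"
      using mult_left_mono[OF f2, of "\<bar>\<sigma>\<bar>"] by (simp add: right_diff_distrib[symmetric] abs_mult)
    then show ?thesis using f1 w(3) by linarith
  qed
  show "(LINT z|lborel. flux v \<psi> z) = \<sigma> * (LINT x|lborel. f x * \<psi> x)"
  proof (rule ccontr)
    assume "\<not> ?thesis"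
    then have "0 < \<bar>(LINT z|lborel. flux v \<psi> z) - \<sigma> * (LINT x|lborel. f x * \<psi> x)\<bar>" (is "0 < ?D") by simp
    then have "0 < ?D / (2 * (1 + \<bar>\<sigma>\<bar>))" by simp
    from close[OF this] have "?D \<le> ?D / (2 * (1 + \<bar>\<sigma>\<bar>)) * (1 + \<bar>\<sigma>\<bar>)"
      unfolding distrib_left mult_1_right by (simp only: mult.commute)
    also have "\<dots> = ?D / 2"
    proof -
      have key: "a / (2 * c) * c = a / 2" if "c \<noteq> 0" for a c :: real using that by simp
      show ?thesis by (rule key) linarith
    qed
    finally show False using \<open>0 < ?D\<close> by simp
  qed
qed

lemma weak_sub_density:
  assumes "\<sigma> = 1" shows "weak_sub \<Omega> v f"
proof (rule weak_subI_bounded)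
  fix \<psi> K B assume a: "\<psi> \<in> borel_measurable borel" "\<And>x. 0 \<le> \<psi> x" "\<And>x. \<psi> x \<le> B" "compact K" "K \<subseteq> \<Omega>"
    "\<And>x. x \<notin> K \<Longrightarrow> \<psi> x = 0" "energy \<psi> < \<infinity>"
  have "\<And>x. \<bar>\<psi> x\<bar> \<le> B" using a(2,3) by simp
  note w = weak_bounded[OF a(1) this a(4,5,6,7)]
  show "ennreal (LINT z|lborel. flux v \<psi> z) \<le> (\<integral>\<^sup>+ x. ennreal (f x * \<psi> x) \<partial>lborel)"
    using w a f_nonneg by (subst nn_integral_eq_integral) (auto simp: assms)
qed (use energy_v f_nonneg in auto)

text \<open>With a nonnegative density and sign -1 the integral of the flux is at most 0, and
  \<open>ennreal\<close> sends it to 0, so the right-hand side 0 is admissible.\<close>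

lemma weak_sub_zero:
  assumes "\<sigma> = - 1" shows "weak_sub \<Omega> v (\<lambda>x. 0)"
proof (rule weak_subI_bounded)
  fix \<psi> K B assume a: "\<psi> \<in> borel_measurable borel" "\<And>x. 0 \<le> \<psi> x" "\<And>x. \<psi> x \<le> B" "compact K" "K \<subseteq> \<Omega>"
    "\<And>x. x \<notin> K \<Longrightarrow> \<psi> x = 0" "energy \<psi> < \<infinity>"
  have "\<And>x. \<bar>\<psi> x\<bar> \<le> B" using a(2,3) by simp
  note w = weak_bounded[OF a(1) this a(4,5,6,7)]
  have "0 \<le> (LINT x|lborel. f x * \<psi> x)" using a f_nonneg by (intro integral_nonneg_AE) auto
  then show "ennreal (LINT z|lborel. flux v \<psi> z) \<le> (\<integral>\<^sup>+ x. ennreal (0 * \<psi> x) \<partial>lborel)"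
    using w by (simp add: assms ennreal_neg)
qed (use energy_v in auto)

end

subsection \<open>The Caccioppoli inequality\<close>

text \<open>It vanishes already from the midpoint radius (\<rho> + R) / 2 on. The remaining gap
  keeps its support away from the complement of the ball of radius R, as interactions with the
  exterior require.\<close>

definition cutoff :: "real ^ 'n \<Rightarrow> real \<Rightarrow> real \<Rightarrow> real ^ 'n \<Rightarrow> real" where
  "cutoff x0 \<rho> R x = max 0 (min 1 (((\<rho> + R) / 2 - norm (x - x0)) / ((R - \<rho>) / 2)))"

lemma cutoff_bounds: "0 \<le> cutoff x0 \<rho> R x" "cutoff x0 \<rho> R x \<le> 1"
  by (auto simp: cutoff_def)

lemma cutoff_one: "\<rho> < R \<Longrightarrow> norm (x - x0) \<le> \<rho> \<Longrightarrow> cutoff x0 \<rho> R x = 1"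
  by (auto simp: cutoff_def field_simps max_def min_def)

lemma cutoff_zero: "\<rho> < R \<Longrightarrow> (\<rho> + R) / 2 \<le> norm (x - x0) \<Longrightarrow> cutoff x0 \<rho> R x = 0"
proof -
  assume "\<rho> < R" "(\<rho> + R) / 2 \<le> norm (x - x0)"
  then have "((\<rho> + R) / 2 - norm (x - x0)) / ((R - \<rho>) / 2) \<le> 0" by (intro divide_nonpos_pos) auto
  then show ?thesis unfolding cutoff_def by simp
qed

lemma cutoff_lipschitz:
  assumes "\<rho> < R"
  shows "\<bar>cutoff x0 \<rho> R x - cutoff x0 \<rho> R y\<bar> \<le> 2 / (R - \<rho>) * norm (x - y)"
proof -
  have "\<bar>cutoff x0 \<rho> R x - cutoff x0 \<rho> R y\<bar>
     \<le> \<bar>((\<rho> + R) / 2 - norm (x - x0)) / ((R - \<rho>) / 2) - ((\<rho> + R) / 2 - norm (y - x0)) / ((R - \<rho>) / 2)\<bar>"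
    unfolding cutoff_def by (auto simp: max_def min_def)
  also have "\<dots> = \<bar>norm (y - x0) - norm (x - x0)\<bar> / ((R - \<rho>) / 2)"
  proof -
    have key: "\<bar>(m - a) / c - (m - b) / c\<bar> = \<bar>b - a\<bar> / c" if "0 < c" for m a b c :: real
      using that by (simp add: diff_divide_distrib[symmetric])
    show ?thesis by (rule key) (use assms in simp)
  qed
  also have "\<dots> \<le> norm (x - y) / ((R - \<rho>) / 2)"
    using assms norm_triangle_ineq3[of "y - x0" "x - x0"] by (intro divide_right_mono) (auto simp: norm_minus_commute)
  finally show ?thesis by (simp add: field_simps)
qed

lemma cutoff_measurable [measurable]: "cutoff x0 \<rho> R \<in> borel_measurable borel"
  unfolding cutoff_def by measurable

text \<open>If the integral of g is infinite there is nothing to show; otherwise g is integrable and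
  the integral of the sum splits. Cutting a negative integral of h off at 0 only enlarges the
  right-hand side.\<close>

lemma nn_integral_le_of_signed:
  fixes h :: "'a \<Rightarrow> real"
  assumes h: "integrable M h" and g[measurable]: "g \<in> borel_measurable M" and g0: "\<And>z. 0 \<le> g z"
    and P0: "\<And>z. 0 \<le> P z" and le: "\<And>z. P z \<le> h z + g z"
  shows "(\<integral>\<^sup>+ z. ennreal (P z) \<partial>M) \<le> ennreal (integral\<^sup>L M h) + (\<integral>\<^sup>+ z. ennreal (g z) \<partial>M)"
proof (cases "(\<integral>\<^sup>+ z. ennreal (g z) \<partial>M) = \<infinity>")
  case False
  then have gi: "integrable M g" using g0 by (intro integrableI_nonneg) (auto simp: less_top)
  have "(\<integral>\<^sup>+ z. ennreal (P z) \<partial>M) \<le> (\<integral>\<^sup>+ z. ennreal (h z + g z) \<partial>M)"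
    by (intro nn_integral_mono ennreal_leI le)
  also have "\<dots> = ennreal (LINT z|M. h z + g z)"
    using h gi order_trans[OF P0 le] by (intro nn_integral_eq_integral) auto
  also have "(LINT z|M. h z + g z) = integral\<^sup>L M h + integral\<^sup>L M g" using h gi by simp
  also have "ennreal \<dots> \<le> ennreal (integral\<^sup>L M h) + ennreal (integral\<^sup>L M g)"
  proof -
    have "0 \<le> integral\<^sup>L M g" using g0 by (intro integral_nonneg_AE) auto
    then show ?thesis
      by (cases "0 \<le> integral\<^sup>L M h") (auto simp: ennreal_plus[symmetric] ennreal_neg ennreal_leI simp del: ennreal_plus)
  qed
  also have "ennreal (integral\<^sup>L M g) = (\<integral>\<^sup>+ z. ennreal (g z) \<partial>M)"
    using gi g0 by (intro nn_integral_eq_integral[symmetric]) auto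
  finally show ?thesis .
qed simp

section \<open>Pointwise coercivity of the flux\<close>

context fractional
begin

lemma powr_split: "0 \<le> c \<Longrightarrow> c powr (p - 1) * c = c powr p"
  using p1 powr_mult_base[of c "p - 1"] by (simp add: mult.commute)

lemma powr_diff_le:
  assumes "0 \<le> \<xi>" "\<xi> \<le> \<zeta>"
  shows "\<zeta> powr p - \<xi> powr p \<le> p * \<zeta> powr (p - 1) * (\<zeta> - \<xi>)"
proof (cases "\<xi> = 0 \<or> \<xi> = \<zeta>")
  case True
  then show ?thesis
    using assms p1 powr_split[of \<zeta>] mult_right_mono[of 1 p "\<zeta> powr p"] by (auto simp: mult.assoc)
next
  case False
  then have "0 < \<xi>" "\<xi> < \<zeta>" using assms by auto
  then have "\<exists>z. \<xi> < z \<and> z < \<zeta> \<and> \<zeta> powr p - \<xi> powr p = (\<zeta> - \<xi>) * (p * z powr (p - 1))"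
    by (intro MVT2) (auto intro!: derivative_eq_intros)
  then obtain z where z: "\<xi> < z" "z < \<zeta>" "\<zeta> powr p - \<xi> powr p = (\<zeta> - \<xi>) * (p * z powr (p - 1))" by blast
  have "(\<zeta> - \<xi>) * (p * z powr (p - 1)) \<le> (\<zeta> - \<xi>) * (p * \<zeta> powr (p - 1))"
    using z assms p1 \<open>0 < \<xi>\<close> by (intro mult_left_mono powr_mono2) auto
  then show ?thesis using z(3) by (simp add: mult_ac)
qed

text \<open>Large enough for every case below: 2^p (1 + 2^p p^p) is what nearby pairs need when the
  cutoff is larger at the lower value, and 1 + 2 * 2^p is what pairs with one point outside the ball
  need.\<close>

definition cacc :: real where "cacc = 2 powr p * (3 + 2 powr p * p powr p)"

lemma cacc_ge: "2 \<le> cacc" "2 powr p \<le> cacc" "0 < cacc" "1 + 2 * 2 powr p \<le> cacc" "1 \<le> 2 powr p"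
proof -
  have a: "1 \<le> (2::real) powr p" using p0 by (intro ge_one_powr_ge_zero) auto
  have b: "0 \<le> (2::real) powr p * p powr p" by simp
  have "2 powr p * 3 \<le> cacc" unfolding cacc_def using b by (intro mult_left_mono) auto
  then show "2 \<le> cacc" "2 powr p \<le> cacc" "0 < cacc" "1 + 2 * 2 powr p \<le> cacc" "1 \<le> 2 powr p" using a by auto
qed

text \<open>\<open>jump a b X Y\<close> is the flux for values \<open>a, b\<close> of the solution and \<open>X, Y\<close> of the test function.\<close>

definition jump :: "real \<Rightarrow> real \<Rightarrow> real \<Rightarrow> real \<Rightarrow> real" where
  "jump a b X Y = \<bar>a - b\<bar> powr (p - 2) * (a - b) * (X - Y)"

lemma jump_sym: "jump a b X Y = jump b a Y X"
  by (simp add: jump_def abs_minus_commute algebra_simps)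

lemma jump_ge: "b \<le> a \<Longrightarrow> jump a b X Y = (a - b) powr (p - 1) * (X - Y)"
  using abs_powr_mult[of "a - b"] by (simp add: jump_def)

text \<open>For a above and b below the level, B = 0 and a - b dominates both a - k and k - b. Each
  of the two nonzero terms is then at most the jump, hence the factor 2.\<close>

lemma coercive_above_level:
  fixes a b k :: real
  assumes ba: "b \<le> a" and bk: "b \<le> k" and xi: "0 \<le> \<xi>"
  defines "A \<equiv> max (a - k) 0" and "B \<equiv> max (b - k) 0"
  shows "\<bar>A * \<xi> - B * \<zeta>\<bar> powr p + max (k - b) 0 powr (p - 1) * (A * \<xi> powr p) + max (k - a) 0 powr (p - 1) * (B * \<zeta> powr p)
      \<le> 2 * jump a b (A * \<xi> powr p) (B * \<zeta> powr p)"
proof (cases "a \<le> k")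
  case True
  then show ?thesis using bk p0 by (simp add: A_def B_def jump_def)
next
  case False
  then have A: "0 < A" "B = 0" "A = a - k" using bk by (auto simp: A_def B_def)
  have "(A * \<xi>) powr p = A powr (p - 1) * (A * \<xi> powr p)"
    using A xi powr_split[of A] by (simp add: powr_mult)
  also have "\<dots> \<le> (a - b) powr (p - 1) * (A * \<xi> powr p)"
    using A bk p1 by (intro mult_right_mono powr_mono2) auto
  finally have 1: "(A * \<xi>) powr p \<le> (a - b) powr (p - 1) * (A * \<xi> powr p)" .
  have 2: "max (k - b) 0 powr (p - 1) * (A * \<xi> powr p) \<le> (a - b) powr (p - 1) * (A * \<xi> powr p)"
    using A bk p1 by (intro mult_right_mono powr_mono2) auto
  have "\<bar>A * \<xi> - B * \<zeta>\<bar> powr p = (A * \<xi>) powr p" using A(1,2) xi by simp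
  moreover have "max (k - a) 0 powr (p - 1) * (B * \<zeta> powr p) = 0" using A(2) by simp
  moreover have "jump a b (A * \<xi> powr p) (B * \<zeta> powr p) = (a - b) powr (p - 1) * (A * \<xi> powr p)"
    using jump_ge[OF ba] A(2) by simp
  ultimately show ?thesis using 1 2 by linarith
qed

text \<open>If both values exceed the level the cross terms vanish and A - B = a - b. The jump alone
  suffices up to a cutoff increment when the cutoff is larger at the higher value; in the opposite
  case the cutoff acts against the flux and its effect is absorbed by Young's inequality.\<close>

lemma coercive_near_aux:
  fixes a b k :: real
  assumes ba: "b \<le> a" and xi: "0 \<le> \<xi>" "0 \<le> \<zeta>"
  defines "A \<equiv> max (a - k) 0" and "B \<equiv> max (b - k) 0"
  shows "\<bar>A * \<xi> - B * \<zeta>\<bar> powr p + max (k - b) 0 powr (p - 1) * (A * \<xi> powr p) + max (k - a) 0 powr (p - 1) * (B * \<zeta> powr p)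
      \<le> 2 * 2 powr p * jump a b (A * \<xi> powr p) (B * \<zeta> powr p) + cacc * (max A B powr p * \<bar>\<xi> - \<zeta>\<bar> powr p)"
proof (cases "b \<le> k")
  case True
  let ?J = "jump a b (A * \<xi> powr p) (B * \<zeta> powr p)"
  let ?P = "\<bar>A * \<xi> - B * \<zeta>\<bar> powr p + max (k - b) 0 powr (p - 1) * (A * \<xi> powr p) + max (k - a) 0 powr (p - 1) * (B * \<zeta> powr p)"
  have le: "?P \<le> 2 * ?J" unfolding A_def B_def by (rule coercive_above_level[OF ba True xi(1)])
  moreover have "0 \<le> ?P" by (intro add_nonneg_nonneg mult_nonneg_nonneg) (auto simp: A_def B_def)
  ultimately have "0 \<le> ?J" by linarith
  then have "2 * ?J \<le> 2 * 2 powr p * ?J" using cacc_ge(5) by (intro mult_right_mono) auto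
  moreover have "0 \<le> cacc * (max A B powr p * \<bar>\<xi> - \<zeta>\<bar> powr p)" using cacc_ge(3) by simp
  ultimately show ?thesis using le by linarith
next
  case False
  define d where "d = a - b"
  have d: "0 \<le> d" using ba by (simp add: d_def)
  have AB: "A = B + d" "0 < B" "B \<le> A" using False ba by (auto simp: A_def B_def d_def)
  let ?J = "jump a b (A * \<xi> powr p) (B * \<zeta> powr p)"
  let ?D = "max A B powr p * \<bar>\<xi> - \<zeta>\<bar> powr p"
  have J: "?J = d powr (p - 1) * (A * \<xi> powr p - B * \<zeta> powr p)" using jump_ge[OF ba] by (simp add: d_def)
  have D0: "0 \<le> ?D" by simp
  have "\<bar>A * \<xi> - B * \<zeta>\<bar> powr p \<le> 2 * 2 powr p * ?J + cacc * ?D"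
  proof (cases "\<zeta> \<le> \<xi>")
    case True
    have "\<zeta> powr p \<le> \<xi> powr p" using True xi p0 by (intro powr_mono2) auto
    then have "B * \<zeta> powr p \<le> B * \<xi> powr p" using AB by (intro mult_left_mono) auto
    then have "d * \<xi> powr p \<le> A * \<xi> powr p - B * \<zeta> powr p" by (simp add: AB algebra_simps)
    then have "d powr (p - 1) * (d * \<xi> powr p) \<le> ?J" unfolding J by (rule mult_left_mono) simp
    then have j: "(d * \<xi>) powr p \<le> ?J" using powr_split[OF d] d xi by (simp add: powr_mult mult.assoc[symmetric])
    have "A * \<xi> - B * \<zeta> = d * \<xi> + B * (\<xi> - \<zeta>)" by (simp add: AB algebra_simps)
    then have "\<bar>A * \<xi> - B * \<zeta>\<bar> powr p \<le> 2 powr p * ((d * \<xi>) powr p + (B * (\<xi> - \<zeta>)) powr p)"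
      using d xi True AB p0 add_powr_le[of "d * \<xi>" "B * (\<xi> - \<zeta>)" p] by simp
    also have "(B * (\<xi> - \<zeta>)) powr p \<le> ?D"
      using True AB p0 by (simp add: powr_mult mult_right_mono powr_mono2)
    also have "2 powr p * ((d * \<xi>) powr p + ?D) \<le> 2 powr p * (?J + ?D)"
      using j by (intro mult_left_mono add_mono) auto
    also have "\<dots> \<le> 2 * 2 powr p * ?J + cacc * ?D"
    proof -
      have "0 \<le> ?J" using j powr_ge_zero order_trans by blast
      then have "2 powr p * ?J \<le> 2 * 2 powr p * ?J" by (intro mult_right_mono) auto
      moreover have "2 powr p * ?D \<le> cacc * ?D" using cacc_ge(2) D0 by (rule mult_right_mono)
      ultimately show ?thesis unfolding distrib_left by linarith
    qed
    finally show ?thesis by simp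
  next
    case False
    then have lt: "\<xi> < \<zeta>" by simp
    define E where "E = A powr p * (\<zeta> - \<xi>) powr p"
    have E: "?D = E" using lt AB by (simp add: E_def max_def abs_if)
    have E0: "0 \<le> E" by (simp add: E_def)
    have "d powr (p - 1) * (A * (\<zeta> powr p - \<xi> powr p)) \<le> d powr (p - 1) * (A * (p * \<zeta> powr (p - 1) * (\<zeta> - \<xi>)))"
      using powr_diff_le[OF xi(1)] lt AB by (intro mult_left_mono) auto
    also have "\<dots> = (d * \<zeta>) powr (p - 1) * (p * A * (\<zeta> - \<xi>))" using d xi by (simp add: powr_mult mult_ac)
    \<comment> \<open>The parameter 2^(p-1) is chosen so that the other coefficient is exactly 1/2;
      half of (d \<zeta>)^p survives the absorption.\<close>
    also have "\<dots> \<le> 2 powr (p - 1) * (p * A * (\<zeta> - \<xi>)) powr p + (2 powr (p - 1)) powr (- 1 / (p - 1)) * (d * \<zeta>) powr p"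
      using d xi lt AB p0 by (intro young) auto
    also have "(2 powr (p - 1)) powr (- 1 / (p - 1)) = 1 / (2::real)"
      using p1 by (simp add: powr_powr powr_minus)
    also have "(p * A * (\<zeta> - \<xi>)) powr p = p powr p * E" using p0 AB lt by (simp add: powr_mult E_def)
    finally have y: "d powr (p - 1) * (A * (\<zeta> powr p - \<xi> powr p)) \<le> 2 powr (p - 1) * (p powr p * E) + 1 / 2 * (d * \<zeta>) powr p" .
    have "d powr (p - 1) * (d * \<zeta> powr p) = (d * \<zeta>) powr p" using powr_split[OF d] d xi by (simp add: powr_mult mult.assoc[symmetric])
    then have "?J = (d * \<zeta>) powr p - d powr (p - 1) * (A * (\<zeta> powr p - \<xi> powr p))"
      unfolding J by (simp add: AB algebra_simps)
    moreover have "2 powr p * p powr p * E = 2 * (2 powr (p - 1) * (p powr p * E))" by (simp add: powr_diff)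
    ultimately have j: "(d * \<zeta>) powr p \<le> 2 * ?J + 2 powr p * p powr p * E" using y by linarith
    have "A * \<xi> - B * \<zeta> = d * \<zeta> - A * (\<zeta> - \<xi>)" by (simp add: AB algebra_simps)
    then have "\<bar>A * \<xi> - B * \<zeta>\<bar> \<le> d * \<zeta> + A * (\<zeta> - \<xi>)" using d xi lt AB by (simp add: abs_le_iff)
    then have "\<bar>A * \<xi> - B * \<zeta>\<bar> powr p \<le> (d * \<zeta> + A * (\<zeta> - \<xi>)) powr p" using p0 by (intro powr_mono2) auto
    also have "\<dots> \<le> 2 powr p * ((d * \<zeta>) powr p + (A * (\<zeta> - \<xi>)) powr p)"
      using d xi lt AB p0 by (intro add_powr_le) auto
    also have "(A * (\<zeta> - \<xi>)) powr p = E" using AB lt by (simp add: powr_mult E_def)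
    also have "2 powr p * ((d * \<zeta>) powr p + E) \<le> 2 powr p * (2 * ?J + 2 powr p * p powr p * E + E)"
      using j by (intro mult_left_mono) auto
    also have "\<dots> \<le> 2 * 2 powr p * ?J + cacc * E"
    proof -
      have "2 powr p * (1 + 2 powr p * p powr p) * E \<le> cacc * E"
        unfolding cacc_def using E0 by (intro mult_right_mono mult_left_mono) auto
      then show ?thesis by (simp add: algebra_simps)
    qed
    finally show ?thesis using E by simp
  qed
  then show ?thesis using False ba p1 by (simp add: max_def)
qed

lemma coercive_near:
  fixes a b k :: real
  assumes xi: "0 \<le> \<xi>" "0 \<le> \<zeta>"
  defines "A \<equiv> max (a - k) 0" and "B \<equiv> max (b - k) 0"
  shows "\<bar>A * \<xi> - B * \<zeta>\<bar> powr p + max (k - b) 0 powr (p - 1) * (A * \<xi> powr p) + max (k - a) 0 powr (p - 1) * (B * \<zeta> powr p)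
      \<le> 2 * 2 powr p * jump a b (A * \<xi> powr p) (B * \<zeta> powr p) + cacc * (max A B powr p * \<bar>\<xi> - \<zeta>\<bar> powr p)"
proof (cases "b \<le> a")
  case True
  show ?thesis unfolding A_def B_def by (rule coercive_near_aux[OF True xi])
next
  case False
  then have "a \<le> b" by simp
  from coercive_near_aux[OF this xi(2,1), of k, folded A_def B_def]
  show ?thesis
    unfolding jump_sym[of b a] max.commute[of B A] abs_minus_commute[of \<zeta> \<xi>]
      abs_minus_commute[of "B * \<zeta>" "A * \<xi>"] by linarith
qed

text \<open>Models a pair whose second point lies outside the support of the cutoff. The correction
  involves B^(p-1) instead of a cutoff increment; integrated against the kernel it becomes the
  tail.\<close>

lemma coercive_far:
  fixes a b k :: real
  assumes xi: "0 \<le> \<xi>"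
  defines "A \<equiv> max (a - k) 0" and "B \<equiv> max (b - k) 0"
  shows "\<bar>A * \<xi>\<bar> powr p + max (k - b) 0 powr (p - 1) * (A * \<xi> powr p)
      \<le> 2 * 2 powr p * jump a b (A * \<xi> powr p) 0 + cacc * (B powr (p - 1) * (A * \<xi> powr p))"
proof -
  let ?J = "jump a b (A * \<xi> powr p) 0"
  let ?X = "B powr (p - 1) * (A * \<xi> powr p)"
  have X0: "0 \<le> ?X" by (simp add: A_def)
  have Axi: "(A * \<xi>) powr p = A powr (p - 1) * (A * \<xi> powr p)"
    using xi powr_split[of A] by (simp add: powr_mult A_def)
  have big: "1 + 2 * 2 powr p \<le> cacc" using cacc_ge(4) .
  show ?thesis
  proof (cases "b \<le> k")
    case True
    show ?thesis
    proof (cases "b \<le> a")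
      case ba: True
      let ?P = "\<bar>A * \<xi>\<bar> powr p + max (k - b) 0 powr (p - 1) * (A * \<xi> powr p)"
      have le: "?P \<le> 2 * ?J"
        using coercive_above_level[OF ba True xi, of 0] p0 True by (simp add: A_def)
      moreover have "0 \<le> ?P" by (intro add_nonneg_nonneg mult_nonneg_nonneg) (auto simp: A_def)
      ultimately have "0 \<le> ?J" by linarith
      then have "2 * ?J \<le> 2 * 2 powr p * ?J" using cacc_ge(5) by (intro mult_right_mono) auto
      moreover have "0 \<le> cacc * ?X" by (rule mult_nonneg_nonneg[OF less_imp_le[OF cacc_ge(3)] X0])
      ultimately show ?thesis using le by linarith
    next
      case False
      then have "A = 0" using True by (simp add: A_def)
      then show ?thesis using p0 by (simp add: jump_def)
    qed
  next
    case False
    then have B: "0 < B" "B = b - k" by (auto simp: B_def)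
    have z: "max (k - b) 0 = 0" using False by simp
    show ?thesis
    proof (cases "b \<le> a")
      case True
      define d where "d = a - b"
      have d: "0 \<le> d" "A = d + B" using True False by (auto simp: d_def A_def B_def)
      have J: "?J = d powr (p - 1) * (A * \<xi> powr p)" using jump_ge[OF True] by (simp add: d_def)
      have "A powr (p - 1) \<le> 2 powr (p - 1) * (d powr (p - 1) + B powr (p - 1))"
        unfolding d(2) using d B p1 by (intro add_powr_le) auto
      also have "\<dots> \<le> 2 powr p * (d powr (p - 1) + B powr (p - 1))"
        by (intro mult_right_mono powr_mono) auto
      finally have "(A * \<xi>) powr p \<le> 2 powr p * (d powr (p - 1) + B powr (p - 1)) * (A * \<xi> powr p)"
        unfolding Axi by (rule mult_right_mono) (simp add: A_def)
      also have "\<dots> = 2 powr p * ?J + 2 powr p * ?X" by (simp add: J algebra_simps)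
      also have "\<dots> \<le> 2 * 2 powr p * ?J + cacc * ?X"
      proof (intro add_mono)
        have "0 \<le> ?J" using J by (simp add: A_def)
        then show "2 powr p * ?J \<le> 2 * 2 powr p * ?J" by (intro mult_right_mono) auto
        show "2 powr p * ?X \<le> cacc * ?X" using X0 cacc_ge(2) by (rule mult_right_mono[rotated])
      qed
      finally show ?thesis using z p1 xi by (simp add: A_def)
    next
      \<comment> \<open>Only here can the flux be negative. If a exceeds the level, its factor (b -
        a)^(p-1) is at most B^(p-1), so the tail term pays for it.\<close>
      case False
      have AB: "A \<le> B" using False by (simp add: A_def B_def)
      have "jump a b (A * \<xi> powr p) 0 = - ((b - a) powr (p - 1) * (A * \<xi> powr p))"
        using False jump_sym[of a b "A * \<xi> powr p" 0] jump_ge[of a b 0 "A * \<xi> powr p"] by simp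
      moreover have "(b - a) powr (p - 1) * (A * \<xi> powr p) \<le> ?X"
      proof (cases "A = 0")
        case A: False
        then have "b - a \<le> B" using B by (auto simp: A_def)
        then show ?thesis using False p1 by (intro mult_right_mono powr_mono2) (auto simp: A_def)
      qed simp
      ultimately have "- (2 * 2 powr p * ?X) \<le> 2 * 2 powr p * ?J" by simp
      moreover have "(A * \<xi>) powr p \<le> ?X"
        unfolding Axi using AB p1 by (intro mult_right_mono powr_mono2) (auto simp: A_def)
      moreover have "(1 + 2 * 2 powr p) * ?X \<le> cacc * ?X" using big X0 by (rule mult_right_mono)
      ultimately show ?thesis using z p1 xi by (simp add: A_def algebra_simps)
    qed
  qed
qed

end

lemma ball_sets_borel [measurable]: "ball (x :: real ^ 'n) r \<in> sets borel" "- ball (x :: real ^ 'n) r \<in> sets borel"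
  by auto

section \<open>Near and far kernels, and the integrated inequality\<close>

context fractional
begin

lemma powr_ker: "norm (x - y) powr p * ker x y = norm (x - y) powr ((p - s * p) - N)"
  by (simp add: ker_def powr_add[symmetric] algebra_simps)

lemma psp_pos: "0 < p - s * p" "s * p \<le> p"
  using p0 s1 by auto

lemma ker_near_le:
  assumes "0 < R"
  shows "(\<integral>\<^sup>+ y. ennreal (indicator (ball x R) y * (norm (x - y) powr p * ker x y)) \<partial>lborel)
     \<le> ennreal (near_const TYPE('n) (p - s * p) * R powr (p - s * p))"
  using kernel_near_le[OF psp_pos(1) assms, of x] by (simp add: powr_ker N_def[symmetric])

lemma nn_integral_fst_le:
  fixes g :: "real ^ 'n \<Rightarrow> ennreal" and h :: "(real ^ 'n) \<times> (real ^ 'n) \<Rightarrow> ennreal"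
  assumes [measurable]: "g \<in> borel_measurable borel" "h \<in> borel_measurable borel"
    and le: "\<And>x. (\<integral>\<^sup>+ y. h (x, y) \<partial>lborel) \<le> c"
  shows "(\<integral>\<^sup>+ z. g (fst z) * h z \<partial>lborel) \<le> (\<integral>\<^sup>+ x. g x \<partial>lborel) * c"
proof -
  have "(\<integral>\<^sup>+ z. g (fst z) * h z \<partial>lborel) = (\<integral>\<^sup>+ x. \<integral>\<^sup>+ y. g x * h (x, y) \<partial>lborel \<partial>lborel)"
    by (subst nn_integral_pair(1)) auto
  also have "\<dots> = (\<integral>\<^sup>+ x. g x * (\<integral>\<^sup>+ y. h (x, y) \<partial>lborel) \<partial>lborel)"
  proof (intro nn_integral_cong nn_integral_cmult)
    fix x
    have "h \<in> borel_measurable (borel \<Otimes>\<^sub>M borel)" by (simp add: borel_prod)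
    then show "(\<lambda>y. h (x, y)) \<in> borel_measurable lborel" by simp
  qed
  also have "\<dots> \<le> (\<integral>\<^sup>+ x. g x * c \<partial>lborel)" by (intro nn_integral_mono mult_left_mono le) auto
  also have "\<dots> = (\<integral>\<^sup>+ x. g x \<partial>lborel) * c" by (intro nn_integral_multc) measurable
  finally show ?thesis .
qed

lemma nn_integral_swap:
  fixes h :: "(real ^ 'n) \<times> (real ^ 'n) \<Rightarrow> ennreal"
  assumes h: "h \<in> borel_measurable borel"
  shows "(\<integral>\<^sup>+ z. h (snd z, fst z) \<partial>lborel) = (\<integral>\<^sup>+ z. h z \<partial>lborel)"
proof -
  have [measurable]: "h \<in> borel_measurable (borel \<Otimes>\<^sub>M borel)" using h by (simp add: borel_prod)
  have "(\<lambda>z. h (snd z, fst z)) \<in> borel_measurable (borel \<Otimes>\<^sub>M borel)" by measurable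
  then have "(\<lambda>z. h (snd z, fst z)) \<in> borel_measurable borel" by (simp add: borel_prod)
  from nn_integral_pair(1)[OF this] nn_integral_pair(2)[OF h] show ?thesis by simp
qed

lemma weak_subD:
  assumes "weak_sub \<Omega> v F" "\<psi> \<in> borel_measurable borel" "\<And>x. 0 \<le> \<psi> x" "compact K" "K \<subseteq> \<Omega>"
    "\<And>x. x \<notin> K \<Longrightarrow> \<psi> x = 0" "energy \<psi> < \<infinity>"
  shows "ennreal (LINT z|lborel. flux v \<psi> z) \<le> (\<integral>\<^sup>+ x. ennreal (F x * \<psi> x) \<partial>lborel)"
  using assms unfolding weak_sub_def by blast

text \<open>Near the diagonal the kernel becomes integrable only with the factor |x - y|^p supplied
  by a Lipschitz cutoff; \<open>far_ker\<close> is integrable by itself. Both are symmetric, so a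
  bound in one variable serves for the other.\<close>

definition near_ker :: "real \<Rightarrow> (real ^ 'n) \<times> (real ^ 'n) \<Rightarrow> real" where
  "near_ker R z = indicator (ball (fst z) R) (snd z) * (norm (fst z - snd z) powr p * ker (fst z) (snd z))"

definition far_ker :: "real \<Rightarrow> (real ^ 'n) \<times> (real ^ 'n) \<Rightarrow> real" where
  "far_ker R z = indicator {y. R \<le> norm (fst z - y)} (snd z) * ker (fst z) (snd z)"

lemma near_ker_measurable [measurable]: "near_ker R \<in> borel_measurable borel"
proof -
  have "near_ker R = (\<lambda>z. if norm (fst z - snd z) < R then norm (fst z - snd z) powr p * ker (fst z) (snd z) else 0)"
    by (auto simp: near_ker_def fun_eq_iff dist_norm)
  then show ?thesis by simp
qed

lemma far_ker_measurable [measurable]: "far_ker R \<in> borel_measurable borel"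
proof -
  have "far_ker R = (\<lambda>z. if R \<le> norm (fst z - snd z) then ker (fst z) (snd z) else 0)"
    by (auto simp: far_ker_def fun_eq_iff)
  then show ?thesis by simp
qed

lemma near_ker_nonneg [simp]: "0 \<le> near_ker R z" and far_ker_nonneg [simp]: "0 \<le> far_ker R z"
  by (auto simp: near_ker_def far_ker_def)

lemma near_ker_integral: "0 < R \<Longrightarrow> (\<integral>\<^sup>+ y. ennreal (near_ker R (x, y)) \<partial>lborel) \<le> ennreal (near_const TYPE('n) (p - s * p) * R powr (p - s * p))"
  using ker_near_le[of R x] by (simp add: near_ker_def)

lemma far_ker_integral: "0 < R \<Longrightarrow> (\<integral>\<^sup>+ y. ennreal (far_ker R (x, y)) \<partial>lborel) \<le> ennreal (tail_const TYPE('n) (s * p) * R powr (- (s * p)))"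
  using ker_tail_le[of R x] by (simp add: far_ker_def)

lemma near_far_swap: "near_ker R (snd z, fst z) = near_ker R z" "far_ker R (snd z, fst z) = far_ker R z"
  by (auto simp: near_ker_def far_ker_def ker_sym norm_minus_commute dist_commute indicator_def)

lemma schur:
  fixes g :: "real ^ 'n \<Rightarrow> ennreal" and h :: "(real ^ 'n) \<times> (real ^ 'n) \<Rightarrow> real"
  assumes [measurable]: "g \<in> borel_measurable borel" "h \<in> borel_measurable borel"
    and sym: "\<And>z. h (snd z, fst z) = h z"
    and le: "\<And>x. (\<integral>\<^sup>+ y. ennreal (h (x, y)) \<partial>lborel) \<le> ennreal c"
  shows "(\<integral>\<^sup>+ z. g (fst z) * ennreal (h z) \<partial>lborel) \<le> (\<integral>\<^sup>+ x. g x \<partial>lborel) * ennreal c"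
    and "(\<integral>\<^sup>+ z. g (snd z) * ennreal (h z) \<partial>lborel) \<le> (\<integral>\<^sup>+ x. g x \<partial>lborel) * ennreal c"
proof -
  show a: "(\<integral>\<^sup>+ z. g (fst z) * ennreal (h z) \<partial>lborel) \<le> (\<integral>\<^sup>+ x. g x \<partial>lborel) * ennreal c"
    using le by (intro nn_integral_fst_le) auto
  have "(\<integral>\<^sup>+ z. g (snd z) * ennreal (h z) \<partial>lborel) = (\<integral>\<^sup>+ z. g (fst z) * ennreal (h z) \<partial>lborel)"
    using nn_integral_swap[of "\<lambda>z. g (fst z) * ennreal (h z)"] by (simp add: sym)
  then show "(\<integral>\<^sup>+ z. g (snd z) * ennreal (h z) \<partial>lborel) \<le> (\<integral>\<^sup>+ x. g x \<partial>lborel) * ennreal c" using a by simp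
qed

text \<open>For two points in the ball the product rule leaves the energy of w and |w|^p against the
  near kernel. If only one point is inside, the gap R - R' separates it from the other wherever
  \<theta> is nonzero, and the far kernel suffices. Used with the cutoff and with its p-th
  power.\<close>

lemma energy_mult_cutoff_finite:
  fixes w \<theta> :: "real ^ 'n \<Rightarrow> real"
  assumes w[measurable]: "w \<in> borel_measurable borel" and Ew: "energy w < \<infinity>"
    and Wp: "(\<integral>\<^sup>+ x. ennreal (\<bar>w x\<bar> powr p) * indicator (ball x0 R) x \<partial>lborel) < \<infinity>"
    and th[measurable]: "\<theta> \<in> borel_measurable borel" and th01: "\<And>x. 0 \<le> \<theta> x" "\<And>x. \<theta> x \<le> 1"
    and th0: "\<And>x. R' \<le> norm (x - x0) \<Longrightarrow> \<theta> x = 0" and R: "R' < R" "0 < R"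
    and lip: "\<And>x y. \<bar>\<theta> x - \<theta> y\<bar> \<le> L * norm (x - y)" and L: "0 \<le> L"
  shows "energy (\<lambda>x. w x * \<theta> x) < \<infinity>"
proof -
  define W where "W = (\<lambda>x. ennreal (\<bar>w x\<bar> powr p) * indicator (ball x0 R) x)"
  have [measurable]: "W \<in> borel_measurable borel" unfolding W_def by measurable
  define d where "d = R - R'"
  have d: "0 < d" using R by (simp add: d_def)
  let ?e = "\<lambda>z. ennreal (\<bar>w (fst z) - w (snd z)\<bar> powr p * ker (fst z) (snd z))"
  let ?n = "\<lambda>z. W (fst z) * ennreal (near_ker (2 * R) z)"
  let ?f = "\<lambda>z. W (fst z) * ennreal (far_ker d z)" and ?f' = "\<lambda>z. W (snd z) * ennreal (far_ker d z)"
  have pw: "ennreal (\<bar>w x * \<theta> x - w y * \<theta> y\<bar> powr p * ker x y)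
     \<le> ennreal (2 powr p) * (?e (x, y) + ennreal (L powr p) * ?n (x, y)) + (?f (x, y) + ?f' (x, y))" for x y
  proof -
    consider "x \<in> ball x0 R" "y \<in> ball x0 R" | "x \<in> ball x0 R" "y \<notin> ball x0 R" | "x \<notin> ball x0 R" "y \<in> ball x0 R" | "x \<notin> ball x0 R" "y \<notin> ball x0 R"
      by blast
    then show ?thesis
    proof cases
      case 1
      then have xy: "norm (x - y) < 2 * R"
        using norm_triangle_ineq4[of "x - x0" "y - x0"] by (simp add: dist_norm norm_minus_commute)
      have "w x * \<theta> x - w y * \<theta> y = (w x - w y) * \<theta> y + w x * (\<theta> x - \<theta> y)" by (simp add: algebra_simps)
      then have "\<bar>w x * \<theta> x - w y * \<theta> y\<bar> \<le> \<bar>w x - w y\<bar> * \<bar>\<theta> y\<bar> + \<bar>w x\<bar> * \<bar>\<theta> x - \<theta> y\<bar>"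
        by (metis abs_mult abs_triangle_ineq)
      also have "\<dots> \<le> \<bar>w x - w y\<bar> + \<bar>w x\<bar> * (L * norm (x - y))"
        using th01[of y] lip[of x y] by (intro add_mono mult_left_mono) (auto intro: mult_left_le)
      finally have "\<bar>w x * \<theta> x - w y * \<theta> y\<bar> powr p \<le> (\<bar>w x - w y\<bar> + \<bar>w x\<bar> * (L * norm (x - y))) powr p"
        using p0 by (intro powr_mono2) auto
      also have "\<dots> \<le> 2 powr p * (\<bar>w x - w y\<bar> powr p + (\<bar>w x\<bar> * (L * norm (x - y))) powr p)"
        using L p0 by (intro add_powr_le) auto
      also have "(\<bar>w x\<bar> * (L * norm (x - y))) powr p = L powr p * (\<bar>w x\<bar> powr p * norm (x - y) powr p)"
        using L by (simp add: powr_mult)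
      finally have "\<bar>w x * \<theta> x - w y * \<theta> y\<bar> powr p * ker x y
         \<le> 2 powr p * (\<bar>w x - w y\<bar> powr p + L powr p * (\<bar>w x\<bar> powr p * norm (x - y) powr p)) * ker x y"
        by (intro mult_right_mono) auto
      also have "\<dots> = 2 powr p * (\<bar>w x - w y\<bar> powr p * ker x y + L powr p * (\<bar>w x\<bar> powr p * near_ker (2 * R) (x, y)))"
        using xy by (simp add: near_ker_def dist_norm algebra_simps)
      finally have "ennreal (\<bar>w x * \<theta> x - w y * \<theta> y\<bar> powr p * ker x y)
        \<le> ennreal (2 powr p) * (?e (x, y) + ennreal (L powr p) * ?n (x, y))"
        using 1 by (simp add: W_def ennreal_mult[symmetric] ennreal_plus[symmetric] ennreal_leI del: ennreal_plus)
      then show ?thesis by (simp add: add_increasing2)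
    next
      case 2
      then have y0: "\<theta> y = 0" using R by (intro th0) (auto simp: dist_norm norm_minus_commute)
      have "ennreal (\<bar>w x * \<theta> x - w y * \<theta> y\<bar> powr p * ker x y) \<le> ?f (x, y)"
      proof (cases "\<theta> x = 0")
        case False
        then have "norm (x - x0) < R'" using th0[of x] by force
        then have "d \<le> norm (x - y)"
          using 2 norm_triangle_ineq[of "y - x" "x - x0"] by (simp add: d_def dist_norm norm_minus_commute)
        moreover have "(\<bar>w x\<bar> * \<theta> x) powr p \<le> \<bar>w x\<bar> powr p"
          using th01[of x] p0 by (intro powr_mono2) (auto intro: mult_left_le)
        ultimately show ?thesis
          using 2 th01[of x] by (simp add: y0 W_def far_ker_def ennreal_mult[symmetric] abs_mult ennreal_leI mult_right_mono)
      qed (simp add: y0)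
      then show ?thesis by (simp add: add_increasing add_increasing2)
    next
      case 3
      then have x0: "\<theta> x = 0" using R by (intro th0) (auto simp: dist_norm norm_minus_commute)
      have "ennreal (\<bar>w x * \<theta> x - w y * \<theta> y\<bar> powr p * ker x y) \<le> ?f' (x, y)"
      proof (cases "\<theta> y = 0")
        case False
        then have "norm (y - x0) < R'" using th0[of y] by force
        then have "d \<le> norm (x - y)"
          using 3 norm_triangle_ineq[of "x - y" "y - x0"] by (simp add: d_def dist_norm norm_minus_commute)
        moreover have "(\<bar>w y\<bar> * \<theta> y) powr p \<le> \<bar>w y\<bar> powr p"
          using th01[of y] p0 by (intro powr_mono2) (auto intro: mult_left_le)
        ultimately show ?thesis
          using 3 th01[of y] by (simp add: x0 W_def far_ker_def ennreal_mult[symmetric] abs_mult ennreal_leI mult_right_mono)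
      qed (simp add: x0)
      then show ?thesis by (simp add: add_increasing)
    next
      case 4
      then have "\<theta> x = 0" "\<theta> y = 0" using R by (auto intro!: th0 simp: dist_norm norm_minus_commute)
      then show ?thesis by simp
    qed
  qed
  have "energy (\<lambda>x. w x * \<theta> x) = (\<integral>\<^sup>+ z. ennreal (\<bar>w (fst z) * \<theta> (fst z) - w (snd z) * \<theta> (snd z)\<bar> powr p * ker (fst z) (snd z)) \<partial>lborel)"
    by (intro energy_pair) measurable
  also have "\<dots> \<le> (\<integral>\<^sup>+ z. ennreal (2 powr p) * (?e z + ennreal (L powr p) * ?n z) + (?f z + ?f' z) \<partial>lborel)"
    using pw by (intro nn_integral_mono) force
  also have "\<dots> = ennreal (2 powr p) * ((\<integral>\<^sup>+ z. ?e z \<partial>lborel) + ennreal (L powr p) * (\<integral>\<^sup>+ z. ?n z \<partial>lborel)) + ((\<integral>\<^sup>+ z. ?f z \<partial>lborel) + (\<integral>\<^sup>+ z. ?f' z \<partial>lborel))"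
    by (simp add: nn_integral_add nn_integral_cmult)
  also have "\<dots> < \<infinity>"
  proof -
    have "(\<integral>\<^sup>+ x. W x \<partial>lborel) < top" using Wp by (simp add: W_def)
    then have fin: "(\<integral>\<^sup>+ x. W x \<partial>lborel) * ennreal c < top" for c by (simp add: ennreal_mult_less_top)
    have "(\<integral>\<^sup>+ z. ?e z \<partial>lborel) < top" using Ew by (simp add: energy_pair)
    moreover have "(\<integral>\<^sup>+ z. ?n z \<partial>lborel) < top"
      by (rule le_less_trans[OF schur(1)[OF _ _ near_far_swap(1) near_ker_integral] fin]) (use R in auto)
    moreover have "(\<integral>\<^sup>+ z. ?f z \<partial>lborel) < top" "(\<integral>\<^sup>+ z. ?f' z \<partial>lborel) < top"
      by (rule le_less_trans[OF schur(1)[OF _ _ near_far_swap(2) far_ker_integral] fin]; use d in simp)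
         (rule le_less_trans[OF schur(2)[OF _ _ near_far_swap(2) far_ker_integral] fin]; use d in simp)
    ultimately show ?thesis by (simp add: ennreal_mult_less_top)
  qed
  finally show ?thesis .
qed

text \<open>The first summand belongs to near pairs: 2 for the two endpoints, 2^p from the slope 2 /
  (R - \<rho>) of the cutoff, and the near kernel at radius 2 R. The second belongs to the exterior,
  counted in both orientations.\<close>

definition caccioppoli_const :: real where
  "caccioppoli_const = cacc * (2 * 2 powr p * near_const TYPE('n) (p - s * p) * 2 powr (p - s * p) + 2 * 2 powr (N + p))"

lemma caccioppoli_const_ge: "2 * 2 powr p \<le> caccioppoli_const" "cacc \<le> caccioppoli_const" "0 < caccioppoli_const"
proof -
  have n: "0 < near_const TYPE('n) (p - s * p)" using psp_pos by (intro near_const_pos) auto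
  have "(1::real) \<le> 2 powr (N + p)" using p0 N0 by (intro ge_one_powr_ge_zero) auto
  then have "1 \<le> 2 * 2 powr p * near_const TYPE('n) (p - s * p) * 2 powr (p - s * p) + 2 * 2 powr (N + p)"
    using n by (intro add_increasing) auto
  then have "cacc * 1 \<le> caccioppoli_const"
    unfolding caccioppoli_const_def using cacc_ge by (intro mult_left_mono) auto
  then show "cacc \<le> caccioppoli_const" "2 * 2 powr p \<le> caccioppoli_const" "0 < caccioppoli_const"
    using cacc_ge by auto
qed

text \<open>The second term on the left survives from the nonlocality of the operator; it takes the place of
  the logarithmic estimate of the local theory.\<close>

theorem caccioppoli:
  fixes v F :: "real ^ 'n \<Rightarrow> real" and x0 :: "real ^ 'n" and k :: real
  assumes sub: "weak_sub \<Omega> v F" and R: "0 < \<rho>" "\<rho> < R" and dom: "cball x0 R \<subseteq> \<Omega>"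
  defines "w \<equiv> \<lambda>x. max (v x - k) 0" and "\<eta> \<equiv> cutoff x0 \<rho> R"
  assumes Wp: "(\<integral>\<^sup>+ x. ennreal (w x powr p) * indicator (ball x0 R) x \<partial>lborel) < \<infinity>"
  shows "energy (\<lambda>x. w x * \<eta> x)
       + (\<integral>\<^sup>+ x. \<integral>\<^sup>+ y. ennreal (max (k - v y) 0 powr (p - 1) * (w x * \<eta> x powr p) * ker x y) \<partial>lborel \<partial>lborel)
     \<le> ennreal (caccioppoli_const * (R / (R - \<rho>)) powr (N + p)) *
         (ennreal (R powr (- (s * p))) * (\<integral>\<^sup>+ x. ennreal (w x powr p) * indicator (ball x0 R) x \<partial>lborel)
          + (\<integral>\<^sup>+ y. ennreal (w y powr (p - 1) * ker x0 y) * indicator (- ball x0 R) y \<partial>lborel)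
            * (\<integral>\<^sup>+ x. ennreal (w x) * indicator (ball x0 R) x \<partial>lborel))
       + ennreal caccioppoli_const * (\<integral>\<^sup>+ x. ennreal (F x * (w x * \<eta> x powr p)) \<partial>lborel)"
proof -
  have v[measurable]: "v \<in> borel_measurable borel" and F[measurable]: "F \<in> borel_measurable borel"
    and Ev: "energy v < \<infinity>" using sub by (auto simp: weak_sub_def)
  have w[measurable]: "w \<in> borel_measurable borel" unfolding w_def by measurable
  have eta[measurable]: "\<eta> \<in> borel_measurable borel" unfolding \<eta>_def by measurable
  have w0: "0 \<le> w x" for x by (simp add: w_def)
  have eta01: "0 \<le> \<eta> x" "\<eta> x \<le> 1" for x by (auto simp: \<eta>_def cutoff_bounds)
  define R' where "R' = (\<rho> + R) / 2"
  have R': "R' < R" "0 < R" using R by (auto simp: R'_def)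
  have eta0: "\<eta> x = 0" if "R' \<le> norm (x - x0)" for x using that R by (auto simp: \<eta>_def R'_def intro: cutoff_zero)
  have eta0': "\<eta> x = 0" if "x \<notin> ball x0 R" for x
    using that R' by (intro eta0) (auto simp: dist_norm norm_minus_commute)
  define L where "L = 2 / (R - \<rho>)"
  have L: "0 < L" using R by (simp add: L_def)
  have lip: "\<bar>\<eta> x - \<eta> y\<bar> \<le> L * norm (x - y)" for x y unfolding \<eta>_def L_def by (rule cutoff_lipschitz[OF R(2)])
  \<comment> \<open>The test function carries the p-th power of the cutoff, so its finite energy
    needs this power to be Lipschitz.\<close>
  have lip_p: "\<bar>\<eta> x powr p - \<eta> y powr p\<bar> \<le> (p * L) * norm (x - y)" for x y
  proof -
    have *: "a powr p - b powr p \<le> p * (a - b)" if "0 \<le> b" "b \<le> a" "a \<le> 1" for a b :: real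
    proof -
      have "a powr p - b powr p \<le> p * a powr (p - 1) * (a - b)" using that by (intro powr_diff_le) auto
      also have "\<dots> \<le> p * 1 * (a - b)" using that p1 by (intro mult_right_mono mult_left_mono powr_le1) auto
      finally show ?thesis by simp
    qed
    have "\<bar>\<eta> x powr p - \<eta> y powr p\<bar> \<le> p * \<bar>\<eta> x - \<eta> y\<bar>"
    proof (cases "\<eta> y \<le> \<eta> x")
      case True
      then have "\<eta> y powr p \<le> \<eta> x powr p" using eta01 p0 by (intro powr_mono2) auto
      then show ?thesis using *[of "\<eta> y" "\<eta> x"] True eta01 by auto
    next
      case False
      then have "\<eta> x powr p \<le> \<eta> y powr p" using eta01 p0 by (intro powr_mono2) auto
      then show ?thesis using *[of "\<eta> x" "\<eta> y"] False eta01 by auto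
    qed
    also have "\<dots> \<le> p * (L * norm (x - y))" using lip p0 by (intro mult_left_mono) auto
    finally show ?thesis by (simp add: mult.assoc)
  qed
  \<comment> \<open>With the weight \<eta>^p, and not \<eta>, the flux controls the p-th power of
    the increments of w \<eta>.\<close>
  define \<psi> where "\<psi> = (\<lambda>x. w x * \<eta> x powr p)"
  have psi[measurable]: "\<psi> \<in> borel_measurable borel" unfolding \<psi>_def by measurable
  have "energy w \<le> energy v" by (rule energy_mono) (auto simp: w_def)
  then have Ew: "energy w < \<infinity>" using Ev by auto
  have Wp': "(\<integral>\<^sup>+ x. ennreal (\<bar>w x\<bar> powr p) * indicator (ball x0 R) x \<partial>lborel) < \<infinity>" using Wp w0 by simp
  have Epsi: "energy \<psi> < \<infinity>"
    unfolding \<psi>_def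
    by (rule energy_mult_cutoff_finite[OF w Ew Wp' _ _ _ _ R' lip_p])
       (use eta01 eta0 L p0 in \<open>auto intro: powr_le1\<close>)
  have psi0: "\<psi> x = 0" if "x \<notin> cball x0 R" for x using that eta0'[of x] p0 by (auto simp: \<psi>_def)
  have weak: "ennreal (LINT z|lborel. flux v \<psi> z) \<le> (\<integral>\<^sup>+ x. ennreal (F x * \<psi> x) \<partial>lborel)"
  proof (rule weak_subD[OF sub psi _ compact_cball dom])
    show "0 \<le> \<psi> x" for x using w0 by (simp add: \<psi>_def)
  qed (use psi0 Epsi in auto)
  \<comment> \<open>Of the two mirror-image cross terms only one is kept.\<close>
  define P where "P = (\<lambda>z. \<bar>w (fst z) * \<eta> (fst z) - w (snd z) * \<eta> (snd z)\<bar> powr p * ker (fst z) (snd z)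
     + max (k - v (snd z)) 0 powr (p - 1) * (w (fst z) * \<eta> (fst z) powr p) * ker (fst z) (snd z))"
  define Gn where "Gn = (\<lambda>z. (w (fst z) powr p * indicator (ball x0 R) (fst z) + w (snd z) powr p * indicator (ball x0 R) (snd z)) * (L powr p * near_ker (2 * R) z))"
  define Gf where "Gf = (\<lambda>z. w (snd z) powr (p - 1) * \<psi> (fst z) * ker (fst z) (snd z) * indicator (- ball x0 R) (snd z))"
  have [measurable]: "Gn \<in> borel_measurable borel" unfolding Gn_def by measurable
  have [measurable]: "Gf \<in> borel_measurable borel" unfolding Gf_def by measurable
  have Gf_swap[measurable]: "(\<lambda>z. Gf (snd z, fst z)) \<in> borel_measurable borel" unfolding Gf_def fst_conv snd_conv by measurable
  have [measurable]: "P \<in> borel_measurable borel" unfolding P_def by measurable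
  define g where "g = (\<lambda>z. cacc * (Gn z + (Gf z + Gf (snd z, fst z))))"
  have [measurable]: "g \<in> borel_measurable borel" unfolding g_def by measurable
  have Gn0: "0 \<le> Gn z" for z unfolding Gn_def by (intro mult_nonneg_nonneg add_nonneg_nonneg) auto
  have Gf0: "0 \<le> Gf z" for z unfolding Gf_def \<psi>_def by (intro mult_nonneg_nonneg) (auto simp: w0)
  have flux_jump: "flux v \<psi> (x, y) = jump (v x) (v y) (w x * \<eta> x powr p) (w y * \<eta> y powr p) * ker x y" for x y
    by (simp add: flux_def jump_def \<psi>_def)
  have pw: "P z \<le> 2 * 2 powr p * flux v \<psi> z + g z" for z
  proof -
    obtain x y where z: "z = (x, y)" by (cases z)
    let ?J = "jump (v x) (v y) (w x * \<eta> x powr p) (w y * \<eta> y powr p)"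
    \<comment> \<open>In the last two cases one of the cutoff values is 0 and
      \<open>coercive_far\<close> applies; their overlap does no harm, since \<open>Gn\<close> and
      \<open>Gf\<close> are nonnegative.\<close>
    consider (nn) "x \<in> ball x0 R" "y \<in> ball x0 R" | (nf) "y \<notin> ball x0 R" | (fn) "x \<notin> ball x0 R"
      by blast
    then have "\<exists>G\<ge>0. \<bar>w x * \<eta> x - w y * \<eta> y\<bar> powr p + max (k - v y) 0 powr (p - 1) * (w x * \<eta> x powr p) \<le> 2 * 2 powr p * ?J + cacc * G
        \<and> G * ker x y \<le> Gn z + (Gf z + Gf (snd z, fst z))"
    proof cases
      case nn
      define G where "G = max (w x) (w y) powr p * \<bar>\<eta> x - \<eta> y\<bar> powr p"
      have xy: "norm (x - y) < 2 * R"
        using nn norm_triangle_ineq4[of "x - x0" "y - x0"] by (simp add: dist_norm norm_minus_commute)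
      have "\<bar>w x * \<eta> x - w y * \<eta> y\<bar> powr p + max (k - v y) 0 powr (p - 1) * (w x * \<eta> x powr p)
         + max (k - v x) 0 powr (p - 1) * (w y * \<eta> y powr p) \<le> 2 * 2 powr p * ?J + cacc * G"
        unfolding w_def G_def by (rule coercive_near[OF eta01(1) eta01(1)])
      moreover have "0 \<le> max (k - v x) 0 powr (p - 1) * (w y * \<eta> y powr p)" by (simp add: w0)
      ultimately have 1: "\<bar>w x * \<eta> x - w y * \<eta> y\<bar> powr p + max (k - v y) 0 powr (p - 1) * (w x * \<eta> x powr p) \<le> 2 * 2 powr p * ?J + cacc * G"
        by linarith
      have "\<bar>\<eta> x - \<eta> y\<bar> powr p \<le> (L * norm (x - y)) powr p" using lip p0 by (intro powr_mono2) auto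
      also have "\<dots> = L powr p * norm (x - y) powr p" using L by (simp add: powr_mult)
      finally have "G \<le> (w x powr p + w y powr p) * (L powr p * norm (x - y) powr p)"
        unfolding G_def by (intro mult_mono) (auto simp: max_def)
      then have "G * ker x y \<le> (w x powr p + w y powr p) * (L powr p * norm (x - y) powr p) * ker x y"
        by (intro mult_right_mono) auto
      also have "\<dots> = Gn z" using xy nn by (simp add: Gn_def z near_ker_def dist_norm mult.assoc)
      also have "\<dots> \<le> Gn z + (Gf z + Gf (snd z, fst z))" using Gf0 by (intro add_increasing2 add_nonneg_nonneg) auto
      finally have 2: "G * ker x y \<le> Gn z + (Gf z + Gf (snd z, fst z))" .
      show ?thesis using 1 2 by (intro exI[of _ G]) (auto simp: G_def)
    next
      case nf
      have y0: "\<eta> y = 0" by (rule eta0'[OF nf])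
      define G where "G = w y powr (p - 1) * (w x * \<eta> x powr p)"
      have 1: "\<bar>w x * \<eta> x - w y * \<eta> y\<bar> powr p + max (k - v y) 0 powr (p - 1) * (w x * \<eta> x powr p) \<le> 2 * 2 powr p * ?J + cacc * G"
        using coercive_far[OF eta01(1), of "v x" k x "v y"] p0 by (simp add: G_def w_def y0)
      have "G * ker x y = Gf z" using nf by (simp add: G_def Gf_def z \<psi>_def)
      also have "\<dots> \<le> Gn z + (Gf z + Gf (snd z, fst z))" using Gf0[of "(snd z, fst z)"] Gn0[of z] by simp
      finally have 2: "G * ker x y \<le> Gn z + (Gf z + Gf (snd z, fst z))" .
      show ?thesis using 1 2 w0 by (intro exI[of _ G]) (auto simp: G_def)
    next
      case fn
      have x0: "\<eta> x = 0" by (rule eta0'[OF fn])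
      define G where "G = w x powr (p - 1) * (w y * \<eta> y powr p)"
      have "\<bar>w y * \<eta> y\<bar> powr p + max (k - v x) 0 powr (p - 1) * (w y * \<eta> y powr p) \<le> 2 * 2 powr p * jump (v y) (v x) (w y * \<eta> y powr p) 0 + cacc * G"
        using coercive_far[OF eta01(1), of "v y" k y "v x"] by (simp add: G_def w_def)
      moreover have "0 \<le> max (k - v x) 0 powr (p - 1) * (w y * \<eta> y powr p)" by (simp add: w0)
      ultimately have 1: "\<bar>w x * \<eta> x - w y * \<eta> y\<bar> powr p + max (k - v y) 0 powr (p - 1) * (w x * \<eta> x powr p) \<le> 2 * 2 powr p * ?J + cacc * G"
        using p0 jump_sym[of "v x" "v y" 0] by (simp add: x0)
      have "G * ker x y = Gf (snd z, fst z)" using fn by (simp add: G_def Gf_def z \<psi>_def ker_sym)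
      also have "\<dots> \<le> Gn z + (Gf z + Gf (snd z, fst z))" using Gf0[of z] Gn0[of z] by simp
      finally have 2: "G * ker x y \<le> Gn z + (Gf z + Gf (snd z, fst z))" .
      show ?thesis using 1 2 w0 by (intro exI[of _ G]) (auto simp: G_def)
    qed
    then obtain G where G: "\<bar>w x * \<eta> x - w y * \<eta> y\<bar> powr p + max (k - v y) 0 powr (p - 1) * (w x * \<eta> x powr p) \<le> 2 * 2 powr p * ?J + cacc * G"
        "G * ker x y \<le> Gn z + (Gf z + Gf (snd z, fst z))" by blast
    have "P z = (\<bar>w x * \<eta> x - w y * \<eta> y\<bar> powr p + max (k - v y) 0 powr (p - 1) * (w x * \<eta> x powr p)) * ker x y"
      by (simp add: P_def z distrib_right)
    also have "\<dots> \<le> (2 * 2 powr p * ?J + cacc * G) * ker x y" using G(1) by (rule mult_right_mono) simp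
    also have "\<dots> = 2 * 2 powr p * flux v \<psi> z + cacc * (G * ker x y)" by (simp add: z flux_jump algebra_simps)
    also have "\<dots> \<le> 2 * 2 powr p * flux v \<psi> z + g z"
      unfolding g_def using G(2) cacc_ge(3) by (intro add_left_mono mult_left_mono) auto
    finally show ?thesis .
  qed
  have P0: "0 \<le> P z" for z unfolding P_def by (intro add_nonneg_nonneg mult_nonneg_nonneg) (auto simp: w0)
  have g0: "0 \<le> g z" for z unfolding g_def using Gf0 Gn0 cacc_ge(3) by (intro mult_nonneg_nonneg add_nonneg_nonneg) auto
  let ?Wp = "\<integral>\<^sup>+ x. ennreal (w x powr p) * indicator (ball x0 R) x \<partial>lborel"
  let ?T = "\<integral>\<^sup>+ y. ennreal (w y powr (p - 1) * ker x0 y) * indicator (- ball x0 R) y \<partial>lborel"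
  let ?W1 = "\<integral>\<^sup>+ x. ennreal (w x) * indicator (ball x0 R) x \<partial>lborel"
  let ?X = "\<integral>\<^sup>+ x. ennreal (F x * \<psi> x) \<partial>lborel"
  define q where "q = R / (R - \<rho>)"
  have q1: "1 \<le> q" using R by (simp add: q_def)
  let ?nc = "near_const TYPE('n) (p - s * p)"
  have nc: "0 < ?nc" using psp_pos by (intro near_const_pos) auto
  have main: "(\<integral>\<^sup>+ z. ennreal (P z) \<partial>lborel) \<le> ennreal (2 * 2 powr p) * ?X + (\<integral>\<^sup>+ z. ennreal (g z) \<partial>lborel)"
  proof -
    have fi: "integrable lborel (flux v \<psi>)" by (rule flux_integrable[OF v psi Ev Epsi])
    have "(\<integral>\<^sup>+ z. ennreal (P z) \<partial>lborel) \<le> ennreal (LINT z|lborel. 2 * 2 powr p * flux v \<psi> z) + (\<integral>\<^sup>+ z. ennreal (g z) \<partial>lborel)"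
      using pw P0 g0 fi by (intro nn_integral_le_of_signed) auto
    also have "(LINT z|lborel. 2 * 2 powr p * flux v \<psi> z) = 2 * 2 powr p * (LINT z|lborel. flux v \<psi> z)" using fi by simp
    also have "ennreal \<dots> = ennreal (2 * 2 powr p) * ennreal (LINT z|lborel. flux v \<psi> z)" by (rule ennreal_mult') simp
    also have "\<dots> \<le> ennreal (2 * 2 powr p) * ?X" by (intro mult_left_mono weak) simp
    finally show ?thesis by simp
  qed
  have near: "(\<integral>\<^sup>+ z. ennreal (Gn z) \<partial>lborel) \<le> ennreal (2 * 2 powr p * ?nc * 2 powr (p - s * p) * q powr p) * (ennreal (R powr (- (s * p))) * ?Wp)"
  proof -
    let ?W = "\<lambda>x. ennreal (L powr p) * (ennreal (w x powr p) * indicator (ball x0 R) x)"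
    have "(\<integral>\<^sup>+ z. ennreal (Gn z) \<partial>lborel) = (\<integral>\<^sup>+ z. ?W (fst z) * ennreal (near_ker (2 * R) z) + ?W (snd z) * ennreal (near_ker (2 * R) z) \<partial>lborel)"
      by (intro nn_integral_cong) (auto simp: Gn_def indicator_def ennreal_mult[symmetric] ennreal_plus[symmetric] algebra_simps simp del: ennreal_plus)
    also have "\<dots> = (\<integral>\<^sup>+ z. ?W (fst z) * ennreal (near_ker (2 * R) z) \<partial>lborel) + (\<integral>\<^sup>+ z. ?W (snd z) * ennreal (near_ker (2 * R) z) \<partial>lborel)"
      by (intro nn_integral_add) measurable
    also have "\<dots> \<le> (\<integral>\<^sup>+ x. ?W x \<partial>lborel) * ennreal (?nc * (2 * R) powr (p - s * p)) + (\<integral>\<^sup>+ x. ?W x \<partial>lborel) * ennreal (?nc * (2 * R) powr (p - s * p))"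
      using R' by (intro add_mono schur near_far_swap near_ker_integral) auto
    also have "(\<integral>\<^sup>+ x. ?W x \<partial>lborel) = ennreal (L powr p) * ?Wp" by (intro nn_integral_cmult) measurable
    also have "ennreal (L powr p) * ?Wp * ennreal (?nc * (2 * R) powr (p - s * p)) + ennreal (L powr p) * ?Wp * ennreal (?nc * (2 * R) powr (p - s * p))
       = (ennreal (L powr p) * ennreal (?nc * (2 * R) powr (p - s * p)) + ennreal (L powr p) * ennreal (?nc * (2 * R) powr (p - s * p))) * ?Wp"
      by (simp only: distrib_right distrib_left mult_ac)
    also have "ennreal (L powr p) * ennreal (?nc * (2 * R) powr (p - s * p)) + ennreal (L powr p) * ennreal (?nc * (2 * R) powr (p - s * p))
       = ennreal (2 * (L powr p * (?nc * (2 * R) powr (p - s * p))))"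
      using nc by (simp add: ennreal_mult[symmetric] ennreal_plus[symmetric] del: ennreal_plus)
    also have "2 * (L powr p * (?nc * (2 * R) powr (p - s * p))) = 2 * 2 powr p * ?nc * 2 powr (p - s * p) * q powr p * R powr (- (s * p))"
    proof -
      have "L powr p = 2 powr p * (1 / (R - \<rho>)) powr p" using R by (simp add: L_def powr_divide)
      moreover have "q powr p = R powr p * (1 / (R - \<rho>)) powr p" using R by (simp add: q_def powr_divide)
      moreover have "(2 * R) powr (p - s * p) = 2 powr (p - s * p) * (R powr p * R powr (- (s * p)))"
        using R by (simp add: powr_mult powr_add[symmetric])
      ultimately show ?thesis by (simp add: mult_ac)
    qed
    also have "ennreal (2 * 2 powr p * ?nc * 2 powr (p - s * p) * q powr p * R powr (- (s * p)))
       = ennreal (2 * 2 powr p * ?nc * 2 powr (p - s * p) * q powr p) * ennreal (R powr (- (s * p)))"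
      using nc by (intro ennreal_mult) auto
    finally show ?thesis by (simp add: mult.assoc)
  qed
  have far: "(\<integral>\<^sup>+ z. ennreal (Gf z) \<partial>lborel) \<le> ennreal ((2 * q) powr (N + s * p)) * (?T * ?W1)"
  proof -
    \<comment> \<open>As x stays within the midpoint radius R', |x - y| \<ge> |y - x0| - R' \<ge> (1
      - R'/R) |y - x0|, and 1 - R'/R = 1 / (2 q). This recentres the tail at x0.\<close>
    have kk: "ker x y \<le> (2 * q) powr (N + s * p) * ker x0 y" if "norm (x - x0) < R'" "y \<notin> ball x0 R" for x y
    proof -
      have ny: "R \<le> norm (y - x0)" using that by (simp add: dist_norm norm_minus_commute)
      have "norm (y - x0) / (2 * q) = norm (y - x0) * ((R - R') / R)"
        using R by (simp add: q_def R'_def field_simps)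
      also have "\<dots> = norm (y - x0) - R' * (norm (y - x0) / R)" using R by (simp add: field_simps)
      also have "\<dots> \<le> norm (y - x0) - R' * 1" using ny R by (intro diff_left_mono mult_left_mono) (auto simp: R'_def)
      also have "\<dots> \<le> norm (x - y)"
        using that norm_triangle_ineq[of "y - x" "x - x0"] by (simp add: norm_minus_commute)
      finally have le: "norm (x0 - y) / (2 * q) \<le> norm (x - y)" by (simp add: norm_minus_commute)
      have "0 < norm (x0 - y)" unfolding norm_minus_commute[of x0 y] using ny R' by linarith
      then have pos: "0 < norm (x0 - y) / (2 * q)" using q1 by (intro divide_pos_pos) auto
      have "ker x y \<le> (norm (x0 - y) / (2 * q)) powr (- (N + s * p))"
        unfolding ker_def using pos le N0 sp0 by (intro powr_minus_mono) auto
      also have "\<dots> = (2 * q) powr (N + s * p) * ker x0 y"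
      proof -
        have key: "(a / b) powr (- c) = b powr c * a powr (- c)" if "0 < b" "0 \<le> a" for a b c :: real
          using that by (simp add: powr_divide powr_minus flip: divide_inverse)
        show ?thesis unfolding ker_def by (rule key) (use q1 in auto)
      qed
      finally show ?thesis .
    qed
    have "(\<integral>\<^sup>+ z. ennreal (Gf z) \<partial>lborel) = (\<integral>\<^sup>+ x. \<integral>\<^sup>+ y. ennreal (Gf (x, y)) \<partial>lborel \<partial>lborel)"
      by (rule nn_integral_pair(1)) measurable
    also have "\<dots> \<le> (\<integral>\<^sup>+ x. (\<integral>\<^sup>+ y. (ennreal ((2 * q) powr (N + s * p)) * (ennreal (w x) * indicator (ball x0 R) x)) *
        (ennreal (w y powr (p - 1) * ker x0 y) * indicator (- ball x0 R) y) \<partial>lborel) \<partial>lborel)"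
    proof (intro nn_integral_mono)
      fix x y
      show "ennreal (Gf (x, y)) \<le> (ennreal ((2 * q) powr (N + s * p)) * (ennreal (w x) * indicator (ball x0 R) x)) *
        (ennreal (w y powr (p - 1) * ker x0 y) * indicator (- ball x0 R) y)"
      proof (cases "\<eta> x = 0 \<or> y \<in> ball x0 R")
        case True
        then show ?thesis using p0 by (auto simp: Gf_def \<psi>_def)
      next
        case False
        then have nx: "norm (x - x0) < R'" and y: "y \<notin> ball x0 R" using eta0[of x] by force+
        then have xb: "x \<in> ball x0 R" using R' by (simp add: dist_norm norm_minus_commute)
        have "\<psi> x \<le> w x * 1" unfolding \<psi>_def using eta01 w0 p0 by (intro mult_left_mono powr_le1) auto
        then have "w y powr (p - 1) * \<psi> x * ker x y \<le> w y powr (p - 1) * w x * ((2 * q) powr (N + s * p) * ker x0 y)"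
          using kk[OF nx y] w0 by (intro mult_mono mult_left_mono) (auto simp: \<psi>_def)
        then have "Gf (x, y) \<le> ((2 * q) powr (N + s * p) * w x) * (w y powr (p - 1) * ker x0 y)"
          using y by (simp add: Gf_def mult_ac)
        then show ?thesis using xb y w0 by (simp add: ennreal_mult[symmetric] ennreal_leI)
      qed
    qed
    also have "\<dots> = (\<integral>\<^sup>+ x. (ennreal ((2 * q) powr (N + s * p)) * (ennreal (w x) * indicator (ball x0 R) x)) * ?T \<partial>lborel)"
      by (intro nn_integral_cong nn_integral_cmult) measurable
    also have "\<dots> = ennreal ((2 * q) powr (N + s * p)) * ?W1 * ?T"
      by (subst nn_integral_multc, measurable, subst nn_integral_cmult, measurable)
    finally show ?thesis by (simp add: mult_ac)
  qed
  have gint: "(\<integral>\<^sup>+ z. ennreal (g z) \<partial>lborel) \<le> ennreal (caccioppoli_const * q powr (N + p)) * (ennreal (R powr (- (s * p))) * ?Wp + ?T * ?W1)"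
  proof -
    let ?c1 = "2 * 2 powr p * ?nc * 2 powr (p - s * p)" and ?c2 = "2 * 2 powr (N + p)"
    have c12: "0 \<le> ?c1" "0 \<le> ?c2" using nc by auto
    have "(\<integral>\<^sup>+ z. ennreal (g z) \<partial>lborel) = (\<integral>\<^sup>+ z. ennreal cacc * (ennreal (Gn z) + (ennreal (Gf z) + ennreal (Gf (snd z, fst z)))) \<partial>lborel)"
      using Gn0 Gf0 cacc_ge(3) by (intro nn_integral_cong) (simp add: g_def ennreal_mult ennreal_plus)
    also have "\<dots> = ennreal cacc * ((\<integral>\<^sup>+ z. ennreal (Gn z) \<partial>lborel) + ((\<integral>\<^sup>+ z. ennreal (Gf z) \<partial>lborel) + (\<integral>\<^sup>+ z. ennreal (Gf (snd z, fst z)) \<partial>lborel)))"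
      by (simp add: nn_integral_add nn_integral_cmult)
    also have "(\<integral>\<^sup>+ z. ennreal (Gf (snd z, fst z)) \<partial>lborel) = (\<integral>\<^sup>+ z. ennreal (Gf z) \<partial>lborel)"
      by (rule nn_integral_swap) measurable
    also have "ennreal cacc * ((\<integral>\<^sup>+ z. ennreal (Gn z) \<partial>lborel) + ((\<integral>\<^sup>+ z. ennreal (Gf z) \<partial>lborel) + (\<integral>\<^sup>+ z. ennreal (Gf z) \<partial>lborel)))
       \<le> ennreal cacc * (ennreal (?c1 * q powr (N + p)) * (ennreal (R powr (- (s * p))) * ?Wp) + ennreal (?c2 * q powr (N + p)) * (?T * ?W1))"
    proof (intro mult_left_mono add_mono)
      have "q powr p \<le> q powr (N + p)" using q1 N0 by (intro powr_mono) auto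
      then have "ennreal (?c1 * q powr p) \<le> ennreal (?c1 * q powr (N + p))" using c12 by (intro ennreal_leI mult_left_mono)
      then show "(\<integral>\<^sup>+ z. ennreal (Gn z) \<partial>lborel) \<le> ennreal (?c1 * q powr (N + p)) * (ennreal (R powr (- (s * p))) * ?Wp)"
        by (intro order_trans[OF near] mult_right_mono) auto
      \<comment> \<open>Since s p \<le> p, the near and the far part can share the power N + p of R
        / (R - \<rho>).\<close>
      have "(2 * q) powr (N + s * p) \<le> (2 * q) powr (N + p)" using q1 psp_pos by (intro powr_mono) auto
      then have "2 * (2 * q) powr (N + s * p) \<le> ?c2 * q powr (N + p)" using q1 by (simp add: powr_mult)
      then have le: "ennreal (2 * (2 * q) powr (N + s * p)) \<le> ennreal (?c2 * q powr (N + p))" by (rule ennreal_leI)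
      have "(\<integral>\<^sup>+ z. ennreal (Gf z) \<partial>lborel) + (\<integral>\<^sup>+ z. ennreal (Gf z) \<partial>lborel)
          \<le> ennreal ((2 * q) powr (N + s * p)) * (?T * ?W1) + ennreal ((2 * q) powr (N + s * p)) * (?T * ?W1)"
        by (intro add_mono far)
      also have "\<dots> = ennreal (2 * (2 * q) powr (N + s * p)) * (?T * ?W1)"
        by (simp add: distrib_right[symmetric] ennreal_plus[symmetric] del: ennreal_plus)
      also have "\<dots> \<le> ennreal (?c2 * q powr (N + p)) * (?T * ?W1)" using le by (intro mult_right_mono) auto
      finally show "(\<integral>\<^sup>+ z. ennreal (Gf z) \<partial>lborel) + (\<integral>\<^sup>+ z. ennreal (Gf z) \<partial>lborel) \<le> ennreal (?c2 * q powr (N + p)) * (?T * ?W1)" .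
    qed simp
    also have "\<dots> \<le> ennreal cacc * (ennreal ((?c1 + ?c2) * q powr (N + p)) * (ennreal (R powr (- (s * p))) * ?Wp) + ennreal ((?c1 + ?c2) * q powr (N + p)) * (?T * ?W1))"
      using c12 by (intro mult_left_mono add_mono mult_right_mono ennreal_leI) auto
    also have "\<dots> = ennreal (caccioppoli_const * q powr (N + p)) * (ennreal (R powr (- (s * p))) * ?Wp + ?T * ?W1)"
    proof -
      have "caccioppoli_const * q powr (N + p) = cacc * ((?c1 + ?c2) * q powr (N + p))"
        by (simp only: caccioppoli_const_def mult.assoc)
      then have "ennreal (caccioppoli_const * q powr (N + p)) = ennreal cacc * ennreal ((?c1 + ?c2) * q powr (N + p))"
        using c12 cacc_ge(3) by (simp only: ennreal_mult' less_imp_le)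
      then show ?thesis by (simp only: distrib_left mult.assoc)
    qed
    finally show ?thesis .
  qed
  have "energy (\<lambda>x. w x * \<eta> x)
       + (\<integral>\<^sup>+ x. \<integral>\<^sup>+ y. ennreal (max (k - v y) 0 powr (p - 1) * (w x * \<eta> x powr p) * ker x y) \<partial>lborel \<partial>lborel) = (\<integral>\<^sup>+ z. ennreal (P z) \<partial>lborel)"
  proof -
    have "(\<integral>\<^sup>+ z. ennreal (P z) \<partial>lborel) = (\<integral>\<^sup>+ z. ennreal (\<bar>w (fst z) * \<eta> (fst z) - w (snd z) * \<eta> (snd z)\<bar> powr p * ker (fst z) (snd z)) \<partial>lborel)
       + (\<integral>\<^sup>+ z. ennreal (max (k - v (snd z)) 0 powr (p - 1) * (w (fst z) * \<eta> (fst z) powr p) * ker (fst z) (snd z)) \<partial>lborel)"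
      unfolding P_def by (subst nn_integral_add[symmetric]) (auto simp: w0)
    also have "(\<integral>\<^sup>+ z. ennreal (max (k - v (snd z)) 0 powr (p - 1) * (w (fst z) * \<eta> (fst z) powr p) * ker (fst z) (snd z)) \<partial>lborel)
       = (\<integral>\<^sup>+ x. \<integral>\<^sup>+ y. ennreal (max (k - v y) 0 powr (p - 1) * (w x * \<eta> x powr p) * ker x y) \<partial>lborel \<partial>lborel)"
      by (subst nn_integral_pair(1)) auto
    finally show ?thesis by (simp add: energy_pair)
  qed
  also have "\<dots> \<le> ennreal (2 * 2 powr p) * ?X + ennreal (caccioppoli_const * q powr (N + p)) * (ennreal (R powr (- (s * p))) * ?Wp + ?T * ?W1)"
    using main gint by (meson add_left_mono order_trans)
  also have "\<dots> \<le> ennreal caccioppoli_const * ?X + ennreal (caccioppoli_const * q powr (N + p)) * (ennreal (R powr (- (s * p))) * ?Wp + ?T * ?W1)"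
    using caccioppoli_const_ge(1) by (intro add_right_mono mult_right_mono ennreal_leI) auto
  finally show ?thesis by (simp add: q_def \<psi>_def add.commute)
qed

end

subsection \<open>De Giorgi iteration\<close>

context fractional
begin

abbreviation \<beta> :: real where "\<beta> \<equiv> s * p / N"

lemma beta_pos: "0 < \<beta>"
  using sp0 N0 by simp

text \<open>Growth of the constants per step: powers of 2^j with exponent N + p from the shrinking
  gap between radii, p - 1 from bounding w by a p-th power, and p \<beta> from the measure of a
  level set. \<open>dg_ratio\<close> is the decay rate whose \<beta>-th power cancels this
  growth.\<close>

definition dg_base :: real where "dg_base = 2 powr (N + p + (p - 1) + p * \<beta>)"

definition dg_ratio :: real where "dg_ratio = dg_base powr (- 1 / \<beta>)"

definition dg_const :: "real \<Rightarrow> real" where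
  "dg_const C = level_const * 2 powr (p * \<beta>) * C * 4 powr (N + p) * 2 * 2 powr (p - 1)"

text \<open>The threshold for which its \<beta>-th power times \<open>dg_const C * K\<close> is
  \<open>dg_ratio\<close>. The explicit power of K matters: in the critical upper bound K depends on
  the level.\<close>

definition dg_small :: "real \<Rightarrow> real \<Rightarrow> real" where
  "dg_small C K = (dg_ratio / (dg_const C * K)) powr (1 / \<beta>)"

lemma dg_ratio: "0 < dg_ratio" "dg_ratio < 1" "dg_ratio powr \<beta> = 1 / dg_base"
proof -
  have "0 < p * \<beta>" using p0 beta_pos by (rule mult_pos_pos)
  then have "2 powr 0 < dg_base" unfolding dg_base_def using N0 p1 by (intro powr_less_mono) linarith+
  then have b: "1 < dg_base" by simp
  then show "0 < dg_ratio" by (simp add: dg_ratio_def)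
  have "- (1 / \<beta>) < 0" by (simp only: neg_less_0_iff_less zero_less_divide_1_iff beta_pos)
  then have "dg_base powr (- (1 / \<beta>)) < dg_base powr 0" using b by (rule powr_less_mono)
  then show "dg_ratio < 1" using b by (simp add: dg_ratio_def)
  show "dg_ratio powr \<beta> = 1 / dg_base"
  proof -
    have gen: "- 1 / c * c = - 1" if "0 < c" for c :: real using that by simp
    show ?thesis using b by (simp only: dg_ratio_def powr_powr gen[OF beta_pos]) (simp add: powr_minus_divide)
  qed
qed

lemma dg_const_pos: "0 < C \<Longrightarrow> 0 < dg_const C"
  by (simp add: dg_const_def level_const_pos)

lemma dg_small_pos: "0 < C \<Longrightarrow> 0 < K \<Longrightarrow> 0 < dg_small C K"
  using dg_const_pos[of C] dg_ratio(1) by (auto simp: dg_small_def)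

text \<open>An equality, since everything cancels: Y^\<beta> supplies r^(s p) against r^(-s p) and
  h^(p \<beta>) against h^(-p \<beta>), and the powers of 2^j meet those of \<open>dg_ratio\<close>.
  So the prescribed geometric decay reproduces itself exactly.\<close>

lemma de_giorgi_step_numeric:
  fixes C K h r :: real and j :: nat
  assumes pos: "0 < C" "1 \<le> K" "0 < h" "0 < r"
  defines "Y \<equiv> dg_small C K * r powr N * h powr p * dg_ratio ^ j"
  shows "level_const * ((2 * 2 ^ j / h) powr p * Y) powr \<beta> *
      (C * (4 * 2 ^ j) powr (N + p) * r powr (- (s * p)) * (2 * K * (2 * 2 ^ j) powr (p - 1) * Y))
     = dg_ratio * Y"
proof -
  define t :: real where "t = 2 ^ j"
  have t: "0 < t" by (simp add: t_def)
  have Y0: "0 < Y" using pos dg_small_pos[of C K] dg_ratio by (simp add: Y_def)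
  have Yb: "Y powr \<beta> = (dg_ratio / (dg_const C * K)) * r powr (s * p) * h powr (p * \<beta>) * (dg_ratio ^ j) powr \<beta>"
  proof -
    have "Y powr \<beta> = dg_small C K powr \<beta> * (r powr N) powr \<beta> * (h powr p) powr \<beta> * (dg_ratio ^ j) powr \<beta>"
      unfolding Y_def using pos dg_ratio dg_small_pos[of C K] by (simp add: powr_mult)
    moreover have "dg_small C K powr \<beta> = dg_ratio / (dg_const C * K)"
    proof -
      have "0 < dg_ratio / (dg_const C * K)" using dg_ratio dg_const_pos pos by (intro divide_pos_pos mult_pos_pos) auto
      moreover have "1 / c * c = 1" if "0 < c" for c :: real using that by simp
      from this[OF beta_pos] have "1 / \<beta> * \<beta> = 1" .
      ultimately show ?thesis unfolding dg_small_def powr_powr by (simp only: powr_one)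
    qed
    moreover have "(r powr N) powr \<beta> = r powr (s * p)" unfolding powr_powr using N0 by simp
    moreover have "(h powr p) powr \<beta> = h powr (p * \<beta>)" unfolding powr_powr ..
    ultimately show ?thesis by (simp only:)
  qed
  have tb: "(dg_ratio ^ j) powr \<beta> * (t powr (N + p) * t powr (p - 1) * t powr (p * \<beta>)) = 1"
  proof -
    have "(dg_ratio ^ j) powr \<beta> = (dg_ratio powr \<beta>) ^ j"
      using dg_ratio(1) by (simp only: powr_realpow[symmetric] powr_powr powr_gt_zero mult.commute)
    also have "\<dots> = (1 / dg_base) ^ j" by (simp only: dg_ratio(3))
    finally have a1: "(dg_ratio ^ j) powr \<beta> = (1 / dg_base) ^ j" .
    have "t powr (N + p) * t powr (p - 1) * t powr (p * \<beta>) = t powr (N + p + (p - 1) + p * \<beta>)"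
      by (simp only: powr_add)
    also have "\<dots> = dg_base ^ j"
      unfolding t_def dg_base_def by (simp only: powr_realpow[symmetric] powr_powr powr_gt_zero mult.commute zero_less_numeral)
    finally have a2: "t powr (N + p) * t powr (p - 1) * t powr (p * \<beta>) = dg_base ^ j" .
    have "0 < dg_base" by (simp add: dg_base_def)
    then have "(1 / dg_base) ^ j * dg_base ^ j = 1" by (simp add: power_one_over)
    then show ?thesis by (simp only: a1 a2)
  qed
  have e1: "((2 * t / h) powr p * Y) powr \<beta> = 2 powr (p * \<beta>) * t powr (p * \<beta>) * h powr (- (p * \<beta>)) * Y powr \<beta>"
    using t pos Y0 by (simp add: powr_mult powr_divide powr_powr powr_minus_divide)
  have e2: "(4 * t) powr (N + p) = 4 powr (N + p) * t powr (N + p)" using t by (simp add: powr_mult)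
  have e3: "(2 * t) powr (p - 1) = 2 powr (p - 1) * t powr (p - 1)" using t by (simp add: powr_mult)
  have "level_const * ((2 * t / h) powr p * Y) powr \<beta> *
      (C * (4 * t) powr (N + p) * r powr (- (s * p)) * (2 * K * (2 * t) powr (p - 1) * Y))
    = dg_const C * K * (h powr (- (p * \<beta>)) * h powr (p * \<beta>)) * (r powr (- (s * p)) * r powr (s * p)) *
       ((dg_ratio ^ j) powr \<beta> * (t powr (N + p) * t powr (p - 1) * t powr (p * \<beta>))) * (dg_ratio / (dg_const C * K)) * Y"
    unfolding e1 e2 e3 Yb dg_const_def by (simp only: mult_ac)
  also have "\<dots> = dg_const C * K * (dg_ratio / (dg_const C * K)) * Y"
    unfolding tb using pos by (simp add: powr_minus)
  also have "\<dots> = dg_ratio * Y" using dg_const_pos[OF pos(1)] pos by simp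
  finally show ?thesis by (simp only: t_def)
qed

text \<open>The linear term with constant \<open>K\<close> collects the tail and the right-hand side.\<close>

theorem de_giorgi:
  fixes v :: "real ^ 'n \<Rightarrow> real"
  assumes v[measurable]: "v \<in> borel_measurable borel"
    and pos: "0 < C" "1 \<le> K" "0 < h" "0 < r"
    and H: "\<And>k \<rho> R. \<lbrakk>k0 \<le> k; k \<le> k0 + h; r \<le> \<rho>; \<rho> < R; R \<le> 2 * r;
        (\<integral>\<^sup>+ x. ennreal (max (v x - k) 0 powr p) * indicator (ball x0 R) x \<partial>lborel) < \<infinity>\<rbrakk> \<Longrightarrow>
       energy (\<lambda>x. max (v x - k) 0 * cutoff x0 \<rho> R x) \<le> ennreal (C * (R / (R - \<rho>)) powr (N + p) * r powr (- (s * p))) *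
         ((\<integral>\<^sup>+ x. ennreal (max (v x - k) 0 powr p) * indicator (ball x0 R) x \<partial>lborel)
          + ennreal (K * h powr (p - 1)) * (\<integral>\<^sup>+ x. ennreal (max (v x - k) 0) * indicator (ball x0 R) x \<partial>lborel))"
    and init: "(\<integral>\<^sup>+ x. ennreal (max (v x - k0) 0 powr p) * indicator (ball x0 (2 * r)) x \<partial>lborel)
       \<le> ennreal (dg_small C K * r powr N * h powr p)"
  shows "AE x in lborel. x \<in> ball x0 r \<longrightarrow> v x \<le> k0 + h"
proof -
  define y where "y = (\<lambda>j::nat. dg_small C K * r powr N * h powr p * dg_ratio ^ j)"
  have y0: "0 < y j" for j using pos dg_small_pos[of C K] dg_ratio by (simp add: y_def)
  \<comment> \<open>Radii fall from 2 r to r and levels rise from k0 to k0 + h; each step halves the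
    remaining gap.\<close>
  define rr where "rr = (\<lambda>j::nat. r * (1 + 1 / 2 ^ j))"
  define kk where "kk = (\<lambda>j::nat. k0 + h * (1 - 1 / 2 ^ j))"
  define w where "w = (\<lambda>j x. max (v x - kk j) 0)"
  have [measurable]: "w j \<in> borel_measurable borel" for j unfolding w_def by measurable
  have w0: "0 \<le> w j x" for j x by (simp add: w_def)
  define Y where "Y = (\<lambda>j. \<integral>\<^sup>+ x. ennreal (w j x powr p) * indicator (ball x0 (rr j)) x \<partial>lborel)"
  have decay: "Y j \<le> ennreal (y j)" for j
  proof (induction j)
    case 0
    then show ?case using init by (simp add: Y_def y_def w_def kk_def rr_def mult.commute)
  next
    case (Suc j)
    define t :: real where "t = 2 ^ j"
    have t: "1 \<le> t" by (simp add: t_def)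
    let ?w = "w (Suc j)" and ?R = "rr j" and ?\<rho> = "rr (Suc j)"
    have kmono: "kk j + h / (2 * t) = kk (Suc j)" by (simp add: kk_def t_def field_simps)
    have hpos: "0 < h / (2 * t)" using pos t by simp
    have wle: "?w x \<le> w j x" for x using kmono hpos by (simp add: w_def max_def)
    \<comment> \<open>Where the higher truncation is positive, the lower one is at least the
      increment of the level. This yields both the measure estimate and the bound of w by a multiple
      of the p-th power of the lower truncation.\<close>
    have wbig: "h / (2 * t) \<le> w j x" if "?w x \<noteq> 0" for x
      using that kmono hpos by (auto simp: w_def max_def split: if_splits)
    have one: "1 \<le> (2 * t / h) powr p * w j x powr p" "(?w x \<le> (2 * t / h) powr (p - 1) * w j x powr p)" if "?w x \<noteq> 0" for x
    proof -
      have b: "1 \<le> 2 * t / h * w j x" using wbig[OF that] pos t by (simp add: field_simps)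
      then show "1 \<le> (2 * t / h) powr p * w j x powr p"
        using pos t w0 p0 by (subst powr_mult[symmetric]) (auto intro!: ge_one_powr_ge_zero)
      have "1 \<le> (2 * t / h * w j x) powr (p - 1)" using b p1 by (intro ge_one_powr_ge_zero) auto
      then have "w j x * 1 \<le> w j x * (2 * t / h * w j x) powr (p - 1)" using w0 by (intro mult_left_mono) auto
      also have "\<dots> = (2 * t / h) powr (p - 1) * w j x powr p"
      proof -
        have "(2 * t / h * w j x) powr (p - 1) = (2 * t / h) powr (p - 1) * w j x powr (p - 1)"
          by (rule powr_mult)
        then show ?thesis using powr_split[OF w0[of j x]] by (metis mult.assoc mult.commute)
      qed
      finally show "?w x \<le> (2 * t / h) powr (p - 1) * w j x powr p" using wle[of x] by linarith
    qed
    \<comment> \<open>Supplies the finiteness that \<open>H\<close> asks for at the next level and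
      radius.\<close>
    have Yfin: "Y j < \<infinity>" using Suc by (auto intro: le_less_trans)
    have a: "(\<integral>\<^sup>+ x. ennreal (?w x powr p) * indicator (ball x0 ?R) x \<partial>lborel) \<le> Y j"
      unfolding Y_def using wle w0 p0 by (intro nn_integral_mono mult_right_mono ennreal_leI powr_mono2) auto
    have b: "(\<integral>\<^sup>+ x. ennreal (?w x) * indicator (ball x0 ?R) x \<partial>lborel) \<le> ennreal ((2 * t / h) powr (p - 1)) * Y j"
    proof -
      have "(\<integral>\<^sup>+ x. ennreal (?w x) * indicator (ball x0 ?R) x \<partial>lborel)
         \<le> (\<integral>\<^sup>+ x. ennreal ((2 * t / h) powr (p - 1)) * (ennreal (w j x powr p) * indicator (ball x0 ?R) x) \<partial>lborel)"
      proof (intro nn_integral_mono)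
        fix x show "ennreal (?w x) * indicator (ball x0 ?R) x \<le> ennreal ((2 * t / h) powr (p - 1)) * (ennreal (w j x powr p) * indicator (ball x0 ?R) x)"
          using one(2)[of x] by (cases "?w x = 0") (auto simp: indicator_def ennreal_mult[symmetric] ennreal_leI)
      qed
      also have "\<dots> = ennreal ((2 * t / h) powr (p - 1)) * Y j" unfolding Y_def by (intro nn_integral_cmult) measurable
      finally show ?thesis .
    qed
    define g where "g = (\<lambda>x. ?w x * cutoff x0 ?\<rho> ?R x)"
    have [measurable]: "g \<in> borel_measurable borel" unfolding g_def by measurable
    have rho: "r \<le> ?\<rho>" "?\<rho> < ?R" "?R \<le> 2 * r" using pos by (auto simp: rr_def field_simps)
    have g_zero: "g x = 0" if "x \<notin> ball x0 ?R" for x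
      using that rho by (auto simp: g_def dist_norm norm_minus_commute intro!: cutoff_zero)
    have c: "emeasure lborel {x. g x \<noteq> 0} \<le> ennreal ((2 * t / h) powr p * y j)"
    proof -
      have "emeasure lborel {x. g x \<noteq> 0} = (\<integral>\<^sup>+ x. indicator {x. g x \<noteq> 0} x \<partial>lborel)" by (subst nn_integral_indicator) auto
      also have "\<dots> \<le> (\<integral>\<^sup>+ x. ennreal ((2 * t / h) powr p) * (ennreal (w j x powr p) * indicator (ball x0 ?R) x) \<partial>lborel)"
      proof (intro nn_integral_mono)
        fix x
        show "indicator {x. g x \<noteq> 0} x \<le> ennreal ((2 * t / h) powr p) * (ennreal (w j x powr p) * indicator (ball x0 ?R) x)"
        proof (cases "g x = 0")
          case False
          then have "x \<in> ball x0 ?R" "?w x \<noteq> 0" using g_zero by (auto simp: g_def)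
          then show ?thesis using one(1)[of x] False by (simp add: ennreal_mult[symmetric] flip: ennreal_1)
        qed simp
      qed
      also have "\<dots> = ennreal ((2 * t / h) powr p) * Y j" unfolding Y_def by (intro nn_integral_cmult) measurable
      also have "\<dots> \<le> ennreal ((2 * t / h) powr p) * ennreal (y j)" by (intro mult_left_mono Suc) simp
      also have "\<dots> = ennreal ((2 * t / h) powr p * y j)" by (intro ennreal_mult[symmetric]) (use y0[of j] in auto)
      finally show ?thesis .
    qed
    have q: "?R / (?R - ?\<rho>) \<le> 4 * t"
    proof -
      have d: "?R - ?\<rho> = r / (2 * t)" by (simp add: rr_def t_def field_simps)
      have "?R * (2 * t) \<le> 2 * r * (2 * t)" using rho(3) t by (intro mult_right_mono) auto
      then show ?thesis unfolding d using pos t by (simp add: divide_simps mult_ac)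
    qed
    have E: "energy g \<le> ennreal (C * (4 * t) powr (N + p) * r powr (- (s * p)) * (2 * K * (2 * t) powr (p - 1) * y j))"
    proof -
      have "energy g \<le> ennreal (C * (?R / (?R - ?\<rho>)) powr (N + p) * r powr (- (s * p))) *
         ((\<integral>\<^sup>+ x. ennreal (?w x powr p) * indicator (ball x0 ?R) x \<partial>lborel)
          + ennreal (K * h powr (p - 1)) * (\<integral>\<^sup>+ x. ennreal (?w x) * indicator (ball x0 ?R) x \<partial>lborel))"
        unfolding g_def w_def
      proof (rule H[OF _ _ rho])
        have "(1::real) \<le> 2 ^ Suc j" by (rule one_le_power) simp
        then have "0 \<le> 1 - 1 / (2::real) ^ Suc j" "1 - 1 / (2::real) ^ Suc j \<le> 1" by auto
        then show "k0 \<le> kk (Suc j)" "kk (Suc j) \<le> k0 + h"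
          unfolding kk_def using pos mult_left_mono[of "1 - 1 / (2::real) ^ Suc j" 1 h] by auto
        show "(\<integral>\<^sup>+ x. ennreal (max (v x - kk (Suc j)) 0 powr p) * indicator (ball x0 ?R) x \<partial>lborel) < \<infinity>"
          using a Yfin unfolding w_def by (rule le_less_trans)
      qed
      also have "\<dots> \<le> ennreal (C * (4 * t) powr (N + p) * r powr (- (s * p))) * (Y j + ennreal (K * h powr (p - 1)) * (ennreal ((2 * t / h) powr (p - 1)) * Y j))"
      proof -
        have "(?R / (?R - ?\<rho>)) powr (N + p) \<le> (4 * t) powr (N + p)"
          using q rho N0 p0 pos by (intro powr_mono2) (auto simp: rr_def)
        then have "C * (?R / (?R - ?\<rho>)) powr (N + p) * r powr (- (s * p)) \<le> C * (4 * t) powr (N + p) * r powr (- (s * p))"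
          using pos by (intro mult_right_mono mult_left_mono) auto
        from mult_mono[OF ennreal_leI[OF this] add_mono[OF a mult_left_mono[OF b]]] show ?thesis by simp
      qed
      also have "\<dots> \<le> ennreal (C * (4 * t) powr (N + p) * r powr (- (s * p))) * (ennreal (y j) + ennreal (K * h powr (p - 1)) * (ennreal ((2 * t / h) powr (p - 1)) * ennreal (y j)))"
        by (intro mult_left_mono add_mono Suc) auto
      also have "\<dots> = ennreal (C * (4 * t) powr (N + p) * r powr (- (s * p)) * (y j + K * h powr (p - 1) * ((2 * t / h) powr (p - 1) * y j)))"
        using pos y0[of j] by (simp add: ennreal_mult[symmetric] ennreal_plus[symmetric] del: ennreal_plus)
      also have "\<dots> \<le> ennreal (C * (4 * t) powr (N + p) * r powr (- (s * p)) * (2 * K * (2 * t) powr (p - 1) * y j))"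
      proof (intro ennreal_leI mult_left_mono)
        \<comment> \<open>The powers of h cancel, which explains the normalisation K h^(p-1) of the
          linear term; K \<ge> 1 then lets it absorb the p-th power term.\<close>
        have "h powr (p - 1) * (2 * t / h) powr (p - 1) = (2 * t) powr (p - 1)"
          using pos t by (simp add: powr_divide)
        then have "K * h powr (p - 1) * ((2 * t / h) powr (p - 1) * y j) = K * (2 * t) powr (p - 1) * y j"
          by (simp add: mult.assoc[symmetric])
        moreover have "1 * 1 \<le> K * (2 * t) powr (p - 1)"
          using pos t p1 by (intro mult_mono ge_one_powr_ge_zero) auto
        then have "y j \<le> K * (2 * t) powr (p - 1) * y j" using y0[of j] by simp
        ultimately show "y j + K * h powr (p - 1) * ((2 * t / h) powr (p - 1) * y j) \<le> 2 * K * (2 * t) powr (p - 1) * y j" by linarith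
      qed (use pos in auto)
      finally show ?thesis .
    qed
    have "Y (Suc j) \<le> (\<integral>\<^sup>+ x. ennreal (\<bar>g x\<bar> powr p) \<partial>lborel)"
      unfolding Y_def
    proof (intro nn_integral_mono)
      fix x
      show "ennreal (?w x powr p) * indicator (ball x0 ?\<rho>) x \<le> ennreal (\<bar>g x\<bar> powr p)"
        using rho w0 by (cases "x \<in> ball x0 ?\<rho>") (auto simp: g_def dist_norm norm_minus_commute cutoff_one abs_mult)
    qed
    also have "\<dots> \<le> ennreal (level_const * ((2 * t / h) powr p * y j) powr \<beta>) * energy g"
      using c y0[of j] pos t by (intro faber_krahn) auto
    also have "\<dots> \<le> ennreal (level_const * ((2 * t / h) powr p * y j) powr \<beta>) *
        ennreal (C * (4 * t) powr (N + p) * r powr (- (s * p)) * (2 * K * (2 * t) powr (p - 1) * y j))"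
      by (intro mult_left_mono E) simp
    also have "\<dots> = ennreal (level_const * ((2 * t / h) powr p * y j) powr \<beta> *
        (C * (4 * t) powr (N + p) * r powr (- (s * p)) * (2 * K * (2 * t) powr (p - 1) * y j)))"
      using pos y0[of j] level_const_pos by (intro ennreal_mult[symmetric]) auto
    also have "level_const * ((2 * t / h) powr p * y j) powr \<beta> *
        (C * (4 * t) powr (N + p) * r powr (- (s * p)) * (2 * K * (2 * t) powr (p - 1) * y j)) = dg_ratio * y j"
      unfolding t_def y_def by (rule de_giorgi_step_numeric[OF pos])
    also have "dg_ratio * y j = y (Suc j)" by (simp add: y_def)
    finally show ?case .
  qed
  let ?W = "\<integral>\<^sup>+ x. ennreal (max (v x - (k0 + h)) 0 powr p) * indicator (ball x0 r) x \<partial>lborel"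
  have "?W \<le> ennreal (y j)" for j
  proof -
    have "?W \<le> Y j" unfolding Y_def w_def
    proof (intro nn_integral_mono mult_mono ennreal_leI powr_mono2)
      fix x
      have "kk j \<le> k0 + h" using pos by (simp add: kk_def field_simps)
      then show "max (v x - (k0 + h)) 0 \<le> max (v x - kk j) 0" by auto
      have "r \<le> rr j" using pos by (simp add: rr_def field_simps)
      then show "indicator (ball x0 r) x \<le> (indicator (ball x0 (rr j)) x :: ennreal)"
        by (auto simp: indicator_def)
    qed (use p0 in auto)
    also have "\<dots> \<le> ennreal (y j)" by (rule decay)
    finally show ?thesis .
  qed
  moreover have "(\<lambda>j. ennreal (y j)) \<longlonglongrightarrow> ennreal 0"
  proof (rule tendsto_ennrealI)
    have "(\<lambda>j. dg_ratio ^ j) \<longlonglongrightarrow> 0" using dg_ratio by (intro LIMSEQ_realpow_zero) auto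
    then show "y \<longlonglongrightarrow> 0" unfolding y_def by (rule tendsto_mult_right_zero)
  qed
  ultimately have "?W \<le> ennreal 0" by (intro LIMSEQ_le_const[of "\<lambda>j. ennreal (y j)"]) auto
  then have "?W = 0" by simp
  then have "AE x in lborel. ennreal (max (v x - (k0 + h)) 0 powr p) * indicator (ball x0 r) x = 0"
    by (subst (asm) nn_integral_0_iff_AE) auto
  then show ?thesis
    by eventually_elim (auto simp: indicator_def ennreal_eq_0_iff split: if_splits)
qed

end

subsection \<open>Positivity and growth of supersolutions\<close>

context fractional
begin

lemma cutoff_powr_le_one: "cutoff x0 \<rho> R x powr p \<le> 1"
  using powr_mono2[of p "cutoff x0 \<rho> R x" 1] cutoff_bounds[of x0 \<rho> R x] p0 by simp

lemma ker_tail_ball_le: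
  assumes "0 < R"
  shows "(\<integral>\<^sup>+ y. ennreal (ker x0 y) * indicator (- ball x0 R) y \<partial>lborel) \<le> ennreal (tail_const TYPE('n) (s * p) * R powr (- (s * p)))"
proof -
  have "(\<integral>\<^sup>+ y. ennreal (ker x0 y) * indicator (- ball x0 R) y \<partial>lborel)
     = (\<integral>\<^sup>+ y. ennreal (indicator {y. R \<le> norm (x0 - y)} y * ker x0 y) \<partial>lborel)"
    by (intro nn_integral_cong) (auto simp: indicator_def dist_norm)
  then show ?thesis using ker_tail_le[OF assms, of x0] by simp
qed

text \<open>In the Caccioppoli inequality the tail and a bounded source both multiply the integral
  of w, so measured in units of r^(-s p) they fit into the linear term of the iteration. Taken above
  the lowest level and outside the smallest ball, the tail dominates those of all later
  steps.\<close>

lemma de_giorgi_weak_sub: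
  fixes v F :: "real ^ 'n \<Rightarrow> real"
  assumes sub: "weak_sub \<Omega> v F" and dom: "cball x0 (2 * r) \<subseteq> \<Omega>"
    and pos: "1 \<le> K" "0 < h" "0 < r" "0 \<le> \<tau>" "0 \<le> \<phi>"
    and tail: "(\<integral>\<^sup>+ y. ennreal (max (v y - k0) 0 powr (p - 1) * ker x0 y) * indicator (- ball x0 r) y \<partial>lborel)
        \<le> ennreal (\<tau> * r powr (- (s * p)))"
    and src: "AE x in lborel. x \<in> ball x0 (2 * r) \<longrightarrow> F x \<le> \<phi> * r powr (- (s * p))"
    and K: "\<tau> + \<phi> \<le> K * h powr (p - 1)"
    and init: "(\<integral>\<^sup>+ x. ennreal (max (v x - k0) 0 powr p) * indicator (ball x0 (2 * r)) x \<partial>lborel)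
       \<le> ennreal (dg_small caccioppoli_const K * r powr N * h powr p)"
  shows "AE x in lborel. x \<in> ball x0 r \<longrightarrow> v x \<le> k0 + h"
proof -
  have v[measurable]: "v \<in> borel_measurable borel" and F[measurable]: "F \<in> borel_measurable borel"
    and F0: "\<And>x. 0 \<le> F x" using sub by (auto simp: weak_sub_def)
  show ?thesis
  proof (rule de_giorgi[OF v caccioppoli_const_ge(3) pos(1,2,3) _ init])
    fix k \<rho> R assume k: "k0 \<le> k" "k \<le> k0 + h" and R: "r \<le> \<rho>" "\<rho> < R" "R \<le> 2 * r"
      and fin: "(\<integral>\<^sup>+ x. ennreal (max (v x - k) 0 powr p) * indicator (ball x0 R) x \<partial>lborel) < \<infinity>"
    define w where "w = (\<lambda>x. max (v x - k) 0)"
    have [measurable]: "w \<in> borel_measurable borel" unfolding w_def by measurable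
    have w0: "0 \<le> w x" for x by (simp add: w_def)
    let ?\<eta> = "cutoff x0 \<rho> R"
    let ?Wp = "\<integral>\<^sup>+ x. ennreal (w x powr p) * indicator (ball x0 R) x \<partial>lborel"
    let ?W1 = "\<integral>\<^sup>+ x. ennreal (w x) * indicator (ball x0 R) x \<partial>lborel"
    let ?T = "\<integral>\<^sup>+ y. ennreal (w y powr (p - 1) * ker x0 y) * indicator (- ball x0 R) y \<partial>lborel"
    let ?X = "\<integral>\<^sup>+ x. ennreal (F x * (w x * ?\<eta> x powr p)) \<partial>lborel"
    let ?r = "r powr (- (s * p))"
    define q where "q = R / (R - \<rho>)"
    have q: "1 \<le> q powr (N + p)" using R pos N0 p0 by (intro ge_one_powr_ge_zero) (auto simp: q_def)
    let ?c = "caccioppoli_const * q powr (N + p)"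
    have c: "0 \<le> ?c" using caccioppoli_const_ge(3) by simp
    have T: "?T \<le> ennreal (\<tau> * ?r)"
    proof (rule order_trans[OF _ tail], intro nn_integral_mono mult_mono ennreal_leI mult_right_mono powr_mono2)
      fix y
      show "indicator (- ball x0 R) y \<le> (indicator (- ball x0 r) y :: ennreal)"
        using R pos by (auto simp: indicator_def)
    qed (use k p1 in \<open>auto simp: w_def\<close>)
    have X: "?X \<le> ennreal (\<phi> * ?r) * ?W1"
    proof -
      have "?X \<le> (\<integral>\<^sup>+ x. ennreal (\<phi> * ?r) * (ennreal (w x) * indicator (ball x0 R) x) \<partial>lborel)"
      proof (intro nn_integral_mono_AE, use src in eventually_elim)
        fix x assume a: "x \<in> ball x0 (2 * r) \<longrightarrow> F x \<le> \<phi> * ?r"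
        show "ennreal (F x * (w x * ?\<eta> x powr p)) \<le> ennreal (\<phi> * ?r) * (ennreal (w x) * indicator (ball x0 R) x)"
        proof (cases "x \<in> ball x0 R")
          case True
          have "w x * ?\<eta> x powr p \<le> w x * 1"
            using w0 cutoff_powr_le_one by (intro mult_left_mono) auto
          then have "F x * (w x * ?\<eta> x powr p) \<le> \<phi> * ?r * w x"
            using a True R w0 F0 pos by (intro mult_mono) (auto intro!: mult_nonneg_nonneg)
          then show ?thesis using True pos w0 by (simp add: ennreal_mult[symmetric] ennreal_leI)
        next
          case False
          then have "?\<eta> x = 0" using R by (intro cutoff_zero) (auto simp: dist_norm norm_minus_commute)
          then show ?thesis using p0 by simp
        qed
      qed
      also have "\<dots> = ennreal (\<phi> * ?r) * ?W1" by (intro nn_integral_cmult) measurable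
      finally show ?thesis .
    qed
    have "energy (\<lambda>x. w x * ?\<eta> x) \<le> ennreal ?c * (ennreal (R powr (- (s * p))) * ?Wp + ?T * ?W1) + ennreal caccioppoli_const * ?X"
    proof -
      have "cball x0 R \<subseteq> \<Omega>" using dom R by (auto simp: subset_iff)
      moreover have "0 < \<rho>" using R pos by linarith
      ultimately have "energy (\<lambda>x. w x * ?\<eta> x)
         + (\<integral>\<^sup>+ x. \<integral>\<^sup>+ y. ennreal (max (k - v y) 0 powr (p - 1) * (w x * ?\<eta> x powr p) * ker x y) \<partial>lborel \<partial>lborel)
         \<le> ennreal ?c * (ennreal (R powr (- (s * p))) * ?Wp + ?T * ?W1) + ennreal caccioppoli_const * ?X"
        using caccioppoli[OF sub _ R(2), of x0 k] fin by (simp add: w_def q_def)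
      then show ?thesis by (rule order_trans[OF add_increasing2[OF zero_le order_refl]])
    qed
    also have "\<dots> \<le> ennreal ?c * (ennreal ?r * ?Wp + ennreal (\<tau> * ?r) * ?W1) + ennreal ?c * (ennreal (\<phi> * ?r) * ?W1)"
    proof (intro add_mono mult_mono mult_left_mono ennreal_leI X T)
      show "R powr (- (s * p)) \<le> ?r" using R pos sp0 by (intro powr_minus_mono) auto
      show "caccioppoli_const \<le> ?c" using q caccioppoli_const_ge(3) by simp
    qed (use c caccioppoli_const_ge(3) in auto)
    also have "\<dots> = ennreal ?c * (ennreal ?r * ?Wp + (ennreal (\<tau> * ?r) + ennreal (\<phi> * ?r)) * ?W1)"
      by (simp only: distrib_left distrib_right add.assoc)
    also have "ennreal (\<tau> * ?r) + ennreal (\<phi> * ?r) = ennreal ?r * ennreal (\<tau> + \<phi>)"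
      using pos by (simp add: ennreal_plus[symmetric] ennreal_mult[symmetric] algebra_simps del: ennreal_plus)
    also have "ennreal ?c * (ennreal ?r * ?Wp + ennreal ?r * ennreal (\<tau> + \<phi>) * ?W1) = ennreal ?c * ennreal ?r * (?Wp + ennreal (\<tau> + \<phi>) * ?W1)"
      by (simp only: distrib_left mult.assoc)
    also have "\<dots> \<le> ennreal ?c * ennreal ?r * (?Wp + ennreal (K * h powr (p - 1)) * ?W1)"
      using K by (intro mult_left_mono add_left_mono mult_right_mono ennreal_leI) auto
    also have "ennreal ?c * ennreal ?r = ennreal (?c * ?r)" using c by (intro ennreal_mult[symmetric]) auto
    finally show "energy (\<lambda>x. max (v x - k) 0 * ?\<eta> x) \<le> ennreal (caccioppoli_const * (R / (R - \<rho>)) powr (N + p) * ?r) *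
         ((\<integral>\<^sup>+ x. ennreal (max (v x - k) 0 powr p) * indicator (ball x0 R) x \<partial>lborel)
          + ennreal (K * h powr (p - 1)) * (\<integral>\<^sup>+ x. ennreal (max (v x - k) 0) * indicator (ball x0 R) x \<partial>lborel))"
      by (simp add: w_def q_def)
  qed
qed

text \<open>No logarithmic estimate is needed: as \<open>u > 0\<close> almost everywhere, the set where \<open>u < t\<close> becomes
  arbitrarily small, and the smallness required by the iteration does not depend on \<open>t\<close>.\<close>

lemma supersolution_lower_bound:
  fixes u :: "real ^ 'n \<Rightarrow> real"
  assumes sub: "weak_sub \<Omega> (\<lambda>x. - u x) (\<lambda>x. 0)" and u[measurable]: "u \<in> borel_measurable borel"
    and u0: "\<And>x. 0 \<le> u x" and pos: "\<And>x. x \<in> \<Omega> \<Longrightarrow> 0 < u x"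
    and dom: "cball x0 (2 * r) \<subseteq> \<Omega>" and r: "0 < r"
  obtains c where "0 < c" "AE x in lborel. x \<in> ball x0 r \<longrightarrow> c \<le> u x"
proof -
  let ?tc = "tail_const TYPE('n) (s * p)"
  have tc: "0 < ?tc" by (rule tail_const_pos[OF sp0])
  \<comment> \<open>The tail of (t - u)^+ is at most t^(p-1) times the kernel tail, while the
    iteration offers K (t/2)^(p-1); the factor 2^(p-1) removes t from the condition. The 2^p in e
    below plays the same part for the initial integral.\<close>
  define K where "K = max 1 (2 powr (p - 1) * ?tc)"
  have K: "1 \<le> K" "2 powr (p - 1) * ?tc \<le> K" by (auto simp: K_def)
  define e where "e = dg_small caccioppoli_const K * r powr N / 2 powr p"
  have e: "0 < e" using dg_small_pos[of caccioppoli_const K] caccioppoli_const_ge(3) K r by (simp add: e_def)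
  let ?B = "ball x0 (2 * r)"
  have sub\<Omega>: "?B \<subseteq> \<Omega>" using dom by auto
  have "(\<lambda>n. \<integral>\<^sup>+ x. indicator (?B \<inter> {x. u x < 1 / real (Suc n)}) x \<partial>lborel) \<longlonglongrightarrow> (\<integral>\<^sup>+ x. 0 \<partial>(lborel :: (real^'n) measure))"
  proof (rule nn_integral_dominated_convergence[where w="indicator ?B"])
    show "AE x in lborel. (\<lambda>n. indicator (?B \<inter> {x. u x < 1 / real (Suc n)}) x :: ennreal) \<longlonglongrightarrow> 0"
    proof (rule AE_I2)
      fix x
      show "(\<lambda>n. indicator (?B \<inter> {x. u x < 1 / real (Suc n)}) x :: ennreal) \<longlonglongrightarrow> 0"
      proof (cases "x \<in> ?B")
        case True
        then have "0 < u x" using sub\<Omega> pos by auto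
        then obtain n where n: "1 / real (Suc n) < u x" using nat_approx_posE by metis
        have "eventually (\<lambda>m. 0 = (indicator (?B \<inter> {x. u x < 1 / real (Suc m)}) x :: ennreal)) sequentially"
          using eventually_ge_at_top[of n]
        proof eventually_elim
          case (elim m)
          have "1 / real (Suc m) \<le> 1 / real (Suc n)" using elim by (intro divide_left_mono) auto
          then show ?case using n by (auto simp: indicator_def)
        qed
        then show ?thesis by (rule Lim_transform_eventually[OF tendsto_const])
      qed simp
    qed
    show "(\<integral>\<^sup>+ x. indicator ?B x \<partial>lborel) < \<infinity>"
      using r by (subst nn_integral_indicator) (auto simp: emeasure_ball_vec)
  qed (auto simp: indicator_def)
  then have "\<forall>\<^sub>F n in sequentially. (\<integral>\<^sup>+ x. indicator (?B \<inter> {x. u x < 1 / real (Suc n)}) x \<partial>lborel) < ennreal e"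
    by (intro order_tendstoD(2)[where y=0]) (use e in auto)
  then obtain n where n: "(\<integral>\<^sup>+ x. indicator (?B \<inter> {x. u x < 1 / real (Suc n)}) x \<partial>lborel) < ennreal e"
    by (auto simp: eventually_sequentially)
  define t where "t = 1 / real (Suc n)"
  have t: "0 < t" by (simp add: t_def)
  have le_t: "max (- u x - (- t)) 0 \<le> t" for x using u0[of x] t by auto
  have "AE x in lborel. x \<in> ball x0 r \<longrightarrow> - u x \<le> - t + t / 2"
  proof (rule de_giorgi_weak_sub[OF sub dom K(1) _ r, where \<tau>="t powr (p - 1) * ?tc" and \<phi>=0])
    have "(\<integral>\<^sup>+ y. ennreal (max (- u y - (- t)) 0 powr (p - 1) * ker x0 y) * indicator (- ball x0 r) y \<partial>lborel)
       \<le> (\<integral>\<^sup>+ y. ennreal (t powr (p - 1)) * (ennreal (ker x0 y) * indicator (- ball x0 r) y) \<partial>lborel)"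
    proof (intro nn_integral_mono)
      fix y
      have "max (- u y - (- t)) 0 powr (p - 1) * ker x0 y \<le> t powr (p - 1) * ker x0 y"
        using le_t p1 by (intro mult_right_mono powr_mono2) auto
      then show "ennreal (max (- u y - (- t)) 0 powr (p - 1) * ker x0 y) * indicator (- ball x0 r) y
         \<le> ennreal (t powr (p - 1)) * (ennreal (ker x0 y) * indicator (- ball x0 r) y)"
        by (auto simp: indicator_def ennreal_mult[symmetric] intro!: ennreal_leI)
    qed
    also have "\<dots> = ennreal (t powr (p - 1)) * (\<integral>\<^sup>+ y. ennreal (ker x0 y) * indicator (- ball x0 r) y \<partial>lborel)"
      by (intro nn_integral_cmult) measurable
    also have "\<dots> \<le> ennreal (t powr (p - 1)) * ennreal (?tc * r powr (- (s * p)))"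
      by (intro mult_left_mono ker_tail_ball_le r) simp
    also have "\<dots> = ennreal (t powr (p - 1) * ?tc * r powr (- (s * p)))"
      using tc by (simp add: ennreal_mult[symmetric] mult.assoc)
    finally show "(\<integral>\<^sup>+ y. ennreal (max (- u y - (- t)) 0 powr (p - 1) * ker x0 y) * indicator (- ball x0 r) y \<partial>lborel)
       \<le> ennreal (t powr (p - 1) * ?tc * r powr (- (s * p)))" .
    have "t powr (p - 1) * ?tc = (2 powr (p - 1) * ?tc) * (t / 2) powr (p - 1)" using t by (simp add: powr_divide)
    also have "\<dots> \<le> K * (t / 2) powr (p - 1)" using K by (intro mult_right_mono) auto
    finally show "t powr (p - 1) * ?tc + 0 \<le> K * (t / 2) powr (p - 1)" by simp
    have "(\<integral>\<^sup>+ x. ennreal (max (- u x - (- t)) 0 powr p) * indicator ?B x \<partial>lborel)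
       \<le> (\<integral>\<^sup>+ x. ennreal (t powr p) * indicator (?B \<inter> {x. u x < t}) x \<partial>lborel)"
    proof (intro nn_integral_mono)
      fix x
      have "max (- u x - (- t)) 0 powr p \<le> t powr p" using le_t p0 by (intro powr_mono2) auto
      then show "ennreal (max (- u x - (- t)) 0 powr p) * indicator ?B x \<le> ennreal (t powr p) * indicator (?B \<inter> {x. u x < t}) x"
        using p0 by (cases "u x < t") (auto simp: indicator_def intro!: ennreal_leI)
    qed
    also have "\<dots> = ennreal (t powr p) * (\<integral>\<^sup>+ x. indicator (?B \<inter> {x. u x < t}) x \<partial>lborel)"
      by (intro nn_integral_cmult) measurable
    also have "\<dots> \<le> ennreal (t powr p) * ennreal e" using n unfolding t_def by (intro mult_left_mono) auto
    also have "\<dots> = ennreal (dg_small caccioppoli_const K * r powr N * (t / 2) powr p)"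
      using t e by (simp add: ennreal_mult[symmetric] e_def powr_divide mult_ac)
    finally show "(\<integral>\<^sup>+ x. ennreal (max (- u x - (- t)) 0 powr p) * indicator ?B x \<partial>lborel)
       \<le> ennreal (dg_small caccioppoli_const K * r powr N * (t / 2) powr p)" .
  qed (use t tc in auto)
  then have "AE x in lborel. x \<in> ball x0 r \<longrightarrow> t / 2 \<le> u x" by eventually_elim auto
  then show ?thesis using that[of "t / 2"] t by simp
qed

text \<open>In \<open>growth\<close>, the truncation outside radius R/8 is at most a = \<kappa>
  \<omega> plus the excess over M. The first part meets the kernel tail at radius R/8, hence 8^(s
  p); the second is the given tail, hence the added 1.\<close>

definition growth_tail :: real where
  "growth_tail = 2 powr (p - 1) * (tail_const TYPE('n) (s * p) * 8 powr (s * p) + 1)"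

text \<open>Upper bound for the cross term with the cutoff between R/2 and R. The p-th power
  integral and the source contribute 1 each, the tail contributes
  \<open>growth_tail\<close>.\<close>

definition growth_up :: real where
  "growth_up = caccioppoli_const * 2 powr (N + p) * unit_ball_vol N * (2 + growth_tail)"

text \<open>Lower bound for the cross term: a gap \<omega>/4 to the power p - 1, times half of the
  volume of the ball of radius R/4.\<close>

definition growth_low :: real where
  "growth_low = (1 / 4) powr (p - 1) * (unit_ball_vol N / 2) * (1 / 4) powr N"

definition growth_K :: real where "growth_K = 2 powr (p - 1) * (growth_tail + 1)"

text \<open>The cap 1/4 keeps the level M - \<kappa> \<omega> at distance at least \<omega>/4 from M
  - \<omega>/2. The other entry makes the initial integral of the iteration at radius R/8 and height
  \<kappa> \<omega> / 2 small enough; it can be met because p - 1 > 0.\<close>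

definition \<kappa> :: real where
  "\<kappa> = min (1 / 4) ((dg_small caccioppoli_const growth_K * (1 / 8) powr N * (1 / 2) powr p * (growth_low / growth_up)) powr (1 / (p - 1)))"

lemma growth_pos: "0 < growth_tail" "0 < growth_up" "0 < growth_low" "1 \<le> growth_K"
proof -
  have "0 < tail_const TYPE('n) (s * p) * 8 powr (s * p)" using tail_const_pos[OF sp0, where 'n='n] by simp
  then show 1: "0 < growth_tail" by (simp add: growth_tail_def add_pos_pos)
  show "0 < growth_up" using 1 caccioppoli_const_ge(3) V_pos by (simp add: growth_up_def del: V_pos)
  show "0 < growth_low" using V_pos by (simp add: growth_low_def del: V_pos)
  have "1 \<le> (2::real) powr (p - 1)" using p1 by (intro ge_one_powr_ge_zero) auto
  then have "1 * 1 \<le> growth_K" unfolding growth_K_def using 1 by (intro mult_mono) auto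
  then show "1 \<le> growth_K" by simp
qed

lemma kappa: "0 < \<kappa>" "\<kappa> \<le> 1 / 4"
  "growth_up / growth_low * \<kappa> powr (p - 1) \<le> dg_small caccioppoli_const growth_K * (1 / 8) powr N * (1 / 2) powr p"
proof -
  let ?a = "dg_small caccioppoli_const growth_K * (1 / 8) powr N * (1 / 2) powr p"
  have "0 < dg_small caccioppoli_const growth_K"
    using growth_pos caccioppoli_const_ge(3) by (intro dg_small_pos) auto
  then have a: "0 < ?a" by simp
  then have b: "0 < ?a * (growth_low / growth_up)" using growth_pos by (intro mult_pos_pos[OF a] divide_pos_pos)
  then show k: "0 < \<kappa>" by (auto simp: \<kappa>_def)
  show "\<kappa> \<le> 1 / 4" by (simp add: \<kappa>_def)
  have "\<kappa> powr (p - 1) \<le> ((?a * (growth_low / growth_up)) powr (1 / (p - 1))) powr (p - 1)"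
    using k p1 by (intro powr_mono2) (auto simp: \<kappa>_def)
  also have "\<dots> = ?a * (growth_low / growth_up)"
  proof -
    have "(c powr (1 / (p - 1))) powr (p - 1) = c" if "0 < c" for c :: real
      using that p1 by (simp add: powr_powr)
    from this[OF b] show ?thesis .
  qed
  finally have "growth_up / growth_low * \<kappa> powr (p - 1) \<le> growth_up / growth_low * (?a * (growth_low / growth_up))"
    using growth_pos by (intro mult_left_mono) auto
  also have "\<dots> = ?a" using growth_pos by simp
  finally show "growth_up / growth_low * \<kappa> powr (p - 1) \<le> ?a" .
qed

text \<open>The nonlocal term of the Caccioppoli inequality bounds \<open>(v - (M - \<kappa> \<omega>))\<^sup>+\<close> in mean by \<open>\<kappa>\<^sup>p \<omega>\<close>, which beats the
  bound \<open>\<kappa> \<omega>\<close> of the iteration because \<open>p > 1\<close>.\<close>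

theorem growth:
  fixes v F :: "real ^ 'n \<Rightarrow> real"
  assumes sub: "weak_sub \<Omega> v F" and dom: "cball x0 R \<subseteq> \<Omega>" and pos: "0 < R" "0 < \<omega>"
    and upper: "AE x in lborel. x \<in> ball x0 R \<longrightarrow> v x \<le> M"
    and src: "AE x in lborel. x \<in> ball x0 R \<longrightarrow> F x \<le> (\<kappa> * \<omega>) powr (p - 1) * R powr (- (s * p))"
    and tail: "(\<integral>\<^sup>+ y. ennreal (max (v y - M) 0 powr (p - 1) * ker x0 y) * indicator (- ball x0 R) y \<partial>lborel)
        \<le> ennreal ((\<kappa> * \<omega>) powr (p - 1) * R powr (- (s * p)))"
    and half: "ennreal (unit_ball_vol N * (R / 4) powr N / 2) \<le> emeasure lborel (ball x0 (R / 4) \<inter> {x. v x \<le> M - \<omega> / 2})"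
  shows "AE x in lborel. x \<in> ball x0 (R / 8) \<longrightarrow> v x \<le> M - \<kappa> * \<omega> / 2"
proof -
  have v[measurable]: "v \<in> borel_measurable borel" and F[measurable]: "F \<in> borel_measurable borel"
    and F0: "\<And>x. 0 \<le> F x" using sub by (auto simp: weak_sub_def)
  let ?tc = "tail_const TYPE('n) (s * p)"
  have tc: "0 < ?tc" by (rule tail_const_pos[OF sp0])
  define a where "a = \<kappa> * \<omega>"
  have a: "0 < a" using kappa pos by (simp add: a_def)
  define k where "k = M - a"
  define w where "w = (\<lambda>x. max (v x - k) 0)"
  have [measurable]: "w \<in> borel_measurable borel" unfolding w_def by measurable
  have w0: "0 \<le> w x" for x by (simp add: w_def)
  have w_upper: "AE x in lborel. x \<in> ball x0 R \<longrightarrow> w x \<le> a"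
    using upper by eventually_elim (use a in \<open>auto simp: w_def k_def\<close>)
  let ?r = "R powr (- (s * p))"
  \<comment> \<open>With radius R this enters the Caccioppoli inequality, with R/8 the final
    iteration. Inside the ball of radius R the truncation is at most a; beyond it the assumed tail
    above M takes over.\<close>
  have T: "(\<integral>\<^sup>+ y. ennreal (w y powr (p - 1) * ker x0 y) * indicator (- ball x0 \<rho>) y \<partial>lborel) \<le> ennreal (growth_tail * a powr (p - 1) * ?r)"
    if rho: "R / 8 \<le> \<rho>" for \<rho>
  proof -
    let ?c = "2 powr (p - 1)"
    have "(\<integral>\<^sup>+ y. ennreal (w y powr (p - 1) * ker x0 y) * indicator (- ball x0 \<rho>) y \<partial>lborel)
       \<le> (\<integral>\<^sup>+ y. ennreal (?c * a powr (p - 1)) * (ennreal (ker x0 y) * indicator (- ball x0 (R / 8)) y)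
           + ennreal ?c * (ennreal (max (v y - M) 0 powr (p - 1) * ker x0 y) * indicator (- ball x0 R) y) \<partial>lborel)"
    proof (intro nn_integral_mono_AE, use upper in eventually_elim)
      fix y assume up: "y \<in> ball x0 R \<longrightarrow> v y \<le> M"
      show "ennreal (w y powr (p - 1) * ker x0 y) * indicator (- ball x0 \<rho>) y
         \<le> ennreal (?c * a powr (p - 1)) * (ennreal (ker x0 y) * indicator (- ball x0 (R / 8)) y)
           + ennreal ?c * (ennreal (max (v y - M) 0 powr (p - 1) * ker x0 y) * indicator (- ball x0 R) y)"
      proof (cases "y \<in> ball x0 \<rho>")
        case False
        then have y8: "y \<notin> ball x0 (R / 8)" using rho by auto
        have "w y \<le> a + max (v y - M) 0" using a by (auto simp: w_def k_def)
        then have "w y powr (p - 1) \<le> (a + max (v y - M) 0) powr (p - 1)" using p1 w0 by (intro powr_mono2) auto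
        also have "\<dots> \<le> ?c * (a powr (p - 1) + max (v y - M) 0 powr (p - 1))" using a p1 by (intro add_powr_le) auto
        finally have le: "w y powr (p - 1) * ker x0 y \<le> ?c * (a powr (p - 1) + max (v y - M) 0 powr (p - 1)) * ker x0 y"
          by (rule mult_right_mono) simp
        show ?thesis
        proof (cases "y \<in> ball x0 R")
          case True
          then have "max (v y - M) 0 = 0" using up by auto
          then have "w y powr (p - 1) * ker x0 y \<le> ?c * a powr (p - 1) * ker x0 y" using le p1 by simp
          then show ?thesis using False y8 True by (simp add: ennreal_mult[symmetric] ennreal_leI)
        next
          case yR: False
          have "w y powr (p - 1) * ker x0 y \<le> ?c * a powr (p - 1) * ker x0 y + ?c * (max (v y - M) 0 powr (p - 1) * ker x0 y)"
            using le by (simp add: algebra_simps)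
          then show ?thesis using False y8 yR
            by (simp add: ennreal_mult[symmetric] ennreal_plus[symmetric] ennreal_leI del: ennreal_plus)
        qed
      qed simp
    qed
    also have "\<dots> = ennreal (?c * a powr (p - 1)) * (\<integral>\<^sup>+ y. ennreal (ker x0 y) * indicator (- ball x0 (R / 8)) y \<partial>lborel)
        + ennreal ?c * (\<integral>\<^sup>+ y. ennreal (max (v y - M) 0 powr (p - 1) * ker x0 y) * indicator (- ball x0 R) y \<partial>lborel)"
      by (simp add: nn_integral_add nn_integral_cmult)
    also have "\<dots> \<le> ennreal (?c * a powr (p - 1)) * ennreal (?tc * (R / 8) powr (- (s * p))) + ennreal ?c * ennreal (a powr (p - 1) * ?r)"
      using pos tail by (intro add_mono mult_left_mono ker_tail_ball_le) (auto simp: a_def)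
    also have "\<dots> = ennreal (?c * a powr (p - 1) * (?tc * (R / 8) powr (- (s * p))) + ?c * (a powr (p - 1) * ?r))"
      using tc by (simp add: ennreal_mult[symmetric] ennreal_plus[symmetric] del: ennreal_plus)
    also have "?c * a powr (p - 1) * (?tc * (R / 8) powr (- (s * p))) + ?c * (a powr (p - 1) * ?r) = growth_tail * a powr (p - 1) * ?r"
    proof -
      have "(R / 8) powr (- c) = 8 powr c * R powr (- c)" for c :: real
        using pos by (simp add: powr_divide powr_minus flip: divide_inverse)
      then have "(R / 8) powr (- (s * p)) = 8 powr (s * p) * ?r" .
      then show ?thesis unfolding growth_tail_def by (simp add: algebra_simps)
    qed
    finally show ?thesis .
  qed
  let ?B = "ball x0 R" and ?B4 = "ball x0 (R / 4)"
  let ?V = "unit_ball_vol N"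
  have VB: "emeasure lborel ?B = ennreal (?V * R powr N)"
    using pos emeasure_ball_vec[of R x0] by (simp add: N_def powr_realpow)
  have Wc: "(\<integral>\<^sup>+ x. ennreal (w x powr c) * indicator ?B x \<partial>lborel) \<le> ennreal (a powr c * (?V * R powr N))" if "0 < c" for c
  proof -
    have "(\<integral>\<^sup>+ x. ennreal (w x powr c) * indicator ?B x \<partial>lborel) \<le> (\<integral>\<^sup>+ x. ennreal (a powr c) * indicator ?B x \<partial>lborel)"
      by (intro nn_integral_mono_AE, use w_upper in eventually_elim)
         (use w0 that in \<open>auto simp: indicator_def intro!: ennreal_leI powr_mono2\<close>)
    also have "\<dots> = ennreal (a powr c) * ennreal (?V * R powr N)" by (subst nn_integral_cmult_indicator) (auto simp: VB)
    also have "\<dots> = ennreal (a powr c * (?V * R powr N))"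
      using V_pos by (intro ennreal_mult[symmetric] mult_nonneg_nonneg) (auto intro: less_imp_le)
    finally show ?thesis .
  qed
  let ?\<eta> = "cutoff x0 (R / 2) R"
  let ?W1 = "\<integral>\<^sup>+ x. ennreal (w x) * indicator ?B x \<partial>lborel"
  have W1: "?W1 \<le> ennreal (a * (?V * R powr N))" using Wc[of 1] w0 a by simp
  let ?Good = "\<integral>\<^sup>+ x. \<integral>\<^sup>+ y. ennreal (max (k - v y) 0 powr (p - 1) * (w x * ?\<eta> x powr p) * ker x y) \<partial>lborel \<partial>lborel"
  have upper_good: "?Good \<le> ennreal (growth_up * a powr p * R powr (N - s * p))"
  proof -
    have fin: "(\<integral>\<^sup>+ x. ennreal (w x powr p) * indicator ?B x \<partial>lborel) < \<infinity>"
      using Wc[OF p0] by (rule le_less_trans) simp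
    have X: "(\<integral>\<^sup>+ x. ennreal (F x * (w x * ?\<eta> x powr p)) \<partial>lborel) \<le> ennreal (a powr (p - 1) * ?r) * ?W1"
    proof -
      have "(\<integral>\<^sup>+ x. ennreal (F x * (w x * ?\<eta> x powr p)) \<partial>lborel) \<le> (\<integral>\<^sup>+ x. ennreal (a powr (p - 1) * ?r) * (ennreal (w x) * indicator ?B x) \<partial>lborel)"
      proof (intro nn_integral_mono_AE, use src in eventually_elim)
        fix x assume Fx: "x \<in> ?B \<longrightarrow> F x \<le> (\<kappa> * \<omega>) powr (p - 1) * ?r"
        show "ennreal (F x * (w x * ?\<eta> x powr p)) \<le> ennreal (a powr (p - 1) * ?r) * (ennreal (w x) * indicator ?B x)"
        proof (cases "x \<in> ?B")
          case True
          have "w x * ?\<eta> x powr p \<le> w x * 1"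
            using w0 cutoff_powr_le_one by (intro mult_left_mono) auto
          then have "F x * (w x * ?\<eta> x powr p) \<le> a powr (p - 1) * ?r * w x"
            using Fx True w0 F0 by (intro mult_mono) (auto simp: a_def intro!: mult_nonneg_nonneg)
          then show ?thesis using True w0 by (simp add: ennreal_mult[symmetric] ennreal_leI)
        next
          case False
          then have "?\<eta> x = 0" using pos by (intro cutoff_zero) (auto simp: dist_norm norm_minus_commute)
          then show ?thesis using p0 by simp
        qed
      qed
      also have "\<dots> = ennreal (a powr (p - 1) * ?r) * ?W1" by (intro nn_integral_cmult) measurable
      finally show ?thesis .
    qed
    have q: "R / (R - R / 2) = 2" using pos by (simp add: field_simps)
    let ?c = "caccioppoli_const * 2 powr (N + p)"
    have c2: "1 \<le> (2::real) powr (N + p)" using N0 p0 by (intro ge_one_powr_ge_zero) auto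
    have c: "0 \<le> ?c" "caccioppoli_const \<le> ?c" using caccioppoli_const_ge(3) c2 by auto
    have "?Good \<le> energy (\<lambda>x. w x * ?\<eta> x) + ?Good" by (simp add: add_increasing)
    also have "\<dots> \<le> ennreal ?c * (ennreal ?r * (\<integral>\<^sup>+ x. ennreal (w x powr p) * indicator ?B x \<partial>lborel)
          + (\<integral>\<^sup>+ y. ennreal (w y powr (p - 1) * ker x0 y) * indicator (- ?B) y \<partial>lborel) * ?W1)
       + ennreal caccioppoli_const * (\<integral>\<^sup>+ x. ennreal (F x * (w x * ?\<eta> x powr p)) \<partial>lborel)"
      using caccioppoli[OF sub _ _ dom, of "R / 2" k] fin pos unfolding w_def q by simp
    also have "\<dots> \<le> ennreal ?c * (ennreal ?r * ennreal (a powr p * (?V * R powr N)) + ennreal (growth_tail * a powr (p - 1) * ?r) * ennreal (a * (?V * R powr N)))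
       + ennreal ?c * (ennreal (a powr (p - 1) * ?r) * ennreal (a * (?V * R powr N)))"
      using c pos
      by (intro add_mono mult_mono mult_left_mono Wc p0 T W1 order_trans[OF X] ennreal_leI) auto
    also have "\<dots> = ennreal (?c * (?r * (a powr p * (?V * R powr N)) + growth_tail * a powr (p - 1) * ?r * (a * (?V * R powr N))) + ?c * (a powr (p - 1) * ?r * (a * (?V * R powr N))))"
      using c V_pos a growth_pos by (simp add: ennreal_mult[symmetric] ennreal_plus[symmetric] del: ennreal_plus V_pos)
    also have "?c * (?r * (a powr p * (?V * R powr N)) + growth_tail * a powr (p - 1) * ?r * (a * (?V * R powr N))) + ?c * (a powr (p - 1) * ?r * (a * (?V * R powr N)))
       = growth_up * a powr p * R powr (N - s * p)"
    proof -
      have "a powr p = a powr (p - 1) * a" using powr_split[of a] a by simp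
      moreover have "R powr (N - s * p) = R powr N * ?r" by (simp add: powr_add[symmetric])
      ultimately show ?thesis unfolding growth_up_def by (simp add: algebra_simps)
    qed
    finally show ?thesis .
  qed
  let ?S = "?B4 \<inter> {x. v x \<le> M - \<omega> / 2}"
  let ?W4 = "\<integral>\<^sup>+ x. ennreal (w x) * indicator ?B4 x \<partial>lborel"
  have lower_good: "ennreal (growth_low * \<omega> powr (p - 1) * ?r) * ?W4 \<le> ?Good"
  proof -
    \<comment> \<open>For x in the quarter ball with w x > 0 and y in \<open>?S\<close>: the gap k -
      v y is at least \<omega>/4, the distance at most R, and the cutoff is 1 at x.\<close>
    let ?d = "(\<omega> / 4) powr (p - 1) * R powr (- (N + s * p))"
    have inner: "ennreal (w x) * indicator ?B4 x * (ennreal ?d * emeasure lborel ?S)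
       \<le> (\<integral>\<^sup>+ y. ennreal (max (k - v y) 0 powr (p - 1) * (w x * ?\<eta> x powr p) * ker x y) \<partial>lborel)" for x
    proof (cases "x \<in> ?B4 \<and> w x \<noteq> 0")
      case True
      then have x: "x \<in> ?B4" "0 < w x" using w0[of x] by auto
      have eta: "?\<eta> x = 1" using x pos by (intro cutoff_one) (auto simp: dist_norm norm_minus_commute)
      have "ennreal (w x) * indicator ?B4 x * (ennreal ?d * emeasure lborel ?S) = ennreal (w x * ?d) * emeasure lborel ?S"
        using x by (simp add: ennreal_mult' mult.assoc)
      also have "\<dots> = (\<integral>\<^sup>+ y. ennreal (w x * ?d) * indicator ?S y \<partial>lborel)" by (subst nn_integral_cmult_indicator) auto
      also have "\<dots> \<le> (\<integral>\<^sup>+ y. ennreal (max (k - v y) 0 powr (p - 1) * (w x * ?\<eta> x powr p) * ker x y) \<partial>lborel)"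
      proof (intro nn_integral_mono)
        fix y
        show "ennreal (w x * ?d) * indicator ?S y \<le> ennreal (max (k - v y) 0 powr (p - 1) * (w x * ?\<eta> x powr p) * ker x y)"
        proof (cases "y \<in> ?S")
          case True
          have a4: "a \<le> \<omega> / 4" using kappa(2) pos mult_right_mono[of \<kappa> "1/4" \<omega>] by (simp add: a_def)
          have vy: "v y \<le> M - \<omega> / 2" using True by simp
          have "\<omega> / 4 \<le> k - v y" unfolding k_def using vy a4 by linarith
          then have d1: "\<omega> / 4 \<le> max (k - v y) 0" by (rule max.coboundedI1)
          have "M - a < v x" using x(2) by (auto simp: w_def k_def max_def split: if_splits)
          then have ne: "x \<noteq> y" using vy a4 pos by auto
          have "norm (x - y) \<le> R"
            using x(1) True norm_triangle_ineq4[of "x - x0" "y - x0"] pos by (simp add: dist_norm norm_minus_commute)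
          then have d2: "R powr (- (N + s * p)) \<le> ker x y"
            unfolding ker_def using ne N0 sp0 by (intro powr_minus_mono) auto
          have "(\<omega> / 4) powr (p - 1) * w x * R powr (- (N + s * p)) \<le> max (k - v y) 0 powr (p - 1) * w x * ker x y"
          proof (intro mult_mono d2 mult_nonneg_nonneg)
            show "(\<omega> / 4) powr (p - 1) \<le> max (k - v y) 0 powr (p - 1)"
              by (rule powr_mono2[OF _ _ d1]) (use pos p1 in auto)
          qed (use w0 in auto)
          then show ?thesis using True eta by (simp add: ennreal_leI mult_ac)
        qed simp
      qed
      finally show ?thesis .
    qed auto
    have "ennreal (growth_low * \<omega> powr (p - 1) * ?r) = ennreal ?d * ennreal (?V * (R / 4) powr N / 2)"
    proof -
      have "growth_low * \<omega> powr (p - 1) * ?r = ?d * (?V * (R / 4) powr N / 2)"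
      proof -
        have "R powr (- (N + s * p)) * R powr N = ?r" by (simp add: powr_add[symmetric])
        moreover have "(R / 4) powr N = R powr N * (1/4) powr N" "(\<omega> / 4) powr (p - 1) = \<omega> powr (p - 1) * (1/4) powr (p - 1)"
          using pos by (simp_all add: powr_divide)
        ultimately show ?thesis unfolding growth_low_def by (simp only:) (simp add: mult_ac)
      qed
      moreover have "ennreal ?d * ennreal (?V * (R / 4) powr N / 2) = ennreal (?d * (?V * (R / 4) powr N / 2))"
        using less_imp_le[OF V_pos] by (intro ennreal_mult[symmetric] mult_nonneg_nonneg divide_nonneg_pos) auto
      ultimately show ?thesis by (simp only:)
    qed
    also have "\<dots> \<le> ennreal ?d * emeasure lborel ?S" by (intro mult_left_mono half) simp
    finally have "ennreal (growth_low * \<omega> powr (p - 1) * ?r) * ?W4 \<le> ennreal ?d * emeasure lborel ?S * ?W4"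
      by (rule mult_right_mono) simp
    also have "\<dots> = (\<integral>\<^sup>+ x. ennreal (w x) * indicator ?B4 x * (ennreal ?d * emeasure lborel ?S) \<partial>lborel)"
      by (subst nn_integral_multc) (auto simp: mult.commute)
    also have "\<dots> \<le> ?Good" by (intro nn_integral_mono inner)
    finally show ?thesis .
  qed
  let ?b = "growth_up / growth_low * \<kappa> powr p * \<omega> * R powr N"
  \<comment> \<open>Comparing the two bounds for the cross term, \<omega>^(p-1) cancels against a^p
    = (\<kappa> \<omega>)^p and leaves \<kappa>^p \<omega>.\<close>
  have W4: "?W4 \<le> ennreal ?b"
  proof -
    let ?g = "growth_low * \<omega> powr (p - 1) * ?r"
    have g: "0 < ?g" using growth_pos pos by simp
    have "ennreal (1 / ?g) * (ennreal ?g * ?W4) \<le> ennreal (1 / ?g) * ennreal (growth_up * a powr p * R powr (N - s * p))"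
      by (intro mult_left_mono order_trans[OF lower_good upper_good]) simp
    also have "\<dots> = ennreal (1 / ?g * (growth_up * a powr p * R powr (N - s * p)))"
      using g growth_pos by (intro ennreal_mult[symmetric]) auto
    also have "1 / ?g * (growth_up * a powr p * R powr (N - s * p)) = ?b"
    proof -
      have "a powr p = \<kappa> powr p * (\<omega> powr (p - 1) * \<omega>)"
        using powr_split[of \<omega>] pos kappa by (simp add: a_def powr_mult)
      moreover have "R powr (N - s * p) = R powr N * ?r" by (simp add: powr_add[symmetric])
      ultimately show ?thesis using growth_pos pos by simp
    qed
    also have "ennreal (1 / ?g) * (ennreal ?g * ?W4) = ?W4"
    proof -
      have "ennreal (1 / ?g) * ennreal ?g = ennreal (1 / ?g * ?g)" using g by (intro ennreal_mult[symmetric]) auto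
      also have "1 / ?g * ?g = 1"
      proof -
        have "1 / c * c = 1" if "0 < c" for c :: real using that by simp
        from this[OF g] show ?thesis .
      qed
      finally show ?thesis by (simp add: mult.assoc[symmetric])
    qed
    finally show ?thesis .
  qed
  have "AE x in lborel. x \<in> ball x0 (R / 8) \<longrightarrow> v x \<le> k + a / 2"
  proof (rule de_giorgi_weak_sub[OF sub _ growth_pos(4), where \<tau>="growth_tail * a powr (p - 1)" and \<phi>="a powr (p - 1)"])
    have r8: "?r \<le> (R / 8) powr (- (s * p))" using pos sp0 by (intro powr_minus_mono) auto
    show "cball x0 (2 * (R / 8)) \<subseteq> \<Omega>" using dom pos by (auto simp: subset_iff)
    have "growth_tail * a powr (p - 1) * ?r \<le> growth_tail * a powr (p - 1) * (R / 8) powr (- (s * p))"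
      using r8 growth_pos by (intro mult_left_mono) auto
    from order_trans[OF T[of "R / 8"] ennreal_leI[OF this]]
    show "(\<integral>\<^sup>+ y. ennreal (max (v y - k) 0 powr (p - 1) * ker x0 y) * indicator (- ball x0 (R / 8)) y \<partial>lborel)
       \<le> ennreal (growth_tail * a powr (p - 1) * (R / 8) powr (- (s * p)))" by (simp add: w_def)
    show "AE x in lborel. x \<in> ball x0 (2 * (R / 8)) \<longrightarrow> F x \<le> a powr (p - 1) * (R / 8) powr (- (s * p))"
      using src
    proof eventually_elim
      case (elim x)
      have "a powr (p - 1) * ?r \<le> a powr (p - 1) * (R / 8) powr (- (s * p))" using r8 by (rule mult_left_mono) simp
      then show ?case using elim pos by (auto simp: a_def)
    qed
    show "growth_tail * a powr (p - 1) + a powr (p - 1) \<le> growth_K * (a / 2) powr (p - 1)"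
      using a by (simp add: growth_K_def powr_divide algebra_simps)
    \<comment> \<open>The doubled radius 2 (R/8) is R/4, where the mean of w was bounded; since w
      \<le> a there, w^p is at most a^(p-1) w.\<close>
    have "(\<integral>\<^sup>+ x. ennreal (max (v x - k) 0 powr p) * indicator (ball x0 (2 * (R / 8))) x \<partial>lborel)
       \<le> (\<integral>\<^sup>+ x. ennreal (a powr (p - 1)) * (ennreal (w x) * indicator ?B4 x) \<partial>lborel)"
    proof (intro nn_integral_mono_AE, use w_upper in eventually_elim)
      fix x assume up: "x \<in> ?B \<longrightarrow> w x \<le> a"
      show "ennreal (max (v x - k) 0 powr p) * indicator (ball x0 (2 * (R / 8))) x \<le> ennreal (a powr (p - 1)) * (ennreal (w x) * indicator ?B4 x)"
      proof (cases "x \<in> ?B4")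
        case True
        then have "w x \<le> a" using up pos by auto
        then have "w x powr (p - 1) * w x \<le> a powr (p - 1) * w x"
          using w0 p1 by (intro mult_right_mono powr_mono2) auto
        then have "w x powr p \<le> a powr (p - 1) * w x" using powr_split[OF w0[of x]] by simp
        then show ?thesis using True w0 by (auto simp: w_def ennreal_mult[symmetric] ennreal_leI)
      qed auto
    qed
    also have "\<dots> = ennreal (a powr (p - 1)) * ?W4" by (intro nn_integral_cmult) measurable
    also have "\<dots> \<le> ennreal (a powr (p - 1)) * ennreal ?b" by (intro mult_left_mono W4) simp
    also have "\<dots> = ennreal (a powr (p - 1) * ?b)" using growth_pos pos by (intro ennreal_mult[symmetric]) auto
    also have "\<dots> \<le> ennreal (dg_small caccioppoli_const growth_K * (R / 8) powr N * (a / 2) powr p)"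
    proof (rule ennreal_leI)
      have "\<kappa> powr p * \<omega> = \<kappa> powr (p - 1) * a" using powr_split[of \<kappa>] kappa by (simp add: a_def)
      then have "a powr (p - 1) * ?b = (growth_up / growth_low * \<kappa> powr (p - 1)) * (a powr (p - 1) * a) * R powr N"
        by (simp add: mult_ac)
      also have "a powr (p - 1) * a = a powr p" using powr_split[of a] a by simp
      also have "(growth_up / growth_low * \<kappa> powr (p - 1)) * a powr p * R powr N
         \<le> (dg_small caccioppoli_const growth_K * (1 / 8) powr N * (1 / 2) powr p) * a powr p * R powr N"
        by (intro mult_right_mono kappa(3)) auto
      also have "\<dots> = dg_small caccioppoli_const growth_K * (R / 8) powr N * (a / 2) powr p"
        using pos a by (simp add: powr_divide)
      finally show "a powr (p - 1) * ?b \<le> dg_small caccioppoli_const growth_K * (R / 8) powr N * (a / 2) powr p" .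
    qed
    finally show "(\<integral>\<^sup>+ x. ennreal (max (v x - k) 0 powr p) * indicator (ball x0 (2 * (R / 8))) x \<partial>lborel)
       \<le> ennreal (dg_small caccioppoli_const growth_K * (R / 8) powr N * (a / 2) powr p)" .
  qed (use a pos growth_pos in auto)
  then show ?thesis by eventually_elim (auto simp: k_def a_def mult.commute)
qed

end

subsection \<open>Local boundedness under critical growth\<close>

text \<open>The weighted mean inequality for f/A and g/B, integrated. It takes upper bounds for the
  two integrals, which is the form in which smallness and the Sobolev bound are available.\<close>

lemma nn_integral_hoelder:
  fixes f g :: "'a \<Rightarrow> real"
  assumes [measurable]: "f \<in> borel_measurable M" "g \<in> borel_measurable M" and nn: "\<And>x. 0 \<le> f x" "\<And>x. 0 \<le> g x"
    and A: "(\<integral>\<^sup>+ x. ennreal (f x) \<partial>M) \<le> ennreal A" "0 < A" and B: "(\<integral>\<^sup>+ x. ennreal (g x) \<partial>M) \<le> ennreal B" "0 < B"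
    and b: "0 < b" "b < 1"
  shows "(\<integral>\<^sup>+ x. ennreal (f x powr b * g x powr (1 - b)) \<partial>M) \<le> ennreal (A powr b * B powr (1 - b))"
proof -
  let ?c = "A powr b * B powr (1 - b)"
  have "(\<integral>\<^sup>+ x. ennreal (f x powr b * g x powr (1 - b)) \<partial>M)
     \<le> (\<integral>\<^sup>+ x. ennreal (?c * b / A) * ennreal (f x) + ennreal (?c * (1 - b) / B) * ennreal (g x) \<partial>M)"
  proof (intro nn_integral_mono)
    fix x
    have "(f x / A) powr b * (g x / B) powr (1 - b) \<le> b * (f x / A) + (1 - b) * (g x / B)"
    proof (cases "f x = 0 \<or> g x = 0")
      case True
      then show ?thesis using nn[of x] A B b by auto
    next
      case False
      then show ?thesis using nn[of x] A B b by (intro Youngs_inequality_0) (auto simp: order_less_le)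
    qed
    then have "?c * ((f x / A) powr b * (g x / B) powr (1 - b)) \<le> ?c * (b * (f x / A) + (1 - b) * (g x / B))"
      by (rule mult_left_mono) simp
    moreover have "?c * ((f x / A) powr b * (g x / B) powr (1 - b)) = f x powr b * g x powr (1 - b)"
      using nn[of x] A B by (simp add: powr_divide)
    ultimately have "f x powr b * g x powr (1 - b) \<le> (?c * b / A) * f x + (?c * (1 - b) / B) * g x"
      by (simp add: algebra_simps)
    then show "ennreal (f x powr b * g x powr (1 - b)) \<le> ennreal (?c * b / A) * ennreal (f x) + ennreal (?c * (1 - b) / B) * ennreal (g x)"
      using nn[of x] A B b by (simp add: ennreal_mult[symmetric] ennreal_plus[symmetric] ennreal_leI del: ennreal_plus)
  qed
  also have "\<dots> = ennreal (?c * b / A) * (\<integral>\<^sup>+ x. ennreal (f x) \<partial>M) + ennreal (?c * (1 - b) / B) * (\<integral>\<^sup>+ x. ennreal (g x) \<partial>M)"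
    by (simp add: nn_integral_add nn_integral_cmult)
  also have "\<dots> \<le> ennreal (?c * b / A) * ennreal A + ennreal (?c * (1 - b) / B) * ennreal B"
    using A B by (intro add_mono mult_left_mono) auto
  also have "\<dots> = ennreal (?c * b / A * A + ?c * (1 - b) / B * B)"
    using A B b by (simp add: ennreal_mult[symmetric] ennreal_plus[symmetric] del: ennreal_plus)
  also have "?c * b / A * A + ?c * (1 - b) / B * B = ?c"
  proof -
    have "c * b / A * A + c * (1 - b) / B * B = c" for c
    proof -
      have "c * b / A * A = c * b" "c * (1 - b) / B * B = c * (1 - b)" using A B by simp_all
      then show ?thesis by (simp only: distrib_left[symmetric]) simp
    qed
    then show ?thesis .
  qed
  finally show ?thesis .
qed

context fractional
begin

lemma beta_lt_1: "\<beta> < 1"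
  using spN N0 by simp

text \<open>A critical source has the homogeneity of the Sobolev inequality, so raising k gains no
  power. What becomes small is the integral of u^pst over {u > k}: by Hoelder and Sobolev the top
  part of the source is then at most half of the energy and is absorbed. The rest is linear in the
  truncation with a coefficient of order k^(pst - 1), which goes into \<open>K\<close>; the
  threshold of the iteration then scales in k exactly as the initial integral does.\<close>

theorem subsolution_upper_bound:
  fixes u F :: "real ^ 'n \<Rightarrow> real"
  assumes sub: "weak_sub \<Omega> u F" and u0: "\<And>x. 0 \<le> u x"
    and crit: "(\<integral>\<^sup>+ x. ennreal (u x powr pst) \<partial>lborel) < \<infinity>"
    and I1: "(\<integral>\<^sup>+ x. ennreal (u x powr (p - 1)) \<partial>lborel) < \<infinity>"
    and dom: "cball x0 (2 * r) \<subseteq> \<Omega>" and r: "0 < r"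
    and L: "0 \<le> \<Lambda>" and growth_F: "\<And>x. 1 \<le> u x \<Longrightarrow> F x \<le> \<Lambda> * u x powr (pst - 1)"
  obtains b where "AE x in lborel. x \<in> ball x0 r \<longrightarrow> u x \<le> b"
proof -
  have u[measurable]: "u \<in> borel_measurable borel" and F[measurable]: "F \<in> borel_measurable borel"
    and F0: "\<And>x. 0 \<le> F x" and Eu: "energy u < \<infinity>" using sub by (auto simp: weak_sub_def)
  let ?C = "caccioppoli_const"
  have C: "0 < ?C" by (rule caccioppoli_const_ge(3))
  obtain I where I: "(\<integral>\<^sup>+ x. ennreal (u x powr (p - 1)) \<partial>lborel) = ennreal I" "0 \<le> I"
    using I1 by (metis ennreal_cases infinity_ennreal_def less_irrefl)
  have pst1: "0 \<le> pst - 1" using pst_props(1) p1 by linarith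
  define G where "G = 2 powr (pst - 1)"
  have G: "0 < G" by (simp add: G_def)
  \<comment> \<open>The first summand pays for the tail, the second for the part of the source that
    stays bounded at levels up to 2 k; the 1 ensures D \<ge> 1.\<close>
  define D where "D = r powr (- N) * I + \<Lambda> * G * G * r powr (s * p) + 1"
  have D: "1 \<le> D" using I L G by (simp add: D_def)
  \<comment> \<open>\<delta>1 is the smallness needed for absorbing half of the energy; cD is the
    threshold of the iteration with the powers of k removed.\<close>
  define \<delta>1 where "\<delta>1 = (1 / (2 * (?C * \<Lambda> * G + 1) * sob_const)) powr (1 / \<beta>)"
  define cD where "cD = (dg_ratio / (dg_const (2 * ?C) * D)) powr (1 / \<beta>)"
  have CL: "0 \<le> ?C * \<Lambda> * G" using C L G by simp
  have d1: "0 < \<delta>1" using sob_const_pos CL by (simp add: \<delta>1_def add_nonneg_eq_0_iff)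
  have cD: "0 < cD" using dg_ratio(1) dg_const_pos[of "2 * ?C"] C D by (simp add: cD_def)
  define \<delta> where "\<delta> = min \<delta>1 (cD * r powr N)"
  have d: "0 < \<delta>" "\<delta> \<le> \<delta>1" "\<delta> \<le> cD * r powr N" using d1 cD r by (auto simp: \<delta>_def)
  have inv_beta: "(c powr (1 / \<beta>)) powr \<beta> = c" if "0 < c" for c
  proof -
    have "1 / c * c = 1" if "0 < c" for c :: real using that by simp
    from this[OF beta_pos] have "1 / \<beta> * \<beta> = 1" .
    then show ?thesis using that by (simp only: powr_powr powr_one)
  qed
  have d_beta: "?C * \<Lambda> * G * (\<delta> powr \<beta> * sob_const) \<le> 1 / 2"
  proof -
    have "\<delta> powr \<beta> \<le> \<delta>1 powr \<beta>" using d beta_pos by (intro powr_mono2) (auto intro: less_imp_le)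
    also have "\<dots> = 1 / (2 * (?C * \<Lambda> * G + 1) * sob_const)"
      unfolding \<delta>1_def using CL sob_const_pos by (intro inv_beta divide_pos_pos mult_pos_pos) auto
    finally have "(?C * \<Lambda> * G) * (\<delta> powr \<beta> * sob_const) \<le> (?C * \<Lambda> * G) * (1 / (2 * (?C * \<Lambda> * G + 1) * sob_const) * sob_const)"
      using CL sob_const_pos by (intro mult_left_mono mult_right_mono) auto
    also have "\<dots> = (?C * \<Lambda> * G) / (2 * (?C * \<Lambda> * G + 1))" using sob_const_pos by simp
    also have "\<dots> \<le> 1 / 2"
    proof -
      have "x / (2 * (x + 1)) \<le> 1 / 2" if "0 \<le> x" for x :: real using that by (simp add: field_simps)
      from this[OF CL] show ?thesis .
    qed
    finally show ?thesis .
  qed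
  have "(\<lambda>n. \<integral>\<^sup>+ x. ennreal (u x powr pst) * indicator {x. real n < u x} x \<partial>lborel) \<longlonglongrightarrow> (\<integral>\<^sup>+ x. 0 \<partial>(lborel :: (real^'n) measure))"
  proof (rule nn_integral_dominated_convergence[where w="\<lambda>x. ennreal (u x powr pst)"])
    show "AE x in lborel. (\<lambda>n. ennreal (u x powr pst) * indicator {x. real n < u x} x) \<longlonglongrightarrow> 0"
    proof (rule AE_I2)
      fix x
      obtain n :: nat where n: "u x \<le> real n" using real_arch_simple by blast
      have "eventually (\<lambda>m. 0 = ennreal (u x powr pst) * indicator {x. real m < u x} x) sequentially"
        using eventually_ge_at_top[of n] by eventually_elim (use n in \<open>auto simp: indicator_def\<close>)
      then show "(\<lambda>n. ennreal (u x powr pst) * indicator {x. real n < u x} x) \<longlonglongrightarrow> 0"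
        by (rule Lim_transform_eventually[OF tendsto_const])
    qed
  qed (use crit in \<open>auto simp: indicator_def\<close>)
  then have "\<forall>\<^sub>F n in sequentially. (\<integral>\<^sup>+ x. ennreal (u x powr pst) * indicator {x. real n < u x} x \<partial>lborel) < ennreal \<delta>"
    by (intro order_tendstoD(2)[where y=0]) (use d in auto)
  then have "\<forall>\<^sub>F n in sequentially. (\<integral>\<^sup>+ x. ennreal (u x powr pst) * indicator {x. real n < u x} x \<partial>lborel) < ennreal \<delta> \<and> 1 \<le> n"
    using eventually_ge_at_top[of "1::nat"] by (rule eventually_conj)
  then obtain n where n: "(\<integral>\<^sup>+ x. ennreal (u x powr pst) * indicator {x. real n < u x} x \<partial>lborel) < ennreal \<delta>" "1 \<le> n"
    by (metis (no_types, lifting) eventually_sequentially order_refl)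
  define k where "k = real n"
  have k: "1 \<le> k" using n by (simp add: k_def)
  define f where "f = (\<lambda>x. u x powr pst * indicator {x. k < u x} x)"
  have [measurable]: "f \<in> borel_measurable borel" unfolding f_def by measurable
  have f0: "0 \<le> f x" for x by (simp add: f_def)
  have fi: "(\<integral>\<^sup>+ x. ennreal (f x) \<partial>lborel) \<le> ennreal \<delta>"
  proof -
    have "(\<integral>\<^sup>+ x. ennreal (f x) \<partial>lborel) = (\<integral>\<^sup>+ x. ennreal (u x powr pst) * indicator {x. real n < u x} x \<partial>lborel)"
      by (intro nn_integral_cong) (auto simp: f_def k_def indicator_def)
    then show ?thesis using n by simp
  qed
  have pstp: "pst * \<beta> = pst - p" "pst * (1 - \<beta>) = p" using pst_props(3) by (simp_all add: right_diff_distrib)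
  define K where "K = D * k powr (pst - p)"
  have "1 * 1 \<le> D * k powr (pst - p)"
    using D k pst_props(1) by (intro mult_mono ge_one_powr_ge_zero) auto
  then have K: "1 \<le> K" by (simp add: K_def)
  have "AE x in lborel. x \<in> ball x0 r \<longrightarrow> u x \<le> k + k"
  proof (rule de_giorgi[OF u _ K _ r, where C="2 * ?C"])
    fix l \<rho> R assume l: "k \<le> l" "l \<le> k + k" and R: "r \<le> \<rho>" "\<rho> < R" "R \<le> 2 * r"
      and fin: "(\<integral>\<^sup>+ x. ennreal (max (u x - l) 0 powr p) * indicator (ball x0 R) x \<partial>lborel) < \<infinity>"
    define w where "w = (\<lambda>x. max (u x - l) 0)"
    have [measurable]: "w \<in> borel_measurable borel" unfolding w_def by measurable
    have w0: "0 \<le> w x" for x by (simp add: w_def)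
    have wu: "w x \<le> u x" for x using u0[of x] l k by (simp add: w_def)
    let ?\<eta> = "cutoff x0 \<rho> R"
    define g where "g = (\<lambda>x. w x * ?\<eta> x)"
    have [measurable]: "g \<in> borel_measurable borel" unfolding g_def by measurable
    have g0: "0 \<le> g x" for x unfolding g_def by (intro mult_nonneg_nonneg w0 cutoff_bounds)
    have eta0: "?\<eta> x = 0" if "x \<notin> ball x0 R" for x
      using that R by (intro cutoff_zero) (auto simp: dist_norm norm_minus_commute)
    let ?Wp = "\<integral>\<^sup>+ x. ennreal (w x powr p) * indicator (ball x0 R) x \<partial>lborel"
    let ?W1 = "\<integral>\<^sup>+ x. ennreal (w x) * indicator (ball x0 R) x \<partial>lborel"
    let ?T = "\<integral>\<^sup>+ y. ennreal (w y powr (p - 1) * ker x0 y) * indicator (- ball x0 R) y \<partial>lborel"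
    let ?X = "\<integral>\<^sup>+ x. ennreal (F x * (w x * ?\<eta> x powr p)) \<partial>lborel"
    let ?r = "r powr (- (s * p))"
    have Rpos: "0 < R" "0 < \<rho>" using R r by auto
    have "energy w \<le> energy u" by (rule energy_mono) (auto simp: w_def)
    then have Ew: "energy w < \<infinity>" using Eu by auto
    \<comment> \<open>Finite energy is what permits subtracting half of it in the
      absorption.\<close>
    have Eg: "energy g < \<infinity>"
      unfolding g_def
    proof (rule energy_mult_cutoff_finite[OF _ Ew, where ?x0.0=x0 and R=R and R'="(\<rho> + R) / 2" and L="2 / (R - \<rho>)"])
      show "(\<integral>\<^sup>+ x. ennreal (\<bar>w x\<bar> powr p) * indicator (ball x0 R) x \<partial>lborel) < \<infinity>" using fin w0 by (simp add: w_def)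
      show "\<bar>?\<eta> x - ?\<eta> y\<bar> \<le> 2 / (R - \<rho>) * norm (x - y)" for x y by (rule cutoff_lipschitz[OF R(2)])
    qed (use R Rpos in \<open>auto simp: cutoff_bounds intro!: cutoff_zero\<close>)
    then obtain e where e: "energy g = ennreal e" "0 \<le> e" by (metis ennreal_cases infinity_ennreal_def less_irrefl)
    define q where "q = R / (R - \<rho>)"
    have q: "1 \<le> q powr (N + p)" using R r N0 p0 by (intro ge_one_powr_ge_zero) (auto simp: q_def)
    let ?c = "?C * q powr (N + p)"
    have c: "0 \<le> ?c" "?C \<le> ?c" using C q by auto
    have cacc': "energy g \<le> ennreal ?c * (ennreal (R powr (- (s * p))) * ?Wp + ?T * ?W1) + ennreal ?C * ?X"
    proof -
      have "cball x0 R \<subseteq> \<Omega>" using dom R by (auto simp: subset_iff)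
      then have "energy g
         + (\<integral>\<^sup>+ x. \<integral>\<^sup>+ y. ennreal (max (l - u y) 0 powr (p - 1) * (w x * ?\<eta> x powr p) * ker x y) \<partial>lborel \<partial>lborel)
         \<le> ennreal ?c * (ennreal (R powr (- (s * p))) * ?Wp + ?T * ?W1) + ennreal ?C * ?X"
        using caccioppoli[OF sub Rpos(2) R(2), of x0 l] fin by (simp add: w_def q_def g_def)
      then show ?thesis by (rule order_trans[OF add_increasing2[OF zero_le order_refl]])
    qed
    have T: "?T \<le> ennreal (r powr (- N) * I * ?r)"
    proof -
      have "?T \<le> (\<integral>\<^sup>+ y. ennreal (r powr (- (N + s * p))) * ennreal (u y powr (p - 1)) \<partial>lborel)"
      proof (intro nn_integral_mono)
        fix y
        show "ennreal (w y powr (p - 1) * ker x0 y) * indicator (- ball x0 R) y \<le> ennreal (r powr (- (N + s * p))) * ennreal (u y powr (p - 1))"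
        proof (cases "y \<in> ball x0 R")
          case False
          then have "r \<le> norm (x0 - y)" using R by (simp add: dist_norm)
          then have "ker x0 y \<le> r powr (- (N + s * p))" unfolding ker_def using r N0 sp0 by (intro powr_minus_mono) auto
          moreover have "w y powr (p - 1) \<le> u y powr (p - 1)" using wu w0 p1 by (intro powr_mono2) auto
          ultimately have "w y powr (p - 1) * ker x0 y \<le> u y powr (p - 1) * r powr (- (N + s * p))" by (intro mult_mono) auto
          then show ?thesis using False by (simp add: ennreal_mult[symmetric] ennreal_leI mult.commute)
        qed simp
      qed
      also have "\<dots> = ennreal (r powr (- (N + s * p))) * ennreal I" by (subst nn_integral_cmult) (auto simp: I)
      also have "\<dots> = ennreal (r powr (- (N + s * p)) * I)" using I by (intro ennreal_mult[symmetric]) auto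
      also have "r powr (- (N + s * p)) = r powr (- N) * ?r" by (simp add: powr_add[symmetric])
      finally show ?thesis by (simp add: mult_ac)
    qed
    \<comment> \<open>The levels stay below 2 k, so up to the factor \<open>G\<close> this constant
      bounds the part of u^(pst - 1) that is not carried by w.\<close>
    define b where "b = (k + k) powr (pst - 1)"
    have b: "0 \<le> b" "b = G * k powr (pst - 1)"
      using k by (simp_all add: b_def G_def powr_mult[symmetric])
    let ?Z = "\<integral>\<^sup>+ x. ennreal (f x powr \<beta> * (g x powr pst) powr (1 - \<beta>)) \<partial>lborel"
    have X: "?X \<le> ennreal (\<Lambda> * G) * ?Z + ennreal (\<Lambda> * G * b) * ?W1"
    proof -
      have "?X \<le> (\<integral>\<^sup>+ x. ennreal (\<Lambda> * G) * ennreal (f x powr \<beta> * (g x powr pst) powr (1 - \<beta>))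
            + ennreal (\<Lambda> * G * b) * (ennreal (w x) * indicator (ball x0 R) x) \<partial>lborel)"
      proof (intro nn_integral_mono)
        fix x
        show "ennreal (F x * (w x * ?\<eta> x powr p)) \<le> ennreal (\<Lambda> * G) * ennreal (f x powr \<beta> * (g x powr pst) powr (1 - \<beta>))
            + ennreal (\<Lambda> * G * b) * (ennreal (w x) * indicator (ball x0 R) x)"
        proof (cases "w x = 0 \<or> x \<notin> ball x0 R")
          case True
          then show ?thesis using eta0[of x] p0 by auto
        next
          case False
          then have xb: "x \<in> ball x0 R" and wx: "0 < w x" using w0[of x] by auto
          then have ux: "u x = w x + l" "k < u x" using l by (auto simp: w_def max_def split: if_splits)
          have Fx: "F x \<le> \<Lambda> * u x powr (pst - 1)" using ux k by (intro growth_F) auto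
          have "u x powr (pst - 1) \<le> G * (w x powr (pst - 1) + l powr (pst - 1))"
            unfolding ux(1) G_def using wx l k pst1 by (intro add_powr_le) auto
          also have "\<dots> \<le> G * (w x powr (pst - 1) + b)"
            unfolding b_def using l k pst1 G by (intro mult_left_mono add_left_mono powr_mono2) auto
          finally have "\<Lambda> * u x powr (pst - 1) \<le> \<Lambda> * (G * (w x powr (pst - 1) + b))" using L by (rule mult_left_mono)
          then have "F x * (w x * ?\<eta> x powr p) \<le> \<Lambda> * (G * (w x powr (pst - 1) + b)) * (w x * ?\<eta> x powr p)"
            using Fx w0 by (intro mult_right_mono) auto
          also have "\<dots> = \<Lambda> * G * (w x powr (pst - 1) * w x * ?\<eta> x powr p) + \<Lambda> * G * b * (w x * ?\<eta> x powr p)"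
            by (simp add: algebra_simps)
          also have "\<dots> \<le> \<Lambda> * G * (f x powr \<beta> * (g x powr pst) powr (1 - \<beta>)) + \<Lambda> * G * b * (w x * 1)"
          proof (intro add_mono mult_left_mono cutoff_powr_le_one)
            \<comment> \<open>The pst powers split into pst - p, which are passed to u and
              controlled by \<open>f\<close>, and p, which together with \<eta>^p form the p-th
              power of g.\<close>
            have "w x powr (pst - 1) * w x = w x powr (pst - p) * w x powr p"
              using wx powr_mult_base[of "w x" "pst - 1"] by (simp add: powr_add[symmetric] mult.commute)
            then have "w x powr (pst - 1) * w x * ?\<eta> x powr p = w x powr (pst - p) * g x powr p"
              using wx cutoff_bounds by (simp add: g_def powr_mult mult.assoc)
            also have "\<dots> \<le> u x powr (pst - p) * g x powr p"
              using wu wx pst_props(1) by (intro mult_right_mono powr_mono2) auto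
            also have "u x powr (pst - p) = f x powr \<beta>"
              using ux(2) by (simp only: f_def powr_powr pstp indicator_simps mem_Collect_eq mult_1_right)
            also have "g x powr p = (g x powr pst) powr (1 - \<beta>)" by (simp only: powr_powr pstp)
            finally show "w x powr (pst - 1) * w x * ?\<eta> x powr p \<le> f x powr \<beta> * (g x powr pst) powr (1 - \<beta>)" .
          qed (use L G b w0 in auto)
          finally have "F x * (w x * ?\<eta> x powr p) \<le> \<Lambda> * G * (f x powr \<beta> * (g x powr pst) powr (1 - \<beta>)) + \<Lambda> * G * b * w x" by simp
          then have "ennreal (F x * (w x * ?\<eta> x powr p)) \<le> ennreal (\<Lambda> * G * (f x powr \<beta> * (g x powr pst) powr (1 - \<beta>)) + \<Lambda> * G * b * w x)"
            by (rule ennreal_leI)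
          also have "\<dots> = ennreal (\<Lambda> * G) * ennreal (f x powr \<beta> * (g x powr pst) powr (1 - \<beta>)) + ennreal (\<Lambda> * G * b) * ennreal (w x)"
            using L G b w0 by (subst ennreal_plus) (auto simp: ennreal_mult intro!: mult_nonneg_nonneg)
          finally show ?thesis using xb by simp
        qed
      qed
      also have "\<dots> = ennreal (\<Lambda> * G) * ?Z + ennreal (\<Lambda> * G * b) * ?W1"
        by (subst nn_integral_add, measurable, subst nn_integral_cmult, measurable, subst nn_integral_cmult, measurable)
      finally show ?thesis .
    qed
    define A where "A = ennreal ?c * (ennreal (R powr (- (s * p))) * ?Wp + ?T * ?W1) + ennreal (?C * (\<Lambda> * G * b)) * ?W1"
    \<comment> \<open>Everything except the absorbed half is \<open>A\<close>; the doubling of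
      \<open>A\<close> is why the iteration runs with constant 2 C.\<close>
    have absorbed: "energy g \<le> A + A"
    proof (cases "e = 0")
      case True
      then show ?thesis using e by simp
    next
      case False
      then have e0: "0 < e" using e by simp
      have "(\<integral>\<^sup>+ x. ennreal (g x powr pst) \<partial>lborel) \<le> ennreal ((sob_const * e) powr (N / (N - s * p)))"
        using e g0 by (intro sobolev[where S="ball x0 R"]) (auto simp: g_def eta0)
      then have "?Z \<le> ennreal (\<delta> powr \<beta> * ((sob_const * e) powr (N / (N - s * p))) powr (1 - \<beta>))"
        using f0 fi d e0 sob_const_pos beta_pos beta_lt_1 by (intro nn_integral_hoelder) auto
      also have "((sob_const * e) powr (N / (N - s * p))) powr (1 - \<beta>) = sob_const * e"
      proof -
        have "N / (N - s * p) * (1 - \<beta>) = 1" using spN N0 by (simp add: field_simps)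
        moreover have "0 < sob_const * e" using sob_const_pos e0 by (rule mult_pos_pos)
        ultimately show ?thesis by (simp only: powr_powr powr_one less_imp_le)
      qed
      finally have Z: "?Z \<le> ennreal (\<delta> powr \<beta> * (sob_const * e))" .
      have "ennreal ?C * ?X \<le> ennreal ?C * (ennreal (\<Lambda> * G) * ennreal (\<delta> powr \<beta> * (sob_const * e)) + ennreal (\<Lambda> * G * b) * ?W1)"
        by (intro mult_left_mono order_trans[OF X] add_right_mono Z) auto
      also have "\<dots> = ennreal (?C * \<Lambda> * G * (\<delta> powr \<beta> * (sob_const * e))) + ennreal (?C * (\<Lambda> * G * b)) * ?W1"
      proof -
        have "ennreal ?C * (ennreal (\<Lambda> * G) * ennreal (\<delta> powr \<beta> * (sob_const * e))) = ennreal (?C * \<Lambda> * G * (\<delta> powr \<beta> * (sob_const * e)))"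
          using C L G sob_const_pos e0 by (simp add: ennreal_mult[symmetric] mult.assoc)
        moreover have "ennreal ?C * (ennreal (\<Lambda> * G * b) * ?W1) = ennreal (?C * (\<Lambda> * G * b)) * ?W1"
          using C L G b by (subst ennreal_mult) (auto simp: mult.assoc)
        ultimately show ?thesis by (simp only: distrib_left)
      qed
      also have "\<dots> \<le> ennreal (e / 2) + ennreal (?C * (\<Lambda> * G * b)) * ?W1"
      proof (intro add_right_mono ennreal_leI)
        show "?C * \<Lambda> * G * (\<delta> powr \<beta> * (sob_const * e)) \<le> e / 2"
          using mult_right_mono[OF d_beta e(2)] by (simp add: mult_ac)
      qed
      finally have "energy g \<le> ennreal ?c * (ennreal (R powr (- (s * p))) * ?Wp + ?T * ?W1) + (ennreal (e / 2) + ennreal (?C * (\<Lambda> * G * b)) * ?W1)"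
        using cacc' by (meson add_left_mono order_trans)
      also have "\<dots> = A + ennreal (e / 2)" by (simp add: A_def add_ac)
      finally have "ennreal (e / 2) + ennreal (e / 2) \<le> ennreal (e / 2) + A"
        using e e0 by (simp add: ennreal_plus[symmetric] add.commute del: ennreal_plus)
      then have h: "ennreal (e / 2) \<le> A" by (simp add: ennreal_add_left_cancel_le)
      have "energy g = ennreal (e / 2) + ennreal (e / 2)" using e e0 by (simp add: ennreal_plus[symmetric] del: ennreal_plus)
      then show ?thesis using h by (simp add: add_mono)
    qed
    have A_le: "A \<le> ennreal (?c * ?r) * (?Wp + ennreal (K * k powr (p - 1)) * ?W1)"
    proof -
      have "A \<le> ennreal ?c * (ennreal ?r * ?Wp + ennreal (r powr (- N) * I * ?r) * ?W1) + ennreal (?c * (\<Lambda> * G * b)) * ?W1"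
        unfolding A_def
      proof (intro add_mono mult_left_mono mult_right_mono T ennreal_leI)
        show "R powr (- (s * p)) \<le> ?r" using R r sp0 by (intro powr_minus_mono) auto
      qed (use c L G b in auto)
      also have "ennreal (?c * (\<Lambda> * G * b)) = ennreal ?c * ennreal (\<Lambda> * G * b * r powr (s * p) * ?r)"
        using c L G b r by (simp add: ennreal_mult[symmetric] powr_minus)
      also have "ennreal ?c * (ennreal ?r * ?Wp + ennreal (r powr (- N) * I * ?r) * ?W1) + ennreal ?c * ennreal (\<Lambda> * G * b * r powr (s * p) * ?r) * ?W1
         = ennreal ?c * (ennreal ?r * ?Wp + (ennreal (r powr (- N) * I * ?r) + ennreal (\<Lambda> * G * b * r powr (s * p) * ?r)) * ?W1)"
        by (simp only: distrib_left distrib_right mult.assoc add.assoc)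
      also have "ennreal (r powr (- N) * I * ?r) + ennreal (\<Lambda> * G * b * r powr (s * p) * ?r) = ennreal ?r * ennreal (r powr (- N) * I + \<Lambda> * G * b * r powr (s * p))"
        using I L G b by (simp add: ennreal_mult[symmetric] ennreal_plus[symmetric] algebra_simps del: ennreal_plus)
      also have "ennreal ?c * (ennreal ?r * ?Wp + ennreal ?r * ennreal (r powr (- N) * I + \<Lambda> * G * b * r powr (s * p)) * ?W1)
         = ennreal ?c * ennreal ?r * (?Wp + ennreal (r powr (- N) * I + \<Lambda> * G * b * r powr (s * p)) * ?W1)"
        by (simp only: distrib_left mult.assoc)
      also have "\<dots> \<le> ennreal ?c * ennreal ?r * (?Wp + ennreal (K * k powr (p - 1)) * ?W1)"
      proof (intro mult_left_mono add_left_mono mult_right_mono ennreal_leI)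
        have kk: "1 \<le> k powr (pst - 1)" using k pst1 by (intro ge_one_powr_ge_zero) auto
        have "r powr (- N) * I * 1 \<le> r powr (- N) * I * k powr (pst - 1)" using I kk by (intro mult_left_mono) auto
        then have "r powr (- N) * I + \<Lambda> * G * b * r powr (s * p) \<le> r powr (- N) * I * k powr (pst - 1) + \<Lambda> * G * b * r powr (s * p) + k powr (pst - 1)"
          using kk by linarith
        also have "\<dots> = D * k powr (pst - 1)" by (simp add: D_def b(2) algebra_simps)
        also have "\<dots> = K * k powr (p - 1)" by (simp add: K_def powr_add[symmetric])
        finally show "r powr (- N) * I + \<Lambda> * G * b * r powr (s * p) \<le> K * k powr (p - 1)" .
      qed auto
      also have "ennreal ?c * ennreal ?r = ennreal (?c * ?r)" using c by (intro ennreal_mult[symmetric]) auto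
      finally show ?thesis .
    qed
    have "energy g \<le> ennreal (?c * ?r) * (?Wp + ennreal (K * k powr (p - 1)) * ?W1) + ennreal (?c * ?r) * (?Wp + ennreal (K * k powr (p - 1)) * ?W1)"
      using absorbed add_mono[OF A_le A_le] by (rule order_trans)
    also have "\<dots> = (ennreal (?c * ?r) + ennreal (?c * ?r)) * (?Wp + ennreal (K * k powr (p - 1)) * ?W1)" by (simp only: distrib_right)
    also have "ennreal (?c * ?r) + ennreal (?c * ?r) = ennreal (?c * ?r + ?c * ?r)"
      using c C by (intro ennreal_plus[symmetric] mult_nonneg_nonneg) auto
    also have "?c * ?r + ?c * ?r = 2 * ?C * q powr (N + p) * ?r" by (simp only: mult_2 mult.assoc distrib_right)
    finally show "energy (\<lambda>x. max (u x - l) 0 * ?\<eta> x) \<le> ennreal (2 * ?C * (R / (R - \<rho>)) powr (N + p) * ?r) *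
         ((\<integral>\<^sup>+ x. ennreal (max (u x - l) 0 powr p) * indicator (ball x0 R) x \<partial>lborel)
          + ennreal (K * k powr (p - 1)) * (\<integral>\<^sup>+ x. ennreal (max (u x - l) 0) * indicator (ball x0 R) x \<partial>lborel))"
      by (simp add: g_def w_def q_def)
  next
    have "(\<integral>\<^sup>+ x. ennreal (max (u x - k) 0 powr p) * indicator (ball x0 (2 * r)) x \<partial>lborel)
       \<le> (\<integral>\<^sup>+ x. ennreal (k powr (p - pst)) * ennreal (f x) \<partial>lborel)"
    proof (intro nn_integral_mono)
      fix x
      show "ennreal (max (u x - k) 0 powr p) * indicator (ball x0 (2 * r)) x \<le> ennreal (k powr (p - pst)) * ennreal (f x)"
      proof (cases "k < u x")
        case True
        have "max (u x - k) 0 powr p \<le> u x powr p" using True k p0 by (intro powr_mono2) auto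
        also have "u x powr p = u x powr (p - pst) * u x powr pst" by (simp add: powr_add[symmetric])
        also have "\<dots> \<le> k powr (p - pst) * u x powr pst"
          using True k pst_props(1) by (intro mult_right_mono powr_mono2') auto
        finally show ?thesis using True by (auto simp: f_def indicator_def ennreal_mult[symmetric] intro!: ennreal_leI)
      qed (use p0 in auto)
    qed
    also have "\<dots> = ennreal (k powr (p - pst)) * (\<integral>\<^sup>+ x. ennreal (f x) \<partial>lborel)" by (intro nn_integral_cmult) measurable
    also have "\<dots> \<le> ennreal (k powr (p - pst)) * ennreal (cD * r powr N)"
      using d fi by (intro mult_left_mono order_trans[OF fi] ennreal_leI) auto
    also have "\<dots> = ennreal (k powr (p - pst) * (cD * r powr N))" using cD by (intro ennreal_mult[symmetric]) auto
    \<comment> \<open>The scalings meet here: K grows like k^(pst - p) = k^(pst \<beta>), so the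
      threshold carries k^(-pst), matching the Chebyshev factor k^(p - pst) over k^p.\<close>
    also have "k powr (p - pst) * (cD * r powr N) = dg_small (2 * ?C) K * r powr N * k powr p"
    proof -
      have "dg_small (2 * ?C) K = (dg_ratio / (dg_const (2 * ?C) * D) * k powr (- (pst - p))) powr (1 / \<beta>)"
        unfolding dg_small_def K_def powr_minus_divide by (simp only: times_divide_eq_right mult_1_right divide_divide_eq_left mult.assoc)
      also have "\<dots> = cD * (k powr (- (pst - p))) powr (1 / \<beta>)" unfolding cD_def by (rule powr_mult)
      also have "(k powr (- (pst - p))) powr (1 / \<beta>) = k powr (- pst)"
      proof -
        have "- (pst * c) * (1 / c) = - pst" if "0 < c" for c :: real using that by simp
        from this[OF beta_pos] have "- (pst - p) * (1 / \<beta>) = - pst" unfolding pstp(1)[symmetric] .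
        then show ?thesis by (simp only: powr_powr)
      qed
      moreover have "k powr (p - pst) = k powr (- pst) * k powr p" by (simp add: powr_add[symmetric])
      ultimately show ?thesis by (simp add: mult_ac)
    qed
    finally show "(\<integral>\<^sup>+ x. ennreal (max (u x - k) 0 powr p) * indicator (ball x0 (2 * r)) x \<partial>lborel)
       \<le> ennreal (dg_small (2 * ?C) K * r powr N * k powr p)" .
  qed (use C k in auto)
  then show ?thesis using that by blast
qed

end

subsection \<open>Decay of oscillation\<close>

text \<open>The factor g on the right is the point: it makes the tail of a barrier of exponent g
  small with g. It follows from 1 - g L \<le> exp(- g L) and L \<le> (2/e) exp(e L / 2) with L = ln
  t.\<close>

lemma powr_minus_one_le:
  fixes t g e :: real
  assumes t: "1 \<le> t" and g: "0 \<le> g" "g \<le> e / 2" and e: "0 < e"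
  shows "t powr g - 1 \<le> (2 * g / e) * t powr e"
proof -
  define L where "L = ln t"
  have L: "0 \<le> L" using t by (simp add: L_def)
  have tp: "t powr c = exp (c * L)" for c using t by (simp add: powr_def L_def)
  have "1 - g * L \<le> exp (- (g * L))" using exp_ge_add_one_self[of "- (g * L)"] by simp
  then have "exp (g * L) * (1 - g * L) \<le> exp (g * L) * exp (- (g * L))" by (intro mult_left_mono) auto
  then have "exp (g * L) - 1 \<le> g * L * exp (g * L)" by (simp add: exp_minus algebra_simps)
  also have "\<dots> \<le> g * (2 / e * exp (e / 2 * L)) * exp (e / 2 * L)"
  proof (intro mult_mono)
    have "e / 2 * L \<le> exp (e / 2 * L)" using exp_ge_add_one_self[of "e / 2 * L"] by linarith
    then show "L \<le> 2 / e * exp (e / 2 * L)" using e by (simp add: field_simps)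
    show "exp (g * L) \<le> exp (e / 2 * L)" unfolding exp_le_cancel_iff by (rule mult_right_mono[OF g(2) L])
  qed (use g L e in auto)
  also have "\<dots> = (2 * g / e) * exp (e * L)" by (simp add: exp_add[symmetric] mult.assoc)
  finally show ?thesis by (simp add: tp)
qed

context fractional
begin

text \<open>Growth of this exponent, raised to the power p - 1, has exponent s p / 2: it uses up
  half of the decay of the kernel and leaves a convergent tail.\<close>

definition tail_exp :: real where "tail_exp = s * p / (2 * (p - 1))"

definition osc_tail :: real where "osc_tail = 2 powr (p - 1) * (8 powr (s * p / 2) * tail_const TYPE('n) (s * p / 2))"

definition hoelder_exp :: "real \<Rightarrow> bool" where
  "hoelder_exp \<gamma> \<longleftrightarrow> 0 < \<gamma> \<and> \<gamma> \<le> s \<and> \<gamma> \<le> tail_exp / 2 \<and> 1 - \<kappa> / 2 \<le> 8 powr (- \<gamma>) \<and>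
     osc_tail * (2 * \<gamma> / tail_exp) powr (p - 1) \<le> \<kappa> powr (p - 1) / 2"

lemma tail_exp_pos: "0 < tail_exp"
  unfolding tail_exp_def using sp0 p1 by simp

lemma osc_tail_pos: "0 < osc_tail"
  unfolding osc_tail_def using tail_const_pos[of "s * p / 2", where 'n='n] sp0 by simp

lemma ex_hoelder_exp: "\<exists>\<gamma>. hoelder_exp \<gamma>"
proof -
  define g1 where "g1 = - log 8 (1 - \<kappa> / 2)"
  have k: "0 < 1 - \<kappa> / 2" "1 - \<kappa> / 2 < 1" using kappa by auto
  have g1: "0 < g1" using k by (simp add: g1_def)
  define c where "c = (\<kappa> powr (p - 1) / 2 / osc_tail) powr (1 / (p - 1))"
  have c: "0 < c" using kappa osc_tail_pos by (simp add: c_def)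
  have cp: "c powr (p - 1) = \<kappa> powr (p - 1) / 2 / osc_tail"
  proof -
    have "(a powr (1 / (p - 1))) powr (p - 1) = a" if "0 < a" for a :: real using that p1 by (simp add: powr_powr)
    moreover have "0 < \<kappa> powr (p - 1) / 2 / osc_tail" using kappa osc_tail_pos by simp
    ultimately show ?thesis unfolding c_def by blast
  qed
  define \<gamma> where "\<gamma> = min (min s (tail_exp / 2)) (min g1 (c * tail_exp / 2))"
  have g: "0 < \<gamma>" "\<gamma> \<le> s" "\<gamma> \<le> tail_exp / 2" "\<gamma> \<le> g1" "\<gamma> \<le> c * tail_exp / 2"
    using s0 tail_exp_pos g1 c by (auto simp: \<gamma>_def)
  have "1 - \<kappa> / 2 = 8 powr (- g1)" using k by (simp add: g1_def)
  also have "\<dots> \<le> 8 powr (- \<gamma>)" using g by (intro powr_mono) auto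
  finally have 1: "1 - \<kappa> / 2 \<le> 8 powr (- \<gamma>)" .
  have "2 * \<gamma> / tail_exp \<le> c" using g(5) tail_exp_pos by (simp add: field_simps)
  then have "(2 * \<gamma> / tail_exp) powr (p - 1) \<le> c powr (p - 1)" using g tail_exp_pos p1 by (intro powr_mono2) auto
  then have "osc_tail * (2 * \<gamma> / tail_exp) powr (p - 1) \<le> osc_tail * (\<kappa> powr (p - 1) / 2 / osc_tail)"
    using osc_tail_pos unfolding cp by (intro mult_left_mono) auto
  also have "\<dots> = \<kappa> powr (p - 1) / 2" using osc_tail_pos by simp
  finally show ?thesis using g 1 by (auto simp: hoelder_exp_def)
qed

lemma barrier_tail_le:
  fixes d u :: "real ^ 'n \<Rightarrow> real"
  assumes g: "hoelder_exp \<gamma>" and pos: "0 < R" "0 < \<omega>" "0 < r0" and d0: "\<And>y. 0 \<le> d y" and u0: "\<And>y. 0 \<le> u y"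
    and u[measurable]: "u \<in> borel_measurable borel"
    and le: "AE y in lborel. R \<le> norm (x0 - y) \<longrightarrow>
       d y \<le> \<omega> * ((8 * norm (x0 - y) / R) powr \<gamma> - 1) + (if r0 \<le> norm (x0 - y) then u y else 0)"
    and I: "(\<integral>\<^sup>+ y. ennreal (u y powr (p - 1)) \<partial>lborel) \<le> ennreal I" "0 \<le> I"
    and small: "2 powr p * (r0 powr (- (N + s * p)) * I) \<le> (\<kappa> * \<omega>) powr (p - 1) * R powr (- (s * p))"
  shows "(\<integral>\<^sup>+ y. ennreal (d y powr (p - 1) * ker x0 y) * indicator (- ball x0 R) y \<partial>lborel)
      \<le> ennreal ((\<kappa> * \<omega>) powr (p - 1) * R powr (- (s * p)))"
proof -
  let ?e = "tail_exp" and ?sp2 = "s * p / 2"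
  have gg: "0 < \<gamma>" "\<gamma> \<le> ?e / 2" "osc_tail * (2 * \<gamma> / ?e) powr (p - 1) \<le> \<kappa> powr (p - 1) / 2"
    using g by (auto simp: hoelder_exp_def)
  let ?a = "2 powr (p - 1) * (\<omega> powr (p - 1) * (2 * \<gamma> / ?e) powr (p - 1) * (8 / R) powr ?sp2)"
  let ?b = "2 powr (p - 1) * r0 powr (- (N + s * p))"
  let ?k2 = "\<lambda>y. indicator {y. R \<le> norm (x0 - y)} y * norm (x0 - y) powr (- (N + ?sp2))"
  have tc: "0 < tail_const TYPE('n) ?sp2" using sp0 by (intro tail_const_pos) auto
  have set_m[measurable]: "{y. R \<le> norm (x0 - y)} \<in> sets borel" by (intro borel_closed closed_Collect_le continuous_intros)
  have "(\<integral>\<^sup>+ y. ennreal (d y powr (p - 1) * ker x0 y) * indicator (- ball x0 R) y \<partial>lborel)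
     \<le> (\<integral>\<^sup>+ y. ennreal ?a * ennreal (?k2 y) + ennreal ?b * ennreal (u y powr (p - 1)) \<partial>lborel)"
  proof (intro nn_integral_mono_AE, use le in eventually_elim)
    fix y
    let ?n = "norm (x0 - y)"
    assume H: "R \<le> ?n \<longrightarrow> d y \<le> \<omega> * ((8 * ?n / R) powr \<gamma> - 1) + (if r0 \<le> ?n then u y else 0)"
    show "ennreal (d y powr (p - 1) * ker x0 y) * indicator (- ball x0 R) y \<le> ennreal ?a * ennreal (?k2 y) + ennreal ?b * ennreal (u y powr (p - 1))"
    proof (cases "y \<in> ball x0 R")
      case False
      then have n: "R \<le> ?n" by (simp add: dist_norm)
      define U where "U = (if r0 \<le> ?n then u y else 0)"
      have U0: "0 \<le> U" using u0 by (simp add: U_def)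
      define t where "t = 8 * ?n / R"
      have t: "1 \<le> t" using n pos by (simp add: t_def field_simps)
      have "d y \<le> \<omega> * (t powr \<gamma> - 1) + U" using H n by (simp add: U_def t_def)
      also have "\<dots> \<le> \<omega> * ((2 * \<gamma> / ?e) * t powr ?e) + U"
        using powr_minus_one_le[OF t _ gg(2) tail_exp_pos] gg pos by (intro add_right_mono mult_left_mono) auto
      finally have "d y powr (p - 1) \<le> (\<omega> * ((2 * \<gamma> / ?e) * t powr ?e) + U) powr (p - 1)"
        using d0 p1 by (intro powr_mono2) auto
      also have "\<dots> \<le> 2 powr (p - 1) * ((\<omega> * ((2 * \<gamma> / ?e) * t powr ?e)) powr (p - 1) + U powr (p - 1))"
        using U0 pos gg tail_exp_pos p1 by (intro add_powr_le mult_nonneg_nonneg) auto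
      also have "(\<omega> * ((2 * \<gamma> / ?e) * t powr ?e)) powr (p - 1) = \<omega> powr (p - 1) * (2 * \<gamma> / ?e) powr (p - 1) * (8 / R) powr ?sp2 * ?n powr ?sp2"
      proof -
        have "a / (2 * c) * c = a / 2" if "0 < c" for a c :: real using that by simp
        from this[of "p - 1" "s * p"] have "?e * (p - 1) = ?sp2" using p1 by (simp only: tail_exp_def diff_gt_0_iff_gt)
        then have "(t powr ?e) powr (p - 1) = t powr ?sp2" by (simp only: powr_powr)
        moreover have "t powr ?sp2 = (8 / R) powr ?sp2 * ?n powr ?sp2"
          unfolding t_def using pos by (simp add: powr_mult[symmetric])
        ultimately show ?thesis by (simp only: powr_mult mult.assoc)
      qed
      finally have "d y powr (p - 1) * ker x0 y \<le> 2 powr (p - 1) * (\<omega> powr (p - 1) * (2 * \<gamma> / ?e) powr (p - 1) * (8 / R) powr ?sp2 * ?n powr ?sp2 + U powr (p - 1)) * ker x0 y"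
        by (rule mult_right_mono) simp
      also have "\<dots> = ?a * (?n powr ?sp2 * ker x0 y) + 2 powr (p - 1) * (U powr (p - 1) * ker x0 y)"
        by (simp add: algebra_simps)
      also have "?n powr ?sp2 * ker x0 y = ?k2 y"
        using n by (simp add: ker_def powr_add[symmetric] add_divide_distrib[symmetric] algebra_simps)
      also have "2 powr (p - 1) * (U powr (p - 1) * ker x0 y) \<le> 2 powr (p - 1) * (u y powr (p - 1) * r0 powr (- (N + s * p)))"
      proof (intro mult_left_mono)
        show "U powr (p - 1) * ker x0 y \<le> u y powr (p - 1) * r0 powr (- (N + s * p))"
        proof (cases "r0 \<le> ?n")
          case True
          then have "ker x0 y \<le> r0 powr (- (N + s * p))" unfolding ker_def using pos N0 sp0 by (intro powr_minus_mono) auto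
          then show ?thesis using True by (simp add: U_def mult_left_mono)
        qed (use p1 in \<open>simp add: U_def\<close>)
      qed simp
      finally have "d y powr (p - 1) * ker x0 y \<le> ?a * ?k2 y + ?b * u y powr (p - 1)" by (simp add: mult_ac)
      then have "ennreal (d y powr (p - 1) * ker x0 y) \<le> ennreal (?a * ?k2 y + ?b * u y powr (p - 1))" by (rule ennreal_leI)
      also have "\<dots> = ennreal ?a * ennreal (?k2 y) + ennreal ?b * ennreal (u y powr (p - 1))"
        by (subst ennreal_plus) (auto simp: ennreal_mult)
      finally show ?thesis using False by simp
    qed simp
  qed
  also have "\<dots> = ennreal ?a * (\<integral>\<^sup>+ y. ennreal (?k2 y) \<partial>lborel) + ennreal ?b * (\<integral>\<^sup>+ y. ennreal (u y powr (p - 1)) \<partial>lborel)"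
    by (subst nn_integral_add, measurable, subst nn_integral_cmult, measurable, subst nn_integral_cmult, measurable)
  also have "\<dots> \<le> ennreal ?a * ennreal (tail_const TYPE('n) ?sp2 * R powr (- ?sp2)) + ennreal ?b * ennreal I"
    using kernel_tail_le[of ?sp2 R x0] sp0 pos I by (intro add_mono mult_left_mono) (auto simp: N_def)
  also have "\<dots> = ennreal (?a * (tail_const TYPE('n) ?sp2 * R powr (- ?sp2)) + ?b * I)"
    using tc I by (simp add: ennreal_mult[symmetric] ennreal_plus[symmetric] del: ennreal_plus)
  also have "\<dots> \<le> ennreal ((\<kappa> * \<omega>) powr (p - 1) * R powr (- (s * p)))"
  proof (rule ennreal_leI)
    let ?Q = "(\<kappa> * \<omega>) powr (p - 1) * R powr (- (s * p))"
    have RR: "(8 / R) powr ?sp2 * R powr (- ?sp2) = 8 powr ?sp2 * R powr (- (s * p))"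
    proof -
      have "(8 / R) powr c * R powr (- c) = 8 powr c * R powr (- (2 * c))" for c
      proof -
        have "R powr (- (2 * c)) = R powr (- c) * R powr (- c)" by (simp add: powr_add[symmetric])
        moreover have "(8 / R) powr c = 8 powr c * R powr (- c)" using pos by (simp add: powr_divide powr_minus_divide)
        ultimately show ?thesis by (simp only: mult.assoc)
      qed
      from this[of ?sp2] show ?thesis by simp
    qed
    have "?a * (tail_const TYPE('n) ?sp2 * R powr (- ?sp2))
        = 2 powr (p - 1) * \<omega> powr (p - 1) * (2 * \<gamma> / ?e) powr (p - 1) * tail_const TYPE('n) ?sp2 * ((8 / R) powr ?sp2 * R powr (- ?sp2))"
      by (simp only: mult_ac)
    also have "\<dots> = (osc_tail * (2 * \<gamma> / ?e) powr (p - 1)) * (\<omega> powr (p - 1) * R powr (- (s * p)))"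
      unfolding RR osc_tail_def by (simp only: mult_ac)
    also have "\<dots> \<le> (\<kappa> powr (p - 1) / 2) * (\<omega> powr (p - 1) * R powr (- (s * p)))"
      by (intro mult_right_mono gg(3)) auto
    also have "\<dots> = ?Q / 2" using kappa pos by (simp add: powr_mult)
    finally have 1: "?a * (tail_const TYPE('n) ?sp2 * R powr (- ?sp2)) \<le> ?Q / 2" .
    have "2 powr p = 2 * 2 powr (p - 1)" by (simp add: powr_diff)
    then have "?b * I = 2 powr p * (r0 powr (- (N + s * p)) * I) / 2" by simp
    then have 2: "?b * I \<le> ?Q / 2" using small by linarith
    show "?a * (tail_const TYPE('n) ?sp2 * R powr (- ?sp2)) + ?b * I \<le> ?Q" using 1 2 by linarith
  qed
  finally show ?thesis .
qed

text \<open>The induction must carry barriers outside the ball besides bounds inside it, because the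
  next growth step needs its tail. On at least half of the quarter ball u lies on one side of the
  midpoint of [m, M], so growth applies to u or to -u and moves one end of the interval.\<close>

theorem oscillation_decay:
  fixes u f :: "real ^ 'n \<Rightarrow> real"
  assumes sub: "weak_sub \<Omega> u f" and super: "weak_sub \<Omega> (\<lambda>x. - u x) (\<lambda>x. 0)" and u0: "\<And>x. 0 \<le> u x"
    and g: "hoelder_exp \<gamma>" and dom: "cball x0 r0 \<subseteq> \<Omega>" and r0: "0 < r0"
    and ub: "AE x in lborel. x \<in> ball x0 r0 \<longrightarrow> u x \<le> \<Lambda>" and fb: "AE x in lborel. x \<in> ball x0 r0 \<longrightarrow> f x \<le> \<Phi>"
    and I: "(\<integral>\<^sup>+ y. ennreal (u y powr (p - 1)) \<partial>lborel) \<le> ennreal I" "0 \<le> I"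
    and \<omega>0: "\<Lambda> \<le> \<omega>0" "0 < \<omega>0" "\<Phi> \<le> (\<kappa> * \<omega>0) powr (p - 1) * r0 powr (- (s * p))"
      "2 powr p * (r0 powr (- (N + s * p)) * I) \<le> (\<kappa> * \<omega>0) powr (p - 1) * r0 powr (- (s * p))"
  shows "\<exists>m M. M - m = \<omega>0 * 8 powr (- (\<gamma> * real i)) \<and> (AE y in lborel. y \<in> ball x0 (r0 / 8 ^ i) \<longrightarrow> m \<le> u y \<and> u y \<le> M)"
proof -
  have u[measurable]: "u \<in> borel_measurable borel" using sub by (auto simp: weak_sub_def)
  have gg: "0 < \<gamma>" "\<gamma> \<le> s" "1 - \<kappa> / 2 \<le> 8 powr (- \<gamma>)" using g by (auto simp: hoelder_exp_def)
  define om where "om = (\<lambda>i::nat. \<omega>0 * 8 powr (- (\<gamma> * real i)))"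
  define rr where "rr = (\<lambda>i::nat. r0 / 8 ^ i)"
  \<comment> \<open>The barrier does not depend on i, and at distance \<open>rr (Suc i)\<close> it
    equals \<open>om i\<close>; from there on it exceeds the oscillation of step i.\<close>
  define \<Theta> where "\<Theta> = (\<lambda>y. \<omega>0 * (8 * norm (x0 - y) / r0) powr \<gamma>)"
  have om_pos: "0 < om i" and rr_pos: "0 < rr i" for i using \<omega>0 r0 by (auto simp: om_def rr_def)
  have om_Suc: "om (Suc i) = 8 powr (- \<gamma>) * om i" for i
    by (simp add: om_def powr_add[symmetric] algebra_simps)
  have om_le: "om (Suc i) \<le> om i" for i
  proof -
    have "8 powr (- \<gamma>) \<le> (8::real) powr 0" using gg by (intro powr_mono) auto
    then show ?thesis using om_pos[of i] by (simp add: om_Suc)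
  qed
  have rr_Suc: "rr (Suc i) = rr i / 8" for i by (simp add: rr_def)
  have rr_le: "rr i \<le> r0" for i using r0 by (simp add: rr_def divide_le_eq)
  have rr_powr: "rr i = r0 * 8 powr (- real i)" for i
    by (simp add: rr_def powr_minus powr_realpow divide_inverse)
  have Theta_eq: "\<Theta> y = om i * (8 * norm (x0 - y) / rr i) powr \<gamma>" for y i
  proof -
    have "8 * norm (x0 - y) / rr i = (8 * norm (x0 - y) / r0) * 8 powr real i"
      using r0 by (simp add: rr_def powr_realpow)
    then have "(8 * norm (x0 - y) / rr i) powr \<gamma> = (8 * norm (x0 - y) / r0) powr \<gamma> * (8 powr real i) powr \<gamma>"
      by (simp only: powr_mult)
    also have "(8 powr real i) powr \<gamma> = (8::real) powr (\<gamma> * real i)" by (simp add: powr_powr mult.commute)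
    finally show ?thesis by (simp add: \<Theta>_def om_def powr_minus)
  qed
  have Theta_ge: "om i \<le> \<Theta> y" if "rr (Suc i) \<le> norm (x0 - y)" for i y
  proof -
    have "1 \<le> 8 * norm (x0 - y) / rr i" using that rr_pos[of i] by (simp add: rr_Suc)
    then have "1 \<le> (8 * norm (x0 - y) / rr i) powr \<gamma>" using gg by (intro ge_one_powr_ge_zero) auto
    then show ?thesis unfolding Theta_eq[of y i] using om_pos[of i] by simp
  qed
  \<comment> \<open>Passing to step i multiplies by 8^(i (s p - \<gamma> (p - 1))), which is at
    least 1 as \<gamma> \<le> s. So smallness of source and tail assumed at radius r0 holds at all
    smaller radii.\<close>
  have scale: "(\<kappa> * \<omega>0) powr (p - 1) * r0 powr (- (s * p)) \<le> (\<kappa> * om i) powr (p - 1) * rr i powr (- (s * p))" for i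
  proof -
    have "(\<kappa> * om i) powr (p - 1) * rr i powr (- (s * p))
       = (\<kappa> * \<omega>0) powr (p - 1) * r0 powr (- (s * p)) * (8 powr (- (\<gamma> * real i) * (p - 1)) * 8 powr (real i * (s * p)))"
      using kappa \<omega>0 r0 by (simp add: om_def rr_powr powr_mult powr_powr)
    also have "8 powr (- (\<gamma> * real i) * (p - 1)) * 8 powr (real i * (s * p)) = (8::real) powr (real i * (s * p - \<gamma> * (p - 1)))"
      by (simp add: powr_add[symmetric] algebra_simps)
    also have "(\<kappa> * \<omega>0) powr (p - 1) * r0 powr (- (s * p)) * 1 \<le> (\<kappa> * \<omega>0) powr (p - 1) * r0 powr (- (s * p)) * (8::real) powr (real i * (s * p - \<gamma> * (p - 1)))"
    proof (intro mult_left_mono ge_one_powr_ge_zero)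
      have "\<gamma> * (p - 1) \<le> s * p" using gg p1 s0 by (intro mult_mono) auto
      then show "0 \<le> real i * (s * p - \<gamma> * (p - 1))" by simp
    qed auto
    finally show ?thesis by simp
  qed
  have tail: "(\<integral>\<^sup>+ y. ennreal (d y powr (p - 1) * ker x0 y) * indicator (- ball x0 (rr i)) y \<partial>lborel)
      \<le> ennreal ((\<kappa> * om i) powr (p - 1) * rr i powr (- (s * p)))"
    if d0: "\<And>y. 0 \<le> d y" and le: "AE y in lborel. rr i \<le> norm (x0 - y) \<longrightarrow> d y \<le> \<Theta> y - om i + (if r0 \<le> norm (x0 - y) then u y else 0)" for d i
  proof (rule barrier_tail_le[OF g rr_pos om_pos r0 d0 u0 u _ I])
    show "AE y in lborel. rr i \<le> norm (x0 - y) \<longrightarrow> d y \<le> om i * ((8 * norm (x0 - y) / rr i) powr \<gamma> - 1) + (if r0 \<le> norm (x0 - y) then u y else 0)"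
      using le by eventually_elim (simp add: Theta_eq[of _ i] right_diff_distrib)
    show "2 powr p * (r0 powr (- (N + s * p)) * I) \<le> (\<kappa> * om i) powr (p - 1) * rr i powr (- (s * p))"
      using \<omega>0(4) scale by (rule order_trans)
  qed
  \<comment> \<open>The upper barrier is claimed only within r0; beyond it u itself enters the tail.
    The lower barrier holds everywhere outside the ball: beyond r0 one has \<Theta> \<ge> \<omega>0
    \<ge> M while u \<ge> 0.\<close>
  define Inv where "Inv = (\<lambda>i m M. 0 \<le> m \<and> M \<le> \<omega>0 \<and> M - m = om i \<and> (AE y in lborel.
     (norm (x0 - y) < rr i \<longrightarrow> m \<le> u y \<and> u y \<le> M) \<and> (rr i \<le> norm (x0 - y) \<longrightarrow> M - \<Theta> y \<le> u y) \<and>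
     (rr i \<le> norm (x0 - y) \<and> norm (x0 - y) < r0 \<longrightarrow> u y \<le> m + \<Theta> y)))"
  have "\<exists>m M. Inv i m M" for i
  proof (induction i)
    case 0
    have "Inv 0 0 \<omega>0"
      unfolding Inv_def
    proof (intro conjI)
      show "AE y in lborel. (norm (x0 - y) < rr 0 \<longrightarrow> 0 \<le> u y \<and> u y \<le> \<omega>0) \<and> (rr 0 \<le> norm (x0 - y) \<longrightarrow> \<omega>0 - \<Theta> y \<le> u y) \<and>
         (rr 0 \<le> norm (x0 - y) \<and> norm (x0 - y) < r0 \<longrightarrow> u y \<le> 0 + \<Theta> y)"
        using ub
      proof eventually_elim
        case (elim y)
        have "\<omega>0 - \<Theta> y \<le> u y" if "rr 0 \<le> norm (x0 - y)"
        proof -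
          have "rr (Suc 0) \<le> norm (x0 - y)" using that r0 by (simp add: rr_def)
          then have "om 0 \<le> \<Theta> y" by (rule Theta_ge)
          then show ?thesis using u0[of y] by (simp add: om_def)
        qed
        then show ?case using elim u0[of y] \<omega>0(1) by (auto simp: rr_def dist_norm)
      qed
    qed (use \<omega>0 in \<open>auto simp: om_def\<close>)
    then show ?case by blast
  next
    case (Suc i)
    then obtain m M where IH: "0 \<le> m" "M \<le> \<omega>0" "M - m = om i" and ae: "AE y in lborel.
       (norm (x0 - y) < rr i \<longrightarrow> m \<le> u y \<and> u y \<le> M) \<and> (rr i \<le> norm (x0 - y) \<longrightarrow> M - \<Theta> y \<le> u y) \<and>
       (rr i \<le> norm (x0 - y) \<and> norm (x0 - y) < r0 \<longrightarrow> u y \<le> m + \<Theta> y)"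
      unfolding Inv_def by blast
    let ?R = "rr i" and ?\<omega> = "om i"
    have Mpos: "0 \<le> M" using IH om_pos[of i] by linarith
    have domR: "cball x0 ?R \<subseteq> \<Omega>" using dom rr_le[of i] by (auto simp: subset_iff)
    \<comment> \<open>Only the shell between the two radii is new. There m \<le> u \<le> M is still
      known and \<Theta> is at least M - m, so the barriers hold with the moved endpoints as
      well.\<close>
    have next_inv: "\<exists>m M. Inv (Suc i) m M"
      if m': "m \<le> m'" and M': "M' \<le> M" "M' - m' = om (Suc i)"
        and inner: "AE y in lborel. norm (x0 - y) < rr (Suc i) \<longrightarrow> m' \<le> u y \<and> u y \<le> M'" for m' M'
    proof -
      have "Inv (Suc i) m' M'"
        unfolding Inv_def
      proof (intro conjI)
        show "AE y in lborel. (norm (x0 - y) < rr (Suc i) \<longrightarrow> m' \<le> u y \<and> u y \<le> M') \<and> (rr (Suc i) \<le> norm (x0 - y) \<longrightarrow> M' - \<Theta> y \<le> u y) \<and>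
           (rr (Suc i) \<le> norm (x0 - y) \<and> norm (x0 - y) < r0 \<longrightarrow> u y \<le> m' + \<Theta> y)"
          using ae inner
        proof eventually_elim
          case (elim y)
          have "M' - \<Theta> y \<le> u y \<and> (norm (x0 - y) < r0 \<longrightarrow> u y \<le> m' + \<Theta> y)" if "rr (Suc i) \<le> norm (x0 - y)"
          proof (cases "norm (x0 - y) < rr i")
            case True
            then show ?thesis using elim Theta_ge[OF that] IH(3) m' M' by auto
          next
            case False
            then show ?thesis using elim m' M' by auto
          qed
          then show ?case using elim by auto
        qed
      qed (use IH m' M' in auto)
      then show ?thesis by blast
    qed
    have om_next: "(1 - \<kappa> / 2) * ?\<omega> \<le> om (Suc i)"
      unfolding om_Suc using gg(3) om_pos[of i] by (intro mult_right_mono) auto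
    let ?h = "ennreal (unit_ball_vol N * (?R / 4) powr N / 2)"
    let ?B = "ball x0 (?R / 4)"
    let ?S1 = "?B \<inter> {x. u x \<le> M - ?\<omega> / 2}" and ?S2 = "?B \<inter> {x. - u x \<le> - m - ?\<omega> / 2}"
    \<comment> \<open>The two sets cover the quarter ball, so they cannot both have less than half
      of its measure.\<close>
    have "?h \<le> emeasure lborel ?S1 \<or> ?h \<le> emeasure lborel ?S2"
    proof (rule ccontr)
      assume "\<not> ?thesis"
      then have lt: "emeasure lborel ?S1 < ?h" "emeasure lborel ?S2 < ?h" by auto
      have "?B \<subseteq> ?S1 \<union> ?S2" using IH(3) by auto
      then have "emeasure lborel ?B \<le> emeasure lborel (?S1 \<union> ?S2)" by (intro emeasure_mono) auto
      also have "\<dots> \<le> emeasure lborel ?S1 + emeasure lborel ?S2" by (intro emeasure_subadditive) auto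
      also have "\<dots> < ?h + ?h" using lt by (intro add_strict_mono)
      also have "?h + ?h = ennreal (unit_ball_vol N * (?R / 4) powr N)"
        using less_imp_le[OF V_pos] by (subst ennreal_plus[symmetric]) (auto intro!: mult_nonneg_nonneg)
      also have "\<dots> = emeasure lborel ?B"
        using rr_pos[of i] by (subst emeasure_ball_vec) (auto simp: N_def powr_realpow)
      finally show False by simp
    qed
    then show ?case
    proof
      assume half: "?h \<le> emeasure lborel ?S1"
      have "AE x in lborel. x \<in> ball x0 (?R / 8) \<longrightarrow> u x \<le> M - \<kappa> * ?\<omega> / 2"
      proof (rule growth[OF sub domR rr_pos om_pos _ _ _ half])
        show "AE x in lborel. x \<in> ball x0 ?R \<longrightarrow> u x \<le> M" using ae by eventually_elim (auto simp: dist_norm)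
        show "AE x in lborel. x \<in> ball x0 ?R \<longrightarrow> f x \<le> (\<kappa> * ?\<omega>) powr (p - 1) * ?R powr (- (s * p))"
          using fb
        proof eventually_elim
          case (elim x)
          then show ?case using rr_le[of i] order_trans[OF \<omega>0(3) scale[of i]] by auto
        qed
        show "(\<integral>\<^sup>+ y. ennreal (max (u y - M) 0 powr (p - 1) * ker x0 y) * indicator (- ball x0 ?R) y \<partial>lborel)
          \<le> ennreal ((\<kappa> * ?\<omega>) powr (p - 1) * ?R powr (- (s * p)))"
        proof (rule tail)
          show "AE y in lborel. ?R \<le> norm (x0 - y) \<longrightarrow> max (u y - M) 0 \<le> \<Theta> y - ?\<omega> + (if r0 \<le> norm (x0 - y) then u y else 0)"
            using ae
          proof eventually_elim
            case (elim y)
            have "?\<omega> \<le> \<Theta> y" if "?R \<le> norm (x0 - y)"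
              using that rr_pos[of i] by (intro Theta_ge) (simp add: rr_Suc)
            then show ?case using elim IH(3) Mpos u0[of y] by auto
          qed
        qed simp
      qed
      \<comment> \<open>The interval is given the exact length \<open>om (Suc i)\<close>, no less
        than what growth provides; keeping the end m and not exceeding the old length keeps it
        inside [m, M].\<close>
      then show ?case
        by (intro next_inv[of m "m + om (Suc i)"])
           (use om_le[of i] om_next IH(3) ae rr_pos[of i] in \<open>auto simp: dist_norm rr_Suc algebra_simps elim!: eventually_elim2\<close>)
    next
      assume half: "?h \<le> emeasure lborel ?S2"
      have "AE x in lborel. x \<in> ball x0 (?R / 8) \<longrightarrow> - u x \<le> - m - \<kappa> * ?\<omega> / 2"
      proof (rule growth[OF super domR rr_pos om_pos _ _ _ half])
        show "AE x in lborel. x \<in> ball x0 ?R \<longrightarrow> - u x \<le> - m" using ae by eventually_elim (auto simp: dist_norm)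
        show "(\<integral>\<^sup>+ y. ennreal (max (- u y - - m) 0 powr (p - 1) * ker x0 y) * indicator (- ball x0 ?R) y \<partial>lborel)
          \<le> ennreal ((\<kappa> * ?\<omega>) powr (p - 1) * ?R powr (- (s * p)))"
        proof (rule tail)
          show "AE y in lborel. ?R \<le> norm (x0 - y) \<longrightarrow> max (- u y - - m) 0 \<le> \<Theta> y - ?\<omega> + (if r0 \<le> norm (x0 - y) then u y else 0)"
            using ae
          proof eventually_elim
            case (elim y)
            have "?\<omega> \<le> \<Theta> y" if "?R \<le> norm (x0 - y)"
              using that rr_pos[of i] by (intro Theta_ge) (simp add: rr_Suc)
            then show ?case using elim IH(3) u0[of y] by auto
          qed
        qed simp
      qed auto
      then show ?case
        by (intro next_inv[of "M - om (Suc i)" M])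
           (use om_le[of i] om_next IH(3) ae rr_pos[of i] in \<open>auto simp: dist_norm rr_Suc algebra_simps elim!: eventually_elim2\<close>)
    qed
  qed
  then obtain m M where "Inv i m M" by blast
  then have "M - m = om i" "AE y in lborel. y \<in> ball x0 (rr i) \<longrightarrow> m \<le> u y \<and> u y \<le> M"
    unfolding Inv_def by (auto simp: dist_norm elim!: eventually_mono)
  then show ?thesis unfolding om_def rr_def by blast
qed

end

subsection \<open>The Hoelder continuous representative\<close>

lemma AE_meets_ball:
  fixes x :: "real ^ 'n"
  assumes "AE y in lborel. P y" "0 < e"
  shows "\<exists>y. P y \<and> dist y x < e"
proof (rule ccontr)
  assume n: "\<not> ?thesis"
  have "AE y in lborel. y \<notin> ball x e"
    using assms(1) by eventually_elim (use n in \<open>auto simp: dist_commute\<close>)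
  then have "emeasure lborel (ball x e) = 0" by (simp add: AE_iff_null_sets null_setsD1)
  moreover have "0 < unit_ball_vol (real CARD('n)) * e ^ CARD('n)"
    using assms(2) unit_ball_vol_vec_pos[where 'n='n] by (intro mult_pos_pos zero_less_power)
  moreover have "emeasure lborel (ball x e) = ennreal (unit_ball_vol (real CARD('n)) * e ^ CARD('n))"
    using assms(2) by (intro emeasure_ball_vec) simp
  ultimately show False by (simp only: ennreal_eq_0_iff)
qed

text \<open>Only countably many balls are used, so that the exceptional null sets can be collected; on the
  remaining dense set \<open>u\<close> is Hoelder continuous and is extended by limits.\<close>

theorem hoelder_representative:
  fixes u :: "real ^ 'n \<Rightarrow> real"
  assumes "open \<Omega>" and g: "0 < \<gamma>"
    and osc: "\<And>K. compact K \<Longrightarrow> K \<subseteq> \<Omega> \<Longrightarrow> \<exists>r>0. \<exists>C\<ge>0. \<forall>x0\<in>K. \<forall>i::nat. \<exists>m M. M - m \<le> C * 8 powr (- (\<gamma> * real i)) \<and>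
        (AE y in lborel. y \<in> ball x0 (r / 8 ^ i) \<longrightarrow> m \<le> u y \<and> u y \<le> M)"
  shows "\<exists>v. (AE x in lborel. x \<in> \<Omega> \<longrightarrow> u x = v x) \<and>
      (\<forall>K. compact K \<longrightarrow> K \<subseteq> \<Omega> \<longrightarrow> (\<exists>C. \<forall>x\<in>K. \<forall>y\<in>K. \<bar>v x - v y\<bar> \<le> C * norm (x - y) powr \<gamma>))"
proof -
  obtain Kn where Kn: "\<And>n::nat. compact (Kn n)" "\<And>n. Kn n \<subseteq> \<Omega>" "\<And>n. Kn n \<subseteq> interior (Kn (Suc n))"
    "\<Union> (range Kn) = \<Omega>" "\<And>K. compact K \<Longrightarrow> K \<subseteq> \<Omega> \<Longrightarrow> \<exists>N. \<forall>n\<ge>N. K \<subseteq> Kn n"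
    using open_Union_compact_subsets[OF assms(1)] by metis
  define E where "E = (\<lambda>r C x0 i m M. M - m \<le> C * 8 powr (- (\<gamma> * real i)) \<and>
        (AE y in lborel. y \<in> ball x0 (r / 8 ^ i) \<longrightarrow> m \<le> u y \<and> u y \<le> M))"
  define Q where "Q = (\<lambda>n r C. \<forall>x0\<in>Kn n. \<forall>i::nat. \<exists>m M. E r C x0 i m M)"
  have "\<forall>n. \<exists>r C. 0 < r \<and> 0 \<le> C \<and> Q n r C"
    unfolding Q_def E_def using osc[OF Kn(1,2)] by blast
  then obtain rr CC where rC: "\<And>n. 0 < rr n" "\<And>n. 0 \<le> CC n" and QrC: "\<And>n. Q n (rr n) (CC n)"
    by metis
  have "\<forall>n x0 i. \<exists>m M. x0 \<in> Kn n \<longrightarrow> E (rr n) (CC n) x0 i m M"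
    using QrC unfolding Q_def by blast
  then obtain mm MM where "\<And>n x0 i. x0 \<in> Kn n \<Longrightarrow> E (rr n) (CC n) x0 i (mm n x0 i) (MM n x0 i)"
    by metis
  then have mM: "\<And>n x0 i. x0 \<in> Kn n \<Longrightarrow> MM n x0 i - mm n x0 i \<le> CC n * 8 powr (- (\<gamma> * real i))"
    "\<And>n x0 i. x0 \<in> Kn n \<Longrightarrow> AE y in lborel. y \<in> ball x0 (rr n / 8 ^ i) \<longrightarrow> mm n x0 i \<le> u y \<and> u y \<le> MM n x0 i"
    unfolding E_def by blast+
  obtain D :: "(real ^ 'n) set" where D: "countable D" "\<And>U. open U \<Longrightarrow> U \<noteq> {} \<Longrightarrow> \<exists>d\<in>D. d \<in> U"
    by (rule countable_dense_setE) blast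
  define G where "G = {y. \<forall>n i. \<forall>q\<in>D. q \<in> Kn n \<longrightarrow> y \<in> ball q (rr n / 8 ^ i) \<longrightarrow> mm n q i \<le> u y \<and> u y \<le> MM n q i}"
  have AEG: "AE y in lborel. y \<in> G"
    unfolding G_def mem_Collect_eq AE_all_countable AE_ball_countable[OF D(1)]
    using mM(2) by auto
  have local_G: "\<bar>u x - u y\<bar> \<le> CC (Suc n) * (16 * norm (x - y) / rr (Suc n)) powr \<gamma>"
    if x: "x \<in> G" "y \<in> G" "x \<in> Kn n" and d: "2 * norm (x - y) < rr (Suc n)" for x y n
  proof (cases "x = y")
    case True
    then show ?thesis using rC(2) by simp
  next
    case False
    define d where "d = norm (x - y)"
    have d0: "0 < d" using False by (simp add: d_def)
    let ?r = "rr (Suc n)"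
    have r0: "0 < ?r" by (rule rC)
    \<comment> \<open>For the least such j, the ball of index i = j - 1 still has radius above 2 d,
      so a centre within d of x sees both points. Its radius is at most 8 times 2 d, the source of
      the 16.\<close>
    define S where "S = (\<lambda>j::nat. ?r / 8 ^ j \<le> 2 * d)"
    have "\<exists>j. S j"
    proof -
      obtain j where "(1 / 8) ^ j < 2 * d / ?r" using real_arch_pow_inv[of "2 * d / ?r" "1/8"] d0 r0 by auto
      then have "S j" using r0 by (simp add: S_def power_one_over field_simps)
      then show ?thesis ..
    qed
    define j where "j = (LEAST j. S j)"
    have Sj: "S j" using LeastI_ex[OF \<open>\<exists>j. S j\<close>] by (simp add: j_def)
    have "\<not> S 0" using d by (simp add: S_def d_def)
    then obtain i where i: "j = Suc i" using Sj by (cases j) auto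
    have "\<not> S i" using not_less_Least[of i S] i by (simp add: j_def)
    then have i1: "2 * d < ?r / 8 ^ i" by (simp add: S_def)
    have i2: "?r / 8 ^ Suc i \<le> 2 * d" using Sj i by (simp add: S_def)
    have "x \<in> interior (Kn (Suc n))" using x Kn(3) by blast
    then have "x \<in> ball x d \<inter> interior (Kn (Suc n))" using d0 by simp
    then have "open (ball x d \<inter> interior (Kn (Suc n)))" "ball x d \<inter> interior (Kn (Suc n)) \<noteq> {}" by blast+
    then obtain q where q: "q \<in> D" "q \<in> ball x d" "q \<in> Kn (Suc n)" using D(2) interior_subset by blast
    have "dist q x < d" using q by (simp add: dist_commute)
    moreover have "dist q y < 2 * d" using calculation dist_triangle[of q y x] by (simp add: d_def dist_norm)
    ultimately have "x \<in> ball q (?r / 8 ^ i)" "y \<in> ball q (?r / 8 ^ i)" using i1 d0 by auto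
    then have "mm (Suc n) q i \<le> u x" "u x \<le> MM (Suc n) q i" "mm (Suc n) q i \<le> u y" "u y \<le> MM (Suc n) q i"
      using x(1,2) q unfolding G_def by blast+
    then have "\<bar>u x - u y\<bar> \<le> MM (Suc n) q i - mm (Suc n) q i" by linarith
    also have "\<dots> \<le> CC (Suc n) * 8 powr (- (\<gamma> * real i))" by (rule mM(1)[OF q(3)])
    also have "8 powr (- (\<gamma> * real i)) = (8 powr (- real i)) powr \<gamma>" by (simp add: powr_powr mult.commute)
    also have "(8::real) powr (- real i) = 1 / 8 ^ i" by (simp add: powr_minus_divide powr_realpow)
    also have "CC (Suc n) * (1 / 8 ^ i) powr \<gamma> \<le> CC (Suc n) * (16 * d / ?r) powr \<gamma>"
    proof (intro mult_left_mono powr_mono2)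
      show "1 / 8 ^ i \<le> 16 * d / ?r" using i2 r0 by (simp add: field_simps)
    qed (use g rC in auto)
    finally show ?thesis by (simp add: d_def)
  qed
  have "\<forall>x k. \<exists>y. y \<in> G \<and> dist y x < 1 / real (Suc k)" using AE_meets_ball[OF AEG] by simp
  then obtain Y where Y: "\<And>x k. Y x k \<in> G" "\<And>x k. dist (Y x k) x < 1 / real (Suc k)" by metis
  \<comment> \<open>The sequence is constant at points of \<open>G\<close>, so the limit v agrees
    with u there.\<close>
  define Z where "Z = (\<lambda>x k. if x \<in> G then x else Y x k)"
  have ZG: "Z x k \<in> G" for x k using Y by (simp add: Z_def)
  have Zlim: "Z x \<longlonglongrightarrow> x" for x
  proof (rule metric_tendsto_imp_tendsto[OF LIMSEQ_inverse_real_of_nat])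
    show "\<forall>\<^sub>F k in sequentially. dist (Z x k) x \<le> dist (inverse (real (Suc k))) 0"
      using Y(2) by (intro always_eventually allI) (auto simp: Z_def inverse_eq_divide less_imp_le)
  qed
  define v where "v = (\<lambda>x. lim (\<lambda>k. u (Z x k)))"
  have vG: "v x = u x" if "x \<in> G" for x using that by (simp add: v_def Z_def)
  have Zin: "\<forall>\<^sub>F k in sequentially. Z x k \<in> Kn (Suc n)" if "x \<in> Kn n" for x n
  proof -
    have "x \<in> interior (Kn (Suc n))" using that Kn(3) by blast
    then have "\<forall>\<^sub>F k in sequentially. Z x k \<in> interior (Kn (Suc n))"
      using Zlim[of x] topological_tendstoD[OF _ open_interior] by blast
    then show ?thesis by eventually_elim (use interior_subset in blast)
  qed
  have conv: "(\<lambda>k. u (Z x k)) \<longlonglongrightarrow> v x" if xn: "x \<in> Kn n" for x n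
  proof -
    \<comment> \<open>One index is spent because the approximating points lie only in
      \<open>Kn (Suc n)\<close>, another because \<open>local_G\<close> takes its radius from the
      following set.\<close>
    let ?n = "Suc (Suc n)"
    have "Cauchy (\<lambda>k. u (Z x k))"
      unfolding Cauchy_def
    proof (intro allI impI)
      fix e :: real assume e: "0 < e"
      have "((\<lambda>h. CC ?n * (16 * h / rr ?n) powr \<gamma>) \<longlongrightarrow> CC ?n * (16 * 0 / rr ?n) powr \<gamma>) (at_right 0)"
        using g rC(1)[of ?n] by (intro tendsto_intros tendsto_powr') (auto simp: eventually_at_filter)
      then have "((\<lambda>h. CC ?n * (16 * h / rr ?n) powr \<gamma>) \<longlongrightarrow> 0) (at_right 0)" by simp
      then have "\<forall>\<^sub>F h in at_right 0. CC ?n * (16 * h / rr ?n) powr \<gamma> < e" using e by (rule order_tendstoD)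
      then obtain b where b: "0 < b" "\<And>h. 0 < h \<Longrightarrow> h < b \<Longrightarrow> CC ?n * (16 * h / rr ?n) powr \<gamma> < e"
        unfolding eventually_at_right_field by auto
      define \<delta> where "\<delta> = min b (rr ?n / 2)"
      have dl: "0 < \<delta>" using b rC(1)[of ?n] by (simp add: \<delta>_def)
      have "\<forall>\<^sub>F k in sequentially. dist (Z x k) x < \<delta> / 2" using Zlim[of x] dl by (intro tendstoD) auto
      then have "\<forall>\<^sub>F k in sequentially. dist (Z x k) x < \<delta> / 2 \<and> Z x k \<in> Kn (Suc n)"
        using Zin[OF xn] by (rule eventually_conj)
      then obtain k0 where k0: "\<And>k. k0 \<le> k \<Longrightarrow> dist (Z x k) x < \<delta> / 2 \<and> Z x k \<in> Kn (Suc n)"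
        unfolding eventually_sequentially by blast
      have "dist (u (Z x k)) (u (Z x l)) < e" if "k0 \<le> k" "k0 \<le> l" for k l
      proof (cases "Z x k = Z x l")
        case False
        have "dist (Z x k) (Z x l) < \<delta>"
          using k0[OF that(1)] k0[OF that(2)] dist_triangle2[of "Z x k" "Z x l" x] by (simp add: dist_commute)
        then have h: "0 < norm (Z x k - Z x l)" "norm (Z x k - Z x l) < b" "2 * norm (Z x k - Z x l) < rr ?n"
          using False by (auto simp: \<delta>_def dist_norm)
        have "\<bar>u (Z x k) - u (Z x l)\<bar> \<le> CC ?n * (16 * norm (Z x k - Z x l) / rr ?n) powr \<gamma>"
          using ZG k0[OF that(1)] h by (intro local_G) auto
        also have "\<dots> < e" using h by (intro b) auto
        finally show ?thesis by (simp add: dist_real_def)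
      qed (use e in simp)
      then show "\<exists>M. \<forall>m\<ge>M. \<forall>n\<ge>M. dist (u (Z x m)) (u (Z x n)) < e" by blast
    qed
    then have "convergent (\<lambda>k. u (Z x k))" by (rule Cauchy_convergent)
    then show ?thesis unfolding v_def by (simp add: convergent_LIMSEQ_iff)
  qed
  have local_v: "\<bar>v x - v y\<bar> \<le> CC (Suc (Suc n)) * (16 * norm (x - y) / rr (Suc (Suc n))) powr \<gamma>"
    if x: "x \<in> Kn n" "y \<in> Kn n" and d: "2 * norm (x - y) < rr (Suc (Suc n))" for x y n
  proof (cases "x = y")
    case True
    then show ?thesis using rC(2) by simp
  next
    case False
    let ?n = "Suc (Suc n)"
    have nl: "(\<lambda>k. norm (Z x k - Z y k)) \<longlonglongrightarrow> norm (x - y)" by (intro tendsto_intros Zlim)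
    have lhs: "(\<lambda>k. \<bar>u (Z x k) - u (Z y k)\<bar>) \<longlonglongrightarrow> \<bar>v x - v y\<bar>" by (intro tendsto_intros conv[OF x(1)] conv[OF x(2)])
    have rhs: "(\<lambda>k. CC ?n * (16 * norm (Z x k - Z y k) / rr ?n) powr \<gamma>) \<longlonglongrightarrow> CC ?n * (16 * norm (x - y) / rr ?n) powr \<gamma>"
      using False rC(1)[of ?n] by (intro tendsto_intros nl) auto
    have "\<forall>\<^sub>F k in sequentially. 2 * norm (Z x k - Z y k) < rr ?n"
      using tendsto_mult_left[OF nl, of 2] d by (rule order_tendstoD)
    then have ev: "\<forall>\<^sub>F k in sequentially. \<bar>u (Z x k) - u (Z y k)\<bar> \<le> CC ?n * (16 * norm (Z x k - Z y k) / rr ?n) powr \<gamma>"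
      using Zin[OF x(1)] by eventually_elim (intro local_G ZG)
    show ?thesis by (rule tendsto_le[OF sequentially_bot rhs lhs ev])
  qed
  have "\<exists>C. \<forall>x\<in>K. \<forall>y\<in>K. \<bar>v x - v y\<bar> \<le> C * norm (x - y) powr \<gamma>" if K: "compact K" "K \<subseteq> \<Omega>" for K
  proof -
    obtain n where n: "K \<subseteq> Kn n" using Kn(5)[OF K] by blast
    let ?n = "Suc (Suc n)"
    define r where "r = rr ?n / 4"
    have r: "0 < r" using rC(1)[of ?n] by (simp add: r_def)
    obtain T where T: "finite T" "T \<subseteq> K" "K \<subseteq> (\<Union>x\<in>T. ball x r)"
      using compactE_image[OF K(1), of K "\<lambda>x. ball x r"] r by force
    obtain b where b: "\<And>x. x \<in> T \<Longrightarrow> \<bar>v x\<bar> \<le> b"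
      using finite_imp_bounded[OF finite_imageI[OF T(1), of v]] by (auto simp: bounded_iff)
    define A where "A = CC ?n * (16 / rr ?n) powr \<gamma>"
    have A0: "0 \<le> A" using rC(2) by (simp add: A_def)
    have lv: "\<bar>v x - v y\<bar> \<le> A * norm (x - y) powr \<gamma>" if "x \<in> K" "y \<in> K" "2 * norm (x - y) < rr ?n" for x y
    proof -
      have "16 * norm (x - y) / rr ?n = (16 / rr ?n) * norm (x - y)" by simp
      then have "CC ?n * (16 * norm (x - y) / rr ?n) powr \<gamma> = A * norm (x - y) powr \<gamma>"
        by (simp only: A_def powr_mult mult.assoc)
      then show ?thesis using local_v[of x n y] that n by auto
    qed
    define B where "B = \<bar>b\<bar> + A * r powr \<gamma>"
    have B: "\<bar>v y\<bar> \<le> B" if y: "y \<in> K" for y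
    proof -
      obtain x where x: "x \<in> T" "dist x y < r" using subsetD[OF T(3) y] by auto
      have "\<bar>v x - v y\<bar> \<le> A * norm (x - y) powr \<gamma>"
        using x T(2) y r by (intro lv) (auto simp: r_def dist_norm)
      also have "\<dots> \<le> A * r powr \<gamma>" using x g A0 by (intro mult_left_mono powr_mono2) (auto simp: dist_norm)
      finally show ?thesis using b[OF x(1)] by (simp add: B_def)
    qed
    have B0: "0 \<le> B" using A0 by (simp add: B_def)
    have "\<bar>v x - v y\<bar> \<le> (A + 2 * B * (2 / rr ?n) powr \<gamma>) * norm (x - y) powr \<gamma>" if xy: "x \<in> K" "y \<in> K" for x y
    proof (cases "2 * norm (x - y) < rr ?n")
      case True
      have "0 \<le> 2 * B * (2 / rr ?n) powr \<gamma> * norm (x - y) powr \<gamma>" using B0 by simp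
      then show ?thesis using lv[OF xy True] unfolding distrib_right by linarith
    next
      case False
      \<comment> \<open>Distant pairs: v is bounded by B on K, and the distance is bounded below, so
        a multiple of its power \<gamma> exceeds 2 B.\<close>
      then have "1 \<le> (2 / rr ?n) * norm (x - y)" using rC(1)[of ?n] by simp
      then have "1 \<le> ((2 / rr ?n) * norm (x - y)) powr \<gamma>" using g by (intro ge_one_powr_ge_zero) auto
      then have "2 * B * 1 \<le> 2 * B * ((2 / rr ?n) powr \<gamma> * norm (x - y) powr \<gamma>)"
        unfolding powr_mult[symmetric] using B0 by (intro mult_left_mono) auto
      moreover have "\<bar>v x - v y\<bar> \<le> 2 * B" using B[OF xy(1)] B[OF xy(2)] by linarith
      moreover have "0 \<le> A * norm (x - y) powr \<gamma>" using A0 by simp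
      ultimately show ?thesis unfolding distrib_right mult.assoc by linarith
    qed
    then show ?thesis by blast
  qed
  moreover have "AE x in lborel. x \<in> \<Omega> \<longrightarrow> u x = v x" using AEG by eventually_elim (simp add: vG)
  ultimately show ?thesis by blast
qed

subsection \<open>The main theorem\<close>

lemma AE_lborel_fst_snd:
  fixes P :: "real ^ 'n \<Rightarrow> bool"
  assumes "AE x in lborel. P x"
  shows "AE z in (lborel :: ((real ^ 'n) \<times> (real ^ 'n)) measure). P (fst z) \<and> P (snd z)"
proof -
  obtain Z where Z: "{x. \<not> P x} \<subseteq> Z" "emeasure lborel Z = 0" "Z \<in> sets lborel"
    using assms by (auto elim: AE_E)
  have 1: "emeasure (lborel \<Otimes>\<^sub>M lborel) (Z \<times> (UNIV :: (real ^ 'n) set)) = 0"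
    using Z by (subst lborel.emeasure_pair_measure_Times) auto
  have 2: "emeasure (lborel \<Otimes>\<^sub>M lborel) ((UNIV :: (real ^ 'n) set) \<times> Z) = 0"
    using Z by (subst lborel.emeasure_pair_measure_Times) auto
  have s: "Z \<times> UNIV \<in> sets (lborel \<Otimes>\<^sub>M lborel)" "UNIV \<times> Z \<in> sets (lborel \<Otimes>\<^sub>M lborel)" using Z(3) by auto
  have "AE z in lborel \<Otimes>\<^sub>M (lborel :: (real ^ 'n) measure). P (fst z)"
    by (rule AE_I[where N="Z \<times> UNIV"]) (use Z(1) 1 s in auto)
  moreover have "AE z in (lborel :: (real ^ 'n) measure) \<Otimes>\<^sub>M lborel. P (snd z)"
    by (rule AE_I[where N="UNIV \<times> Z"]) (use Z(1) 2 s in auto)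
  ultimately have "AE z in lborel \<Otimes>\<^sub>M lborel. P (fst z) \<and> P (snd z)" by eventually_elim auto
  then show ?thesis unfolding lborel_prod .
qed

text \<open>The sign and support conditions are made to hold at every point, so that later arguments
  carry no exceptional sets. The value 1 only fills a null set.\<close>

lemma borel_version:
  fixes u :: "real ^ 'n \<Rightarrow> real"
  assumes "open \<Omega>" and u: "u \<in> borel_measurable lebesgue" and zero: "AE x in lebesgue. x \<notin> \<Omega> \<longrightarrow> u x = 0"
    and pos: "AE x in lebesgue. x \<in> \<Omega> \<longrightarrow> 0 < u x"
  obtains w where "w \<in> borel_measurable borel" "AE x in lborel. u x = w x" "\<And>x. x \<notin> \<Omega> \<Longrightarrow> w x = 0" "\<And>x. x \<in> \<Omega> \<Longrightarrow> 0 < w x"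
proof -
  obtain g where g: "g \<in> borel_measurable lborel" "AE x in lborel. u x = g x"
    using completion_ex_borel_measurable_real[OF u] by blast
  then have [measurable]: "g \<in> borel_measurable borel" by simp
  have [measurable]: "\<Omega> \<in> sets borel" using assms(1) by simp
  define w where "w = (\<lambda>x. if x \<in> \<Omega> then if 0 < g x then g x else 1 else 0)"
  have "AE x in lborel. u x = w x"
    using g(2) zero[unfolded AE_completion_iff] pos[unfolded AE_completion_iff]
    by eventually_elim (auto simp: w_def)
  moreover have "w \<in> borel_measurable borel" unfolding w_def by measurable
  ultimately show ?thesis using that[of w] by (auto simp: w_def)
qed

lemma lebesgue_integral_cong_borel:
  fixes f g :: "'a::euclidean_space \<Rightarrow> real"
  assumes f: "integrable lebesgue f" and g: "g \<in> borel_measurable borel" and eq: "AE x in lborel. f x = g x"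
  shows "integrable lborel g" "integral\<^sup>L lebesgue f = integral\<^sup>L lborel g"
proof -
  have g': "g \<in> borel_measurable lborel" using g by simp
  have gl: "g \<in> borel_measurable lebesgue" by (rule measurable_completion[OF g'])
  have eq': "AE x in lebesgue. f x = g x" using eq by (simp add: AE_completion_iff)
  have "integrable lebesgue g" by (rule integrable_cong_AE_imp[OF f gl eq'])
  then show "integrable lborel g" using integrable_completion[OF g'] by simp
  have "integral\<^sup>L lebesgue f = integral\<^sup>L lebesgue g"
    using f gl eq' by (intro integral_cong_AE) auto
  then show "integral\<^sup>L lebesgue f = integral\<^sup>L lborel g" using integral_completion[OF g'] by simp
qed

lemma compact_AE_bounds:
  fixes w :: "real ^ 'n \<Rightarrow> real"
  assumes K: "compact K" and loc: "\<And>x. x \<in> K \<Longrightarrow> \<exists>r>0. \<exists>c>0. \<exists>b. AE y in lborel. y \<in> ball x r \<longrightarrow> c \<le> w y \<and> w y \<le> b"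
  shows "\<exists>c>0. \<exists>b. AE y in lborel. y \<in> K \<longrightarrow> c \<le> w y \<and> w y \<le> b"
proof -
  define E where "E = (\<lambda>x r c b. AE y in lborel. y \<in> ball x r \<longrightarrow> c \<le> w y \<and> w y \<le> b)"
  have "\<forall>x. \<exists>r c b. x \<in> K \<longrightarrow> 0 < r \<and> 0 < c \<and> E x r c b"
    using loc unfolding E_def by blast
  then obtain r c b where rcb: "\<And>x. x \<in> K \<Longrightarrow> 0 < r x" "\<And>x. x \<in> K \<Longrightarrow> 0 < c x"
    "\<And>x. x \<in> K \<Longrightarrow> E x (r x) (c x) (b x)"
    by metis
  obtain T where T: "finite T" "T \<subseteq> K" "K \<subseteq> (\<Union>x\<in>T. ball x (r x))"
  proof (rule compactE_image[OF K, of K "\<lambda>x. ball x (r x)"])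
    show "K \<subseteq> (\<Union>x\<in>K. ball x (r x))"
    proof
      fix x assume x: "x \<in> K"
      show "x \<in> (\<Union>x\<in>K. ball x (r x))" by (rule UN_I[OF x]) (simp add: rcb(1)[OF x])
    qed
  qed auto
  \<comment> \<open>The inserted 1 keeps minimum and maximum meaningful when K is empty.\<close>
  define c0 where "c0 = Min (insert 1 (c ` T))"
  define b0 where "b0 = Max (insert 1 (b ` T))"
  have c0: "0 < c0" using T rcb(2) by (auto simp: c0_def)
  have "AE y in lborel. \<forall>x\<in>T. y \<in> ball x (r x) \<longrightarrow> c x \<le> w y \<and> w y \<le> b x"
    using T rcb(3) unfolding E_def by (intro AE_finite_allI) auto
  then have "AE y in lborel. y \<in> K \<longrightarrow> c0 \<le> w y \<and> w y \<le> b0"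
  proof eventually_elim
    case (elim y)
    show ?case
    proof
      assume "y \<in> K"
      then obtain x where x: "x \<in> T" "y \<in> ball x (r x)" using T(3) by blast
      have "c0 \<le> c x" "b x \<le> b0" using T(1) x(1) by (auto simp: c0_def b0_def)
      then show "c0 \<le> w y \<and> w y \<le> b0" using elim x by force
    qed
  qed
  then show ?thesis using c0 by blast
qed

text \<open>Elements of \<open>X0\<close> are determined up to null sets, so continuity is asserted
  of a representative v. One exponent and one v serve all \<Omega>' at once.\<close>

theorem theorem6p5:
  fixes p s lam q \<alpha> :: real
    and \<Omega> :: "(real ^ 'n) set"
    and u :: "real ^ 'n \<Rightarrow> real"
  assumes "1 < p"
    and "0 < s" and "s < 1"
    and "s * p < real CARD('n)"
    and "smooth_bounded_domain \<Omega>"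
    and "lam > 0"
    and "0 < q" and "q \<le> 1"
    and "\<alpha> \<le> critical_exponent CARD('n) p s - 1"
    and "positive_weak_solution p s \<Omega> lam q \<alpha> u"
  shows "\<exists>\<gamma>. 0 < \<gamma> \<and> \<gamma> \<le> s \<and>
           (\<exists>v. (AE x in lebesgue. x \<in> \<Omega> \<longrightarrow> u x = v x) \<and>
                (\<forall>\<Omega>'. compactly_contained \<Omega>' \<Omega> \<longrightarrow> locally_hoelder_on \<gamma> \<Omega>' v))"
proof -
  interpret fractional p s "real CARD('n)" "TYPE('n)"
    using assms(1-4) by unfold_locales auto
  have op: "open \<Omega>" and bd: "bounded \<Omega>" using assms(5) by (auto simp: smooth_bounded_domain_def)
  have [measurable]: "\<Omega> \<in> sets borel" using op by simp
  have X: "u \<in> X0 p s \<Omega>" and upos: "AE x in lebesgue. x \<in> \<Omega> \<longrightarrow> u x > 0"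
    and weak: "\<And>\<psi>. test_function \<Omega> \<psi> \<Longrightarrow>
        set_integrable lebesgue (Qset \<Omega>) (weak_integrand p s u \<psi>) \<and>
        set_integrable lebesgue \<Omega> (\<lambda>x. (lam * u x powr (- q) + u x powr \<alpha>) * \<psi> x) \<and>
        (LINT z : Qset \<Omega> | lebesgue. weak_integrand p s u \<psi> z)
          - (LINT x : \<Omega> | lebesgue. (lam * u x powr (- q) + u x powr \<alpha>) * \<psi> x) = 0"
    using assms(10) by (auto simp: positive_weak_solution_def)
  have X1: "u \<in> borel_measurable lebesgue" "(\<integral>\<^sup>+ x \<in> \<Omega>. ennreal (\<bar>u x\<bar> powr p) \<partial>lebesgue) < \<infinity>"
    "AE x in lebesgue. x \<notin> \<Omega> \<longrightarrow> u x = 0"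
    "(\<integral>\<^sup>+ z \<in> Qset \<Omega>. ennreal (\<bar>u (fst z) - u (snd z)\<bar> powr p /
        norm (fst z - snd z) powr (real CARD('n) + s * p)) \<partial>lebesgue) < \<infinity>"
    using X by (auto simp: X0_def)
  obtain w where w[measurable]: "w \<in> borel_measurable borel" and uw: "AE x in lborel. u x = w x"
    and w_out: "\<And>x. x \<notin> \<Omega> \<Longrightarrow> w x = 0" and w_in: "\<And>x. x \<in> \<Omega> \<Longrightarrow> 0 < w x"
    using borel_version[OF op X1(1,3) upos] by blast
  have w0: "0 \<le> w x" for x using w_out[of x] w_in[of x] by (cases "x \<in> \<Omega>") auto
  have uwp: "AE z in (lborel :: ((real ^ 'n) \<times> (real ^ 'n)) measure). u (fst z) = w (fst z) \<and> u (snd z) = w (snd z)"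
    by (rule AE_lborel_fst_snd[OF uw])
  have ker_inverse: "ker x y = inverse (norm (x - y) powr (real CARD('n) + s * p))" for x y
    by (simp only: ker_def powr_minus)
  \<comment> \<open>Off \<open>Qset \<Omega>\<close> both points lie outside \<Omega> and w vanishes
    at both, so the seminorm condition of \<open>X0\<close> controls the energy over the whole
    space.\<close>
  have Ew: "energy w < \<infinity>"
  proof -
    have "energy w = (\<integral>\<^sup>+ z. ennreal (\<bar>u (fst z) - u (snd z)\<bar> powr p /
        norm (fst z - snd z) powr (real CARD('n) + s * p)) * indicator (Qset \<Omega>) z \<partial>lborel)"
      unfolding energy_pair[OF w]
    proof (intro nn_integral_cong_AE, use uwp in eventually_elim)
      fix z :: "(real ^ 'n) \<times> (real ^ 'n)" assume "u (fst z) = w (fst z) \<and> u (snd z) = w (snd z)"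
      then show "ennreal (\<bar>w (fst z) - w (snd z)\<bar> powr p * ker (fst z) (snd z)) = ennreal (\<bar>u (fst z) - u (snd z)\<bar> powr p /
        norm (fst z - snd z) powr (real CARD('n) + s * p)) * indicator (Qset \<Omega>) z"
        using w_out[of "fst z"] w_out[of "snd z"] p0
        by (cases "z \<in> Qset \<Omega>") (auto simp only: ker_inverse divide_inverse Qset_def mem_Times_iff indicator_simps
          Compl_iff DiffE Diff_iff UNIV_I simp_thms powr_zero_eq_one powr_0 diff_self abs_zero mult_zero_left ennreal_0 mult_1_right mult_zero_right)
    qed
    then show ?thesis using X1(4) unfolding nn_integral_completion by (simp only:)
  qed
  \<comment> \<open>Tails involve the power p - 1. It is integrable because \<Omega> is bounded and
    w^(p-1) \<le> 1 + w^p.\<close>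
  have Lp: "(\<integral>\<^sup>+ x. ennreal (w x powr (p - 1)) \<partial>lborel) < \<infinity>"
  proof -
    have "(\<integral>\<^sup>+ x. ennreal (w x powr (p - 1)) \<partial>lborel)
       \<le> (\<integral>\<^sup>+ x. indicator \<Omega> x + ennreal (\<bar>u x\<bar> powr p) * indicator \<Omega> x \<partial>lborel)"
    proof (intro nn_integral_mono_AE, use uw in eventually_elim)
      fix x assume e: "u x = w x"
      show "ennreal (w x powr (p - 1)) \<le> indicator \<Omega> x + ennreal (\<bar>u x\<bar> powr p) * indicator \<Omega> x"
      proof (cases "x \<in> \<Omega>")
        case True
        have "w x powr (p - 1) \<le> 1 + w x powr p"
        proof (cases "w x \<le> 1")
          case True
          then have "w x powr (p - 1) \<le> 1" using w0[of x] p1 powr_mono2[of "p - 1" "w x" 1] by simp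
          then show ?thesis by (simp add: add_increasing2)
        next
          case False
          then have "w x powr (p - 1) \<le> w x powr p" by (intro powr_mono) auto
          then show ?thesis by simp
        qed
        then have "ennreal (w x powr (p - 1)) \<le> ennreal (1 + w x powr p)" by (rule ennreal_leI)
        also have "\<dots> = 1 + ennreal (w x powr p)" by (subst ennreal_plus) auto
        finally show ?thesis using True e w0[of x] by simp
      qed (use w_out in simp)
    qed
    also have "\<dots> = (\<integral>\<^sup>+ x. indicator \<Omega> x \<partial>lborel) + (\<integral>\<^sup>+ x. ennreal (\<bar>u x\<bar> powr p) * indicator \<Omega> x \<partial>lborel)"
    proof -
      have "(\<integral>\<^sup>+ x. indicator \<Omega> x + ennreal (\<bar>u x\<bar> powr p) * indicator \<Omega> x \<partial>lborel) = (\<integral>\<^sup>+ x. indicator \<Omega> x + ennreal (\<bar>w x\<bar> powr p) * indicator \<Omega> x \<partial>lborel)"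
        by (intro nn_integral_cong_AE, use uw in eventually_elim) simp
      also have "\<dots> = (\<integral>\<^sup>+ x. indicator \<Omega> x \<partial>lborel) + (\<integral>\<^sup>+ x. ennreal (\<bar>w x\<bar> powr p) * indicator \<Omega> x \<partial>lborel)"
        by (intro nn_integral_add) measurable
      also have "(\<integral>\<^sup>+ x. ennreal (\<bar>w x\<bar> powr p) * indicator \<Omega> x \<partial>lborel) = (\<integral>\<^sup>+ x. ennreal (\<bar>u x\<bar> powr p) * indicator \<Omega> x \<partial>lborel)"
        by (intro nn_integral_cong_AE, use uw in eventually_elim) simp
      finally show ?thesis .
    qed
    also have "\<dots> < \<infinity>"
      using X1(2) emeasure_bounded_finite[OF bd] by (simp add: nn_integral_completion)
    finally show ?thesis .
  qed
  have crit: "(\<integral>\<^sup>+ x. ennreal (w x powr pst) \<partial>lborel) < \<infinity>"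
  proof -
    obtain e where e: "energy w = ennreal e" "0 \<le> e" using Ew by (metis ennreal_cases infinity_ennreal_def less_irrefl)
    show ?thesis by (rule le_less_trans[OF sobolev[OF w w0 bd w_out _ e(2)]]) (use e in auto)
  qed
  define f where "f = (\<lambda>x. if x \<in> \<Omega> then lam * w x powr (- q) + w x powr \<alpha> else 0)"
  have f[measurable]: "f \<in> borel_measurable borel" unfolding f_def by measurable
  have f0: "0 \<le> f x" for x using assms(6) by (simp add: f_def)
  have weak': "integrable lborel (flux w \<psi>) \<and> integrable lborel (\<lambda>x. f x * \<psi> x) \<and>
      (LINT z|lborel. flux w \<psi> z) = (LINT x|lborel. f x * \<psi> x)" if t: "test_function \<Omega> \<psi>" for \<psi>
  proof -
    have "smooth \<psi>" using t by (simp add: test_function_def)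
    then have [measurable]: "\<psi> \<in> borel_measurable borel" by (rule smooth_measurable)
    have psi0: "\<psi> x = 0" if "x \<notin> \<Omega>" for x
      using t that closure_subset[of "{x. \<psi> x \<noteq> 0}"] by (auto simp: test_function_def)
    have e1: "AE z in lborel. indicat_real (Qset \<Omega>) z *\<^sub>R weak_integrand p s u \<psi> z = flux w \<psi> z"
      using uwp
    proof eventually_elim
      case (elim z)
      then show ?case
        by (cases "z \<in> Qset \<Omega>") (auto simp: weak_integrand_def flux_def ker_inverse divide_inverse Qset_def psi0 mem_Times_iff)
    qed
    have e2: "AE x in lborel. indicat_real \<Omega> x *\<^sub>R ((lam * u x powr (- q) + u x powr \<alpha>) * \<psi> x) = f x * \<psi> x"
      using uw by eventually_elim (auto simp: f_def)
    have i1: "integrable lebesgue (\<lambda>z. indicat_real (Qset \<Omega>) z *\<^sub>R weak_integrand p s u \<psi> z)"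
      and i2: "integrable lebesgue (\<lambda>x. indicat_real \<Omega> x *\<^sub>R ((lam * u x powr (- q) + u x powr \<alpha>) * \<psi> x))"
      using weak[OF t] by (auto simp: set_integrable_def)
    have m1: "flux w \<psi> \<in> borel_measurable borel" and m2: "(\<lambda>x. f x * \<psi> x) \<in> borel_measurable borel" by measurable
    show ?thesis
      using weak[OF t] lebesgue_integral_cong_borel[OF i1 m1 e1] lebesgue_integral_cong_borel[OF i2 m2 e2]
      by (simp add: set_lebesgue_integral_def)
  qed
  have flux_minus: "flux (\<lambda>x. - w x) \<psi> = (\<lambda>z. - flux w \<psi> z)" for \<psi>
    by (rule ext) (simp add: flux_def abs_minus_commute algebra_simps)
  have Ew': "energy (\<lambda>x. - w x) < \<infinity>" using Ew by (simp add: energy_def abs_minus_commute)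
  interpret U: weak_equation p s "real CARD('n)" "TYPE('n)" \<Omega> w f 1
    using op w Ew f f0 weak' by unfold_locales auto
  interpret D: weak_equation p s "real CARD('n)" "TYPE('n)" \<Omega> "\<lambda>x. - w x" f "- 1"
    using op w Ew' f f0 weak' by unfold_locales (auto simp: flux_minus)
  have sub: "weak_sub \<Omega> w f" by (rule U.weak_sub_density) simp
  have super: "weak_sub \<Omega> (\<lambda>x. - w x) (\<lambda>x. 0)" by (rule D.weak_sub_zero) simp
  \<comment> \<open>Where w \<ge> 1 a larger exponent gives a larger power, and both -q and \<alpha>
    are at most pst - 1; the singular term is harmless there.\<close>
  have growth_f: "f x \<le> (lam + 1) * w x powr (pst - 1)" if "1 \<le> w x" for x
  proof -
    have "w x powr (- q) \<le> 1 * w x powr (pst - 1)"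
      using that assms(7) pst_props(1) p1 by (simp, intro powr_mono) auto
    then have "lam * w x powr (- q) \<le> lam * w x powr (pst - 1)" using assms(6) by (intro mult_left_mono) auto
    moreover have "w x powr \<alpha> \<le> w x powr (pst - 1)"
      using that assms(9) by (intro powr_mono) (auto simp: critical_exponent_def)
    moreover have "0 \<le> (lam + 1) * w x powr (pst - 1)" using assms(6) by simp
    ultimately show ?thesis by (auto simp: f_def distrib_right)
  qed
  have local_bounds: "\<exists>r>0. \<exists>c>0. \<exists>b. AE y in lborel. y \<in> ball x r \<longrightarrow> c \<le> w y \<and> w y \<le> b" if x: "x \<in> \<Omega>" for x
  proof -
    obtain e where e: "0 < e" "cball x e \<subseteq> \<Omega>" using op x open_contains_cball by blast
    define r where "r = e / 2"
    have r: "0 < r" "cball x (2 * r) \<subseteq> \<Omega>" using e by (auto simp: r_def)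
    obtain c where c: "0 < c" "AE y in lborel. y \<in> ball x r \<longrightarrow> c \<le> w y"
      using supersolution_lower_bound[OF super w w0 w_in r(2,1)] by blast
    obtain b where b: "AE y in lborel. y \<in> ball x r \<longrightarrow> w y \<le> b"
      using subsolution_upper_bound[OF sub w0 crit Lp r(2,1) _ growth_f] assms(6) by auto
    have "AE y in lborel. y \<in> ball x r \<longrightarrow> c \<le> w y \<and> w y \<le> b" using c(2) b by eventually_elim auto
    then show ?thesis using r c by blast
  qed
  obtain \<gamma> where g: "hoelder_exp \<gamma>" using ex_hoelder_exp by blast
  have g01: "0 < \<gamma>" "\<gamma> \<le> s" using g by (auto simp: hoelder_exp_def)
  obtain I where I: "(\<integral>\<^sup>+ x. ennreal (w x powr (p - 1)) \<partial>lborel) = ennreal I" "0 \<le> I"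
    using Lp by (metis ennreal_cases infinity_ennreal_def less_irrefl)
  have osc: "\<exists>r>0. \<exists>C\<ge>0. \<forall>x0\<in>K. \<forall>i::nat. \<exists>m M. M - m \<le> C * 8 powr (- (\<gamma> * real i)) \<and>
        (AE y in lborel. y \<in> ball x0 (r / 8 ^ i) \<longrightarrow> m \<le> w y \<and> w y \<le> M)"
    if K: "compact K" "K \<subseteq> \<Omega>" for K
  proof -
    obtain d where d: "0 < d" "(\<Union>x\<in>K. cball x d) \<subseteq> \<Omega>" "compact (\<Union>x\<in>K. cball x d)"
      using compact_neighbourhood[OF K(1) op K(2)] by metis
    let ?K' = "\<Union>x\<in>K. cball x d"
    have "\<exists>c>0. \<exists>b. AE y in lborel. y \<in> ?K' \<longrightarrow> c \<le> w y \<and> w y \<le> b"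
      by (rule compact_AE_bounds[OF d(3)]) (use local_bounds d(2) in blast)
    then obtain c b where c: "0 < c" and cb: "AE y in lborel. y \<in> ?K' \<longrightarrow> c \<le> w y \<and> w y \<le> b" by blast
    \<comment> \<open>Both c^\<alpha> and b^\<alpha> occur because \<alpha> may have either
      sign.\<close>
    define \<Phi> where "\<Phi> = lam * c powr (- q) + c powr \<alpha> + b powr \<alpha>"
    have Phi0: "0 \<le> \<Phi>" using assms(6) by (simp add: \<Phi>_def)
    have fPhi: "f y \<le> \<Phi>" if y: "c \<le> w y" "w y \<le> b" for y
    proof -
      have "w y powr (- q) \<le> c powr (- q)" using y c assms(7) by (intro powr_minus_mono) auto
      then have "lam * w y powr (- q) \<le> lam * c powr (- q)" using assms(6) by (intro mult_left_mono) auto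
      moreover have "w y powr \<alpha> \<le> c powr \<alpha> + b powr \<alpha>"
      proof (cases "0 \<le> \<alpha>")
        case True
        then have "w y powr \<alpha> \<le> b powr \<alpha>" using y c by (intro powr_mono2) auto
        then show ?thesis by (simp add: add_increasing)
      next
        case False
        then have "w y powr \<alpha> \<le> c powr \<alpha>" using y c by (intro powr_mono2') auto
        then show ?thesis by (simp add: add_increasing2)
      qed
      ultimately show ?thesis using Phi0 by (auto simp: f_def \<Phi>_def)
    qed
    let ?J = "2 powr p * (d powr (- (real CARD('n) + s * p)) * I)"
    define A where "A = \<Phi> + ?J"
    have A: "0 \<le> A" "\<Phi> \<le> A" "?J \<le> A" using Phi0 I by (auto simp: A_def)
    \<comment> \<open>The solution of (\<kappa> a)^(p-1) d^(-s p) = A, where A dominates both the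
      source bound and the far tail. Enlarging it to \<omega> also covers the bound b for w.\<close>
    define a where "a = (A * d powr (s * p)) powr (1 / (p - 1)) / \<kappa>"
    define \<omega> where "\<omega> = max 1 (max b a)"
    have om: "0 < \<omega>" "b \<le> \<omega>" "a \<le> \<omega>" by (auto simp: \<omega>_def)
    have a0: "0 \<le> a" using kappa(1) by (simp add: a_def)
    have "A * d powr (s * p) = (\<kappa> * a) powr (p - 1)"
    proof -
      have "(t powr (1 / (p - 1))) powr (p - 1) = t" if "0 \<le> t" for t :: real
        using that p1 by (simp add: powr_powr)
      moreover have "\<kappa> * a = (A * d powr (s * p)) powr (1 / (p - 1))" using kappa(1) by (simp add: a_def)
      ultimately show ?thesis using A(1) by simp
    qed
    also have "\<dots> \<le> (\<kappa> * \<omega>) powr (p - 1)"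
      using kappa(1) om a0 p1 by (intro powr_mono2 mult_left_mono) auto
    finally have "A * d powr (s * p) * d powr (- (s * p)) \<le> (\<kappa> * \<omega>) powr (p - 1) * d powr (- (s * p))"
      by (rule mult_right_mono) simp
    then have big: "A \<le> (\<kappa> * \<omega>) powr (p - 1) * d powr (- (s * p))"
      using d(1) by (simp add: mult.assoc powr_add[symmetric])
    have dec: "\<exists>m M. M - m \<le> \<omega> * 8 powr (- (\<gamma> * real i)) \<and> (AE y in lborel. y \<in> ball x0 (d / 8 ^ i) \<longrightarrow> m \<le> w y \<and> w y \<le> M)"
      if x0: "x0 \<in> K" for x0 i
    proof -
      have dom: "cball x0 d \<subseteq> \<Omega>" using d(2) x0 by blast
      have inK: "y \<in> ?K'" if "y \<in> ball x0 d" for y using that x0 by (auto intro!: bexI[of _ x0])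
      have ub: "AE y in lborel. y \<in> ball x0 d \<longrightarrow> w y \<le> b"
        using cb by eventually_elim (use inK in blast)
      have fb: "AE y in lborel. y \<in> ball x0 d \<longrightarrow> f y \<le> \<Phi>"
        using cb by eventually_elim (use inK fPhi in blast)
      have "\<exists>m M. M - m = \<omega> * 8 powr (- (\<gamma> * real i)) \<and> (AE y in lborel. y \<in> ball x0 (d / 8 ^ i) \<longrightarrow> m \<le> w y \<and> w y \<le> M)"
      proof (rule oscillation_decay[OF sub super w0 g dom d(1) ub fb _ I(2) om(2,1)])
        show "(\<integral>\<^sup>+ y. ennreal (w y powr (p - 1)) \<partial>lborel) \<le> ennreal I" using I by simp
      qed (use A big in auto)
      then obtain m M where "M - m = \<omega> * 8 powr (- (\<gamma> * real i))"
          "AE y in lborel. y \<in> ball x0 (d / 8 ^ i) \<longrightarrow> m \<le> w y \<and> w y \<le> M" by (elim exE conjE)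
      then show ?thesis by (intro exI[of _ m] exI[of _ M] conjI) simp_all
    qed
    show ?thesis by (intro exI[of _ d] exI[of _ \<omega>] conjI ballI allI dec d(1) less_imp_le[OF om(1)])
  qed
  obtain v where v: "(AE x in lborel. x \<in> \<Omega> \<longrightarrow> w x = v x) \<and>
      (\<forall>K. compact K \<longrightarrow> K \<subseteq> \<Omega> \<longrightarrow> (\<exists>C. \<forall>x\<in>K. \<forall>y\<in>K. \<bar>v x - v y\<bar> \<le> C * norm (x - y) powr \<gamma>))"
    using hoelder_representative[OF op g01(1) osc] by (rule exE)
  have "AE x in lborel. x \<in> \<Omega> \<longrightarrow> u x = v x" using uw v[THEN conjunct1] by eventually_elim simp
  then have "AE x in lebesgue. x \<in> \<Omega> \<longrightarrow> u x = v x" by (rule AE_completion)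
  moreover have "locally_hoelder_on \<gamma> \<Omega>' v" if c: "compactly_contained \<Omega>' \<Omega>" for \<Omega>'
    unfolding locally_hoelder_on_def
  proof (intro allI impI)
    fix K assume K: "compact K \<and> K \<subseteq> \<Omega>'"
    then have "K \<subseteq> \<Omega>" using c closure_subset[of \<Omega>'] by (auto simp: compactly_contained_def)
    then show "\<exists>C. \<forall>x\<in>K. \<forall>y\<in>K. \<bar>v x - v y\<bar> \<le> C * norm (x - y) powr \<gamma>" using v[THEN conjunct2] K by simp
  qed
  ultimately show ?thesis using g01 by blast
qed

end
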